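(* For any integer $d\ge 4$, there exists a smooth real algebraic surface in $\mathbb{R}P^3$ of degree $d$ whose parabolic curve is smooth and has $d(d-2)^2$ connected components.
   Context: For a homogeneous polynomial $P(X_0,X_1,X_2,X_3)$ with real coefficients, $\mathrm{Hess}(P)$ denotes the determinant of the $4\times 4$ matrix $\left(\frac{\partial^2 P}{\partial X_i\,\partial X_j}\right)_{0\le i,j\le 3}$. The parabolic curve of the real algebraic surface in $\mathbb{R}P^3$ with equation $P=0$ is the set of real solutions $\{P=0\}\cap\{\mathrm{Hess}(P)=0\}\subset \mathbb{R}P^3$. The degree of the surface is the degree of $P$. *)

theory Defs
  imports "HOL-Analysis.Analysis" "HOL-Library.Poly_Mapping"
begin

text \<open>
  Real polynomials in variables indexed by the finite type \<open>'n\<close>: finitely supported families of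
  coefficients indexed by exponent vectors, with the ring structure of
  \<^theory>\<open>HOL-Library.Poly_Mapping\<close>.
\<close>

type_synonym 'n rpoly = "('n \<Rightarrow>\<^sub>0 nat) \<Rightarrow>\<^sub>0 real"

definition rpoly_eval :: "'n::finite rpoly \<Rightarrow> real ^ 'n \<Rightarrow> real" where
  "rpoly_eval P x = (\<Sum>m\<in>Poly_Mapping.keys P.
     Poly_Mapping.lookup P m * (\<Prod>i\<in>UNIV. (x $ i) ^ Poly_Mapping.lookup m i))"

text \<open>The zero polynomial is excluded, so that \<open>d\<close> is the degree of \<open>P\<close>.\<close>

definition homogeneous_of_degree :: "nat \<Rightarrow> 'n::finite rpoly \<Rightarrow> bool" where
  "homogeneous_of_degree d P \<longleftrightarrow>
     P \<noteq> 0 \<and> (\<forall>m\<in>Poly_Mapping.keys P. (\<Sum>i\<in>UNIV. Poly_Mapping.lookup m i) = d)"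

text \<open>
  The formal partial derivative. The truncated subtraction is harmless: where it truncates, the
  coefficient is \<open>0\<close>.
\<close>

definition rpoly_partial :: "'n \<Rightarrow> 'n rpoly \<Rightarrow> 'n rpoly" where
  "rpoly_partial i P = (\<Sum>m\<in>Poly_Mapping.keys P.
     Poly_Mapping.single (m - Poly_Mapping.single i 1)
       (real (Poly_Mapping.lookup m i) * Poly_Mapping.lookup P m))"

definition Hess :: "'n::finite rpoly \<Rightarrow> 'n rpoly" where
  "Hess P = det (\<chi> i j. rpoly_partial i (rpoly_partial j P))"

text \<open>
  A point of real projective space is a line through the origin, and the topology is the quotient
  topology of \<open>x \<mapsto> span {x}\<close> on the nonzero vectors (see \<open>quotient_map_rproj\<close>).
\<close>

definition rproj_points :: "(real ^ 'n) set set" where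
  "rproj_points = {span {x} | x. x \<noteq> 0}"

definition rproj_space :: "(real ^ 'n) set topology" where
  "rproj_space = topology (\<lambda>U. U \<subseteq> rproj_points \<and> open {x. x \<noteq> 0 \<and> span {x} \<in> U})"

lemma openin_rproj_space:
  fixes U :: "(real ^ 'n) set set"
  shows "openin rproj_space U \<longleftrightarrow> U \<subseteq> rproj_points \<and> open {x. x \<noteq> 0 \<and> span {x} \<in> U}"
proof -
  have "istopology (\<lambda>U. U \<subseteq> rproj_points \<and> open {x::real^'n. x \<noteq> 0 \<and> span {x} \<in> U})"
    unfolding istopology_def
  proof (intro conjI allI impI)
    fix S T :: "(real^'n) set set"
    assume S: "S \<subseteq> rproj_points \<and> open {x. x \<noteq> 0 \<and> span {x} \<in> S}"
      and T: "T \<subseteq> rproj_points \<and> open {x. x \<noteq> 0 \<and> span {x} \<in> T}"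
    show "S \<inter> T \<subseteq> rproj_points" using S by blast
    have "{x. x \<noteq> 0 \<and> span {x} \<in> S \<inter> T} =
        {x. x \<noteq> 0 \<and> span {x} \<in> S} \<inter> {x. x \<noteq> 0 \<and> span {x} \<in> T}" by blast
    then show "open {x. x \<noteq> 0 \<and> span {x} \<in> S \<inter> T}" using S T by auto
  next
    fix K :: "(real^'n) set set set"
    assume K: "\<forall>S\<in>K. S \<subseteq> rproj_points \<and> open {x. x \<noteq> 0 \<and> span {x} \<in> S}"
    show "\<Union>K \<subseteq> rproj_points" using K by blast
    have "{x. x \<noteq> 0 \<and> span {x} \<in> \<Union>K} = (\<Union>S\<in>K. {x. x \<noteq> 0 \<and> span {x} \<in> S})" by blast
    then show "open {x. x \<noteq> 0 \<and> span {x} \<in> \<Union>K}" using K by auto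
  qed
  then show ?thesis unfolding rproj_space_def by (simp add: topology_inverse')
qed

lemma topspace_rproj_space: "topspace rproj_space = (rproj_points :: (real ^ 'n) set set)"
proof -
  have "{x::real^'n. x \<noteq> 0 \<and> span {x} \<in> rproj_points} = - {0}"
    by (auto simp: rproj_points_def)
  then have "openin rproj_space (rproj_points :: (real^'n) set set)"
    by (simp add: openin_rproj_space open_Compl)
  then show ?thesis
    by (meson openin_rproj_space openin_subset openin_topspace subset_antisym)
qed

lemma quotient_map_rproj:
  "quotient_map (top_of_set (- {0})) rproj_space (\<lambda>x::real^'n. span {x})"
  unfolding quotient_map_def topspace_rproj_space
proof (intro conjI allI impI)
  show "(\<lambda>x::real^'n. span {x}) ` topspace (top_of_set (- {0})) = rproj_points"
    by (auto simp: rproj_points_def)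
next
  fix U :: "(real^'n) set set" assume "U \<subseteq> rproj_points"
  moreover have "{x \<in> topspace (top_of_set (- {0})). span {x} \<in> U} = {x. x \<noteq> 0 \<and> span {x} \<in> U}"
    by auto
  moreover have "open (- {0::real^'n})" by (simp add: open_Compl)
  ultimately show "openin (top_of_set (- {0})) {x \<in> topspace (top_of_set (- {0})). span {x} \<in> U}
      = openin rproj_space U"
    by (auto simp: openin_rproj_space openin_open_eq)
qed

text \<open>
  A family \<open>F\<close> of \<open>CARD('k)\<close> homogeneous polynomials gives the real projective algebraic set
  \<open>rproj_zeros F\<close>. It is smooth, as the subset of projective space with equations \<open>F = 0\<close>, when the
  Jacobian criterion holds at each of its (real) points, i.e. the differentials of the equations
  are linearly independent there; this can be tested on homogeneous coordinates.
\<close>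

definition rproj_zeros :: "('n::finite rpoly) ^ 'k \<Rightarrow> (real ^ 'n) set set" where
  "rproj_zeros F = {span {x} | x. x \<noteq> 0 \<and> (\<forall>k. rpoly_eval (F $ k) x = 0)}"

definition jacobian_at :: "('n::finite rpoly) ^ 'k \<Rightarrow> real ^ 'n \<Rightarrow> real ^ 'n ^ 'k" where
  "jacobian_at F x = (\<chi> k i. rpoly_eval (rpoly_partial i (F $ k)) x)"

definition smooth_rproj_zeros :: "('n::finite rpoly) ^ 'k::finite \<Rightarrow> bool" where
  "smooth_rproj_zeros F \<longleftrightarrow>
     (\<forall>x. x \<noteq> 0 \<and> (\<forall>k. rpoly_eval (F $ k) x = 0) \<longrightarrow> rank (jacobian_at F x) = CARD('k))"

definition surface_eqs :: "4 rpoly \<Rightarrow> 4 rpoly ^ 1" where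
  "surface_eqs P = vector [P]"

definition parabolic_curve_eqs :: "4 rpoly \<Rightarrow> 4 rpoly ^ 2" where
  "parabolic_curve_eqs P = vector [P, Hess P]"

definition parabolic_curve :: "4 rpoly \<Rightarrow> (real ^ 4) set set" where
  "parabolic_curve P = rproj_zeros (parabolic_curve_eqs P)"

end

theory Submission
  imports Defs "HOL-Computational_Algebra.Polynomial"
begin

text \<open>
  The surface is a perturbation of \<open>A(x, y) + B(w, z) = 0\<close>, where \<open>A\<close> and \<open>B\<close> are binary forms of
  degree \<open>d\<close> with \<open>d\<close> real root lines and negative Hessian off the origin. The Hessian of the sum is
  the product of the two Hessians, so the parabolic set of the unperturbed surface consists of \<open>2 d\<close>
  flat points, one on each root line of \<open>A\<close> or \<open>B\<close>.

  Let \<open>F(x, y, e)\<close> and \<open>G(w, z, e)\<close> be ternary forms with \<open>F(x, y, 0) = A\<close> and \<open>G(w, z, 0) = B\<close>, and take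
  \<open>F(x, y, \<epsilon> w) + G(w, z, \<epsilon>\<^sup>d x)\<close>. Blown up at a flat point over a root of \<open>B\<close>, this surface tends to
  the graph of \<open>F(x, y, 1)\<close>, and its parabolic curve to the Hessian curve of that planar polynomial;
  over a root of \<open>A\<close> the limit is the graph of \<open>G(w, z, 1)\<close>, because \<open>F\<close> has a linear factor there.
  Hence if the Hessian curves are smooth with \<open>M\<close> and \<open>N\<close> components, the parabolic curve is smooth
  with \<open>d (M + N)\<close> components.

  A product of \<open>d\<close> lines in suitable position gives \<open>M = (d - 1)(d - 2) / 2\<close>: multiplying a form of
  degree \<open>n\<close> by one more line that is far away adds \<open>n - 1\<close> ovals near infinity. To reach
  \<open>M + N = (d - 2)\<^sup>2\<close>, the same step is applied to a harmonic polynomial with a small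
  rotation-invariant quadratic term. Its Hessian curve is a level set of the modulus of a complex polynomial with a
  prescribed number of distinct zeros, each of which is surrounded by one oval.
\<close>

section \<open>Directional derivatives of polynomial functions\<close>

text \<open>The two perturbation terms have unequal size on purpose. At a root of \<open>B\<close>
  the zoom has scale r = \<epsilon>, and the term \<epsilon>^d x inside \<open>G\<close> becomes
  \<epsilon>^d r x in the zoomed coordinate: a factor r below the surviving terms, which have order
  r^d. At a root of \<open>A\<close> the scale is r = \<epsilon>^d, and the term \<epsilon> w inside
  \<open>F\<close> becomes \<epsilon> r w, far above r^d; only a linear factor, which a shear of the
  zoom straightens exactly, cancels it. So one planar curve has to contain a line for each of its
  directions at infinity, while the other is free. The freedom is needed: two products of lines
  would give (d - 1)(d - 2), too many by d - 2.

  Limits at single scales leave gaps between the scales. Homogeneity closes them: a zero at an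
  intermediate scale is moved to a fixed circle, where a parameter e runs through the compact
  interval [0, 1] and the limiting Hessian has no zero. This device serves both for adding a line
  and for the flat points. Parameters are carried as additional variables of polynomial functions,
  so that each such claim is an instance of the tube lemma.\<close>

abbreviation rpf :: "('a::real_normed_vector \<Rightarrow> real) \<Rightarrow> bool" where
  "rpf \<equiv> real_polynomial_function"

text \<open>One coordinate-free derivative serves all the product spaces: a partial derivative in
  the plane, in space, or on a slice with frozen parameters is \<open>dird\<close> along a suitable
  vector of the product.\<close>

definition dird :: "'a::real_normed_vector \<Rightarrow> ('a \<Rightarrow> real) \<Rightarrow> 'a \<Rightarrow> real" where
  "dird v f x = frechet_derivative f (at x) v"

named_theorems rpf_intros

lemma rpf_basic [rpf_intros]:
  "rpf (\<lambda>x. c)"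
  "rpf f \<Longrightarrow> rpf g \<Longrightarrow> rpf (\<lambda>x. f x + g x)"
  "rpf f \<Longrightarrow> rpf g \<Longrightarrow> rpf (\<lambda>x. f x * g x)"

  by (auto intro: real_polynomial_function.intros)

lemmas [rpf_intros] =
  real_polynomial_function_minus real_polynomial_function_diff
  real_polynomial_function_divide real_polynomial_function_power real_polynomial_function_sum
  real_polynomial_function_prod

lemma polyfun_fst [rpf_intros]: "polynomial_function f \<Longrightarrow> polynomial_function (\<lambda>x. fst (f x))"
  using polynomial_function_compose[OF _ polynomial_function_bounded_linear[OF bounded_linear_fst]]
  by (auto simp: o_def)

lemma polyfun_snd [rpf_intros]: "polynomial_function f \<Longrightarrow> polynomial_function (\<lambda>x. snd (f x))"
  using polynomial_function_compose[OF _ polynomial_function_bounded_linear[OF bounded_linear_snd]]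
  by (auto simp: o_def)

lemma rpf_fst [rpf_intros]: "polynomial_function f \<Longrightarrow> rpf (\<lambda>x. fst (f x))"
  by (simp add: polyfun_fst real_polynomial_function_eq)

lemma rpf_snd [rpf_intros]: "polynomial_function f \<Longrightarrow> rpf (\<lambda>x. snd (f x))"
  by (simp add: polyfun_snd real_polynomial_function_eq)

lemma rpf_nth [rpf_intros]: "polynomial_function f \<Longrightarrow> rpf (\<lambda>x. f x $ i)"
  using polynomial_function_compose[OF _ polynomial_function_bounded_linear[OF bounded_linear_vec_nth]]
  by (auto simp: real_polynomial_function_eq o_def)

lemma polyfun_fst_snd [rpf_intros]:
  "polynomial_function (fst :: 'a::real_normed_vector \<times> 'b::real_normed_vector \<Rightarrow> 'a)"
  "polynomial_function (snd :: 'a::real_normed_vector \<times> 'b::real_normed_vector \<Rightarrow> 'b)"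
  "rpf (fst :: real \<times> 'b \<Rightarrow> real)" "rpf (snd :: 'a \<times> real \<Rightarrow> real)"
  using polyfun_fst[OF polynomial_function_id] polyfun_snd[OF polynomial_function_id]
    rpf_fst[OF polynomial_function_id] rpf_snd[OF polynomial_function_id] by simp_all

lemma polyfun_Pair [rpf_intros]:
  assumes "polynomial_function f" "polynomial_function g"
  shows "polynomial_function (\<lambda>x. (f x, g x))"
  unfolding polynomial_function_def o_def
proof (intro allI impI)
  fix h :: "'b \<times> 'c \<Rightarrow> real" assume h: "bounded_linear h"
  have 1: "h (f x, g x) = h (f x, 0) + h (0, g x)" for x
    using linear_add[OF bounded_linear.linear[OF h], of "(f x, 0)" "(0, g x)"] by simp
  have "bounded_linear (\<lambda>x. h (x, 0))" "bounded_linear (\<lambda>x. h (0, x))"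
    by (auto intro!: bounded_linear_compose[OF h] bounded_linear_Pair bounded_linear_ident bounded_linear_zero)
  then show "rpf (\<lambda>x. h (f x, g x))"
    using assms[unfolded polynomial_function_def o_def] unfolding 1 by (intro rpf_basic) auto
qed

lemma polyfun_real: "rpf f \<Longrightarrow> polynomial_function f"
  by (simp add: real_polynomial_function_eq)

lemma polyfun_scaleR [rpf_intros]: "rpf f \<Longrightarrow> polynomial_function g \<Longrightarrow> polynomial_function (\<lambda>x. f x *\<^sub>R g x)"
  by (intro polynomial_function_mult polyfun_real)

lemma polyfun_vec [rpf_intros]:
  fixes f :: "'a::real_normed_vector \<Rightarrow> 'n::finite \<Rightarrow> real"
  assumes "\<And>i. rpf (\<lambda>x. f x i)" shows "polynomial_function (\<lambda>x. \<chi> i. f x i)"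
  unfolding polynomial_function_iff_Basis_inner
  by (auto simp: Basis_vec_def inner_axis assms)

lemmas [rpf_intros] = polynomial_function_id polynomial_function_const polynomial_function_add
  polynomial_function_minus polynomial_function_diff polyfun_real

lemma rpf_comp:
  assumes "rpf g" "polynomial_function f" shows "rpf (\<lambda>x. g (f x))"
  using real_polynomial_function_compose[OF assms(2,1)] by (simp add: o_def)

lemma rpf_cont: "rpf f \<Longrightarrow> continuous_on S f"
  for f :: "'a::euclidean_space \<Rightarrow> real"
  by (simp add: continuous_on_polymonial_function real_polynomial_function_eq)

lemma rpf_differentiable:
  fixes f :: "'a::real_normed_vector \<Rightarrow> real"
  shows "rpf f \<Longrightarrow> f differentiable (at x)"
proof (induction f rule: real_polynomial_function.induct)
  case (linear f)
  then show ?case using bounded_linear_imp_has_derivative differentiableI by blast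
qed (auto intro: derivative_intros)

lemma rpf_has_derivative:
  "rpf f \<Longrightarrow> (f has_derivative (\<lambda>v. dird v f x)) (at x)"
  unfolding dird_def using rpf_differentiable frechet_derivative_works by (metis (no_types))

lemma dirdI: "(f has_derivative f') (at x) \<Longrightarrow> dird v f x = f' v"
  unfolding dird_def by (metis frechet_derivative_at)

lemma dird_const [simp]: "dird v (\<lambda>x. c) = (\<lambda>x. 0)"
  by (rule ext, rule dirdI) auto

lemma dird_linear: "bounded_linear f \<Longrightarrow> dird v f = (\<lambda>x. f v)"
  by (rule ext, rule dirdI) (rule bounded_linear_imp_has_derivative)

lemma dird_add: "rpf f \<Longrightarrow> rpf g \<Longrightarrow> dird v (\<lambda>x. f x + g x) = (\<lambda>x. dird v f x + dird v g x)"
  by (rule ext, rule dirdI) (auto intro!: derivative_eq_intros rpf_has_derivative)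

lemma dird_mult: "rpf f \<Longrightarrow> rpf g \<Longrightarrow>
    dird v (\<lambda>x. f x * g x) = (\<lambda>x. f x * dird v g x + dird v f x * g x)"
  by (rule ext, rule dirdI) (auto intro!: derivative_eq_intros rpf_has_derivative)

lemma dird_cmult: "rpf f \<Longrightarrow> dird v (\<lambda>x. c * f x) = (\<lambda>x. c * dird v f x)"
  by (rule ext, rule dirdI) (auto intro!: derivative_eq_intros rpf_has_derivative)

lemma rpf_dird [rpf_intros]: "rpf f \<Longrightarrow> rpf (dird v f)"
proof (induction f rule: real_polynomial_function.induct)
  case (linear f) then show ?case by (simp add: dird_linear rpf_intros)
next
  case (const c) show ?case by (simp add: rpf_intros)
next
  case (add f g) then show ?case by (simp add: dird_add rpf_intros)
next
  case (mult f g) then show ?case by (simp add: dird_mult rpf_intros)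
qed

text \<open>Induction over the generation of polynomial functions replaces Schwarz's theorem: for
  linear functions and constants both sides vanish, and the Leibniz rule carries the symmetry over
  to products.\<close>

lemma dird_commute: "rpf f \<Longrightarrow> dird v (dird w f) = dird w (dird v f)"
proof (induction f rule: real_polynomial_function.induct)
  case (linear f) then show ?case by (simp add: dird_linear)
next
  case (const c) show ?case by simp
next
  case (add f g) then show ?case by (simp add: dird_add rpf_intros)
next
  case (mult f g) then show ?case by (simp add: dird_mult dird_add rpf_intros fun_eq_iff algebra_simps)
qed

lemma dird_add_dir: "rpf f \<Longrightarrow> dird (v + w) f x = dird v f x + dird w f x"
  using linear_add[OF has_derivative_linear[OF rpf_has_derivative]] by blast

lemma dird_scale_dir: "rpf f \<Longrightarrow> dird (c *\<^sub>R v) f x = c * dird v f x"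
  using linear_cmul[OF has_derivative_linear[OF rpf_has_derivative]] by fastforce

lemma dird_zero_dir: "rpf f \<Longrightarrow> dird 0 f x = 0"
  using linear_0[OF has_derivative_linear[OF rpf_has_derivative]] by blast

lemma dird_sum_dir: "rpf f \<Longrightarrow> dird (\<Sum>i\<in>I. v i) f x = (\<Sum>i\<in>I. dird (v i) f x)"
  using linear_sum[OF has_derivative_linear[OF rpf_has_derivative]] by blast

lemma dird_chain:
  assumes "rpf f" "(g has_derivative g') (at x)"
  shows "dird v (\<lambda>x. f (g x)) x = dird (g' v) f (g x)"
  using dirdI[OF has_derivative_compose[OF assms(2) rpf_has_derivative[OF assms(1)]]] .

lemma dird_compose:
  assumes "rpf f" "(g has_derivative g') (at x)" "g' v = w" "g x = y"
  shows "dird v (\<lambda>x. f (g x)) x = dird w f y"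
  using dird_chain[OF assms(1,2)] assms(3,4) by metis

lemma dird_linear_comp:
  assumes "rpf f" "bounded_linear L"
  shows "dird v (\<lambda>x. f (L x)) = (\<lambda>x. dird (L v) f (L x))"
  using dird_chain[OF assms(1) bounded_linear_imp_has_derivative[OF assms(2)]] by blast

text \<open>Freezing a parameter and differentiating is differentiating along \<open>(v, 0)\<close>.
  Hessians with parameters thereby become polynomial functions of all variables jointly, to which
  compactness arguments apply.\<close>

lemma dird_slice:
  fixes f :: "'a::euclidean_space \<times> 'b::euclidean_space \<Rightarrow> real"
  assumes "rpf f" shows "dird v (\<lambda>x. f (x, t)) = (\<lambda>x. dird (v, 0) f (x, t))"
  by (rule ext, rule dird_chain[OF assms]) (auto intro!: derivative_eq_intros)

lemma rpf_slice: "rpf f \<Longrightarrow> rpf (\<lambda>x. f (x, t))"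
  by (rule rpf_comp) (auto intro!: rpf_intros)

lemma rpf_slice2: "rpf f \<Longrightarrow> rpf (\<lambda>t. f (x, t))"
  by (rule rpf_comp) (auto intro!: rpf_intros)

lemma rpf_mvt:
  assumes f: "rpf f"
  obtains s where "0 < s" "s < 1" "f q - f p = dird (q - p) f (p + s *\<^sub>R (q - p))"
proof -
  have d: "((\<lambda>s. f (p + s *\<^sub>R (q - p))) has_real_derivative dird (q - p) f (p + s *\<^sub>R (q - p))) (at s)" for s
  proof -
    have "((\<lambda>s. p + s *\<^sub>R (q - p)) has_derivative (\<lambda>h. h *\<^sub>R (q - p))) (at s)"
      by (auto intro!: derivative_eq_intros)
    from has_derivative_compose[OF this rpf_has_derivative[OF f]]
    show ?thesis by (simp add: has_field_derivative_def dird_scale_dir[OF f] mult.commute[of _ "dird _ _ _"] )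
  qed
  obtain z where "0 < z" "z < 1" "f (p + 1 *\<^sub>R (q - p)) - f (p + 0 *\<^sub>R (q - p)) = (1 - 0) * dird (q - p) f (p + z *\<^sub>R (q - p))"
    using MVT2[of 0 1 "\<lambda>s. f (p + s *\<^sub>R (q - p))", OF _ d] by auto
  then show ?thesis using that by auto
qed

lemma dird_Pair: "rpf f \<Longrightarrow> dird (a, b) f x = a * dird (1, 0) f x + dird (0, b) f x"
  using dird_add_dir[of f "a *\<^sub>R (1, 0)" "(0, b)" x] dird_scale_dir[of f a "(1, 0)" x] by simp

section \<open>Homogeneous functions and Euler's relation\<close>

definition homog :: "nat \<Rightarrow> ('a::real_vector \<Rightarrow> real) \<Rightarrow> bool" where
  "homog n f \<longleftrightarrow> (\<forall>t x. t \<noteq> 0 \<longrightarrow> f (t *\<^sub>R x) = t ^ n * f x)"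

lemma homogD: "homog n f \<Longrightarrow> t \<noteq> 0 \<Longrightarrow> f (t *\<^sub>R x) = t ^ n * f x"
  by (simp add: homog_def)

lemma homog_0: assumes "homog n f" "n > 0" shows "f 0 = 0"
  using homogD[OF assms(1), of 2 0] one_less_power[of "2::real" n] assms(2)
  by (metis mult_cancel_right1 one_less_numeral_iff order_less_irrefl scaleR_zero_right semiring_norm(76) zero_neq_numeral)

lemma homog_dird:
  assumes "rpf f" "homog n f" "t \<noteq> 0" shows "t * dird v f (t *\<^sub>R x) = t ^ n * dird v f x"
proof -
  have "dird v (\<lambda>x. f (t *\<^sub>R x)) x = dird v (\<lambda>x. t ^ n * f x) x"
    using homogD[OF assms(2,3)] by simp
  then show ?thesis
    by (simp add: dird_linear_comp[OF assms(1) bounded_linear_scaleR_right] dird_cmult assms(1) dird_scale_dir)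
qed

lemma euler:
  assumes "rpf f" "homog n f" shows "dird x f x = n * f x"
proof -
  have "((\<lambda>t. f (t *\<^sub>R x)) has_derivative (\<lambda>h. dird (h *\<^sub>R x) f (1 *\<^sub>R x))) (at 1)"
    by (rule has_derivative_compose[OF _ rpf_has_derivative[OF assms(1)]]) (auto intro!: derivative_eq_intros)
  moreover have "((\<lambda>t. t ^ n * f x) has_derivative (\<lambda>h. h * (n * f x))) (at 1)"
    by (auto intro!: derivative_eq_intros)
  then have "((\<lambda>t. f (t *\<^sub>R x)) has_derivative (\<lambda>h. h * (n * f x))) (at 1)"
  proof (rule has_derivative_transform_within_open)
    show "open {(0::real)<..}" by simp
    show "\<And>t. t \<in> {0<..} \<Longrightarrow> t ^ n * f x = f (t *\<^sub>R x)" using homogD[OF assms(2)] by fastforce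
  qed auto
  ultimately have "(\<lambda>h. dird (h *\<^sub>R x) f (1 *\<^sub>R x)) = (\<lambda>h. h * (n * f x))"
    by (rule has_derivative_unique)
  from fun_cong[OF this, of 1] show ?thesis by simp
qed

lemma homog_dird':
  fixes f :: "'a::euclidean_space \<Rightarrow> real"
  assumes "rpf f" "homog (Suc n) f" shows "homog n (dird v f)"
  unfolding homog_def using homog_dird[OF assms] by simp

section \<open>Finite unions of disjoint continua\<close>

text \<open>Only the number of components matters, so no member is required to be a circle. A finite
  partition into disjoint continua is automatically the partition into components, because each
  member is closed and hence also open in the union.\<close>

definition ovals :: "nat \<Rightarrow> 'a::metric_space set \<Rightarrow> bool" where
  "ovals N S \<longleftrightarrow> (\<exists>\<K>. finite \<K> \<and> card \<K> = N \<and>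
     (\<forall>K\<in>\<K>. compact K \<and> connected K \<and> K \<noteq> {}) \<and> disjoint \<K> \<and> S = \<Union>\<K>)"

lemma ovals_0: "ovals 0 {}"
  unfolding ovals_def by (rule exI[of _ "{}"]) auto

lemma ovals_1: "compact K \<Longrightarrow> connected K \<Longrightarrow> K \<noteq> {} \<Longrightarrow> ovals 1 K"
  unfolding ovals_def by (rule exI[of _ "{K}"]) auto

lemma ovals_compact: "ovals N S \<Longrightarrow> compact S"
  unfolding ovals_def by (auto intro: compact_Union)

lemma ovals_Un:
  assumes "ovals m S" "ovals n T" "S \<inter> T = {}" shows "ovals (m + n) (S \<union> T)"
proof -
  obtain \<A> where A: "finite \<A>" "card \<A> = m" "\<forall>K\<in>\<A>. compact K \<and> connected K \<and> K \<noteq> {}" "disjoint \<A>" "S = \<Union>\<A>"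
    using assms(1) by (auto simp: ovals_def)
  obtain \<B> where B: "finite \<B>" "card \<B> = n" "\<forall>K\<in>\<B>. compact K \<and> connected K \<and> K \<noteq> {}" "disjoint \<B>" "T = \<Union>\<B>"
    using assms(2) by (auto simp: ovals_def)
  have "\<A> \<inter> \<B> = {}" using A(3,5) B(5) assms(3) by blast
  then have "card (\<A> \<union> \<B>) = m + n" using A B by (simp add: card_Un_disjoint)
  moreover have "disjoint (\<A> \<union> \<B>)" using A B assms(3) by (intro disjoint_union) auto
  ultimately show ?thesis unfolding ovals_def using A B
    by (intro exI[of _ "\<A> \<union> \<B>"]) (simp add: ball_Un)
qed

lemma ovals_UN:
  assumes "finite I" "\<And>i. i \<in> I \<Longrightarrow> ovals N (S i)"
    and "\<And>i j. i \<in> I \<Longrightarrow> j \<in> I \<Longrightarrow> i \<noteq> j \<Longrightarrow> S i \<inter> S j = {}"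
  shows "ovals (card I * N) (\<Union>i\<in>I. S i)"
  using assms
proof (induction I rule: finite_induct)
  case empty then show ?case by (simp add: ovals_0)
next
  case (insert i I)
  have "S i \<inter> (\<Union>j\<in>I. S j) = {}" using insert.prems(2) insert.hyps(2) by blast
  with insert ovals_Un[of N "S i" "card I * N" "\<Union>j\<in>I. S j"] show ?case by simp
qed

lemma ovals_image:
  assumes "ovals N S" "continuous_on S f" "inj_on f S" shows "ovals N (f ` S)"
proof -
  obtain \<A> where A: "finite \<A>" "card \<A> = N" "\<forall>K\<in>\<A>. compact K \<and> connected K \<and> K \<noteq> {}" "disjoint \<A>" "S = \<Union>\<A>"
    using assms(1) by (auto simp: ovals_def)
  have inj: "inj_on ((`) f) \<A>"
    using inj_on_image_eq_iff[OF assms(3)] A(5) by (auto intro!: inj_onI simp: Union_upper)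
  have "disjoint ((`) f ` \<A>)"
  proof (clarsimp simp: disjoint_def)
    fix K L assume KL: "K \<in> \<A>" "L \<in> \<A>" "f ` K \<noteq> f ` L"
    then have "K \<inter> L = {}" using A(4) by (auto simp: disjoint_def)
    then show "f ` K \<inter> f ` L = {}"
      using inj_on_image_Int[OF assms(3), of K L] KL A(5) by (simp add: Union_upper)
  qed
  moreover have "\<forall>K\<in>(`) f ` \<A>. compact K \<and> connected K \<and> K \<noteq> {}"
    using A assms(2) by (auto intro!: compact_continuous_image connected_continuous_image intro: continuous_on_subset)
  ultimately show ?thesis
    unfolding ovals_def using A card_image[OF inj]
    by (intro exI[of _ "(`) f ` \<A>"]) auto
qed

text \<open>The nerve of an open cover of a connected set is connected. The sets \<open>T p\<close>
  overlap whenever the cover does, so their union is connected as well; this transfers connectedness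
  from a limit curve to its perturbation.\<close>

lemma connected_box_chain:
  assumes K: "connected K" "K \<subseteq> (\<Union>p\<in>F. U p)" and U: "\<And>p. p \<in> F \<Longrightarrow> open (U p)" "\<And>p. p \<in> F \<Longrightarrow> p \<in> U p" "F \<subseteq> K"
    and ne: "F \<noteq> {}"
    and T: "\<And>p. p \<in> F \<Longrightarrow> connected (T p)" "\<And>p. p \<in> F \<Longrightarrow> T p \<noteq> {}"
    and ov: "\<And>p q. p \<in> F \<Longrightarrow> q \<in> F \<Longrightarrow> U p \<inter> U q \<inter> K \<noteq> {} \<Longrightarrow> T p \<inter> T q \<noteq> {}"
  shows "connected (\<Union>p\<in>F. T p)"
proof -
  obtain p0 x0 where p0: "p0 \<in> F" "x0 \<in> T p0" using ne T(2) by blast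
  let ?V = "\<Union>p\<in>F. T p"
  let ?C = "connected_component_set ?V x0"
  have sub: "T p \<subseteq> ?C" if "p \<in> F" "y \<in> T p" "y \<in> ?C" for p y
  proof -
    have "T p \<subseteq> connected_component_set ?V y"
      by (rule connected_component_maximal) (use that T in auto)
    also have "\<dots> = ?C" using that(3) connected_component_eq by blast
    finally show ?thesis .
  qed
  \<comment> \<open>The indices whose set lies in the component of \<open>x0\<close>. If some index
    were left out, the open sets of the two groups would cover \<open>K\<close> and both meet it, so
    two of them would overlap on \<open>K\<close>, and with them the corresponding sets
    \<open>T\<close>.\<close>
  define S where "S = {p \<in> F. T p \<subseteq> ?C}"
  have x0C: "x0 \<in> ?C" using p0 by (simp add: connected_component_refl_eq) blast
  have p0S: "p0 \<in> S" using sub[OF p0 x0C] p0 by (simp add: S_def)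
  have "S = F"
  proof (rule ccontr)
    assume "S \<noteq> F"
    then obtain q where q: "q \<in> F" "q \<notin> S" by (auto simp: S_def)
    let ?A = "\<Union>p\<in>S. U p" and ?B = "\<Union>p\<in>F - S. U p"
    have "open ?A" "open ?B" using U(1) by (auto simp: S_def)
    moreover have "K \<subseteq> ?A \<union> ?B" using K(2) by blast
    moreover have "?A \<inter> K \<noteq> {}" using p0S U(2,3) p0 by blast
    moreover have "?B \<inter> K \<noteq> {}" using q U(2,3) by blast
    ultimately have "?A \<inter> ?B \<inter> K \<noteq> {}" using connectedD[OF K(1), of ?A ?B] by meson
    then obtain p r where pr: "p \<in> S" "r \<in> F - S" "U p \<inter> U r \<inter> K \<noteq> {}" by blast
    then obtain y where "y \<in> T p" "y \<in> T r" using ov[of p r] by (auto simp: S_def)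
    then have "T r \<subseteq> ?C" using sub[of r y] pr by (auto simp: S_def)
    then show False using pr by (simp add: S_def)
  qed
  then have "?V \<subseteq> ?C" by (auto simp: S_def)
  then have "?V = ?C" using connected_component_subset by blast
  then show ?thesis by (metis connected_connected_component)
qed

lemma disjoint_open_nbhds:
  fixes \<K> :: "'a::metric_space set set"
  assumes "finite \<K>" "\<And>K. K \<in> \<K> \<Longrightarrow> compact K" "\<And>K. K \<in> \<K> \<Longrightarrow> K \<noteq> {}" "disjoint \<K>"
  obtains Nb where "\<And>K. K \<in> \<K> \<Longrightarrow> open (Nb K)" "\<And>K. K \<in> \<K> \<Longrightarrow> K \<subseteq> Nb K"
    "\<And>K L. K \<in> \<K> \<Longrightarrow> L \<in> \<K> \<Longrightarrow> K \<noteq> L \<Longrightarrow> Nb K \<inter> Nb L = {}"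
proof
  \<comment> \<open>Voronoi cells: the points strictly closer to \<open>K\<close> than to every
    other member.\<close>
  define Nb where "Nb K = (\<Inter>L\<in>\<K> - {K}. {x. infdist x K < infdist x L})" for K
  show "open (Nb K)" if "K \<in> \<K>" for K
    unfolding Nb_def using assms(1) by (intro open_INT ballI open_Collect_less continuous_intros) auto
  show "K \<subseteq> Nb K" if "K \<in> \<K>" for K
  proof
    fix x assume x: "x \<in> K"
    have "infdist x K < infdist x L" if L: "L \<in> \<K> - {K}" for L
    proof -
      have "x \<notin> L" using assms(4) L \<open>K \<in> \<K>\<close> x by (auto simp: disjoint_def)
      then have "infdist x L > 0"
        using infdist_pos_not_in_closed[of L x] assms(2,3) L compact_imp_closed by blast
      then show ?thesis using x by simp
    qed
    then show "x \<in> Nb K" by (simp add: Nb_def)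
  qed
  show "Nb K \<inter> Nb L = {}" if "K \<in> \<K>" "L \<in> \<K>" "K \<noteq> L" for K L
  proof (rule ccontr)
    assume "Nb K \<inter> Nb L \<noteq> {}"
    then obtain x where x: "x \<in> Nb K" "x \<in> Nb L" by auto
    have "infdist x K < infdist x L" using x(1) that(2,3) by (auto simp: Nb_def)
    moreover have "infdist x L < infdist x K" using x(2) that(1,3) by (auto simp: Nb_def)
    ultimately show False by simp
  qed
qed

text \<open>Each component of the limit is covered by finitely many boxes over which
  \<open>C t\<close> is connected and nonempty; chaining them gives one continuum of
  \<open>C t\<close> per component of \<open>C0\<close>. \<open>near\<close> excludes further
  points, and disjoint neighbourhoods of the components keep the continua apart.\<close>

theorem ovals_stable:
  fixes C0 :: "'a::metric_space set" and C :: "'t \<Rightarrow> 'b::metric_space set"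
  assumes "ovals N C0" and cont: "continuous_on UNIV \<pi>"
    and loc: "\<And>c W. c \<in> C0 \<Longrightarrow> open W \<Longrightarrow> c \<in> W \<Longrightarrow> \<exists>B. c \<in> interior B \<and> closed B \<and> B \<subseteq> W \<and>
        eventually (\<lambda>t. connected (C t \<inter> \<pi> -` B) \<and> C t \<inter> \<pi> -` B \<noteq> {}) F"
    and near: "\<And>W. open W \<Longrightarrow> C0 \<subseteq> W \<Longrightarrow> eventually (\<lambda>t. \<pi> ` C t \<subseteq> W) F"
    and comp: "eventually (\<lambda>t. compact (C t)) F"
  shows "eventually (\<lambda>t. ovals N (C t)) F"
proof -
  obtain \<K> where K: "finite \<K>" "card \<K> = N" "\<And>K. K \<in> \<K> \<Longrightarrow> compact K" "\<And>K. K \<in> \<K> \<Longrightarrow> connected K"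
      "\<And>K. K \<in> \<K> \<Longrightarrow> K \<noteq> {}" "disjoint \<K>" "C0 = \<Union>\<K>"
    using assms(1) by (auto simp: ovals_def)
  obtain Nb where Nb: "\<And>K. K \<in> \<K> \<Longrightarrow> open (Nb K)" "\<And>K. K \<in> \<K> \<Longrightarrow> K \<subseteq> Nb K"
    "\<And>K L. K \<in> \<K> \<Longrightarrow> L \<in> \<K> \<Longrightarrow> K \<noteq> L \<Longrightarrow> Nb K \<inter> Nb L = {}"
    using disjoint_open_nbhds[OF K(1,3,5,6)] by metis
  define G where "G K p B \<longleftrightarrow> p \<in> interior B \<and> closed B \<and> B \<subseteq> Nb K \<and>
        eventually (\<lambda>t. connected (C t \<inter> \<pi> -` B) \<and> C t \<inter> \<pi> -` B \<noteq> {}) F" for K p B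
  have "\<exists>B. G K p B" if "K \<in> \<K>" "p \<in> K" for K p
    unfolding G_def
  proof (rule loc)
    show "p \<in> C0" using that K(7) by auto
    show "open (Nb K)" "p \<in> Nb K" using Nb(1,2)[OF that(1)] that(2) by auto
  qed
  then obtain B where G: "\<And>K p. K \<in> \<K> \<Longrightarrow> p \<in> K \<Longrightarrow> G K p (B K p)"
    by metis
  note B = G[unfolded G_def]
  have "\<exists>P. P \<subseteq> K \<and> finite P \<and> K \<subseteq> (\<Union>p\<in>P. interior (B K p))" if "K \<in> \<K>" for K
  proof -
    have "K \<subseteq> (\<Union>p\<in>K. interior (B K p))" using B[OF that] by blast
    from compactE_image[OF K(3)[OF that] _ this] show ?thesis by (metis open_interior)
  qed
  then obtain P where P: "\<And>K. K \<in> \<K> \<Longrightarrow> P K \<subseteq> K \<and> finite (P K) \<and> K \<subseteq> (\<Union>p\<in>P K. interior (B K p))"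
    by metis
  let ?U = "\<lambda>K p. interior (B K p)"
  have ev1: "eventually (\<lambda>t. \<forall>K\<in>\<K>. \<forall>p\<in>P K. connected (C t \<inter> \<pi> -` B K p) \<and> C t \<inter> \<pi> -` B K p \<noteq> {}) F"
  proof (intro eventually_ball_finite ballI)
    fix K p assume "K \<in> \<K>" "p \<in> P K"
    then show "eventually (\<lambda>t. connected (C t \<inter> \<pi> -` B K p) \<and> C t \<inter> \<pi> -` B K p \<noteq> {}) F"
      using P[of K] B[of K p] by auto
  qed (use K(1) P in auto)
  \<comment> \<open>Where two boxes meet at a point c of \<open>K\<close>, a smaller box about c
    inside both still carries points of \<open>C t\<close>, and these belong to both parts.\<close>
  have ev2: "eventually (\<lambda>t. \<forall>K\<in>\<K>. \<forall>p\<in>P K. \<forall>q\<in>P K. ?U K p \<inter> ?U K q \<inter> K \<noteq> {} \<longrightarrow>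
      (C t \<inter> \<pi> -` B K p) \<inter> (C t \<inter> \<pi> -` B K q) \<noteq> {}) F"
  proof -
    have "eventually (\<lambda>t. ?U K p \<inter> ?U K q \<inter> K \<noteq> {} \<longrightarrow>
      (C t \<inter> \<pi> -` B K p) \<inter> (C t \<inter> \<pi> -` B K q) \<noteq> {}) F" if "K \<in> \<K>" for K p q
    proof (cases "?U K p \<inter> ?U K q \<inter> K = {}")
      case False
      then obtain c where c: "c \<in> ?U K p \<inter> ?U K q" "c \<in> K" by blast
      have "\<exists>B'. c \<in> interior B' \<and> closed B' \<and> B' \<subseteq> ?U K p \<inter> ?U K q \<and>
          eventually (\<lambda>t. connected (C t \<inter> \<pi> -` B') \<and> C t \<inter> \<pi> -` B' \<noteq> {}) F"
      proof (rule loc)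
        show "c \<in> C0" using c(2) that K(7) by auto
      qed (use c in auto)
      then obtain B' where B': "B' \<subseteq> ?U K p \<inter> ?U K q"
          "eventually (\<lambda>t. connected (C t \<inter> \<pi> -` B') \<and> C t \<inter> \<pi> -` B' \<noteq> {}) F"
        by (elim exE conjE) (rule that)
      have sub: "B' \<subseteq> B K p \<inter> B K q" using B'(1) interior_subset[of "B K p"] interior_subset[of "B K q"] by auto
      show ?thesis by (rule eventually_mono[OF B'(2)]) (use sub in auto)
    qed simp
    then show ?thesis using K(1) P by (intro eventually_ball_finite ballI) auto
  qed
  have "eventually (\<lambda>t. \<pi> ` C t \<subseteq> (\<Union>K\<in>\<K>. \<Union>p\<in>P K. ?U K p)) F"
    by (rule near) (use P K(7) in \<open>auto intro!: open_UN\<close>, fastforce)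
  with ev1 ev2 comp show ?thesis
  proof eventually_elim
    case (elim t)
    define T where "T K = (\<Union>p\<in>P K. C t \<inter> \<pi> -` B K p)" for K
    have conn: "connected (T K)" if "K \<in> \<K>" for K
      unfolding T_def
      proof (rule connected_box_chain[OF K(4)[OF that], where U = "?U K" and F = "P K"])
      fix p assume p: "p \<in> P K"
      then have pK: "p \<in> K" using P[OF that] by auto
      show "p \<in> ?U K p" using B[OF that pK] by auto
      show "connected (C t \<inter> \<pi> -` B K p)" "C t \<inter> \<pi> -` B K p \<noteq> {}"
        using elim(1) that p by auto
      show "(C t \<inter> \<pi> -` B K p) \<inter> (C t \<inter> \<pi> -` B K q) \<noteq> {}"
        if "q \<in> P K" "?U K p \<inter> ?U K q \<inter> K \<noteq> {}" for q
        using elim(2) \<open>K \<in> \<K>\<close> p that by blast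
    qed (use P[OF that] K(5)[OF that] in auto)
    have clo: "compact (T K)" if "K \<in> \<K>" for K
    proof -
      have "closed (\<pi> -` B K p)" if "p \<in> P K" for p
        using cont B[OF \<open>K \<in> \<K>\<close>, of p] P[OF \<open>K \<in> \<K>\<close>] that by (metis closed_vimage subsetD)
      then show ?thesis unfolding T_def using P[OF that] elim(3)
        by (intro compact_UN) (auto intro: compact_Int_closed)
    qed
    have nonempty: "T K \<noteq> {}" if "K \<in> \<K>" for K
    proof -
      have "P K \<noteq> {}" using P[OF that] K(5)[OF that] by auto
      then obtain p where p: "p \<in> P K" by auto
      then have "C t \<inter> \<pi> -` B K p \<noteq> {}" using elim(1) that by blast
      then show ?thesis unfolding T_def using p by blast
    qed
    have sub: "T K \<subseteq> \<pi> -` Nb K" if "K \<in> \<K>" for K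
    proof
      fix y assume "y \<in> T K"
      then obtain p where "p \<in> P K" "\<pi> y \<in> B K p" by (auto simp: T_def)
      then show "y \<in> \<pi> -` Nb K" using B[OF that, of p] P[OF that] by auto
    qed
    have dis: "T K \<inter> T L = {}" if "K \<in> \<K>" "L \<in> \<K>" "K \<noteq> L" for K L
      using sub[OF that(1)] sub[OF that(2)] Nb(3)[OF that] by blast
    have inj: "inj_on T \<K>"
      using dis nonempty by (intro inj_onI) (metis inf.idem)
    have "C t = (\<Union>K\<in>\<K>. T K)"
    proof
      show "C t \<subseteq> (\<Union>K\<in>\<K>. T K)"
      proof
        fix c assume c: "c \<in> C t"
        then obtain K p where "K \<in> \<K>" "p \<in> P K" "\<pi> c \<in> ?U K p" using elim(4) by blast
        then show "c \<in> (\<Union>K\<in>\<K>. T K)"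
          using c interior_subset[of "B K p"] by (auto simp: T_def)
      qed
    qed (auto simp: T_def)
    moreover have "disjoint (T ` \<K>)"
      unfolding disjoint_def using dis by (metis imageE)
    ultimately show ?case unfolding ovals_def
      using K(1,2) conn clo nonempty card_image[OF inj]
      by (intro exI[of _ "T ` \<K>"]) auto
  qed
qed

text \<open>The tube lemma, in the form from which the claims about small parameters below are
  obtained.\<close>

lemma eventually_tube:
  fixes S :: "'a::euclidean_space set" and t0 :: "'b::euclidean_space"
  assumes "compact S" "open W" "\<And>p. p \<in> S \<Longrightarrow> (p, t0) \<in> W"
  shows "eventually (\<lambda>t. \<forall>p\<in>S. (p, t) \<in> W) (nhds t0)"
proof (cases "S = {}")
  case False
  obtain V where V: "openin (top_of_set UNIV) V" "t0 \<in> V" "S \<times> V \<subseteq> W \<inter> (S \<times> UNIV)"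
    by (rule tube_lemma[OF assms(1) False, of t0 "W \<inter> (S \<times> UNIV)" UNIV])
      (use assms in \<open>auto simp: openin_open\<close>)
  then show ?thesis unfolding eventually_nhds by (intro exI[of _ V]) auto
qed simp

section \<open>Stability of regular space curves near a planar curve\<close>

lemma open_contains_square:
  fixes W :: "(real \<times> real) set"
  assumes "open W" "(x, y) \<in> W"
  obtains b where "b > 0" "{x - b..x + b} \<times> {y - b..y + b} \<subseteq> W"
proof -
  obtain A B where AB: "open A" "open B" "x \<in> A" "y \<in> B" "A \<times> B \<subseteq> W"
    using open_prod_elim[OF assms] by (metis mem_Sigma_iff)
  obtain e f where e: "e > 0" "cball x e \<subseteq> A" and f: "f > 0" "cball y f \<subseteq> B"
    using AB open_contains_cball by (metis (no_types))
  have "{x - min e f..x + min e f} \<times> {y - min e f..y + min e f} \<subseteq> cball x e \<times> cball y f"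
    by (auto simp: cball_eq_atLeastAtMost)
  then show ?thesis using that[of "min e f"] e f AB(5) by fastforce
qed

lemma dird_pos_strict_mono:
  fixes f :: "real \<times> real \<Rightarrow> real"
  assumes "rpf f" "\<And>y. y \<in> {a..b} \<Longrightarrow> dird (0, 1) f (x, y) > 0" "a < b"
  shows "f (x, a) < f (x, b)"
proof -
  obtain s where s: "0 < s" "s < 1" and
    eq: "f (x, b) - f (x, a) = dird ((x, b) - (x, a)) f ((x, a) + s *\<^sub>R ((x, b) - (x, a)))"
    using rpf_mvt[OF assms(1)] .
  have "a + s * (b - a) \<in> {a..b}"
  proof -
    have "s * (b - a) \<le> 1 * (b - a)" by (rule mult_right_mono) (use s assms(3) in auto)
    then have "a + s * (b - a) \<le> a + 1 * (b - a)" by (rule add_left_mono)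
    then have "a + s * (b - a) \<le> b" by simp
    then show ?thesis using s assms(3) by simp
  qed
  then have pos: "dird (0, 1) f (x, a + s * (b - a)) > 0" by (rule assms(2))
  have "(x, b) - (x, a) = (b - a) *\<^sub>R (0, 1)" "(x, a) + s *\<^sub>R ((x, b) - (x, a)) = (x, a + s * (b - a))"
    by auto
  then have "f (x, b) - f (x, a) = (b - a) * dird (0, 1) f (x, a + s * (b - a))"
    using eq dird_scale_dir[OF assms(1)] by metis
  then show ?thesis using mult_pos_pos[OF _ pos, of "b - a"] assms(3) by simp
qed

text \<open>A space curve over the planar region \<open>B\<close>, cut off at height
  \<open>Z\<close>, with perturbation parameter \<open>t\<close>. In the intended limit \<Phi> is
  the equation of a graph and \<Psi> does not depend on z, so that the curve is the lift of a planar
  curve.\<close>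

definition zero_curve :: "((real \<times> real \<times> real) \<times> 'p \<Rightarrow> real) \<Rightarrow> ((real \<times> real \<times> real) \<times> 'p \<Rightarrow> real)
    \<Rightarrow> (real \<times> real) set \<Rightarrow> real \<Rightarrow> 'p \<Rightarrow> (real \<times> real \<times> real) set" where
  "zero_curve \<Phi> \<Psi> B Z t = {(x, y, z). (x, y) \<in> B \<and> \<bar>z\<bar> \<le> Z \<and> \<Phi> ((x, y, z), t) = 0 \<and> \<Psi> ((x, y, z), t) = 0}"

abbreviation "ex1 \<equiv> ((1, 0, 0), 0)"
abbreviation "ex2 \<equiv> ((0, 1, 0), 0)"
abbreviation "ex3 \<equiv> ((0, 0, 1), 0)"

lemma compact_zero_curve:
  fixes \<Phi> \<Psi> :: "(real \<times> real \<times> real) \<times> 'p::euclidean_space \<Rightarrow> real"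
  assumes "rpf \<Phi>" "rpf \<Psi>" "compact B" shows "compact (zero_curve \<Phi> \<Psi> B Z t)"
proof -
  let ?h = "\<lambda>p::(real \<times> real) \<times> real. (fst (fst p), snd (fst p), snd p)"
  have c: "compact (?h ` (B \<times> {-Z..Z}))"
    by (intro compact_continuous_image continuous_intros compact_Times assms) auto
  have cl: "closed {p. \<Phi> (p, t) = 0 \<and> \<Psi> (p, t) = 0}"
    by (intro closed_Collect_conj closed_Collect_eq rpf_cont[OF rpf_slice[OF assms(1)]]
        rpf_cont[OF rpf_slice[OF assms(2)]] continuous_on_const)
  have "zero_curve \<Phi> \<Psi> B Z t = ?h ` (B \<times> {-Z..Z}) \<inter> {p. \<Phi> (p, t) = 0 \<and> \<Psi> (p, t) = 0}"
  proof (rule set_eqI)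
    fix p :: "real \<times> real \<times> real"
    obtain x y z where p: "p = (x, y, z)" by (cases p)
    have "p \<in> ?h ` (B \<times> {-Z..Z}) \<longleftrightarrow> (x, y) \<in> B \<and> \<bar>z\<bar> \<le> Z"
    proof
      assume "(x, y) \<in> B \<and> \<bar>z\<bar> \<le> Z"
      then have "((x, y), z) \<in> B \<times> {-Z..Z}" by auto
      then show "p \<in> ?h ` (B \<times> {-Z..Z})" by (rule rev_image_eqI) (simp add: p)
    qed (auto simp: p)
    then show "p \<in> zero_curve \<Phi> \<Psi> B Z t \<longleftrightarrow> p \<in> ?h ` (B \<times> {-Z..Z}) \<inter> {p. \<Phi> (p, t) = 0 \<and> \<Psi> (p, t) = 0}"
      by (simp add: zero_curve_def p)
  qed
  then show ?thesis using compact_Int_closed[OF c cl] by simp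
qed

text \<open>Sign changes on opposite faces yield a solution (y, z) for every x. It is unique because
  \<open>m\<close> makes the Jacobian in (y, z) nonsingular even if its two rows are taken at
  different points. The curve is therefore a graph over the x interval: \<open>fst\<close> is a
  continuous bijection from a compact set onto it.\<close>

lemma unique_zero_graph:
  fixes \<Phi> \<Psi> :: "(real \<times> real \<times> real) \<times> 'p::euclidean_space \<Rightarrow> real"
  assumes "rpf \<Phi>" "rpf \<Psi>" and ab: "a \<le> a'" "b \<le> b'" "Z > 0"
    and top: "\<And>x y. x \<in> {a..a'} \<Longrightarrow> y \<in> {b..b'} \<Longrightarrow> \<Phi> ((x, y, -Z), t) < 0 \<and> \<Phi> ((x, y, Z), t) > 0"
    and side: "\<And>x z. x \<in> {a..a'} \<Longrightarrow> z \<in> {-Z..Z} \<Longrightarrow> \<Psi> ((x, b, z), t) < 0 \<and> \<Psi> ((x, b', z), t) > 0"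
    and d: "\<And>p. p \<in> {a..a'} \<times> {b..b'} \<times> {-Z..Z} \<Longrightarrow> dird ex3 \<Phi> (p, t) > 0"
    and m: "\<And>p q. p \<in> {a..a'} \<times> {b..b'} \<times> {-Z..Z} \<Longrightarrow> q \<in> {a..a'} \<times> {b..b'} \<times> {-Z..Z} \<Longrightarrow>
       dird ex2 \<Psi> (q, t) * dird ex3 \<Phi> (p, t) - dird ex3 \<Psi> (q, t) * dird ex2 \<Phi> (p, t) > 0"
  shows "connected (zero_curve \<Phi> \<Psi> ({a..a'} \<times> {b..b'}) Z t)" "zero_curve \<Phi> \<Psi> ({a..a'} \<times> {b..b'}) Z t \<noteq> {}"
proof -
  let ?X = "{a..a'} \<times> {b..b'} \<times> {-Z..Z}"
  let ?S = "zero_curve \<Phi> \<Psi> ({a..a'} \<times> {b..b'}) Z t"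
  have convX: "convex ?X" by (intro convex_Times) auto
  have mvt: "\<exists>\<xi>\<in>?X. f (q, t) - f (p, t) = (fst (snd q) - fst (snd p)) * dird ex2 f (\<xi>, t)
       + (snd (snd q) - snd (snd p)) * dird ex3 f (\<xi>, t)"
    if f: "rpf f" and pq: "p \<in> ?X" "q \<in> ?X" "fst p = fst q" for f :: "(real \<times> real \<times> real) \<times> 'p \<Rightarrow> real" and p q
  proof -
    obtain s where s: "0 < s" "s < 1" and
      eq: "f (q, t) - f (p, t) = dird ((q, t) - (p, t)) f ((p, t) + s *\<^sub>R ((q, t) - (p, t)))"
      using rpf_mvt[OF f] .
    have "p + s *\<^sub>R (q - p) = (1 - s) *\<^sub>R p + s *\<^sub>R q" by (simp add: algebra_simps)
    then have "p + s *\<^sub>R (q - p) \<in> ?X"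
      using convexD_alt[OF convX pq(1,2), of s] s by (simp add: add.commute)
    moreover have "(q, t) - (p, t) = (fst (snd q) - fst (snd p)) *\<^sub>R ex2 + (snd (snd q) - snd (snd p)) *\<^sub>R ex3"
      using pq(3) by (simp add: prod_eq_iff)
    moreover have "(p, t) + s *\<^sub>R ((q, t) - (p, t)) = (p + s *\<^sub>R (q - p), t)" by simp
    moreover have "dird (u *\<^sub>R ex2 + v *\<^sub>R ex3) f z = u * dird ex2 f z + v * dird ex3 f z" for u v z
      by (simp only: dird_add_dir[OF f] dird_scale_dir[OF f])
    ultimately show ?thesis using eq by metis
  qed
  have c\<Phi>: "continuous_on UNIV (\<lambda>p. \<Phi> (p, t))" and c\<Psi>: "continuous_on UNIV (\<lambda>p. \<Psi> (p, t))"
    by (rule rpf_cont[OF rpf_slice[OF assms(1)]] rpf_cont[OF rpf_slice[OF assms(2)]])+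
  have uni: "p = q" if pq: "p \<in> ?X" "q \<in> ?X" "fst p = fst q" and y: "fst (snd p) = fst (snd q)"
      and "\<Phi> (p, t) = 0" "\<Phi> (q, t) = 0" for p q
  proof -
    obtain \<xi> where "\<xi> \<in> ?X" "\<Phi> (q, t) - \<Phi> (p, t) = (snd (snd q) - snd (snd p)) * dird ex3 \<Phi> (\<xi>, t)"
      using mvt[OF assms(1) pq] y by auto
    then have "snd (snd p) = snd (snd q)" using d[of \<xi>] that(5,6) by simp
    then show ?thesis using pq(3) y by (simp add: prod_eq_iff)
  qed
  have "\<exists>z. z \<in> {-Z..Z} \<and> \<Phi> ((x, y, z), t) = 0" if "x \<in> {a..a'}" "y \<in> {b..b'}" for x y
  proof -
    have "continuous_on {-Z..Z} (\<lambda>z. \<Phi> ((x, y, z), t))"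
      by (rule continuous_on_compose2[OF c\<Phi>]) (auto intro!: continuous_intros)
    with top[OF that] have "\<exists>z\<ge>-Z. z \<le> Z \<and> \<Phi> ((x, y, z), t) = 0"
      using ab(3) by (intro IVT') auto
    then show ?thesis by auto
  qed
  then obtain \<zeta> where \<zeta>: "\<And>x y. x \<in> {a..a'} \<Longrightarrow> y \<in> {b..b'} \<Longrightarrow> \<zeta> x y \<in> {-Z..Z} \<and> \<Phi> ((x, y, \<zeta> x y), t) = 0"
    by metis
  \<comment> \<open>The solution z of \<Phi> = 0 was merely chosen; it is continuous in y since its
    graph is closed and its range lies in a compact interval.\<close>
  have \<zeta>cont: "continuous_on {b..b'} (\<zeta> x)" if x: "x \<in> {a..a'}" for x
  proof (rule continuous_from_closed_graph[of "{-Z..Z}"])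
    have "(\<lambda>y. (y, \<zeta> x y)) ` {b..b'} = {b..b'} \<times> {-Z..Z} \<inter> {p. \<Phi> ((x, fst p, snd p), t) = 0}"
    proof (intro subset_antisym subsetI)
      fix p assume p: "p \<in> {b..b'} \<times> {-Z..Z} \<inter> {p. \<Phi> ((x, fst p, snd p), t) = 0}"
      have y: "fst p \<in> {b..b'}" using p by auto
      have "(x, fst p, snd p) = (x, fst p, \<zeta> x (fst p))"
        by (rule uni) (use p x \<zeta>[OF x y] in \<open>auto simp: mem_Times_iff\<close>)
      then have "p = (fst p, \<zeta> x (fst p))" by (simp add: prod_eq_iff)
      then show "p \<in> (\<lambda>y. (y, \<zeta> x y)) ` {b..b'}" using y by (metis image_eqI)
    qed (use \<zeta>[OF x] in auto)
    moreover have "closed ({b..b'} \<times> {-Z..Z} \<inter> {p. \<Phi> ((x, fst p, snd p), t) = 0})"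
    proof (intro closed_Int closed_Times closed_Collect_eq)
      show "continuous_on UNIV (\<lambda>p. \<Phi> ((x, fst p, snd p), t))"
        by (rule continuous_on_compose2[OF c\<Phi>]) (auto intro!: continuous_intros)
    qed auto
    ultimately show "closed ((\<lambda>y. (y, \<zeta> x y)) ` {b..b'})" by simp
  qed (use \<zeta>[OF x] in auto)
  have ex: "\<exists>y. y \<in> {b..b'} \<and> \<Psi> ((x, y, \<zeta> x y), t) = 0" if x: "x \<in> {a..a'}" for x
  proof -
    have "continuous_on {b..b'} (\<lambda>y. \<Psi> ((x, y, \<zeta> x y), t))"
      by (rule continuous_on_compose2[OF c\<Psi>]) (auto intro!: continuous_intros \<zeta>cont[OF x])
    moreover have "\<Psi> ((x, b, \<zeta> x b), t) < 0" "\<Psi> ((x, b', \<zeta> x b'), t) > 0"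
      using side[OF x] \<zeta>[OF x] ab by auto
    ultimately have "\<exists>y\<ge>b. y \<le> b' \<and> \<Psi> ((x, y, \<zeta> x y), t) = 0"
      using ab(2) by (intro IVT') auto
    then show ?thesis by auto
  qed
  have S: "p \<in> ?S \<longleftrightarrow> p \<in> ?X \<and> \<Phi> (p, t) = 0 \<and> \<Psi> (p, t) = 0" for p
    by (auto simp: zero_curve_def abs_le_iff)
  have uni2: "p = q" if pq: "p \<in> ?S" "q \<in> ?S" "fst p = fst q" for p q
  proof -
    have X: "p \<in> ?X" "q \<in> ?X" and z: "\<Phi> (p, t) = 0" "\<Phi> (q, t) = 0" "\<Psi> (p, t) = 0" "\<Psi> (q, t) = 0"
      using pq S by auto
    define u where "u = fst (snd q) - fst (snd p)"
    define v where "v = snd (snd q) - snd (snd p)"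
    obtain \<xi> where \<xi>: "\<xi> \<in> ?X" "0 = u * dird ex2 \<Phi> (\<xi>, t) + v * dird ex3 \<Phi> (\<xi>, t)"
      using mvt[OF assms(1) X pq(3)] z by (auto simp: u_def v_def)
    obtain \<eta> where \<eta>: "\<eta> \<in> ?X" "0 = u * dird ex2 \<Psi> (\<eta>, t) + v * dird ex3 \<Psi> (\<eta>, t)"
      using mvt[OF assms(2) X pq(3)] z by (auto simp: u_def v_def)
    \<comment> \<open>Cramer's rule eliminates v. The mean value theorem gives one point for each of
      the two functions, which is why \<open>m\<close> speaks of independent points p and q.\<close>
    have "u * (dird ex2 \<Psi> (\<eta>, t) * dird ex3 \<Phi> (\<xi>, t) - dird ex3 \<Psi> (\<eta>, t) * dird ex2 \<Phi> (\<xi>, t))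
       = (u * dird ex2 \<Psi> (\<eta>, t) + v * dird ex3 \<Psi> (\<eta>, t)) * dird ex3 \<Phi> (\<xi>, t)
         - (u * dird ex2 \<Phi> (\<xi>, t) + v * dird ex3 \<Phi> (\<xi>, t)) * dird ex3 \<Psi> (\<eta>, t)"
      by (simp add: algebra_simps)
    also have "\<dots> = 0" using \<xi>(2) \<eta>(2) by simp
    finally have "u = 0" using m[OF \<xi>(1) \<eta>(1)] by simp
    then show ?thesis using uni[OF X pq(3) _ z(1,2)] by (simp add: u_def)
  qed
  have img: "fst ` ?S = {a..a'}"
  proof (intro subset_antisym subsetI)
    fix x assume x: "x \<in> {a..a'}"
    then obtain y where "y \<in> {b..b'}" "\<Psi> ((x, y, \<zeta> x y), t) = 0" using ex by auto
    then have "(x, y, \<zeta> x y) \<in> ?S" using \<zeta>[OF x] x by (auto simp: S)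
    then show "x \<in> fst ` ?S" by force
  qed (use S in auto)
  have inj: "inj_on fst ?S" using uni2 by (auto intro: inj_onI)
  have "continuous_on (fst ` ?S) (the_inv_into ?S fst)"
    by (rule continuous_on_inv[OF _ compact_zero_curve])
      (auto intro!: continuous_intros compact_Times assms the_inv_into_f_f[OF inj])
  then have "connected (the_inv_into ?S fst ` fst ` ?S)"
    unfolding img by (rule connected_continuous_image) auto
  moreover have "the_inv_into ?S fst ` fst ` ?S = ?S"
    using the_inv_into_f_f[OF inj] by force
  ultimately show "connected ?S" by simp
  show "?S \<noteq> {}" using img ab(1) by auto
qed

text \<open>Nothing is assumed about \<open>f\<close>: it is the restriction of \<Phi> to z = 0, and
  as a function of (x, y, z) that restriction has no derivative in the z direction.\<close>

lemma dird_limit_affine: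
  fixes \<Phi> :: "(real \<times> real \<times> real) \<times> 'p::euclidean_space \<Rightarrow> real"
  assumes \<Phi>: "rpf \<Phi>" and l1: "\<And>x y z. \<Phi> ((x, y, z), t0) = \<kappa> * z + f (x, y)"
  shows "dird ex3 \<Phi> (p, t0) = \<kappa>"
proof -
  have bl: "bounded_linear (\<lambda>p::real \<times> real \<times> real. \<kappa> * snd (snd p))"
    by (intro bounded_linear_intros)
  have "dird ex3 \<Phi> (p, t0) = dird (0, 0, 1) (\<lambda>p. \<Phi> (p, t0)) p" by (simp add: dird_slice[OF \<Phi>])
  also have "(\<lambda>p. \<Phi> (p, t0)) = (\<lambda>p. \<kappa> * snd (snd p) + (\<Phi> (p, t0) - \<kappa> * snd (snd p)))" by simp
  finally have "dird ex3 \<Phi> (p, t0) = \<kappa> + dird (0, 0, 1) (\<lambda>p. \<Phi> (p, t0) - \<kappa> * snd (snd p)) p"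
    by (subst (asm) dird_add)
      (auto intro!: real_polynomial_function.intros(1)[OF bl] rpf_slice[OF \<Phi>] real_polynomial_function_diff simp: dird_linear[OF bl] rpf_intros)
  moreover have "(\<lambda>p. \<Phi> (p, t0) - \<kappa> * snd (snd p)) = (\<lambda>p. \<Phi> ((fst p, fst (snd p), 0), t0))"
    by (auto simp: fun_eq_iff l1)
  moreover have "dird (0, 0, 1) (\<lambda>p. \<Phi> ((fst p, fst (snd p), 0), t0)) p = 0"
  proof -
    have "dird (0, 0, 1) (\<lambda>p. \<Phi> ((fst p, fst (snd p), 0), t0)) p = dird 0 \<Phi> ((fst p, fst (snd p), 0), t0)"
    proof (rule dird_compose[OF \<Phi>])
      show "((\<lambda>p. ((fst p, fst (snd p), 0), t0)) has_derivative (\<lambda>h. ((fst h, fst (snd h), 0), 0))) (at p)"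
        by (auto intro!: derivative_eq_intros)
    qed (auto simp: zero_prod_def)
    then show ?thesis by (simp add: dird_zero_dir[OF \<Phi>])
  qed
  ultimately show ?thesis by simp
qed

lemma dird_limit_planar:
  fixes \<Psi> :: "(real \<times> real \<times> real) \<times> 'p::euclidean_space \<Rightarrow> real"
  assumes \<Psi>: "rpf \<Psi>" and \<Omega>: "rpf \<Omega>" and l2: "\<And>x y z. \<Psi> ((x, y, z), t0) = \<Omega> (x, y)"
  shows "dird (v, 0) \<Psi> (p, t0) = dird (fst v, fst (snd v)) \<Omega> (fst p, fst (snd p))"
proof -
  have "dird (v, 0) \<Psi> (p, t0) = dird v (\<lambda>p. \<Psi> (p, t0)) p" by (simp add: dird_slice[OF \<Psi>])
  also have "(\<lambda>p. \<Psi> (p, t0)) = (\<lambda>p. \<Omega> (fst p, fst (snd p)))" by (auto simp: fun_eq_iff l2)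
  also have "dird v \<dots> p = dird (fst v, fst (snd v)) \<Omega> (fst p, fst (snd p))"
    by (rule dird_chain[OF \<Omega>]) (auto intro!: derivative_eq_intros)
  finally show ?thesis .
qed

text \<open>At \<open>t0\<close> the Jacobian in (y, z) is triangular with diagonal entries the y
  derivative of \<Omega> and \<kappa>, both positive. The height b of the box is fixed first, so
  that \<Omega> increases in y; the width a is then shrunk until the signs on the two horizontal
  sides hold for all its x. All hypotheses of \<open>unique_zero_graph\<close> are open conditions
  on compact sets and persist for t near \<open>t0\<close>.\<close>

lemma box_vertical:
  fixes \<Phi> \<Psi> :: "(real \<times> real \<times> real) \<times> 'p::euclidean_space \<Rightarrow> real"
  assumes \<Phi>: "rpf \<Phi>" and \<Psi>: "rpf \<Psi>" and \<Omega>: "rpf \<Omega>" and W: "open W" "(x0, y0) \<in> W" and Z: "Z > 0"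
    and l1: "\<And>x y z. \<Phi> ((x, y, z), t0) = \<kappa> * z + f (x, y)" and l2: "\<And>x y z. \<Psi> ((x, y, z), t0) = \<Omega> (x, y)"
    and \<kappa>: "\<kappa> > 0" and fZ: "\<And>p. p \<in> W \<Longrightarrow> \<bar>f p\<bar> < \<kappa> * Z"
    and c: "\<Omega> (x0, y0) = 0" "dird (0, 1) \<Omega> (x0, y0) > 0"
  shows "\<exists>B. (x0, y0) \<in> interior B \<and> closed B \<and> B \<subseteq> W \<and>
    eventually (\<lambda>t. connected (zero_curve \<Phi> \<Psi> B Z t) \<and> zero_curve \<Phi> \<Psi> B Z t \<noteq> {}) (nhds t0)"
proof -
  have c\<Omega>: "continuous_on UNIV \<Omega>" and c\<Omega>': "continuous_on UNIV (dird (0, 1) \<Omega>)"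
    by (rule rpf_cont[OF \<Omega>] rpf_cont[OF rpf_dird[OF \<Omega>]])+
  have "open (W \<inter> {p. dird (0, 1) \<Omega> p > 0})"
    by (intro open_Int W(1) open_Collect_less c\<Omega>' continuous_on_const)
  moreover have "(x0, y0) \<in> W \<inter> {p. dird (0, 1) \<Omega> p > 0}" using W(2) c(2) by simp
  ultimately obtain b where b: "b > 0"
    "{x0 - b..x0 + b} \<times> {y0 - b..y0 + b} \<subseteq> W \<inter> {p. dird (0, 1) \<Omega> p > 0}"
    by (rule open_contains_square)
  have pos: "dird (0, 1) \<Omega> (x, y) > 0" if "x \<in> {x0 - b..x0 + b}" "y \<in> {y0 - b..y0 + b}" for x y
    using b(2) that by blast
  have ends: "\<Omega> (x0, y0 - b) < 0" "\<Omega> (x0, y0 + b) > 0"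
  proof -
    have "\<Omega> (x0, y0 - b) < \<Omega> (x0, y0)" "\<Omega> (x0, y0) < \<Omega> (x0, y0 + b)"
      by (rule dird_pos_strict_mono[OF \<Omega> pos]; use b(1) in simp)+
    then show "\<Omega> (x0, y0 - b) < 0" "\<Omega> (x0, y0 + b) > 0" using c(1) by auto
  qed
  have "open {x. \<Omega> (x, y0 - b) < 0 \<and> \<Omega> (x, y0 + b) > 0}"
    by (intro open_Collect_conj open_Collect_less continuous_on_compose2[OF c\<Omega>]) (auto intro!: continuous_intros)
  then obtain a0 where a0: "a0 > 0" "cball x0 a0 \<subseteq> {x. \<Omega> (x, y0 - b) < 0 \<and> \<Omega> (x, y0 + b) > 0}"
    using ends open_contains_cball by blast
  define a where "a = min a0 b"
  have a: "a > 0" "a \<le> b" using a0 b by (auto simp: a_def)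
  have side0: "\<Omega> (x, y0 - b) < 0" "\<Omega> (x, y0 + b) > 0" if "x \<in> {x0 - a..x0 + a}" for x
  proof -
    have "x \<in> cball x0 a0" using that by (auto simp: cball_eq_atLeastAtMost a_def)
    then show "\<Omega> (x, y0 - b) < 0" "\<Omega> (x, y0 + b) > 0" using a0(2) by auto
  qed
  let ?I = "{x0 - a..x0 + a}" and ?J = "{y0 - b..y0 + b}"
  let ?B = "?I \<times> ?J" and ?X = "?I \<times> ?J \<times> {-Z..Z}"
  have BW: "?B \<subseteq> W" using b(2) a by fastforce
  have posX: "dird (0, 1) \<Omega> (x, y) > 0" if "x \<in> ?I" "y \<in> ?J" for x y
    using that a by (intro pos) auto
  note d\<Phi>3 = dird_limit_affine[OF \<Phi> l1] and d\<Psi> = dird_limit_planar[OF \<Psi> \<Omega> l2]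
  have c\<Phi>: "continuous_on UNIV \<Phi>" and c\<Psi>: "continuous_on UNIV \<Psi>"
    by (rule rpf_cont[OF \<Phi>] rpf_cont[OF \<Psi>])+
  have E1: "eventually (\<lambda>t. \<forall>p\<in>?I \<times> {-Z..Z}. (p, t) \<in> {q. \<Psi> ((fst (fst q), y0 - b, snd (fst q)), snd q) < 0 \<and>
      \<Psi> ((fst (fst q), y0 + b, snd (fst q)), snd q) > 0}) (nhds t0)"
    by (intro eventually_tube compact_Times open_Collect_conj open_Collect_less
        continuous_on_compose2[OF c\<Psi>] continuous_intros) (use side0 in \<open>auto simp: l2\<close>)
  have E2: "eventually (\<lambda>t. \<forall>p\<in>?B. (p, t) \<in> {q. \<Phi> ((fst (fst q), snd (fst q), -Z), snd q) < 0 \<and>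
      \<Phi> ((fst (fst q), snd (fst q), Z), snd q) > 0}) (nhds t0)"
  proof (intro eventually_tube compact_Times open_Collect_conj open_Collect_less
        continuous_on_compose2[OF c\<Phi>] continuous_intros)
    fix p assume "p \<in> ?B"
    then have "\<bar>f p\<bar> < \<kappa> * Z" using fZ BW by blast
    then show "(p, t0) \<in> {q. \<Phi> ((fst (fst q), snd (fst q), -Z), snd q) < 0 \<and>
      \<Phi> ((fst (fst q), snd (fst q), Z), snd q) > 0}" by (auto simp: l1)
  qed auto
  have E3: "eventually (\<lambda>t. \<forall>p\<in>?X. (p, t) \<in> {q. dird ex3 \<Phi> q > 0}) (nhds t0)"
    by (intro eventually_tube compact_Times open_Collect_less rpf_cont[OF rpf_dird[OF \<Phi>]] continuous_on_const)
      (auto simp: d\<Phi>3 \<kappa>)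
  \<comment> \<open>The tube lemma is applied to pairs of points, because the determinant condition
    has its two rows at independent points.\<close>
  have E4: "eventually (\<lambda>t. \<forall>r\<in>?X \<times> ?X. (r, t) \<in> {s.
       dird ex2 \<Psi> (snd (fst s), snd s) * dird ex3 \<Phi> (fst (fst s), snd s)
       - dird ex3 \<Psi> (snd (fst s), snd s) * dird ex2 \<Phi> (fst (fst s), snd s) > 0}) (nhds t0)"
    by (intro eventually_tube compact_Times open_Collect_less continuous_intros
        continuous_on_compose2[OF rpf_cont[OF rpf_dird[OF \<Phi>], of UNIV]]
        continuous_on_compose2[OF rpf_cont[OF rpf_dird[OF \<Psi>], of UNIV]])
      (auto simp: d\<Phi>3 \<kappa> d\<Psi> posX dird_zero_dir[OF \<Omega>, unfolded zero_prod_def])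
  show ?thesis
  proof (intro exI[of _ ?B] conjI)
    show "(x0, y0) \<in> interior ?B" using a b(1) by (simp add: interior_Times)
    show "closed ?B" by (intro closed_Times) auto
    show "?B \<subseteq> W" by fact
    show "eventually (\<lambda>t. connected (zero_curve \<Phi> \<Psi> ?B Z t) \<and> zero_curve \<Phi> \<Psi> ?B Z t \<noteq> {}) (nhds t0)"
      using E1 E2 E3 E4
    proof eventually_elim
      case (elim t)
      have M: "dird ex2 \<Psi> (q, t) * dird ex3 \<Phi> (p, t) - dird ex3 \<Psi> (q, t) * dird ex2 \<Phi> (p, t) > 0"
        if "p \<in> ?X" "q \<in> ?X" for p q
        using that bspec[OF elim(4), of "(p, q)"] by simp
      have S: "\<Psi> ((x, y0 - b, z), t) < 0 \<and> \<Psi> ((x, y0 + b, z), t) > 0" if "x \<in> ?I" "z \<in> {-Z..Z}" for x z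
        using that bspec[OF elim(1), of "(x, z)"] by simp
      have T: "\<Phi> ((x, y, -Z), t) < 0 \<and> \<Phi> ((x, y, Z), t) > 0" if "x \<in> ?I" "y \<in> ?J" for x y
        using that bspec[OF elim(2), of "(x, y)"] by simp
      have D: "dird ex3 \<Phi> (p, t) > 0" if "p \<in> ?X" for p
        using that bspec[OF elim(3), of p] by simp
      have "x0 - a \<le> x0 + a" "y0 - b \<le> y0 + b" using a b by auto
      note unique_zero_graph[OF \<Phi> \<Psi> this Z T S D M]
      then show ?case by simp
    qed
  qed
qed

text \<open>Changing the signs of \<Phi> and \<Psi>, and exchanging x and y if necessary, turns any
  point with nonzero gradient into the case of \<open>box_vertical\<close>.\<close>

lemma box:
  fixes \<Phi> \<Psi> :: "(real \<times> real \<times> real) \<times> 'p::euclidean_space \<Rightarrow> real"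
  assumes \<Phi>: "rpf \<Phi>" and \<Psi>: "rpf \<Psi>" and \<Omega>: "rpf \<Omega>" and W: "open W" "c \<in> W" and Z: "Z > 0"
    and l1: "\<And>x y z. \<Phi> ((x, y, z), t0) = \<kappa> * z + f (x, y)" and l2: "\<And>x y z. \<Psi> ((x, y, z), t0) = \<Omega> (x, y)"
    and \<kappa>: "\<kappa> \<noteq> 0" and fZ: "\<And>p. p \<in> W \<Longrightarrow> \<bar>f p\<bar> < \<bar>\<kappa>\<bar> * Z"
    and c: "\<Omega> c = 0" "dird (1, 0) \<Omega> c \<noteq> 0 \<or> dird (0, 1) \<Omega> c \<noteq> 0"
  shows "\<exists>B. c \<in> interior B \<and> closed B \<and> B \<subseteq> W \<and>
    eventually (\<lambda>t. connected (zero_curve \<Phi> \<Psi> B Z t) \<and> zero_curve \<Phi> \<Psi> B Z t \<noteq> {}) (nhds t0)"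
proof -
  obtain x0 y0 where c0: "c = (x0, y0)" by (cases c)
  have scale: "zero_curve (\<lambda>p. a * \<Phi> p) (\<lambda>p. b * \<Psi> p) B Z t = zero_curve \<Phi> \<Psi> B Z t"
    if "a \<noteq> 0" "b \<noteq> 0" for a b B t and \<Phi> \<Psi> :: "(real \<times> real \<times> real) \<times> 'p \<Rightarrow> real"
    using that by (auto simp: zero_curve_def)
  have \<kappa>': "sgn \<kappa> * \<kappa> = \<bar>\<kappa>\<bar>" by (simp add: abs_sgn mult.commute)
  show ?thesis
  proof (cases "dird (0, 1) \<Omega> c = 0")
    case False
    define s where "s = sgn (dird (0, 1) \<Omega> c)"
    have s: "s \<noteq> 0" "s * dird (0, 1) \<Omega> c > 0" using False by (auto simp: s_def sgn_if)
    have "\<exists>B. (x0, y0) \<in> interior B \<and> closed B \<and> B \<subseteq> W \<and> eventually (\<lambda>t.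
        connected (zero_curve (\<lambda>p. sgn \<kappa> * \<Phi> p) (\<lambda>p. s * \<Psi> p) B Z t) \<and>
        zero_curve (\<lambda>p. sgn \<kappa> * \<Phi> p) (\<lambda>p. s * \<Psi> p) B Z t \<noteq> {}) (nhds t0)"
    proof (rule box_vertical[where \<kappa> = "\<bar>\<kappa>\<bar>" and f = "\<lambda>p. sgn \<kappa> * f p" and \<Omega> = "\<lambda>p. s * \<Omega> p"])
      show "dird (0, 1) (\<lambda>p. s * \<Omega> p) (x0, y0) > 0" using s c0 by (simp add: dird_cmult[OF \<Omega>])
      show "sgn \<kappa> * \<Phi> ((x, y, z), t0) = \<bar>\<kappa>\<bar> * z + sgn \<kappa> * f (x, y)" for x y z
        by (simp add: l1 distrib_left \<kappa>' flip: mult.assoc)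
      show "\<bar>sgn \<kappa> * f p\<bar> < \<bar>\<kappa>\<bar> * Z" if "p \<in> W" for p
        using fZ[OF that] \<kappa> by (simp add: abs_mult abs_sgn_eq)
    qed (use W Z c c0 l2 \<kappa> in \<open>auto intro: rpf_intros \<Phi> \<Psi> \<Omega>\<close>)
    then show ?thesis using \<kappa> s(1) by (simp add: scale c0 sgn_0_0)
  next
    case True
    define s where "s = sgn (dird (1, 0) \<Omega> c)"
    have s: "s \<noteq> 0" "s * dird (1, 0) \<Omega> c > 0" using True c(2) by (auto simp: s_def sgn_if)
    define \<tau> :: "(real \<times> real \<times> real) \<times> 'p \<Rightarrow> (real \<times> real \<times> real) \<times> 'p"
      where "\<tau> p = ((fst (snd (fst p)), fst (fst p), snd (snd (fst p))), snd p)" for p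
    have \<tau>: "polynomial_function \<tau>" unfolding \<tau>_def
      by (intro rpf_intros)
    have sw: "polynomial_function (\<lambda>p::real \<times> real. (snd p, fst p))" by (intro rpf_intros)
    have swb: "bounded_linear (\<lambda>p::real \<times> real. (snd p, fst p))" by (intro bounded_linear_intros)
    let ?\<Phi> = "\<lambda>p. \<Phi> (\<tau> p)" and ?\<Psi> = "\<lambda>p. \<Psi> (\<tau> p)" and ?\<Omega> = "\<lambda>p. \<Omega> (snd p, fst p)"
    have r: "rpf ?\<Phi>" "rpf ?\<Psi>" "rpf ?\<Omega>"
      by (rule rpf_comp[OF \<Phi> \<tau>] rpf_comp[OF \<Psi> \<tau>] rpf_comp[OF \<Omega> sw])+
    let ?W = "(\<lambda>p. (snd p, fst p)) -` W"
    have oW: "open ?W" by (intro open_vimage W continuous_intros)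
    have "\<exists>B. (y0, x0) \<in> interior B \<and> closed B \<and> B \<subseteq> ?W \<and> eventually (\<lambda>t.
        connected (zero_curve (\<lambda>p. sgn \<kappa> * ?\<Phi> p) (\<lambda>p. s * ?\<Psi> p) B Z t) \<and>
        zero_curve (\<lambda>p. sgn \<kappa> * ?\<Phi> p) (\<lambda>p. s * ?\<Psi> p) B Z t \<noteq> {}) (nhds t0)"
    proof (rule box_vertical[where \<kappa> = "\<bar>\<kappa>\<bar>" and f = "\<lambda>p. sgn \<kappa> * f (snd p, fst p)" and \<Omega> = "\<lambda>p. s * ?\<Omega> p"])
      show "dird (0, 1) (\<lambda>p. s * ?\<Omega> p) (y0, x0) > 0"
        using s c0 by (simp add: dird_cmult[OF r(3)] dird_linear_comp[OF \<Omega> swb])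
      show "sgn \<kappa> * ?\<Phi> ((x, y, z), t0) = \<bar>\<kappa>\<bar> * z + sgn \<kappa> * f (snd (x, y), fst (x, y))" for x y z
        by (simp add: l1 distrib_left \<kappa>' \<tau>_def flip: mult.assoc)
      show "\<bar>sgn \<kappa> * f (snd p, fst p)\<bar> < \<bar>\<kappa>\<bar> * Z" if "p \<in> ?W" for p
        using fZ[of "(snd p, fst p)"] that \<kappa> by (simp add: abs_mult abs_sgn_eq)
      show "s * ?\<Psi> ((x, y, z), t0) = s * \<Omega> (snd (x, y), fst (x, y))" for x y z by (simp add: l2 \<tau>_def)
      show "rpf (\<lambda>p. sgn \<kappa> * ?\<Phi> p)" "rpf (\<lambda>p. s * ?\<Psi> p)" "rpf (\<lambda>p. s * ?\<Omega> p)"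
        using r by (auto intro: rpf_basic)
    qed (use oW W Z c c0 \<kappa> in auto)
    then obtain B where B: "(y0, x0) \<in> interior B" "closed B" "B \<subseteq> ?W" "eventually (\<lambda>t.
        connected (zero_curve ?\<Phi> ?\<Psi> B Z t) \<and> zero_curve ?\<Phi> ?\<Psi> B Z t \<noteq> {}) (nhds t0)"
      using \<kappa> s(1) by (auto simp: scale sgn_0_0)
    let ?s = "\<lambda>p::real \<times> real. (snd p, fst p)"
    let ?B = "?s -` B"
    have i: "c \<in> interior ?B"
    proof (rule interiorI)
      show "open (?s -` interior B)" by (intro open_vimage continuous_intros) auto
      show "?s -` interior B \<subseteq> ?B" using interior_subset by auto
    qed (use B(1) c0 in auto)
    have im: "zero_curve \<Phi> \<Psi> ?B Z t = (\<lambda>p. (fst (snd p), fst p, snd (snd p))) ` zero_curve ?\<Phi> ?\<Psi> B Z t" for t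
    proof (intro subset_antisym subsetI)
      fix p assume "p \<in> zero_curve \<Phi> \<Psi> ?B Z t"
      then have "(fst (snd p), fst p, snd (snd p)) \<in> zero_curve ?\<Phi> ?\<Psi> B Z t"
        by (auto simp: zero_curve_def \<tau>_def)
      then show "p \<in> (\<lambda>p. (fst (snd p), fst p, snd (snd p))) ` zero_curve ?\<Phi> ?\<Psi> B Z t"
        by (rule rev_image_eqI) simp
    qed (auto simp: zero_curve_def \<tau>_def)
    have "eventually (\<lambda>t. connected (zero_curve \<Phi> \<Psi> ?B Z t) \<and> zero_curve \<Phi> \<Psi> ?B Z t \<noteq> {}) (nhds t0)"
      using B(4) unfolding im
      by eventually_elim (auto intro!: connected_continuous_image continuous_intros)
    then show ?thesis
      using i B(2,3) by (intro exI[of _ ?B]) (auto intro!: closed_vimage continuous_intros)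
  qed
qed

text \<open>The local boxes are assembled by \<open>ovals_stable\<close>; the bound on
  \<open>f\<close> keeps the limit curve off the top and bottom of the cylinder. Transversality is
  an open condition on the compact cylinder: at \<open>t0\<close> the two minors are \<kappa> times
  the partial derivatives of \<Omega>.\<close>

theorem zero_curve_stable:
  fixes \<Phi> \<Psi> :: "(real \<times> real \<times> real) \<times> 'p::euclidean_space \<Rightarrow> real"
  assumes \<Phi>: "rpf \<Phi>" and \<Psi>: "rpf \<Psi>" and \<Omega>: "rpf \<Omega>" and K: "compact K" and Z: "Z > 0"
    and l1: "\<And>x y z. \<Phi> ((x, y, z), t0) = \<kappa> * z + f (x, y)" and l2: "\<And>x y z. \<Psi> ((x, y, z), t0) = \<Omega> (x, y)"
    and \<kappa>: "\<kappa> \<noteq> 0" and fZ: "\<And>p. p \<in> K \<Longrightarrow> \<bar>f p\<bar> < \<bar>\<kappa>\<bar> * Z"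
    and C0: "ovals N {p \<in> K. \<Omega> p = 0}" "{p \<in> K. \<Omega> p = 0} \<subseteq> interior K"
    and reg: "\<And>p. p \<in> K \<Longrightarrow> \<Omega> p = 0 \<Longrightarrow> dird (1, 0) \<Omega> p \<noteq> 0 \<or> dird (0, 1) \<Omega> p \<noteq> 0"
  shows "eventually (\<lambda>t. ovals N (zero_curve \<Phi> \<Psi> K Z t)) (nhds t0)"
    and "eventually (\<lambda>t. \<forall>p\<in>zero_curve \<Phi> \<Psi> K Z t.
       dird ex3 \<Phi> (p, t) * dird ex1 \<Psi> (p, t) - dird ex1 \<Phi> (p, t) * dird ex3 \<Psi> (p, t) \<noteq> 0 \<or>
       dird ex3 \<Phi> (p, t) * dird ex2 \<Psi> (p, t) - dird ex2 \<Phi> (p, t) * dird ex3 \<Psi> (p, t) \<noteq> 0) (nhds t0)"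
proof -
  let ?C = "zero_curve \<Phi> \<Psi> K Z"
  let ?\<pi> = "\<lambda>p::real \<times> real \<times> real. (fst p, fst (snd p))"
  let ?X = "(\<lambda>p::(real \<times> real) \<times> real. (fst (fst p), snd (fst p), snd p)) ` (K \<times> {-Z..Z})"
  have X: "compact ?X"
    by (intro compact_continuous_image continuous_intros compact_Times K) auto
  have CX: "?C t \<subseteq> ?X" for t
  proof
    fix p assume "p \<in> ?C t"
    then obtain x y z where p: "p = (x, y, z)" "(x, y) \<in> K" "\<bar>z\<bar> \<le> Z" by (auto simp: zero_curve_def)
    then have "((x, y), z) \<in> K \<times> {-Z..Z}" by (auto simp: abs_le_iff)
    then show "p \<in> ?X" by (rule rev_image_eqI) (simp add: p)
  qed
  have c\<Phi>: "continuous_on UNIV \<Phi>" and c\<Psi>: "continuous_on UNIV \<Psi>"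
    by (rule rpf_cont[OF \<Phi>] rpf_cont[OF \<Psi>])+
  have c\<pi>: "continuous_on UNIV ?\<pi>" by (intro continuous_intros)
  show "eventually (\<lambda>t. ovals N (?C t)) (nhds t0)"
  proof (rule ovals_stable[OF C0(1) c\<pi>])
    fix c W assume c: "c \<in> {p \<in> K. \<Omega> p = 0}" and W: "open W" "c \<in> W"
    have "\<exists>B. c \<in> interior B \<and> closed B \<and> B \<subseteq> W \<inter> interior K \<and>
      eventually (\<lambda>t. connected (zero_curve \<Phi> \<Psi> B Z t) \<and> zero_curve \<Phi> \<Psi> B Z t \<noteq> {}) (nhds t0)"
    proof (rule box[OF \<Phi> \<Psi> \<Omega> _ _ Z l1 l2 \<kappa>])
      show "\<bar>f p\<bar> < \<bar>\<kappa>\<bar> * Z" if "p \<in> W \<inter> interior K" for p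
        using fZ[of p] interior_subset[of K] that by blast
    qed (use c W C0(2) reg in auto)
    then obtain B where B: "c \<in> interior B" "closed B" "B \<subseteq> W \<inter> interior K"
      "eventually (\<lambda>t. connected (zero_curve \<Phi> \<Psi> B Z t) \<and> zero_curve \<Phi> \<Psi> B Z t \<noteq> {}) (nhds t0)"
      by (elim exE conjE) (rule that)
    have "?C t \<inter> ?\<pi> -` B = zero_curve \<Phi> \<Psi> B Z t" for t
      using B(3) interior_subset[of K] by (auto simp: zero_curve_def)
    then show "\<exists>B. c \<in> interior B \<and> closed B \<and> B \<subseteq> W \<and>
      eventually (\<lambda>t. connected (?C t \<inter> ?\<pi> -` B) \<and> ?C t \<inter> ?\<pi> -` B \<noteq> {}) (nhds t0)"
      using B by (intro exI[of _ B]) auto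
  next
    fix W assume W: "open W" "{p \<in> K. \<Omega> p = 0} \<subseteq> W"
    have "eventually (\<lambda>t. \<forall>p\<in>?X. (p, t) \<in> (\<lambda>q. ?\<pi> (fst q)) -` W \<union> {q. \<Psi> q \<noteq> 0}) (nhds t0)"
    proof (rule eventually_tube[OF X])
      show "open ((\<lambda>q::(real \<times> real \<times> real) \<times> 'p. ?\<pi> (fst q)) -` W \<union> {q. \<Psi> q \<noteq> 0})"
        by (intro open_Un open_vimage W open_Collect_neq c\<Psi> continuous_intros)
    qed (use W(2) l2 in auto)
    then show "eventually (\<lambda>t. ?\<pi> ` ?C t \<subseteq> W) (nhds t0)"
    proof eventually_elim
      case (elim t)
      show ?case
      proof (intro image_subsetI)
        fix p assume p: "p \<in> ?C t"
        then have "\<Psi> (p, t) = 0" by (auto simp: zero_curve_def)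
        moreover have "(p, t) \<in> (\<lambda>q. ?\<pi> (fst q)) -` W \<union> {q. \<Psi> q \<noteq> 0}"
          using elim subsetD[OF CX p] by (rule bspec)
        ultimately show "?\<pi> p \<in> W" by auto
      qed
    qed
  qed (simp add: compact_zero_curve[OF \<Phi> \<Psi> K])
  let ?M = "\<lambda>v q. dird ex3 \<Phi> q * dird v \<Psi> q - dird v \<Phi> q * dird ex3 \<Psi> q"
  have "eventually (\<lambda>t. \<forall>p\<in>?X. (p, t) \<in> {q. \<Psi> q \<noteq> 0} \<union> ({q. ?M ex1 q \<noteq> 0} \<union> {q. ?M ex2 q \<noteq> 0})) (nhds t0)"
  proof (rule eventually_tube[OF X])
    show "open ({q. \<Psi> q \<noteq> 0} \<union> ({q. ?M ex1 q \<noteq> 0} \<union> {q. ?M ex2 q \<noteq> 0}))"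
      by (intro open_Un open_Collect_neq c\<Psi> continuous_on_diff continuous_on_mult continuous_on_const
          rpf_cont[OF rpf_dird[OF \<Phi>]] rpf_cont[OF rpf_dird[OF \<Psi>]])
    fix p assume "p \<in> ?X"
    then obtain x y z where p: "p = (x, y, z)" "(x, y) \<in> K" by auto
    show "(p, t0) \<in> {q. \<Psi> q \<noteq> 0} \<union> ({q. ?M ex1 q \<noteq> 0} \<union> {q. ?M ex2 q \<noteq> 0})"
      using reg[OF p(2)] \<kappa>
      by (auto simp: p l2 dird_limit_affine[OF \<Phi> l1] dird_limit_planar[OF \<Psi> \<Omega> l2]
          dird_zero_dir[OF \<Omega>, unfolded zero_prod_def])
  qed
  then show "eventually (\<lambda>t. \<forall>p\<in>?C t. ?M ex1 (p, t) \<noteq> 0 \<or> ?M ex2 (p, t) \<noteq> 0) (nhds t0)"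
  proof eventually_elim
    case (elim t)
    show ?case
    proof
      fix p assume p: "p \<in> ?C t"
      then have "\<Psi> (p, t) = 0" by (auto simp: zero_curve_def)
      then show "?M ex1 (p, t) \<noteq> 0 \<or> ?M ex2 (p, t) \<noteq> 0" using elim CX[of t] p by blast
    qed
  qed
qed

section \<open>Hessian curve of a binary form times a distant line\<close>

lemma rolle_roots:
  fixes p :: "real poly"
  assumes "finite S" "S \<noteq> {}" "\<And>x. x \<in> S \<Longrightarrow> poly p x = 0"
  shows "\<exists>T. finite T \<and> Suc (card T) = card S \<and> (\<forall>x\<in>T. poly (pderiv p) x = 0 \<and> x < Max S)"
  using assms
proof (induction S rule: finite_linorder_max_induct)
  case empty then show ?case by simp
next
  case (insert b A)
  show ?case
  proof (cases "A = {}")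
    case True then show ?thesis by (intro exI[of _ "{}"]) auto
  next
    case False
    then obtain T where T: "finite T" "Suc (card T) = card A" "\<forall>x\<in>T. poly (pderiv p) x = 0 \<and> x < Max A"
      using insert by auto
    have M: "Max A \<in> A" "Max A < b" using False insert by auto
    obtain z where z: "Max A < z" "z < b" "poly p b - poly p (Max A) = (b - Max A) * poly (pderiv p) z"
      using poly_MVT[OF M(2)] by auto
    then have "poly (pderiv p) z = 0" using insert.prems(2) M by auto
    moreover have "Max (insert b A) = b" using insert.hyps by (intro Max_eqI) (auto intro: less_imp_le)
    \<comment> \<open>The points found before lie below \<open>Max A\<close>, hence below z; the
      bound is part of the induction for this reason.\<close>
    moreover have "z \<notin> T" using T(3) z(1) by auto
    moreover have "b \<notin> A" using insert.hyps(2) by auto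
    ultimately show ?thesis using T z M(2) insert.hyps(1)
      by (intro exI[of _ "insert z T"]) auto
  qed
qed

text \<open>\<open>card {x. poly p x = 0} = degree p\<close> is the encoding of having only real and
  simple roots. The cofactor of a root inherits it by counting.\<close>

lemma split_simple_root:
  fixes p :: "real poly"
  assumes "p \<noteq> 0" "card {x. poly p x = 0} = degree p" "poly p a = 0"
  obtains q where "p = [:-a, 1:] * q" "q \<noteq> 0" "degree p = Suc (degree q)" "poly q a \<noteq> 0"
    "card {x. poly q x = 0} = degree q"
proof -
  obtain q where q: "p = [:-a, 1:] * q" using assms(3) poly_eq_0_iff_dvd by (metis dvdE)
  have q0: "q \<noteq> 0" using q assms(1) by auto
  have d: "degree p = Suc (degree q)" using q0 degree_mult_eq[of "[:-a, 1:]" q] q by (simp del: mult_pCons_left)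
  have fin: "finite {x. poly q x = 0}" using poly_roots_finite q0 by auto
  have r: "{x. poly p x = 0} = insert a {x. poly q x = 0}" using q by auto
  have le: "card {x. poly q x = 0} \<le> degree q" using card_poly_roots_bound[OF q0] by simp
  have na: "a \<notin> {x. poly q x = 0}"
  proof
    assume "a \<in> {x. poly q x = 0}"
    then have "card {x. poly p x = 0} = card {x. poly q x = 0}" using r by (simp add: insert_absorb)
    then show False using le d assms(2) by simp
  qed
  then have "card {x. poly q x = 0} = degree q" using r d assms(2) fin by simp
  then show ?thesis using that q q0 d na by auto
qed

lemma simple_root_pderiv:
  fixes p :: "real poly"
  assumes "p \<noteq> 0" "card {x. poly p x = 0} = degree p" "poly p a = 0"
  shows "poly (pderiv p) a \<noteq> 0"
proof -
  obtain q where q: "p = [:-a, 1:] * q" "poly q a \<noteq> 0" by (rule split_simple_root[OF assms])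
  then show ?thesis by (simp add: pderiv_mult pderiv_pCons del: mult_pCons_left)
qed

lemma poly_eq_prod_roots:
  fixes p :: "real poly"
  assumes "p \<noteq> 0" "card {x. poly p x = 0} = degree p"
  shows "poly p x = lead_coeff p * (\<Prod>a\<in>{x. poly p x = 0}. x - a)"
  using assms
proof (induction "degree p" arbitrary: p)
  case 0
  then have "{x. poly p x = 0} = {}" using poly_roots_finite[OF 0(2)] by simp
  moreover obtain c where "p = [:c:]" using 0(1) degree_eq_zeroE by metis
  ultimately show ?case by simp
next
  case (Suc n)
  have "{x. poly p x = 0} \<noteq> {}" using Suc.hyps(2) Suc.prems by force
  then obtain a where a: "poly p a = 0" by auto
  obtain q where q: "p = [:-a, 1:] * q" "q \<noteq> 0" "degree p = Suc (degree q)" "poly q a \<noteq> 0"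
    "card {x. poly q x = 0} = degree q"
    by (rule split_simple_root[OF Suc.prems a])
  have "poly q x = lead_coeff q * (\<Prod>a\<in>{x. poly q x = 0}. x - a)"
    using Suc.hyps(1)[of q] q Suc.hyps(2) by simp
  moreover have "lead_coeff p = lead_coeff q"
    using q(1) lead_coeff_mult[of "[:-a, 1:]" q] by (simp del: mult_pCons_left)
  moreover have "poly p x = (x - a) * poly q x" by (subst q(1)) (simp add: algebra_simps)
  moreover have "(\<Prod>a\<in>{x. poly p x = 0}. x - a) = (x - a) * (\<Prod>a\<in>{x. poly q x = 0}. x - a)"
  proof -
    have "{x. poly p x = 0} = insert a {x. poly q x = 0}" using q(1) by auto
    moreover have "finite {x. poly q x = 0}" using poly_roots_finite q(2) by auto
    ultimately show ?thesis using q(4) by simp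
  qed
  ultimately show ?case by simp
qed

lemma pderiv_real_rooted:
  fixes p :: "real poly"
  assumes "card {x. poly p x = 0} = degree p" "degree p > 0"
  shows "card {x. poly (pderiv p) x = 0} = degree (pderiv p)" "degree (pderiv p) = degree p - 1"
    "lead_coeff (pderiv p) = degree p * lead_coeff p" "pderiv p \<noteq> 0"
proof -
  have p0: "p \<noteq> 0" using assms(2) by auto
  have d0: "pderiv p \<noteq> 0" using assms(2) pderiv_eq_0_iff[of p] by simp
  have fin: "finite {x. poly p x = 0}" using poly_roots_finite[OF p0] .
  have ne: "{x. poly p x = 0} \<noteq> {}" using assms by (metis card.empty less_irrefl)
  show deg: "degree (pderiv p) = degree p - 1" by (rule degree_pderiv)
  obtain T where T: "finite T" "Suc (card T) = degree p" "\<forall>x\<in>T. poly (pderiv p) x = 0"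
    using rolle_roots[OF fin ne, of p] assms(1) by auto
  have "card T \<le> card {x. poly (pderiv p) x = 0}"
    using T poly_roots_finite[OF d0] by (intro card_mono) auto
  then show "card {x. poly (pderiv p) x = 0} = degree (pderiv p)"
    using card_poly_roots_bound[OF d0] T(2) deg by simp
  show "lead_coeff (pderiv p) = degree p * lead_coeff p"
    using assms(2) by (simp add: deg coeff_pderiv)
  show "pderiv p \<noteq> 0" by fact
qed

definition interval_family :: "nat \<Rightarrow> (real \<Rightarrow> real) \<Rightarrow> (real \<times> real) set \<Rightarrow> bool" where
  "interval_family m r I \<longleftrightarrow> finite I \<and> card I = m \<and> (\<forall>(a, b)\<in>I. a < b \<and> r a = 0 \<and> r b = 0) \<and>
     {s. r s \<le> 0} = (\<Union>(a, b)\<in>I. {a..b}) \<and> (\<forall>i\<in>I. \<forall>j\<in>I. i \<noteq> j \<longrightarrow> {fst i..snd i} \<inter> {fst j..snd j} = {})"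

lemma prod_neg_even:
  assumes "finite S" "even (card S)" "\<And>a. a \<in> S \<Longrightarrow> x < (a::real)" shows "(\<Prod>a\<in>S. x - a) > 0"
proof -
  have "(\<Prod>a\<in>S. x - a) = (\<Prod>a\<in>S. - (a - x))" by simp
  also have "\<dots> = (-1) ^ card S * (\<Prod>a\<in>S. a - x)" by (simp only: prod_uminus)
  also have "\<dots> = (\<Prod>a\<in>S. a - x)" using assms(2) by simp
  also have "\<dots> > 0" using assms(3) by (intro prod_pos) auto
  finally show ?thesis .
qed

text \<open>Consecutive roots are paired from the left. Splitting off the two smallest roots leaves
  an even number of factors, whose product is positive up to the second root. Recording that left
  end points are roots shows that the new interval lies to the left of all the others.\<close>

lemma interval_family_prod:
  assumes "finite C" "card C = 2 * m"
  shows "\<exists>I. interval_family m (\<lambda>s. \<Prod>a\<in>C. s - a) I \<and> (\<forall>(a, b)\<in>I. a \<in> C)"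
  using assms
proof (induction m arbitrary: C)
  case 0 then show ?case by (intro exI[of _ "{}"]) (auto simp: interval_family_def)
next
  case (Suc m)
  define a where "a = Min C"
  have C: "C \<noteq> {}" using Suc.prems by auto
  have a: "a \<in> C" "\<And>c. c \<in> C \<Longrightarrow> a \<le> c" using Suc.prems(1) C by (auto simp: a_def)
  define C1 where "C1 = C - {a}"
  have C1: "finite C1" "card C1 = Suc (2 * m)" using Suc.prems a by (auto simp: C1_def)
  then have C1n: "C1 \<noteq> {}" by auto
  define b where "b = Min C1"
  have b: "b \<in> C1" "\<And>c. c \<in> C1 \<Longrightarrow> b \<le> c" using C1 C1n by (auto simp: b_def)
  define C2 where "C2 = C1 - {b}"
  have C2: "finite C2" "card C2 = 2 * m" using C1 b by (auto simp: C2_def)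
  have ab: "a < b" using a(2)[of b] b(1) by (auto simp: C1_def)
  have bc: "b < c" if "c \<in> C2" for c using b(2)[of c] that by (auto simp: C2_def)
  obtain I where I: "interval_family m (\<lambda>s. \<Prod>a\<in>C2. s - a) I" "\<forall>(a, b)\<in>I. a \<in> C2"
    using Suc.IH[OF C2] by auto
  let ?r = "\<lambda>s. \<Prod>a\<in>C. s - a" and ?r2 = "\<lambda>s. \<Prod>a\<in>C2. s - a"
  have r: "?r s = (s - a) * (s - b) * ?r2 s" for s
    using Suc.prems(1) C1(1) a(1) b(1) by (simp add: C1_def C2_def prod.remove[of C a] prod.remove[of "C - {a}" b])
  have r2pos: "?r2 s > 0" if "s \<le> b" for s
    using C2 bc that by (intro prod_neg_even) fastforce+
  have iff: "?r s \<le> 0 \<longleftrightarrow> s \<in> {a..b} \<or> ?r2 s \<le> 0" for s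
  proof (cases "s \<in> {a..b}")
    case True
    then have "(s - a) * (s - b) \<le> 0" by (simp add: mult_nonneg_nonpos)
    then show ?thesis using r2pos[of s] True r by (simp add: mult_nonpos_nonneg less_imp_le)
  next
    case False
    then have "(s - a) * (s - b) > 0" using ab by (auto simp: mult_neg_neg not_le)
    then have "?r s \<le> 0 \<longleftrightarrow> ?r2 s \<le> 0"
      unfolding r using mult_le_cancel_left_pos[of "(s - a) * (s - b)" "?r2 s" 0] by simp
    then show ?thesis using False by blast
  qed
  have sep: "b < fst i" if "i \<in> I" for i using I(2) bc that by (cases i) auto
  have "(a, b) \<notin> I" using sep[of "(a, b)"] ab by auto
  moreover have "interval_family (Suc m) ?r (insert (a, b) I)"
    unfolding interval_family_def
  proof (intro conjI)
    show "finite (insert (a, b) I)" "card (insert (a, b) I) = Suc m"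
      using I(1) \<open>(a, b) \<notin> I\<close> by (auto simp: interval_family_def)
    show "\<forall>(a', b')\<in>insert (a, b) I. a' < b' \<and> ?r a' = 0 \<and> ?r b' = 0"
      using I(1) ab r by (auto simp: interval_family_def)
    have "{s. ?r s \<le> 0} = {a..b} \<union> {s. ?r2 s \<le> 0}" using iff by blast
    then show "{s. ?r s \<le> 0} = (\<Union>(a, b)\<in>insert (a, b) I. {a..b})"
      using I(1) by (simp add: interval_family_def)
    have "{a..b} \<inter> {fst j..snd j} = {}" if "j \<in> I" for j using sep[OF that] by auto
    then show "\<forall>i\<in>insert (a, b) I. \<forall>j\<in>insert (a, b) I. i \<noteq> j \<longrightarrow> {fst i..snd i} \<inter> {fst j..snd j} = {}"
      using I(1) by (auto simp: interval_family_def)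
  qed
  moreover have "\<forall>(a', b')\<in>insert (a, b) I. a' \<in> C" using I(2) a(1) by (auto simp: C2_def C1_def)
  ultimately show ?case by (intro exI[of _ "insert (a, b) I"]) simp
qed

text \<open>Over one interval the set is the union of the graphs of \<open>sqrt (R s)\<close> and
  \<open>- sqrt (R s)\<close>, which meet at the left end point because \<open>R\<close> vanishes
  there. So every interval contributes one continuum.\<close>

lemma ovals_double_cover:
  fixes R :: "real \<Rightarrow> real"
  assumes I: "interval_family m r I" and R: "continuous_on {s. r s \<le> 0} R"
    "\<And>s. r s \<le> 0 \<Longrightarrow> R s \<ge> 0" "\<And>s. r s = 0 \<Longrightarrow> R s = 0"
  shows "ovals m {(s, v). r s \<le> 0 \<and> v\<^sup>2 = R s}"
proof -
  define L where "L i = {(s, v). s \<in> {fst i..snd i} \<and> v\<^sup>2 = R s}" for i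
  have "ovals (card I * 1) (\<Union>i\<in>I. L i)"
  proof (rule ovals_UN)
    show "finite I" using I by (simp add: interval_family_def)
    fix i assume i: "i \<in> I"
    obtain a b where ab: "i = (a, b)" "a < b" "r a = 0" "{a..b} \<subseteq> {s. r s \<le> 0}"
      using I i by (cases i) (auto simp: interval_family_def)
    have c: "continuous_on {a..b} (\<lambda>s. sqrt (R s))"
      using continuous_on_subset[OF R(1) ab(4)] by (intro continuous_intros)
    have L: "L i = (\<lambda>s. (s, sqrt (R s))) ` {a..b} \<union> (\<lambda>s. (s, - sqrt (R s))) ` {a..b}"
    proof (intro subset_antisym subsetI)
      fix p assume "p \<in> L i"
      then obtain s v where p: "p = (s, v)" "s \<in> {a..b}" "v\<^sup>2 = R s" by (auto simp: L_def ab)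
      then have "v = sqrt (R s) \<or> v = - sqrt (R s)" by (metis abs_if real_sqrt_abs minus_minus)
      then show "p \<in> (\<lambda>s. (s, sqrt (R s))) ` {a..b} \<union> (\<lambda>s. (s, - sqrt (R s))) ` {a..b}"
        using p by auto
    next
      fix p assume "p \<in> (\<lambda>s. (s, sqrt (R s))) ` {a..b} \<union> (\<lambda>s. (s, - sqrt (R s))) ` {a..b}"
      then show "p \<in> L i" using R(2) ab by (auto simp: L_def)
    qed
    have "(a, 0) \<in> (\<lambda>s. (s, sqrt (R s))) ` {a..b} \<inter> (\<lambda>s. (s, - sqrt (R s))) ` {a..b}"
      using ab R(3) by force
    then have "connected (L i)" unfolding L
      by (intro connected_Un connected_continuous_image continuous_intros c) auto
    moreover have "compact (L i)" unfolding L
      by (intro compact_Un compact_continuous_image continuous_intros c) auto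
    moreover have "L i \<noteq> {}" using L ab by auto
    ultimately show "ovals 1 (L i)" by (intro ovals_1)
  next
    fix i j assume "i \<in> I" "j \<in> I" "i \<noteq> j"
    then have "{fst i..snd i} \<inter> {fst j..snd j} = {}" using I by (auto simp: interval_family_def)
    then show "L i \<inter> L j = {}" by (fastforce simp: L_def)
  qed
  moreover have "(\<Union>i\<in>I. L i) = {(s, v). r s \<le> 0 \<and> v\<^sup>2 = R s}"
  proof -
    have "r s \<le> 0 \<longleftrightarrow> (\<exists>i\<in>I. s \<in> {fst i..snd i})" for s
    proof -
      have "s \<in> {s. r s \<le> 0} \<longleftrightarrow> s \<in> (\<Union>(a, b)\<in>I. {a..b})" using I by (simp add: interval_family_def)
      then show ?thesis by (auto simp: case_prod_beta)
    qed
    then show ?thesis by (auto simp: L_def)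
  qed
  moreover have "card I = m" using I by (simp add: interval_family_def)
  ultimately show ?thesis by simp
qed

section \<open>Hessians of binary forms in the affine coordinate s = y / x\<close>

definition hess2 :: "(real \<times> real \<Rightarrow> real) \<Rightarrow> real \<times> real \<Rightarrow> real" where
  "hess2 g p = dird (1, 0) (dird (1, 0) g) p * dird (0, 1) (dird (0, 1) g) p
     - (dird (1, 0) (dird (0, 1) g) p)\<^sup>2"

lemma rpf_hess2 [rpf_intros]: "rpf g \<Longrightarrow> rpf (hess2 g)"
  unfolding hess2_def by (intro rpf_intros)

lemma dird_euler2:
  assumes "rpf g" "homog n g" shows "x * dird (1, 0) g (x, y) + y * dird (0, 1) g (x, y) = n * g (x, y)"
proof -
  have "(x, y) = x *\<^sub>R (1, 0) + y *\<^sub>R (0, 1::real)" by simp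
  then have "dird (x, y) g (x, y) = x * dird (1, 0) g (x, y) + y * dird (0, 1) g (x, y)"
    using dird_add_dir[OF assms(1)] dird_scale_dir[OF assms(1)] by metis
  then show ?thesis using euler[OF assms] by simp
qed

lemma Y_poly:
  fixes g :: "real \<times> real \<Rightarrow> real"
  assumes "rpf g" "\<And>s. g (1, s) = poly p s" shows "dird (0, 1) g (1, s) = poly (pderiv p) s"
proof -
  have "((\<lambda>s. g (1, s)) has_derivative (\<lambda>h. dird (0, h) g (1, s))) (at s)"
    by (rule has_derivative_compose[OF _ rpf_has_derivative[OF assms(1)]]) (auto intro!: derivative_eq_intros)
  moreover have "((\<lambda>s. g (1, s)) has_derivative (\<lambda>h. poly (pderiv p) s * h)) (at s)"
    unfolding assms(2) using poly_DERIV[of p s] by (simp add: has_field_derivative_def)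
  ultimately have "(\<lambda>h. dird (0, h) g (1, s)) = (\<lambda>h. poly (pderiv p) s * h)"
    by (rule has_derivative_unique)
  from fun_cong[OF this, of 1] show ?thesis by simp
qed

text \<open>\<open>q\<close> is the dehomogenised form. That it has degree n and n roots says that
  the root lines are real and distinct and that x = 0 is not one of them. \<open>gen\<close> keeps q
  and q'' from having a common root, so that their product has simple roots only; a generic shear
  achieves this.\<close>

locale hyperbolic_form =
  fixes A :: "real \<times> real \<Rightarrow> real" and n :: nat and q :: "real poly"
  assumes A: "rpf A" "homog n A" and n: "n \<ge> 3"
    and hyp: "\<And>p. p \<noteq> 0 \<Longrightarrow> hess2 A p < 0"
    and q: "\<And>s. A (1, s) = poly q s" "degree q = n" "card {s. poly q s = 0} = n"
    and gen: "\<And>s. poly q s = 0 \<Longrightarrow> poly (pderiv (pderiv q)) s \<noteq> 0"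
begin

abbreviation "q1 \<equiv> pderiv q"
abbreviation "q2 \<equiv> pderiv (pderiv q)"
abbreviation "X \<equiv> dird (1, 0)"
abbreviation "Y \<equiv> dird (0, 1)"

text \<open>The limit seen at the scale on which the added line is x = -1: at that scale all other
  parts of the form shrink to its leading part \<open>A\<close>.\<close>

definition "f0 p = (1 + fst p) * A p"

lemma rpf_f0: "rpf f0"
  unfolding f0_def by (intro rpf_intros A)

text \<open>On x = 1 the polynomial q determines only derivatives in y; Euler's relation for
  \<open>A\<close> and for its first derivatives supplies those in x.\<close>

lemma partials:
  "Y A (1, s) = poly q1 s" "Y (Y A) (1, s) = poly q2 s"
  "X A (1, s) = n * poly q s - s * poly q1 s"
  "X (Y A) (1, s) = (real n - 1) * poly q1 s - s * poly q2 s"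
  "X (X A) (1, s) = (real n - 1) * (n * poly q s - s * poly q1 s) - s * ((real n - 1) * poly q1 s - s * poly q2 s)"
proof -
  have hd: "homog (n - 1) (dird v A)" for v
    using homog_dird'[of A "n - 1"] A n by simp
  show Y: "Y A (1, s) = poly q1 s" for s by (rule Y_poly[OF A(1) q(1)])
  show YY: "Y (Y A) (1, s) = poly q2 s" by (rule Y_poly[OF rpf_dird[OF A(1)] Y])
  show X: "X A (1, s) = n * poly q s - s * poly q1 s"
    using dird_euler2[OF A, of 1 s] Y q(1) by simp
  show XY: "X (Y A) (1, s) = (real n - 1) * poly q1 s - s * poly q2 s"
    using dird_euler2[OF rpf_dird[OF A(1)] hd, of 1 "(0, 1)" s] Y YY n by (simp add: of_nat_diff)
  show "X (X A) (1, s) = (real n - 1) * (n * poly q s - s * poly q1 s) - s * ((real n - 1) * poly q1 s - s * poly q2 s)"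
    using dird_euler2[OF rpf_dird[OF A(1)] hd, of 1 "(1, 0)" s] X XY n
      fun_cong[OF dird_commute[OF A(1), of "(0, 1)" "(1, 0)"], of "(1, s)"] by (simp add: of_nat_diff)
qed

text \<open>On x = 1 the Hessian of \<open>A\<close> is -(n - 1) times this function.\<close>

definition "w s = (real n - 1) * (poly q1 s)\<^sup>2 - n * poly q s * poly q2 s"

lemma w_pos: "w s > 0"
proof -
  have "hess2 A (1, s) = - (real n - 1) * w s"
    unfolding hess2_def partials w_def by (simp add: power2_eq_square algebra_simps)
  moreover have "hess2 A (1, s) < 0" by (rule hyp) (simp add: zero_prod_def)
  ultimately have "(real n - 1) * w s > 0" by (simp add: left_diff_distrib)
  then show ?thesis using n by (simp add: zero_less_mult_iff)
qed

lemma f0_partials: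
  "X (X f0) p = (1 + fst p) * X (X A) p + 2 * X A p"
  "X (Y f0) p = (1 + fst p) * X (Y A) p + Y A p"
  "Y (Y f0) p = (1 + fst p) * Y (Y A) p"
proof -
  have bl: "dird v (\<lambda>p. 1 + fst p) = (\<lambda>p. fst v)" for v :: "real \<times> real"
    by (rule ext, rule dirdI) (auto intro!: derivative_eq_intros)
  have r: "rpf (\<lambda>p::real \<times> real. 1 + fst p)" by (intro rpf_intros)
  have d: "dird v f0 = (\<lambda>p. (1 + fst p) * dird v A p + fst v * A p)" for v
    unfolding f0_def by (subst dird_mult[OF r A(1)]) (simp add: bl)
  have dd: "dird u (dird v f0) p = (1 + fst p) * dird u (dird v A) p + fst u * dird v A p + fst v * dird u A p" for u v
    unfolding d
    by (subst dird_add) (simp_all add: dird_mult[OF r rpf_dird[OF A(1)]] bl dird_cmult[OF A(1)] rpf_intros A r)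
  show "X (X f0) p = (1 + fst p) * X (X A) p + 2 * X A p"
    "X (Y f0) p = (1 + fst p) * X (Y A) p + Y A p"
    "Y (Y f0) p = (1 + fst p) * Y (Y A) p"
    by (simp_all add: dd)
qed

text \<open>
  In the coordinates \<open>s = y / x\<close> and \<open>1 / x\<close> the Hessian is quadratic in \<open>1 / x\<close>. Its zero set is thus a
  double cover of \<open>{s. q s * q2 s \<le> 0}\<close>, branched over the endpoints; this set consists of \<open>n - 1\<close>
  intervals, because \<open>q * q2\<close> has \<open>2 (n - 1)\<close> simple real roots.
\<close>

lemma hess_f0:
  assumes "x \<noteq> 0"
  shows "hess2 f0 (x, x * s) = x ^ (2 * n - 2) * (- (n / (real n - 1)) * poly q s * poly q2 s
     - (real n - 1) * w s * (1 / x + n / (real n - 1))\<^sup>2)"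
proof -
  define k where "k = n - 2"
  have k: "n = k + 2" using n by (simp add: k_def)
  have hA: "homog (Suc (Suc k)) A" using A(2) k by simp
  note hd1 = homog_dird'[OF A(1) hA] and hd2 = homog_dird'[OF rpf_dird[OF A(1)] homog_dird'[OF A(1) hA]]
  have p: "(x, x * s) = x *\<^sub>R (1, s)" by simp
  have h1: "dird v A (x, x * s) = x ^ (k + 1) * dird v A (1, s)" for v
    using homogD[OF hd1 assms, of v "(1, s)"] by simp
  have h2: "dird u (dird v A) (x, x * s) = x ^ k * dird u (dird v A) (1, s)" for u v
    using homogD[OF hd2 assms, of u v "(1, s)"] by simp
  define a where "a = poly q s" define b where "b = poly q1 s" define c where "c = poly q2 s"
  define N where "N = real n"
  have N: "N > 1" using n by (simp add: N_def)
  have "hess2 f0 (x, x * s) = (x ^ k)\<^sup>2 * (((1 + x) * ((N - 1) * (N * a - s * b) - s * ((N - 1) * b - s * c)) + 2 * x * (N * a - s * b)) * ((1 + x) * c)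
     - ((1 + x) * ((N - 1) * b - s * c) + x * b)\<^sup>2)"
    unfolding hess2_def f0_partials h1 h2 partials a_def b_def c_def N_def
    by (simp add: power2_eq_square algebra_simps)
  also have "\<dots> = (x ^ k)\<^sup>2 * (- ((N - 1) * b\<^sup>2 - N * a * c) * (1 + x) * ((N - 1) + (N + 1) * x) - x\<^sup>2 * b\<^sup>2)"
    by (simp add: power2_eq_square algebra_simps)
  also have "\<dots> = (x ^ k)\<^sup>2 * x\<^sup>2 * (- (N / (N - 1)) * a * c - (N - 1) * ((N - 1) * b\<^sup>2 - N * a * c) * (1 / x + N / (N - 1))\<^sup>2)"
  proof -
    have "x * (1 / x + N / (N - 1)) = 1 + x * N / (N - 1)" using assms by (simp add: distrib_left)
    then have e: "x\<^sup>2 * (1 / x + N / (N - 1))\<^sup>2 = (1 + x * N / (N - 1))\<^sup>2"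
      by (simp flip: power_mult_distrib)
    have "x\<^sup>2 * (- (N / (N - 1)) * a * c - (N - 1) * ((N - 1) * b\<^sup>2 - N * a * c) * (1 / x + N / (N - 1))\<^sup>2)
       = x\<^sup>2 * (- (N / (N - 1)) * a * c) - (N - 1) * ((N - 1) * b\<^sup>2 - N * a * c) * (1 + x * N / (N - 1))\<^sup>2"
      unfolding e[symmetric] by (simp add: algebra_simps)
    also have "\<dots> = - ((N - 1) * b\<^sup>2 - N * a * c) * (1 + x) * ((N - 1) + (N + 1) * x) - x\<^sup>2 * b\<^sup>2"
    proof -
      \<comment> \<open>An auxiliary u with M u = 1 removes the denominators, so that a polynomial
        identity modulo this relation remains.\<close>
      define M where "M = N - 1"
      define u where "u = 1 / M"
      have Mu: "M * u = 1" using N by (simp add: M_def u_def)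
      have NN: "N = M + 1" "N / (N - 1) = (M + 1) * u" "x * N / (N - 1) = x * (M + 1) * u"
        by (auto simp: M_def u_def)
      show ?thesis unfolding NN(2,3) using Mu NN(1) by algebra
    qed
    finally show ?thesis by (simp add: mult.assoc)
  qed
  also have "(x ^ k)\<^sup>2 * x\<^sup>2 = x ^ (2 * n - 2)"
    unfolding k by (simp add: power_mult[symmetric] power_add[symmetric] algebra_simps)
  finally show ?thesis by (simp add: a_def b_def c_def N_def w_def)
qed

text \<open>The chart s = y / x misses the line x = 0. There Euler's relation makes the mixed term
  vanish, and what is left is the Hessian of \<open>A\<close> minus a square.\<close>

lemma hess_f0_axis:
  assumes "y \<noteq> 0" shows "hess2 f0 (0, y) < 0"
proof -
  have hd: "homog (n - 1) (dird v A)" for v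
    using homog_dird'[of A "n - 1"] A n by simp
  have 1: "y * Y (X A) (0, y) = (real n - 1) * X A (0, y)" "y * Y (Y A) (0, y) = (real n - 1) * Y A (0, y)"
    using dird_euler2[OF rpf_dird[OF A(1)] hd, of 0 _ y] n by (simp_all add: of_nat_diff)
  have XY: "X (Y A) (0, y) = Y (X A) (0, y)"
    using dird_commute[OF A(1)] by metis
  have "hess2 f0 (0, y) = hess2 A (0, y) + 2 * (X A (0, y) * Y (Y A) (0, y) - Y (X A) (0, y) * Y A (0, y)) - (Y A (0, y))\<^sup>2"
    unfolding hess2_def f0_partials XY by (simp add: power2_eq_square algebra_simps)
  also have "X A (0, y) * Y (Y A) (0, y) - Y (X A) (0, y) * Y A (0, y) = 0"
  proof -
    have "y * (X A (0, y) * Y (Y A) (0, y) - Y (X A) (0, y) * Y A (0, y))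
       = X A (0, y) * (y * Y (Y A) (0, y)) - (y * Y (X A) (0, y)) * Y A (0, y)" by (simp add: algebra_simps)
    also have "\<dots> = 0" unfolding 1 by simp
    finally show ?thesis using assms by simp
  qed
  finally have "hess2 f0 (0, y) \<le> hess2 A (0, y)" by simp
  also have "\<dots> < 0" using assms by (intro hyp) (simp add: zero_prod_def)
  finally show ?thesis .
qed

definition "r s = poly q s * poly q2 s"

lemma q_nz: "q \<noteq> 0" using q(2) n by auto

lemma real_rooted_q2: "card {s. poly q2 s = 0} = degree q2" "degree q2 = n - 2" "lead_coeff q2 = n * (real n - 1) * lead_coeff q" "q2 \<noteq> 0"
proof -
  have 1: "card {s. poly q s = 0} = degree q" "degree q > 0" using q n by auto
  note d1 = pderiv_real_rooted[OF 1]
  have 2: "degree q1 > 0" using d1(2) q(2) n by simp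
  note d2 = pderiv_real_rooted[OF d1(1) 2]
  show "card {s. poly q2 s = 0} = degree q2" "degree q2 = n - 2" "q2 \<noteq> 0" using d2 d1(2) q(2) by auto
  show "lead_coeff q2 = n * (real n - 1) * lead_coeff q" using d2(3) d1(2,3) q(2) n by (simp add: of_nat_diff)
qed

lemma r_intervals: "\<exists>I. interval_family (n - 1) r I"
proof -
  let ?C = "{s. poly q s = 0} \<union> {s. poly q2 s = 0}"
  have fin: "finite {s. poly q s = 0}" "finite {s. poly q2 s = 0}"
    using poly_roots_finite q_nz real_rooted_q2(4) by auto
  have dis: "{s. poly q s = 0} \<inter> {s. poly q2 s = 0} = {}" using gen by auto
  have "card ?C = 2 * (n - 1)"
    using card_Un_disjoint[OF fin dis] q(3) real_rooted_q2(1,2) n by simp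
  then obtain I where I: "interval_family (n - 1) (\<lambda>s. \<Prod>a\<in>?C. s - a) I"
    using interval_family_prod[of ?C "n - 1"] fin by auto
  \<comment> \<open>The leading coefficient of q'' is n (n - 1) times that of q, so the product has
    a positive leading coefficient and its sign is that of the monic product over the roots.\<close>
  define K where "K = lead_coeff q * lead_coeff q2"
  have "K = n * (real n - 1) * (lead_coeff q)\<^sup>2"
    by (simp add: K_def real_rooted_q2(3) power2_eq_square)
  moreover have "lead_coeff q \<noteq> 0" using q_nz by simp
  ultimately have K: "K > 0" using n by simp
  have "r s = K * (\<Prod>a\<in>?C. s - a)" for s
    using poly_eq_prod_roots[OF q_nz, of s] poly_eq_prod_roots[OF real_rooted_q2(4,1), of s] q(2,3)
      prod.union_disjoint[OF fin dis, of "\<lambda>a. s - a"] by (simp add: r_def K_def)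
  then have "r s = 0 \<longleftrightarrow> (\<Prod>a\<in>?C. s - a) = 0" "r s \<le> 0 \<longleftrightarrow> (\<Prod>a\<in>?C. s - a) \<le> 0" for s
    using K by (auto simp: mult_le_0_iff simp del: prod_zero_iff)
  then show ?thesis using I unfolding interval_family_def by (intro exI[of _ I]) simp
qed

definition "R s = - real n * r s / ((real n - 1)\<^sup>2 * w s)"

abbreviation "Vc x \<equiv> 1 / x + n / (real n - 1)"

text \<open>The value n / (n - 1) of \<open>Vc x\<close> belongs to x at infinity. As n > 1, its
  square exceeds the bound 1 / (n - 1)^2, so the Hessian curve stays away from infinity and the
  change of coordinates is regular on it.\<close>

lemma R_le: "R s \<le> 1 / (real n - 1)\<^sup>2"
proof -
  have "- real n * r s \<le> w s" using n unfolding w_def r_def by (simp add: mult.assoc)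
  then have "- real n * r s / w s \<le> 1" by (subst pos_divide_le_eq[OF w_pos]) simp
  then have "- real n * r s / w s / (real n - 1)\<^sup>2 \<le> 1 / (real n - 1)\<^sup>2" by (rule divide_right_mono) simp
  then show ?thesis by (simp add: R_def mult.commute)
qed

lemma hess_f0_iff:
  assumes "x \<noteq> 0" shows "hess2 f0 (x, x * s) = 0 \<longleftrightarrow> r s \<le> 0 \<and> (Vc x)\<^sup>2 = R s"
proof -
  have n1: "real n - 1 > 0" using n by simp
  have "hess2 f0 (x, x * s) = 0 \<longleftrightarrow> - (n / (real n - 1)) * r s = (real n - 1) * w s * (Vc x)\<^sup>2"
    unfolding hess_f0[OF assms] using assms by (simp add: r_def mult.assoc)
  also have "\<dots> \<longleftrightarrow> (Vc x)\<^sup>2 = R s"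
  proof -
    have "- (N / d) * t = d * W * u \<longleftrightarrow> u = - N * t / (d\<^sup>2 * W)" if "d > 0" "W > 0" for d W N t u :: real
      using that by (auto simp: field_simps power2_eq_square)
    from this[OF n1 w_pos[of s]] show ?thesis unfolding R_def .
  qed
  also have "\<dots> \<longleftrightarrow> r s \<le> 0 \<and> (Vc x)\<^sup>2 = R s"
  proof -
    have "r s \<le> 0" if "(Vc x)\<^sup>2 = R s"
    proof (rule ccontr)
      assume "\<not> r s \<le> 0"
      then have "- real n * r s < 0" "(real n - 1)\<^sup>2 * w s > 0" using n1 w_pos[of s] n by auto
      then have "R s < 0" unfolding R_def by (rule divide_neg_pos)
      then show False using that zero_le_power2[of "Vc x"] by linarith
    qed
    then show ?thesis by blast
  qed
  finally show ?thesis .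
qed

lemma outer_ovals: "ovals (n - 1) {p. p \<noteq> 0 \<and> hess2 f0 p = 0}"
proof -
  let ?S = "{(s, v). r s \<le> 0 \<and> v\<^sup>2 = R s}"
  have n1: "real n - 1 > 0" using n by simp
  obtain I where I: "interval_family (n - 1) r I" using r_intervals by auto
  have S: "ovals (n - 1) ?S"
  proof (rule ovals_double_cover[OF I])
    show "continuous_on {s. r s \<le> 0} R"
      unfolding R_def r_def w_def using w_pos n1 unfolding w_def
      by (intro continuous_intros) (simp add: less_imp_neq[symmetric])
    show "R s \<ge> 0" if "r s \<le> 0" for s
      using that w_pos[of s] by (simp add: R_def divide_nonneg_nonneg mult_nonneg_nonpos zero_le_mult_iff divide_nonpos_nonneg)
    show "R s = 0" if "r s = 0" for s using that by (simp add: R_def)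
  qed
  let ?g = "\<lambda>(s, v). (1 / (v - n / (real n - 1)), s / (v - n / (real n - 1)))"
  have v: "v \<noteq> n / (real n - 1)" if "(s, v) \<in> ?S" for s v
  proof
    assume "v = n / (real n - 1)"
    then have "(n / (real n - 1))\<^sup>2 \<le> 1 / (real n - 1)\<^sup>2" using that R_le[of s] by simp
    then have "(real n)\<^sup>2 \<le> 1" using n1 by (simp add: power_divide divide_le_cancel)
    moreover have "1 < (real n)\<^sup>2" using n by (intro one_less_power) auto
    ultimately show False by simp
  qed
  have cont: "continuous_on ?S ?g"
    using v by (auto simp: case_prod_beta intro!: continuous_intros)
  have inj: "inj_on ?g ?S"
    using v by (auto intro!: inj_onI)
  have "?g ` ?S = {p. p \<noteq> 0 \<and> hess2 f0 p = 0}"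
  proof (intro subset_antisym subsetI)
    fix p assume "p \<in> ?g ` ?S"
    then obtain s v where sv: "r s \<le> 0" "v\<^sup>2 = R s" "p = ?g (s, v)" by auto
    define x where "x = 1 / (v - n / (real n - 1))"
    have x: "x \<noteq> 0" "Vc x = v" "p = (x, x * s)" using v[of s v] sv by (auto simp: x_def)
    then show "p \<in> {p. p \<noteq> 0 \<and> hess2 f0 p = 0}"
      using hess_f0_iff[OF x(1)] sv by (simp add: zero_prod_def)
  next
    fix p assume p: "p \<in> {p. p \<noteq> 0 \<and> hess2 f0 p = 0}"
    obtain x y where xy: "p = (x, y)" by (cases p)
    have x: "x \<noteq> 0" using p hess_f0_axis[of y] xy by (auto simp: zero_prod_def)
    define s where "s = y / x"
    have y: "y = x * s" using x by (simp add: s_def)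
    have "(s, Vc x) \<in> ?S" using p hess_f0_iff[OF x, of s] xy y by simp
    moreover have "p = ?g (s, Vc x)" using xy y by simp
    ultimately show "p \<in> ?g ` ?S" by blast
  qed
  then show ?thesis using ovals_image[OF S cont inj] by simp
qed

text \<open>At a singular point the derivative along the line of constant s forces
  \<open>Vc x = 0\<close>, because \<open>w\<close> is positive. There q q'' vanishes, and the
  derivative in s would make this zero a double one, whereas all zeros of q q'' are simple.\<close>

lemma outer_regular:
  assumes "p \<noteq> 0" "hess2 f0 p = 0" shows "X (hess2 f0) p \<noteq> 0 \<or> Y (hess2 f0) p \<noteq> 0"
proof (rule ccontr)
  assume "\<not> ?thesis"
  then have z: "X (hess2 f0) p = 0" "Y (hess2 f0) p = 0" by auto
  have rh: "rpf (hess2 f0)" by (intro rpf_intros rpf_f0)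
  have dz: "dird v (hess2 f0) p = 0" for v
  proof -
    have "v = fst v *\<^sub>R (1, 0) + snd v *\<^sub>R (0, 1)" by (simp add: prod_eq_iff)
    then have "dird v (hess2 f0) p = fst v * X (hess2 f0) p + snd v * Y (hess2 f0) p"
      using dird_add_dir[OF rh] dird_scale_dir[OF rh] by metis
    then show ?thesis using z by simp
  qed
  obtain x y where xy: "p = (x, y)" by (cases p)
  have x: "x \<noteq> 0" using assms hess_f0_axis[of y] xy by (auto simp: zero_prod_def)
  define s where "s = y / x"
  have p: "p = (x, x * s)" using x xy by (simp add: s_def)
  have n1: "real n - 1 > 0" using n by simp
  define B where "B x s = - (n / (real n - 1)) * poly q s * poly q2 s - (real n - 1) * w s * (Vc x)\<^sup>2" for x s
  have B0: "B x s = 0" using assms(2) x unfolding p hess_f0[OF x] B_def by simp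
  have hB: "hess2 f0 (x, x * s) = x ^ (2 * n - 2) * B x s" if "x \<noteq> 0" for x s
    using hess_f0[OF that] by (simp add: B_def)
  have "((\<lambda>x. hess2 f0 (x, x * s)) has_derivative (\<lambda>h. dird (h, h * s) (hess2 f0) (x, x * s))) (at x)"
    by (rule has_derivative_compose[OF _ rpf_has_derivative[OF rh]]) (auto intro!: derivative_eq_intros)
  then have "((\<lambda>x. hess2 f0 (x, x * s)) has_real_derivative 0) (at x)"
    using dz by (simp add: has_field_derivative_def p lambda_zero)
  then have D0: "((\<lambda>x. x ^ (2 * n - 2) * B x s) has_real_derivative 0) (at x)"
    by (rule has_field_derivative_transform_within_open[where S = "- {0}"]) (use x hB in auto)
  have "((\<lambda>x. B x s) has_real_derivative (real n - 1) * w s * (2 * Vc x / x\<^sup>2)) (at x)"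
  proof -
    have "((\<lambda>x. a - c * (1 / x + e)\<^sup>2) has_real_derivative c * (2 * (1 / x + e) / x\<^sup>2)) (at x)" for a c e :: real
    proof -
      have "- ((- (2 / x) - 2 * e) * c / (x * x)) = c * (2 / x + 2 * e) / (x * x)"
        by (simp add: algebra_simps diff_divide_distrib add_divide_distrib)
      then show ?thesis using x by (auto intro!: derivative_eq_intros simp: power2_eq_square)
    qed
    then show ?thesis unfolding B_def .
  qed
  from DERIV_mult[OF DERIV_power[OF DERIV_ident] this, of "2 * n - 2"]
  have "((\<lambda>x. x ^ (2 * n - 2) * B x s) has_real_derivative
      x ^ (2 * n - 2) * ((real n - 1) * w s * (2 * Vc x / x\<^sup>2))) (at x)"
    using B0 by (simp add: mult.commute)
  then have "x ^ (2 * n - 2) * ((real n - 1) * w s * (2 * Vc x / x\<^sup>2)) = 0"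
    using D0 DERIV_unique by blast
  then have V0: "Vc x = 0" using x n1 w_pos[of s] by simp
  then have r0: "poly q s * poly q2 s = 0" using B0 n1 n unfolding B_def by simp
  have "((\<lambda>s. hess2 f0 (x, x * s)) has_derivative (\<lambda>h. dird (0, x * h) (hess2 f0) (x, x * s))) (at s)"
    by (rule has_derivative_compose[OF _ rpf_has_derivative[OF rh]]) (auto intro!: derivative_eq_intros)
  then have "((\<lambda>s. hess2 f0 (x, x * s)) has_real_derivative 0) (at s)"
    using dz by (simp add: has_field_derivative_def p lambda_zero)
  then have D1: "((\<lambda>s. - (x ^ (2 * n - 2) * (n / (real n - 1))) * poly (q * q2) s) has_real_derivative 0) (at s)"
    using hB[OF x] V0 by (simp add: B_def mult.assoc)
  have "((\<lambda>s. - (x ^ (2 * n - 2) * (n / (real n - 1))) * poly (q * q2) s) has_real_derivative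
     - (x ^ (2 * n - 2) * (n / (real n - 1))) * poly (pderiv (q * q2)) s) (at s)"
    by (rule DERIV_cmult[OF poly_DERIV])
  then have "- (x ^ (2 * n - 2) * (n / (real n - 1))) * poly (pderiv (q * q2)) s = 0"
    using D1 DERIV_unique by blast
  then have d: "poly (pderiv (q * q2)) s = 0" using x n1 n by simp
  show False
  proof (cases "poly q s = 0")
    case True
    then show False using d gen simple_root_pderiv[OF q_nz, of s] q(2,3) by (simp add: pderiv_mult)
  next
    case False
    then have "poly q2 s = 0" using r0 by simp
    then show False using d False simple_root_pderiv[OF real_rooted_q2(4,1), of s] by (simp add: pderiv_mult)
  qed
qed

end

text \<open>
  The argument \<open>((x, y), e)\<close> stands for the point \<open>(x : y : e)\<close> of the projective plane, with \<open>e = 0\<close> as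
  the line at infinity. The set \<open>S\<close> selects one vector on each root line of the leading form.
\<close>

definition good :: "nat \<Rightarrow> nat \<Rightarrow> ((real \<times> real) \<times> real \<Rightarrow> real) \<Rightarrow> bool" where
  "good n N F \<longleftrightarrow> rpf F \<and> homog n F \<and> (\<forall>p. p \<noteq> 0 \<longrightarrow> hess2 (\<lambda>p. F (p, 0)) p < 0) \<and>
     (\<exists>S. finite S \<and> card S = n \<and> (\<forall>p\<in>S. F (p, 0) = 0) \<and>
        (\<forall>p\<in>S. \<forall>r\<in>S. p \<noteq> r \<longrightarrow> fst p * snd r \<noteq> snd p * fst r)) \<and>
     ovals N {p. hess2 (\<lambda>p. F (p, 1)) p = 0} \<and>
     (\<forall>p. hess2 (\<lambda>p. F (p, 1)) p = 0 \<longrightarrow> dird (1, 0) (hess2 (\<lambda>p. F (p, 1))) p \<noteq> 0 \<or> dird (0, 1) (hess2 (\<lambda>p. F (p, 1))) p \<noteq> 0)"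

section \<open>Shears, and a normal form for the leading form\<close>

abbreviation "shear c p \<equiv> (fst p + c * snd p, snd p)"

lemma bounded_linear_shear: "bounded_linear (\<lambda>p::real \<times> real. shear c p)"
  by (intro bounded_linear_intros)

lemma dird_shear:
  assumes "rpf g" shows "dird (1, 0) (\<lambda>p. g (shear c p)) = (\<lambda>p. dird (1, 0) g (shear c p))"
    "dird (0, 1) (\<lambda>p. g (shear c p)) = (\<lambda>p. c * dird (1, 0) g (shear c p) + dird (0, 1) g (shear c p))"
  unfolding dird_linear_comp[OF assms bounded_linear_shear] using dird_Pair[OF assms, of c 1] by auto

lemma rpf_shear:
  fixes g :: "real \<times> real \<Rightarrow> real"
  assumes "rpf g" shows "rpf (\<lambda>p. g (shear c p))"
proof (rule rpf_comp[OF assms])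
  show "polynomial_function (\<lambda>p::real \<times> real. shear c p)"
    by (intro polyfun_Pair polyfun_real) (intro rpf_intros)+
qed

lemma hess2_shear:
  assumes g: "rpf g" shows "hess2 (\<lambda>p. g (shear c p)) = (\<lambda>p. hess2 g (shear c p))"
proof
  fix p
  note d = dird_shear[OF g] dird_shear[OF rpf_dird[OF g]]
  have yx: "dird (0, 1) (dird (1, 0) g) = dird (1, 0) (dird (0, 1) g)" by (rule dird_commute[OF g])
  have r: "rpf (\<lambda>p. c * dird (1, 0) g (shear c p))" "rpf (\<lambda>p. dird (0, 1) g (shear c p))"
    by (auto intro!: rpf_basic rpf_shear rpf_dird g)
  show "hess2 (\<lambda>p. g (shear c p)) p = hess2 g (shear c p)"
    unfolding hess2_def d dird_add[OF r] dird_cmult[OF rpf_shear[OF rpf_dird[OF g]]] yx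
    by (simp add: power2_eq_square algebra_simps)
qed

lemma good_roots:
  assumes "good n N F"
  shows "\<exists>S. finite S \<and> card S = n \<and> (\<forall>p\<in>S. F (p, 0) = 0) \<and>
        (\<forall>p\<in>S. \<forall>r\<in>S. p \<noteq> r \<longrightarrow> fst p * snd r \<noteq> snd p * fst r)"
  using assms by (simp add: good_def)

lemma good_shear:
  assumes "good n N F" shows "good n N (\<lambda>q. F (shear c (fst q), snd q))"
proof -
  let ?G = "\<lambda>q::(real \<times> real) \<times> real. F (shear c (fst q), snd q)"
  have F: "rpf F" "homog n F" and H: "\<And>p. p \<noteq> 0 \<Longrightarrow> hess2 (\<lambda>p. F (p, 0)) p < 0"
    and ov: "ovals N {p. hess2 (\<lambda>p. F (p, 1)) p = 0}"
    and reg: "\<And>p. hess2 (\<lambda>p. F (p, 1)) p = 0 \<Longrightarrow> dird (1, 0) (hess2 (\<lambda>p. F (p, 1))) p \<noteq> 0 \<or> dird (0, 1) (hess2 (\<lambda>p. F (p, 1))) p \<noteq> 0"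
    using assms by (auto simp: good_def)
  obtain S where S': "finite S" "card S = n" "\<forall>p\<in>S. F (p, 0) = 0"
     "\<forall>p\<in>S. \<forall>r\<in>S. p \<noteq> r \<longrightarrow> fst p * snd r \<noteq> snd p * fst r"
    using good_roots[OF assms] by (elim exE conjE) (rule that)
  note S = S'(1,2) S'(3)[rule_format] S'(4)[rule_format]
  have r: "rpf (\<lambda>p. F (p, e))" for e by (rule rpf_slice[OF F(1)])
  have h: "hess2 (\<lambda>p. F (shear c p, e)) = (\<lambda>p. hess2 (\<lambda>p. F (p, e)) (shear c p))" for e
    by (rule hess2_shear[OF r])
  have inv: "shear c (shear (-c) p) = p" "shear (-c) (shear c p) = p" for p :: "real \<times> real"
    by (auto simp: prod_eq_iff)
  have 1: "rpf ?G" by (rule rpf_comp[OF F(1)]) (auto intro!: rpf_intros)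
  have 2: "homog n ?G"
  proof -
    have "F (t *\<^sub>R (shear c (fst x)), t *\<^sub>R snd x) = t ^ n * F (shear c (fst x), snd x)" if "t \<noteq> 0" for t x
      using homogD[OF F(2) that, of "(shear c (fst x), snd x)"] by simp
    then show ?thesis by (simp add: homog_def algebra_simps)
  qed
  have 3: "hess2 (\<lambda>p. ?G (p, 0)) p < 0" if "p \<noteq> 0" for p
  proof -
    have "shear c p \<noteq> 0" using that by (auto simp: prod_eq_iff)
    then show ?thesis using H by (simp add: h)
  qed
  have 4: "\<exists>S. finite S \<and> card S = n \<and> (\<forall>p\<in>S. ?G (p, 0) = 0) \<and>
        (\<forall>p\<in>S. \<forall>r\<in>S. p \<noteq> r \<longrightarrow> fst p * snd r \<noteq> snd p * fst r)"
  proof (intro exI[of _ "(\<lambda>p. shear (-c) p) ` S"] conjI ballI impI)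
    have "inj_on (\<lambda>p. shear (-c) p) S"
      by (rule inj_on_inverseI[where g = "\<lambda>p. shear c p"]) (rule inv)
    then show "card ((\<lambda>p. shear (-c) p) ` S) = n" using S(2) card_image by blast
    show "?G (p, 0) = 0" if "p \<in> (\<lambda>p. shear (-c) p) ` S" for p
      using that S(3) by auto
    show "fst p * snd r \<noteq> snd p * fst r" if "p \<in> (\<lambda>p. shear (-c) p) ` S" "r \<in> (\<lambda>p. shear (-c) p) ` S" "p \<noteq> r" for p r
    proof -
      obtain p' r' where pr: "p' \<in> S" "r' \<in> S" "p = shear (-c) p'" "r = shear (-c) r'"
        using \<open>p \<in> _\<close> \<open>r \<in> _\<close> by (elim imageE)
      then have "p' \<noteq> r'" using \<open>p \<noteq> r\<close> by auto
      then have "fst p' * snd r' \<noteq> snd p' * fst r'" by (rule S(4)[OF pr(1,2)])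
      then show ?thesis using pr by (simp add: algebra_simps)
    qed
  qed (use S(1) in auto)
  have 5: "ovals N {p. hess2 (\<lambda>p. ?G (p, 1)) p = 0}"
  proof -
    have "{p. hess2 (\<lambda>p. ?G (p, 1)) p = 0} = (\<lambda>p. shear (-c) p) ` {p. hess2 (\<lambda>p. F (p, 1)) p = 0}"
    proof (intro subset_antisym subsetI)
      fix p assume "p \<in> {p. hess2 (\<lambda>p. ?G (p, 1)) p = 0}"
      then have "shear c p \<in> {p. hess2 (\<lambda>p. F (p, 1)) p = 0}" by (simp add: h)
      then show "p \<in> (\<lambda>p. shear (-c) p) ` {p. hess2 (\<lambda>p. F (p, 1)) p = 0}"
        by (rule rev_image_eqI) (simp add: inv)
    qed (auto simp: h inv)
    moreover have "inj_on (\<lambda>p. shear (-c) p) {p. hess2 (\<lambda>p. F (p, 1)) p = 0}"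
      by (rule inj_on_inverseI[where g = "\<lambda>p. shear c p"]) (rule inv)
    ultimately show ?thesis
      using ovals_image[OF ov, of "\<lambda>p. shear (-c) p"] by (simp add: continuous_intros)
  qed
  have 6: "dird (1, 0) (hess2 (\<lambda>p. ?G (p, 1))) p \<noteq> 0 \<or> dird (0, 1) (hess2 (\<lambda>p. ?G (p, 1))) p \<noteq> 0"
    if "hess2 (\<lambda>p. ?G (p, 1)) p = 0" for p
    using reg[of "shear c p"] that by (auto simp: h dird_shear[OF rpf_hess2[OF r]])
  show ?thesis unfolding good_def using 1 2 3 4 5 6 by blast
qed

text \<open>By homogeneity A(1, s) = s^n A(1 / s, 1), so q is, up to powers of s, the reflection of
  the polynomial p for A(s, 1). A zero of \<open>A\<close> at (0, 1) is a vanishing constant term of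
  p, which lowers the degree of q.\<close>

lemma homog_poly_degree:
  fixes A :: "real \<times> real \<Rightarrow> real"
  assumes "rpf A" "homog n A"
  obtains q :: "real poly" where "\<And>s. A (1, s) = poly q s" "degree q \<le> n"
    "A (0, 1) = 0 \<Longrightarrow> q \<noteq> 0 \<Longrightarrow> degree q < n"
proof -
  have ex: "\<exists>q. \<forall>s. f s = poly q s" if "rpf f" for f :: "real \<Rightarrow> real"
  proof -
    from that obtain a n where "f = (\<lambda>x. \<Sum>i\<le>n. a i * x ^ i)"
      unfolding real_polynomial_function_iff_sum by (elim exE)
    then have "f s = poly (\<Sum>i\<le>n. monom (a i) i) s" for s by (simp add: poly_sum poly_monom)
    then show ?thesis by blast
  qed
  obtain q where q: "\<And>s. A (1, s) = poly q s"
    using ex[OF rpf_slice2[OF assms(1)]] by blast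
  obtain p where p: "\<And>s. A (s, 1) = poly p s"
    using ex[OF rpf_slice[OF assms(1)]] by blast
  let ?m = "degree p"
  have eq: "poly (monom 1 ?m * q) s = poly (monom 1 n * reflect_poly p) s" if "s \<noteq> 0" for s
  proof -
    have "poly q s = s ^ n * poly p (inverse s)"
      using homogD[OF assms(2) that, of "(inverse s, 1)"] that q p by simp
    moreover have "poly (reflect_poly p) s = s ^ ?m * poly p (inverse s)"
      using poly_reflect_poly_nz[OF that] by simp
    ultimately show ?thesis by (simp add: poly_monom)
  qed
  let ?d = "monom 1 ?m * q - monom 1 n * reflect_poly p"
  have "?d = 0"
  proof (rule ccontr)
    assume "?d \<noteq> 0"
    then have "finite {s. poly ?d s = 0}" by (rule poly_roots_finite)
    moreover have "- {0} \<subseteq> {s. poly ?d s = 0}" using eq by auto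
    ultimately have "finite (- {0::real})" by (rule finite_subset[rotated])
    then show False by (simp add: finite_compl infinite_UNIV_char_0)
  qed
  then have mq: "monom 1 ?m * q = monom 1 n * reflect_poly p" by simp
  have deg: "degree q = n + degree (reflect_poly p) - ?m" "reflect_poly p \<noteq> 0" if "q \<noteq> 0"
  proof -
    show "reflect_poly p \<noteq> 0" using mq that by auto
    then show "degree q = n + degree (reflect_poly p) - ?m"
      using arg_cong[OF mq, of degree] that by (simp add: degree_mult_eq degree_monom_eq)
  qed
  have dle: "degree (reflect_poly p) \<le> ?m" by (rule degree_reflect_poly_le)
  show thesis
  proof (rule that)
    show "A (1, s) = poly q s" for s by (rule q)
    show "degree q \<le> n" using deg dle by (cases "q = 0") auto
    show "degree q < n" if "A (0, 1) = 0" "q \<noteq> 0"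
    proof -
      have "p \<noteq> 0" using deg(2)[OF that(2)] by auto
      have "coeff p 0 = 0" using that(1) p[of 0] by (simp add: poly_0_coeff_0)
      then have "coeff (reflect_poly p) ?m = 0" by (simp add: coeff_reflect_poly)
      then have "degree (reflect_poly p) \<noteq> ?m" using deg(2)[OF that(2)] leading_coeff_0_iff by metis
      moreover have "n > 0"
      proof (rule ccontr)
        assume "\<not> n > 0"
        then show False using calculation dle deg(1)[OF that(2)] arg_cong[OF mq, of degree] deg(2)[OF that(2)] that(2)
          by (simp add: degree_mult_eq degree_monom_eq)
      qed
      ultimately show ?thesis using deg(1)[OF that(2)] dle by linarith
    qed
  qed
qed

text \<open>A generic shear suffices: it must move every root line off x = 0 and make the second y
  derivative nonzero on it. Each root line thereby excludes only finitely many values of c.\<close>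

lemma normal_form:
  assumes "good n N F" and n: "n \<ge> 3"
  shows "\<exists>c q. hyperbolic_form (\<lambda>p. F (shear c p, 0)) n q \<and> F (shear c (0, 1), 0) \<noteq> 0"
proof -
  have F: "rpf F" "homog n F" and H: "\<And>p. p \<noteq> 0 \<Longrightarrow> hess2 (\<lambda>p. F (p, 0)) p < 0"
    using assms by (auto simp: good_def)
  obtain S where S': "finite S" "card S = n" "\<forall>p\<in>S. F (p, 0) = 0"
     "\<forall>p\<in>S. \<forall>r\<in>S. p \<noteq> r \<longrightarrow> fst p * snd r \<noteq> snd p * fst r"
    using good_roots[OF assms(1)] by (elim exE conjE) (rule that)
  note S = S'(1,2) S'(3)[rule_format] S'(4)[rule_format]
  define A where "A p = F (p, 0)" for p
  have A: "rpf A" "homog n A" and HA: "\<And>p. p \<noteq> 0 \<Longrightarrow> hess2 A p < 0"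
  proof -
    show "rpf A" unfolding A_def by (rule rpf_slice[OF F(1)])
    show "homog n A" using F(2) unfolding homog_def A_def by (metis scaleR_Pair scaleR_zero_right)
    show "\<And>p. p \<noteq> 0 \<Longrightarrow> hess2 A p < 0" unfolding A_def by (rule H)
  qed
  have S0: "p \<noteq> 0" if pS: "p \<in> S" for p
  proof -
    have "S \<noteq> {p}" using S(2) n by auto
    then obtain r where "r \<in> S" "r \<noteq> p" using pS by blast
    then show ?thesis using S(4)[OF pS, of r] by auto
  qed
  let ?a = "\<lambda>p. dird (1, 0) (dird (1, 0) A) p" and ?b = "\<lambda>p. dird (1, 0) (dird (0, 1) A) p"
    and ?d = "\<lambda>p. dird (0, 1) (dird (0, 1) A) p"
  \<comment> \<open>As a polynomial in c: the first factor vanishes if the sheared root line is x =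
    0, the second if the second derivative in the sheared y direction vanishes. If the second factor
    were the zero polynomial, the Hessian would be 0 on the root line.\<close>
  define P where "P p = [:fst p, - snd p:] * [:?d p, 2 * ?b p, ?a p:]" for p
  have "P p \<noteq> 0" if "p \<in> S" for p
  proof -
    have "[:?d p, 2 * ?b p, ?a p:] \<noteq> 0" using HA[OF S0[OF that]] by (auto simp: hess2_def)
    moreover have "[:fst p, - snd p:] \<noteq> 0" using S0[OF that] by (auto simp: prod_eq_iff)
    ultimately show ?thesis by (simp add: P_def del: mult_pCons_left mult_pCons_right)
  qed
  then have "finite (\<Union>p\<in>S. {c. poly (P p) c = 0})" using S(1) poly_roots_finite by blast
  then obtain c where "c \<notin> (\<Union>p\<in>S. {c. poly (P p) c = 0})"
    using ex_new_if_finite[OF infinite_UNIV_char_0] by blast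
  then have c: "fst p - c * snd p \<noteq> 0" "?d p + 2 * c * ?b p + c\<^sup>2 * ?a p \<noteq> 0" if "p \<in> S" for p
  proof -
    have "poly (P p) c = (fst p - c * snd p) * (?d p + 2 * c * ?b p + c\<^sup>2 * ?a p)"
      by (simp add: P_def power2_eq_square algebra_simps del: mult_pCons_left mult_pCons_right)
    moreover have "poly (P p) c \<noteq> 0" using \<open>c \<notin> _\<close> that by blast
    ultimately show "fst p - c * snd p \<noteq> 0" "?d p + 2 * c * ?b p + c\<^sup>2 * ?a p \<noteq> 0" by auto
  qed
  define B where "B p = A (shear c p)" for p
  have B: "rpf B" "homog n B" "\<And>p. p \<noteq> 0 \<Longrightarrow> hess2 B p < 0"
  proof -
    show "rpf B" unfolding B_def by (rule rpf_shear[OF A(1)])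
    show "homog n B"
    proof -
      have "A (shear c (t *\<^sub>R p)) = t ^ n * A (shear c p)" if "t \<noteq> 0" for t p
        using homogD[OF A(2) that, of "shear c p"] by (simp add: algebra_simps)
      then show ?thesis by (simp add: homog_def B_def)
    qed
    show "hess2 B p < 0" if "p \<noteq> 0" for p
    proof -
      have "shear c p \<noteq> 0" using that by (auto simp: prod_eq_iff)
      then show ?thesis using HA by (simp add: B_def[abs_def] hess2_shear[OF A(1)])
    qed
  qed
  obtain q where q: "\<And>s. B (1, s) = poly q s" "degree q \<le> n" "B (0, 1) = 0 \<Longrightarrow> q \<noteq> 0 \<Longrightarrow> degree q < n"
    using homog_poly_degree[OF B(1,2)] by metis
  define sl where "sl p = snd p / (fst p - c * snd p)" for p :: "real \<times> real"
  have pt: "shear c ((fst p - c * snd p) *\<^sub>R (1, sl p)) = p" if "p \<in> S" for p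
    using c(1)[OF that] by (auto simp: sl_def prod_eq_iff field_simps)
  have root: "poly q (sl p) = 0" if "p \<in> S" for p
  proof -
    have "B ((fst p - c * snd p) *\<^sub>R (1, sl p)) = 0"
      using S(3)[OF that] pt[OF that] unfolding B_def A_def by metis
    then show ?thesis using homogD[OF B(2) c(1)[OF that], of "(1, sl p)"] c(1)[OF that] q(1) by simp
  qed
  have inj: "inj_on sl S"
  proof (rule inj_onI, rule ccontr)
    fix p r assume pr: "p \<in> S" "r \<in> S" "sl p = sl r" "p \<noteq> r"
    then have "snd p * (fst r - c * snd r) = snd r * (fst p - c * snd p)"
      using c(1)[OF pr(1)] c(1)[OF pr(2)] by (simp add: sl_def frac_eq_eq)
    then show False using S(4)[OF pr(1,2,4)] by (simp add: algebra_simps)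
  qed
  have q0: "q \<noteq> 0"
  proof
    assume "q = 0"
    have "dird (0, 1) B (1, s) = poly (pderiv q) s" for s by (rule Y_poly[OF B(1) q(1)])
    then have "dird (0, 1) (dird (0, 1) B) (1, 0) = poly (pderiv (pderiv q)) 0" by (rule Y_poly[OF rpf_dird[OF B(1)]])
    then have "hess2 B (1, 0) = - (dird (1, 0) (dird (0, 1) B) (1, 0))\<^sup>2"
      using \<open>q = 0\<close> by (simp add: hess2_def)
    moreover have "dird (1, 0) (dird (0, 1) B) (1, 0) = 0"
    proof -
      have hd: "homog (n - 1) (dird (0, 1) B)" using homog_dird'[of B "n - 1"] B n by simp
      show ?thesis
        using dird_euler2[OF rpf_dird[OF B(1)] hd, of 1 0] Y_poly[OF B(1) q(1), of 0] \<open>q = 0\<close> by simp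
    qed
    ultimately show False using B(3)[of "(1, 0)"] by (simp add: zero_prod_def)
  qed
  have fin: "finite {s. poly q s = 0}" by (rule poly_roots_finite[OF q0])
  have sub: "sl ` S \<subseteq> {s. poly q s = 0}" using root by auto
  have "n \<le> card {s. poly q s = 0}"
    using card_mono[OF fin sub] card_image[OF inj] S(2) by simp
  then have card: "card {s. poly q s = 0} = n" "degree q = n" using card_poly_roots_bound[OF q0] q(2) by auto
  have im: "sl ` S = {s. poly q s = 0}"
    using card_subset_eq[OF fin sub] card_image[OF inj] S(2) card(1) by simp
  have gen: "poly (pderiv (pderiv q)) s \<noteq> 0" if "poly q s = 0" for s
  proof -
    have "s \<in> sl ` S" using im that by simp
    then obtain p where p: "s = sl p" "p \<in> S" by (rule imageE)
    note p = p(2,1)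
    let ?u = "fst p - c * snd p"
    have dd: "dird (0, 1) (dird (0, 1) B) x = ?d (shear c x) + 2 * c * ?b (shear c x) + c\<^sup>2 * ?a (shear c x)" for x
    proof -
      have r: "rpf (\<lambda>p. c * dird (1, 0) A (shear c p))" "rpf (\<lambda>p. dird (0, 1) A (shear c p))"
        by (rule rpf_basic(3)[OF rpf_basic(1) rpf_shear[OF rpf_dird[OF A(1)]]] rpf_shear[OF rpf_dird[OF A(1)]])+
      have "dird (0, 1) (dird (1, 0) A) = dird (1, 0) (dird (0, 1) A)" by (rule dird_commute[OF A(1)])
      then show ?thesis
        unfolding B_def[abs_def] dird_shear[OF A(1)] dird_add[OF r] dird_cmult[OF rpf_shear[OF rpf_dird[OF A(1)]]]
          dird_shear[OF rpf_dird[OF A(1)]]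
        by (simp add: power2_eq_square algebra_simps)
    qed
    have h2: "homog (n - 2) (dird (0, 1) (dird (0, 1) B))"
      using homog_dird'[of B "n - 1"] homog_dird'[of "dird (0, 1) B" "n - 2"] B n rpf_dird[OF B(1)]
      by (simp add: numeral_2_eq_2 Suc_diff_Suc)
    have "dird (0, 1) (dird (0, 1) B) (?u *\<^sub>R (1, s)) \<noteq> 0"
      unfolding dd p(2) pt[OF p(1)] by (rule c(2)[OF p(1)])
    then have "dird (0, 1) (dird (0, 1) B) (1, s) \<noteq> 0"
      using homogD[OF h2 c(1)[OF p(1)], of "(1, s)"] by simp
    moreover have "dird (0, 1) B (1, s) = poly (pderiv q) s" for s by (rule Y_poly[OF B(1) q(1)])
    ultimately show ?thesis using Y_poly[OF rpf_dird[OF B(1)]] by simp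
  qed
  have "hyperbolic_form B n q" using B n q card gen by unfold_locales auto
  moreover have "B (0, 1) \<noteq> 0" using q(3)[OF _ q0] card(2) by auto
  ultimately show ?thesis unfolding B_def[abs_def] A_def by blast
qed

section \<open>Adding a line to a planar form\<close>

text \<open>The planar Hessian with the parameters kept as variables, so that it is one polynomial
  function of the point and the parameters.\<close>

definition hessp :: "((real \<times> real) \<times> 'p::euclidean_space \<Rightarrow> real) \<Rightarrow> (real \<times> real) \<times> 'p \<Rightarrow> real" where
  "hessp F q = dird ((1, 0), 0) (dird ((1, 0), 0) F) q * dird ((0, 1), 0) (dird ((0, 1), 0) F) q
     - (dird ((1, 0), 0) (dird ((0, 1), 0) F) q)\<^sup>2"

lemma rpf_hessp [rpf_intros]: "rpf F \<Longrightarrow> rpf (hessp F)"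
  unfolding hessp_def by (intro rpf_intros)

lemma hess2_slice:
  assumes "rpf F" shows "hess2 (\<lambda>p. F (p, t)) = (\<lambda>p. hessp F (p, t))"
  by (rule ext) (simp add: hess2_def hessp_def dird_slice assms rpf_dird)

lemma hess2_scale:
  assumes "rpf g"
  shows "hess2 (\<lambda>p. c * g (r *\<^sub>R p)) = (\<lambda>p. c\<^sup>2 * r ^ 4 * hess2 g (r *\<^sub>R p))"
proof
  fix p
  have rs: "rpf (\<lambda>p. h (r *\<^sub>R p))" if "rpf h" for h :: "real \<times> real \<Rightarrow> real"
    by (rule rpf_comp[OF that]) (intro rpf_intros)
  have d: "dird v (\<lambda>p. c * h (r *\<^sub>R p)) = (\<lambda>p. (c * r) * dird v h (r *\<^sub>R p))" if "rpf h" for v c and h :: "real \<times> real \<Rightarrow> real"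
    by (simp add: dird_cmult[OF rs[OF that]] dird_linear_comp[OF that bounded_linear_scaleR_right] dird_scale_dir[OF that] mult.assoc)
  show "hess2 (\<lambda>p. c * g (r *\<^sub>R p)) p = c\<^sup>2 * r ^ 4 * hess2 g (r *\<^sub>R p)"
    unfolding hess2_def d[OF assms] d[OF rpf_dird[OF assms]]
    by (simp add: power2_eq_square power4_eq_xxxx algebra_simps)
qed

lemma hess2_scaled_eq:
  assumes g: "rpf g" and h: "rpf h" and eq: "\<And>p. g (r *\<^sub>R p) = c * h p"
  shows "r ^ 4 * hess2 g (r *\<^sub>R p) = c\<^sup>2 * hess2 h p"
proof -
  have "hess2 (\<lambda>p. 1 * g (r *\<^sub>R p)) p = hess2 (\<lambda>p. c * h (1 *\<^sub>R p)) p" using eq by simp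
  then show ?thesis unfolding hess2_scale[OF g] hess2_scale[OF h] by simp
qed

text \<open>The planar case is the spatial one with a dummy height z and the additional equation z =
  0.\<close>

theorem planar_stable:
  fixes \<Psi> :: "(real \<times> real) \<times> 'p::euclidean_space \<Rightarrow> real"
  assumes \<Psi>: "rpf \<Psi>" and K: "compact K" and C0: "ovals N {p \<in> K. \<Psi> (p, t0) = 0}" "{p \<in> K. \<Psi> (p, t0) = 0} \<subseteq> interior K"
    and reg: "\<And>p. p \<in> K \<Longrightarrow> \<Psi> (p, t0) = 0 \<Longrightarrow> dird ((1, 0), 0) \<Psi> (p, t0) \<noteq> 0 \<or> dird ((0, 1), 0) \<Psi> (p, t0) \<noteq> 0"
  shows "eventually (\<lambda>t. ovals N {p \<in> K. \<Psi> (p, t) = 0} \<and>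
    (\<forall>p\<in>K. \<Psi> (p, t) = 0 \<longrightarrow> dird ((1, 0), 0) \<Psi> (p, t) \<noteq> 0 \<or> dird ((0, 1), 0) \<Psi> (p, t) \<noteq> 0)) (nhds t0)"
proof -
  let ?\<Phi> = "\<lambda>q::(real \<times> real \<times> real) \<times> 'p. snd (snd (fst q))"
  let ?\<Theta> = "\<lambda>q::(real \<times> real \<times> real) \<times> 'p. \<Psi> ((fst (fst q), fst (snd (fst q))), snd q)"
  let ?\<Omega> = "\<lambda>p. \<Psi> (p, t0)"
  have bl: "bounded_linear ?\<Phi>" by (intro bounded_linear_intros)
  have bl2: "bounded_linear (\<lambda>q::(real \<times> real \<times> real) \<times> 'p. ((fst (fst q), fst (snd (fst q))), snd q))"
    by (intro bounded_linear_intros)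
  have r1: "rpf ?\<Phi>" by (rule real_polynomial_function.intros(1)[OF bl])
  have r2: "rpf ?\<Theta>" by (rule rpf_comp[OF \<Psi>]) (intro rpf_intros)
  have d1: "dird v ?\<Phi> q = ?\<Phi> v" for v q by (simp add: dird_linear[OF bl])
  have d2: "dird v ?\<Theta> q = dird ((fst (fst v), fst (snd (fst v))), snd v) \<Psi> ((fst (fst q), fst (snd (fst q))), snd q)" for v q
    by (simp add: dird_linear_comp[OF \<Psi> bl2])
  have z: "zero_curve ?\<Phi> ?\<Theta> K 1 t = (\<lambda>p. (fst p, snd p, 0::real)) ` {p \<in> K. \<Psi> (p, t) = 0}" for t
    by (force simp: zero_curve_def)
  have reg': "dird (1, 0) ?\<Omega> p \<noteq> 0 \<or> dird (0, 1) ?\<Omega> p \<noteq> 0" if "p \<in> K" "?\<Omega> p = 0" for p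
    using reg[OF that] by (simp add: dird_slice[OF \<Psi>])
  have l1: "?\<Phi> ((x, y, z), t0) = 1 * z + 0" and l2: "?\<Theta> ((x, y, z), t0) = ?\<Omega> (x, y)" for x y z by simp_all
  note S = zero_curve_stable[OF r1 r2 rpf_slice[OF \<Psi>] K, where \<kappa> = 1 and f = "\<lambda>p. 0" and Z = 1, OF _ l1 l2 _ _ C0 reg']
  have 1: "eventually (\<lambda>t. ovals N (zero_curve ?\<Phi> ?\<Theta> K 1 t)) (nhds t0)" by (rule S(1)) auto
  have 2: "eventually (\<lambda>t. \<forall>p\<in>zero_curve ?\<Phi> ?\<Theta> K 1 t.
       dird ex3 ?\<Phi> (p, t) * dird ex1 ?\<Theta> (p, t) - dird ex1 ?\<Phi> (p, t) * dird ex3 ?\<Theta> (p, t) \<noteq> 0 \<or>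
       dird ex3 ?\<Phi> (p, t) * dird ex2 ?\<Theta> (p, t) - dird ex2 ?\<Phi> (p, t) * dird ex3 ?\<Theta> (p, t) \<noteq> 0) (nhds t0)"
    by (rule S(2)) auto
  show ?thesis using 1 2
  proof eventually_elim
    case (elim t)
    have "ovals N ((\<lambda>p. (fst p, fst (snd p))) ` (\<lambda>p. (fst p, snd p, 0::real)) ` {p \<in> K. \<Psi> (p, t) = 0})"
      using elim(1) unfolding z by (rule ovals_image) (auto intro!: continuous_intros inj_onI)
    moreover have "(\<lambda>p. (fst p, fst (snd p))) ` (\<lambda>p. (fst p, snd p, 0::real)) ` {p \<in> K. \<Psi> (p, t) = 0} = {p \<in> K. \<Psi> (p, t) = 0}"
      by (simp add: image_image)
    ultimately have "ovals N {p \<in> K. \<Psi> (p, t) = 0}" by simp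
    moreover have "dird ((1, 0), 0) \<Psi> (p, t) \<noteq> 0 \<or> dird ((0, 1), 0) \<Psi> (p, t) \<noteq> 0" if "p \<in> K" "\<Psi> (p, t) = 0" for p
    proof -
      have "(fst p, snd p, 0) \<in> zero_curve ?\<Phi> ?\<Theta> K 1 t" unfolding z using that by auto
      from bspec[OF elim(2) this] show ?thesis by (simp add: d1 d2)
    qed
    ultimately show ?case by blast
  qed
qed

lemma goodD:
  assumes "good n N F"
  shows "rpf F" "homog n F" "\<And>p. p \<noteq> 0 \<Longrightarrow> hessp F (p, 0) < 0" "ovals N {p. hessp F (p, 1) = 0}"
    "\<And>p. hessp F (p, 1) = 0 \<Longrightarrow> dird ((1, 0), 0) (hessp F) (p, 1) \<noteq> 0 \<or> dird ((0, 1), 0) (hessp F) (p, 1) \<noteq> 0"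
proof -
  show F: "rpf F" "homog n F" using assms by (simp_all add: good_def)
  note s = hess2_slice[OF F(1)] and d = dird_slice[OF rpf_hessp[OF F(1)]]
  show "hessp F (p, 0) < 0" if "p \<noteq> 0" for p using assms that unfolding good_def s by blast
  show "ovals N {p. hessp F (p, 1) = 0}" using assms unfolding good_def s by blast
  show "dird ((1, 0), 0) (hessp F) (p, 1) \<noteq> 0 \<or> dird ((0, 1), 0) (hessp F) (p, 1) \<noteq> 0" if "hessp F (p, 1) = 0" for p
    using assms that unfolding good_def s d by blast
qed

lemma hessp_homog:
  assumes "rpf F" "homog n F" "t \<noteq> 0"
  shows "t ^ 4 * hessp F (t *\<^sub>R p, t * e) = (t ^ n)\<^sup>2 * hessp F (p, e)"
proof -
  have "t ^ 4 * hess2 (\<lambda>p. F (p, t * e)) (t *\<^sub>R p) = (t ^ n)\<^sup>2 * hess2 (\<lambda>p. F (p, e)) p"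
  proof (rule hess2_scaled_eq)
    show "F (t *\<^sub>R p, t * e) = t ^ n * F (p, e)" for p
      using homogD[OF assms(2,3), of "(p, e)"] by simp
  qed (rule rpf_slice[OF assms(1)])+
  then show ?thesis by (simp add: hess2_slice[OF assms(1)])
qed

text \<open>For e > 0 the point (p, e) is proportional to (p / e, 1), which is at least as far out
  and hence off the bounded Hessian curve; for e = 0 the Hessian of the leading form is negative.
  The range of e in [0, 1] is what bridges the intermediate scales later.\<close>

lemma hessp_far:
  assumes "good n N F"
  obtains R where "R > 0" "\<And>p e. 0 \<le> e \<Longrightarrow> e \<le> 1 \<Longrightarrow> norm p \<ge> R \<Longrightarrow> hessp F (p, e) \<noteq> 0"
    "\<And>p. hessp F (p, 1) = 0 \<Longrightarrow> norm p < R"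
proof -
  note F = goodD[OF assms]
  have "bounded {p. hessp F (p, 1) = 0}" using ovals_compact[OF F(4)] compact_imp_bounded by blast
  then obtain R where R: "R > 0" "\<And>p. hessp F (p, 1) = 0 \<Longrightarrow> norm p < R"
    unfolding bounded_pos_less by auto
  have "hessp F (p, e) \<noteq> 0" if e: "0 \<le> e" "e \<le> 1" and p: "norm p \<ge> R" for p e
  proof (cases "e = 0")
    case True
    have "p \<noteq> 0" using p R(1) by auto
    then show ?thesis using F(3)[of p] True by simp
  next
    case False
    have "hessp F (inverse e *\<^sub>R p, 1) \<noteq> 0"
    proof
      assume "hessp F (inverse e *\<^sub>R p, 1) = 0"
      from R(2)[OF this] have "norm p < R * e" using e False by (simp add: field_simps)
      also have "\<dots> \<le> R * 1" using e R(1) by (intro mult_left_mono) auto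
      finally show False using p by simp
    qed
    then show ?thesis using hessp_homog[OF F(1,2), of "inverse e" p e] False by auto
  qed
  then show ?thesis using that R by blast
qed

context hyperbolic_form
begin

text \<open>By Euler's relation the Hessian of x A is (1 + 2 / (n - 1)) x^2 times that of
  \<open>A\<close>, minus the square of the y derivative of \<open>A\<close>. On x = 0 the square
  takes over; it is nonzero there because \<open>A (0, 1)\<close> is.\<close>

lemma hess_times_x:
  assumes "A (0, 1) \<noteq> 0" "p \<noteq> 0" shows "hess2 (\<lambda>p. fst p * A p) p < 0"
proof -
  obtain x y where p: "p = (x, y)" by (cases p)
  have hd: "homog (n - 1) (dird v A)" for v
    using homog_dird'[of A "n - 1"] A n by simp
  have bl: "dird v fst = (\<lambda>p. fst v)" for v :: "real \<times> real"
    by (simp add: dird_linear[OF bounded_linear_fst])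
  have r: "rpf (fst :: real \<times> real \<Rightarrow> real)" by (intro rpf_intros)
  have d: "dird v (\<lambda>p. fst p * A p) = (\<lambda>p. fst p * dird v A p + fst v * A p)" for v
    by (subst dird_mult[OF r A(1)]) (simp add: bl)
  have dd: "dird u (dird v (\<lambda>p. fst p * A p)) p = fst p * dird u (dird v A) p + fst u * dird v A p + fst v * dird u A p" for u v p
    unfolding d
    by (subst dird_add) (simp_all add: dird_mult[OF r rpf_dird[OF A(1)]] bl dird_cmult[OF A(1)] rpf_intros A r)
  have e: "x * X (X A) p + y * X (Y A) p = (real n - 1) * X A p" "x * X (Y A) p + y * Y (Y A) p = (real n - 1) * Y A p"
    using dird_euler2[OF rpf_dird[OF A(1)] hd, of x "(1, 0)" y] dird_euler2[OF rpf_dird[OF A(1)] hd, of x "(0, 1)" y]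
      n dird_commute[OF A(1), of "(0, 1)" "(1, 0)"] p by (simp_all add: of_nat_diff)
  have n1: "real n - 1 > 0" using n by simp
  have "(real n - 1) * (X A p * Y (Y A) p - X (Y A) p * Y A p) = x * hess2 A p"
  proof -
    have "(real n - 1) * (X A p * Y (Y A) p - X (Y A) p * Y A p)
      = ((real n - 1) * X A p) * Y (Y A) p - X (Y A) p * ((real n - 1) * Y A p)" by (simp add: algebra_simps)
    also have "\<dots> = x * hess2 A p" unfolding e[symmetric] hess2_def by (simp add: power2_eq_square algebra_simps)
    finally show ?thesis .
  qed
  then have m: "X A p * Y (Y A) p - X (Y A) p * Y A p = x * hess2 A p / (real n - 1)"
    using n1 by (simp add: field_simps)
  have "hess2 (\<lambda>p. fst p * A p) p = x\<^sup>2 * hess2 A p + 2 * x * (X A p * Y (Y A) p - X (Y A) p * Y A p) - (Y A p)\<^sup>2"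
    unfolding hess2_def dd p by (simp add: power2_eq_square algebra_simps)
  also have "\<dots> = x\<^sup>2 * hess2 A p * (1 + 2 / (real n - 1)) - (Y A p)\<^sup>2"
    unfolding m by (simp add: power2_eq_square algebra_simps)
  also have "\<dots> < 0"
  proof (cases "x = 0")
    case True
    then have y: "y \<noteq> 0" using assms(2) p by (auto simp: zero_prod_def)
    have "A (0, y) \<noteq> 0" using homogD[OF A(2) y, of "(0, 1)"] y assms(1) by simp
    then have "Y A p \<noteq> 0" using dird_euler2[OF A, of 0 y] n p True by auto
    then show ?thesis using True by simp
  next
    case False
    then have "x\<^sup>2 * hess2 A p < 0" using hyp[OF assms(2)] by (simp add: mult_pos_neg)
    moreover have "1 + 2 / (real n - 1) > 0" using n1 by (simp add: add_pos_pos)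
    ultimately have "x\<^sup>2 * hess2 A p * (1 + 2 / (real n - 1)) < 0" by (rule mult_neg_pos)
    then show ?thesis using zero_le_power2[of "Y A p"] by linarith
  qed
  finally show ?thesis .
qed

end

lemma eventually_nhds_Pair0:
  fixes P :: "real \<times> real \<Rightarrow> bool"
  assumes "eventually P (nhds (a, 0))"
  obtains d where "d > 0" "\<And>x y. \<bar>x - a\<bar> < d \<Longrightarrow> \<bar>y\<bar> < d \<Longrightarrow> P (x, y)"
proof -
  obtain d where d: "d > 0" "\<And>t. dist t (a, 0) < d \<Longrightarrow> P t"
    using assms unfolding eventually_nhds_metric by auto
  have "P (x, y)" if "\<bar>x - a\<bar> < d / 2" "\<bar>y\<bar> < d / 2" for x y
  proof (rule d(2))
    have "dist (x, y) (a, 0) = norm (x - a, y)" by (simp add: dist_norm)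
    also have "\<dots> \<le> \<bar>x - a\<bar> + \<bar>y\<bar>" using norm_Pair_le[of "x - a" y] by simp
    finally show "dist (x, y) (a, 0) < d" using that by simp
  qed
  then show ?thesis using that[of "d / 2"] d(1) by simp
qed

text \<open>The new line has distance 1 / \<delta> from the origin. At scale 1 its factor tends to 1
  and the N old ovals persist; at scale 1 / \<delta> the form tends to (1 + x) A, which contributes
  n - 1 new ones; beyond both, the form tends to its leading part x A, without zeros of the Hessian.
  The scales in between are covered by the circle of radius R.\<close>

theorem line_step:
  assumes good: "good n N F" and hf: "hyperbolic_form (\<lambda>p. F (p, 0)) n q" and A01: "F ((0, 1), 0) \<noteq> 0"
  obtains \<delta>0 where "\<delta>0 > 0" "\<And>\<delta>. 0 < \<delta> \<Longrightarrow> \<delta> < \<delta>0 \<Longrightarrow> good (n + 1) (N + (n - 1)) (\<lambda>q. (snd q + \<delta> * fst (fst q)) * F q)"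
proof -
  note F = goodD[OF good]
  define A where "A p = F (p, 0)" for p
  interpret H: hyperbolic_form A n q using hf by (simp add: A_def[abs_def])
  have n: "n \<ge> 3" by (rule H.n)
  \<comment> \<open>Two normalisations of the same product. In \<open>k\<close> with parameters
    (\<tau>, e) the new line is \<tau> + x = 0; in \<open>k'\<close> with parameters (e, r) it is 1
    + r x = 0.\<close>
  define k where "k = (\<lambda>q::(real \<times> real) \<times> (real \<times> real). (fst (snd q) + fst (fst q)) * F (fst q, snd (snd q)))"
  define k' where "k' = (\<lambda>q::(real \<times> real) \<times> (real \<times> real). (1 + snd (snd q) * fst (fst q)) * F (fst q, fst (snd q)))"
  have rF: "rpf (\<lambda>q::(real \<times> real) \<times> (real \<times> real). F (fst q, snd (snd q)))"
    "rpf (\<lambda>q::(real \<times> real) \<times> (real \<times> real). F (fst q, fst (snd q)))"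
    by (rule rpf_comp[OF F(1)], intro rpf_intros)+
  have rk: "rpf k" "rpf k'"
    unfolding k_def k'_def by (intro rpf_basic(2,3) rF; intro rpf_intros)+
  have ck: "continuous_on S (hessp k)" "continuous_on S (hessp k')" for S
    by (rule rpf_cont[OF rpf_hessp[OF rk(1)]] rpf_cont[OF rpf_hessp[OF rk(2)]])+
  have k0: "hessp k (p, (1, 0)) = hess2 H.f0 p" for p
    using fun_cong[OF hess2_slice[OF rk(1), of "(1, 0)"], of p] by (simp add: k_def H.f0_def[abs_def] A_def)
  have kinf: "hessp k (p, (0, 0)) < 0" if "p \<noteq> 0" for p
    using fun_cong[OF hess2_slice[OF rk(1), of "(0, 0)"], of p] H.hess_times_x[OF _ that] A01 by (simp add: k_def A_def)
  have k'0: "hessp k' (p, (e, 0)) = hessp F (p, e)" for p e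
    using fun_cong[OF hess2_slice[OF rk(2), of "(e, 0)"], of p] fun_cong[OF hess2_slice[OF F(1), of e], of p] by (simp add: k'_def)
  have scale: "r ^ 4 * hessp k (r *\<^sub>R p, (1, r * e)) = (r ^ n)\<^sup>2 * hessp k' (p, (e, r))" if "r \<noteq> 0" for r p e
  proof -
    have "r ^ 4 * hess2 (\<lambda>p. k (p, (1, r * e))) (r *\<^sub>R p) = (r ^ n)\<^sup>2 * hess2 (\<lambda>p. k' (p, (e, r))) p"
    proof (rule hess2_scaled_eq)
      show "k (r *\<^sub>R p, (1, r * e)) = r ^ n * k' (p, (e, r))" for p
        using homogD[OF F(2) that, of "(p, e)"] by (simp add: k_def k'_def)
    qed (rule rpf_slice[OF rk(1)] rpf_slice[OF rk(2)])+
    then show ?thesis by (simp add: hess2_slice rk)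
  qed
  have infinity: "(1 / \<tau>) ^ 4 * hessp k ((1 / \<tau>) *\<^sub>R p, (1, \<delta>)) = ((1 / \<tau>) ^ (n + 1))\<^sup>2 * hessp k (p, (\<tau>, \<tau> * \<delta>))" if "\<tau> \<noteq> 0" for \<tau> p \<delta>
  proof -
    have "(1 / \<tau>) ^ 4 * hess2 (\<lambda>p. k (p, (1, \<delta>))) ((1 / \<tau>) *\<^sub>R p) = ((1 / \<tau>) ^ (n + 1))\<^sup>2 * hess2 (\<lambda>p. k (p, (\<tau>, \<tau> * \<delta>))) p"
    proof (rule hess2_scaled_eq)
      show "k ((1 / \<tau>) *\<^sub>R p, (1, \<delta>)) = (1 / \<tau>) ^ (n + 1) * k (p, (\<tau>, \<tau> * \<delta>))" for p
        using homogD[OF F(2), of "1 / \<tau>" "(p, \<tau> * \<delta>)"] that by (simp add: k_def field_simps)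
    qed (rule rpf_slice[OF rk(1)])+
    then show ?thesis by (simp add: hess2_slice rk)
  qed
  obtain R where R: "R > 0" "\<And>p e. 0 \<le> e \<Longrightarrow> e \<le> 1 \<Longrightarrow> norm p \<ge> R \<Longrightarrow> hessp F (p, e) \<noteq> 0"
    "\<And>p. hessp F (p, 1) = 0 \<Longrightarrow> norm p < R"
    using hessp_far[OF good] by metis
  have "eventually (\<lambda>t. \<forall>p\<in>sphere 0 1. (p, t) \<in> {q. hessp k q \<noteq> 0}) (nhds (0, 0))"
  proof (rule eventually_tube)
    show "open {q. hessp k q \<noteq> 0}" by (intro open_Collect_neq ck continuous_on_const)
    show "(p, (0, 0)) \<in> {q. hessp k q \<noteq> 0}" if "p \<in> sphere 0 1" for p
    proof -
      have "p \<noteq> 0" using that by auto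
      from kinf[OF this] show ?thesis by simp
    qed
  qed simp
  then obtain \<tau>2 where \<tau>2: "\<tau>2 > 0" "\<And>\<tau> \<mu> p. \<bar>\<tau>\<bar> < \<tau>2 \<Longrightarrow> \<bar>\<mu>\<bar> < \<tau>2 \<Longrightarrow> norm p = 1 \<Longrightarrow> hessp k (p, (\<tau>, \<mu>)) \<noteq> 0"
    by (rule eventually_nhds_Pair0) auto
  \<comment> \<open>No zero on the circle of radius R for any e in [0, 1], as long as the new line
    is far away. This covers all scales between the inner and the outer ovals.\<close>
  have "eventually (\<lambda>r. \<forall>x\<in>sphere 0 R \<times> {0..1}. (x, r) \<in> {q. hessp k' (fst (fst q), (snd (fst q), snd q)) \<noteq> 0}) (nhds (0::real))"
  proof (rule eventually_tube)
    show "open {q. hessp k' (fst (fst q), (snd (fst q), snd q)) \<noteq> 0}"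
      by (intro open_Collect_neq continuous_on_compose2[OF ck(2)[of UNIV]] continuous_intros) auto
    show "(x, 0) \<in> {q. hessp k' (fst (fst q), (snd (fst q), snd q)) \<noteq> 0}" if "x \<in> sphere 0 R \<times> {0..1}" for x
      using R(2)[of "snd x" "fst x"] that by (auto simp: k'0)
  qed (intro compact_Times; simp)
  then obtain r1 where r1: "r1 > 0" "\<And>r p e. \<bar>r\<bar> < r1 \<Longrightarrow> norm p = R \<Longrightarrow> 0 \<le> e \<Longrightarrow> e \<le> 1 \<Longrightarrow> hessp k' (p, (e, r)) \<noteq> 0"
    unfolding eventually_nhds_metric by (auto simp: dist_real_def)
  define Ov where "Ov = {p. p \<noteq> 0 \<and> hess2 H.f0 p = 0}"
  have Ov: "ovals (n - 1) Ov" unfolding Ov_def by (rule H.outer_ovals)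
  then have cOv: "compact Ov" by (rule ovals_compact)
  obtain \<rho>0 where \<rho>0: "\<rho>0 > 0" "\<And>p. p \<in> Ov \<Longrightarrow> norm p > \<rho>0"
  proof -
    have "open (- Ov)" "0 \<in> - Ov" using compact_imp_closed[OF cOv] by (auto simp: Ov_def)
    then obtain e where "e > 0" "cball 0 e \<subseteq> - Ov" using open_contains_cball by blast
    then show thesis using that[of e] by (force simp: subset_iff)
  qed
  obtain R0 where R0: "R0 > 0" "\<And>p. p \<in> Ov \<Longrightarrow> norm p < R0"
    using compact_imp_bounded[OF cOv] unfolding bounded_pos_less by auto
  \<comment> \<open>Inside radius \<rho> there are no outer ovals, and a point of that disc is
    brought to the circle of radius R by a scale below \<open>r1\<close>.\<close>
  define \<rho> where "\<rho> = min \<rho>0 (R * r1 / 2)"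
  have \<rho>: "\<rho> > 0" "\<rho> \<le> \<rho>0" "\<rho> \<le> R * r1 / 2" using \<rho>0(1) R(1) r1(1) by (auto simp: \<rho>_def)
  define R2 where "R2 = R0 + 2 / \<tau>2"
  have R2: "R2 > R0" "R2 > 1 / \<tau>2" "R2 > 0" using \<tau>2(1) R0(1) by (auto simp: R2_def field_simps add_pos_pos)
  define K where "K = cball 0 R2 - ball (0::real \<times> real) \<rho>"
  have K: "compact K" unfolding K_def by (intro compact_diff) auto
  have OvK: "{p \<in> K. hessp k (p, (1, 0)) = 0} = Ov" "Ov \<subseteq> interior K"
  proof -
    have "ball 0 R2 - cball 0 \<rho> \<subseteq> interior K"
      unfolding K_def by (intro interior_maximal) auto
    moreover have "Ov \<subseteq> ball 0 R2 - cball 0 \<rho>" using R0(2) \<rho>0(2) R2(1) \<rho>(2) by force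
    ultimately show "Ov \<subseteq> interior K" by blast
    then have "Ov \<subseteq> K" using interior_subset by blast
    moreover have "p \<noteq> 0" if "p \<in> K" for p using that \<rho>(1) by (auto simp: K_def)
    ultimately show "{p \<in> K. hessp k (p, (1, 0)) = 0} = Ov" by (auto simp: k0 Ov_def)
  qed
  have dk0: "dird (v, 0) (hessp k) (p, (1, 0)) = dird v (hess2 H.f0) p" for v p
    using fun_cong[OF dird_slice[OF rpf_hessp[OF rk(1)], of v "(1, 0)"], of p] by (simp add: k0[abs_def])
  have dk'0: "dird (v, 0) (hessp k') (p, (1, 0)) = dird (v, 0) (hessp F) (p, 1)" for v p
    using fun_cong[OF dird_slice[OF rpf_hessp[OF rk(2)], of v "(1, 0)"], of p]
      fun_cong[OF dird_slice[OF rpf_hessp[OF F(1)], of v 1], of p] by (simp add: k'0)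
  have "eventually (\<lambda>t. ovals (n - 1) {p \<in> K. hessp k (p, t) = 0} \<and>
    (\<forall>p\<in>K. hessp k (p, t) = 0 \<longrightarrow> dird ((1, 0), 0) (hessp k) (p, t) \<noteq> 0 \<or> dird ((0, 1), 0) (hessp k) (p, t) \<noteq> 0)) (nhds (1, 0))"
  proof (rule planar_stable[OF rpf_hessp[OF rk(1)] K])
    show "dird ((1, 0), 0) (hessp k) (p, (1, 0)) \<noteq> 0 \<or> dird ((0, 1), 0) (hessp k) (p, (1, 0)) \<noteq> 0"
      if "p \<in> K" "hessp k (p, (1, 0)) = 0" for p
    proof -
      have "p \<noteq> 0" using that \<rho>(1) by (auto simp: K_def)
      then show ?thesis unfolding dk0 using H.outer_regular[of p] that by (simp add: k0)
    qed
  qed (use OvK Ov in auto)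
  then obtain d1 where d1: "d1 > 0" "\<And>\<delta>. \<bar>\<delta>\<bar> < d1 \<Longrightarrow> ovals (n - 1) {p \<in> K. hessp k (p, (1, \<delta>)) = 0}"
    "\<And>\<delta> p. \<bar>\<delta>\<bar> < d1 \<Longrightarrow> p \<in> K \<Longrightarrow> hessp k (p, (1, \<delta>)) = 0 \<Longrightarrow>
       dird ((1, 0), 0) (hessp k) (p, (1, \<delta>)) \<noteq> 0 \<or> dird ((0, 1), 0) (hessp k) (p, (1, \<delta>)) \<noteq> 0"
    by (rule eventually_nhds_Pair0) auto
  have inner0: "{p \<in> cball 0 R. hessp k' (p, (1, 0)) = 0} = {p. hessp F (p, 1) = 0}"
    using R(3) by (auto simp: k'0 less_imp_le)
  have "eventually (\<lambda>t. ovals N {p \<in> cball 0 R. hessp k' (p, t) = 0} \<and>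
    (\<forall>p\<in>cball 0 R. hessp k' (p, t) = 0 \<longrightarrow> dird ((1, 0), 0) (hessp k') (p, t) \<noteq> 0 \<or> dird ((0, 1), 0) (hessp k') (p, t) \<noteq> 0)) (nhds (1, 0))"
  proof (rule planar_stable[OF rpf_hessp[OF rk(2)]])
    show "ovals N {p \<in> cball 0 R. hessp k' (p, (1, 0)) = 0}" unfolding inner0 by (rule F(4))
    show "{p \<in> cball 0 R. hessp k' (p, (1, 0)) = 0} \<subseteq> interior (cball 0 R)"
      unfolding inner0 using R(3) by (auto simp: interior_cball)
    show "dird ((1, 0), 0) (hessp k') (p, (1, 0)) \<noteq> 0 \<or> dird ((0, 1), 0) (hessp k') (p, (1, 0)) \<noteq> 0"
      if "hessp k' (p, (1, 0)) = 0" for p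
      unfolding dk'0 using F(5)[of p] that by (simp add: k'0)
  qed simp
  then obtain d2 where d2: "d2 > 0" "\<And>\<delta>. \<bar>\<delta>\<bar> < d2 \<Longrightarrow> ovals N {p \<in> cball 0 R. hessp k' (p, (1, \<delta>)) = 0}"
    "\<And>\<delta> p. \<bar>\<delta>\<bar> < d2 \<Longrightarrow> p \<in> cball 0 R \<Longrightarrow> hessp k' (p, (1, \<delta>)) = 0 \<Longrightarrow>
       dird ((1, 0), 0) (hessp k') (p, (1, \<delta>)) \<noteq> 0 \<or> dird ((0, 1), 0) (hessp k') (p, (1, \<delta>)) \<noteq> 0"
    by (rule eventually_nhds_Pair0) auto
  define \<delta>0 where "\<delta>0 = min (min d1 d2) (min (min 1 r1) (\<rho> / R))"
  have \<delta>0: "\<delta>0 > 0" using d1(1) d2(1) r1(1) \<rho>(1) R(1) by (simp add: \<delta>0_def)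
  have "good (n + 1) (N + (n - 1)) (\<lambda>q. (snd q + \<delta> * fst (fst q)) * F q)" if \<delta>: "0 < \<delta>" "\<delta> < \<delta>0" for \<delta>
  proof -
    have \<delta>': "\<bar>\<delta>\<bar> < d1" "\<bar>\<delta>\<bar> < d2" "\<delta> < 1" "\<delta> < r1" "R * \<delta> < \<rho>"
      using \<delta> R(1) by (auto simp: \<delta>0_def field_simps)
    define G where "G = (\<lambda>q. (snd q + \<delta> * fst (fst q)) * F q)"
    have rG: "rpf G" unfolding G_def by (intro rpf_basic(2,3) F(1); intro rpf_intros)
    have hG: "homog (n + 1) G"
    proof -
      have "G (t *\<^sub>R x) = t ^ (n + 1) * G x" if "t \<noteq> 0" for t x
        using homogD[OF F(2) that, of x] by (simp add: G_def algebra_simps)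
      then show ?thesis unfolding homog_def by blast
    qed
    have G1: "hess2 (\<lambda>p. G (p, 1)) = (\<lambda>p. hessp k' (p, (1, \<delta>)))"
      unfolding hess2_slice[OF rk(2), symmetric] by (simp add: G_def k'_def)
    have lead: "hess2 (\<lambda>p. G (p, 0)) p < 0" if "p \<noteq> 0" for p
    proof -
      have "hess2 (\<lambda>p. \<delta> * (fst (1 *\<^sub>R p) * A (1 *\<^sub>R p))) p = \<delta>\<^sup>2 * 1 ^ 4 * hess2 (\<lambda>p. fst p * A p) (1 *\<^sub>R p)"
        by (subst hess2_scale) (intro rpf_basic(3) H.A(1) rpf_intros, simp)
      moreover have "\<dots> < 0" using H.hess_times_x[OF _ that] A01 \<delta>(1) by (simp add: A_def mult_pos_neg)
      ultimately show ?thesis by (simp add: G_def A_def mult.assoc)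
    qed
    have roots: "\<exists>S. finite S \<and> card S = n + 1 \<and> (\<forall>p\<in>S. G (p, 0) = 0) \<and>
        (\<forall>p\<in>S. \<forall>r\<in>S. p \<noteq> r \<longrightarrow> fst p * snd r \<noteq> snd p * fst r)"
    proof -
      obtain S where S: "finite S" "card S = n" "\<forall>p\<in>S. F (p, 0) = 0"
        "\<forall>p\<in>S. \<forall>r\<in>S. p \<noteq> r \<longrightarrow> fst p * snd r \<noteq> snd p * fst r"
        using good_roots[OF good] by (elim exE conjE) (rule that)
      have f: "fst p \<noteq> 0" if pS: "p \<in> S" for p
      proof
        assume 0: "fst p = 0"
        have "S \<noteq> {p}" using S(2) n by auto
        then obtain r where "r \<in> S" "r \<noteq> p" using pS by blast
        then have "fst p * snd r \<noteq> snd p * fst r" using S(4) pS by metis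
        then have s: "snd p \<noteq> 0" using 0 by auto
        have "snd p *\<^sub>R ((0, 1), 0) = (p, 0)" using 0 by (simp add: prod_eq_iff)
        then have "F (p, 0) = snd p ^ n * F ((0, 1), 0)" using homogD[OF F(2) s, of "((0, 1), 0)"] by simp
        then show False using S(3) pS A01 s by simp
      qed
      have "(0, 1) \<notin> S" using f by force
      then show ?thesis
        using S f by (intro exI[of _ "insert (0, 1) S"]) (auto simp: G_def)
    qed
    let ?Z = "{p. hessp k' (p, (1, \<delta>)) = 0}"
    let ?N = "{p \<in> cball 0 R. hessp k' (p, (1, \<delta>)) = 0}" and ?O = "{p \<in> K. hessp k (p, (1, \<delta>)) = 0}"
    have sc: "hessp k (\<delta> *\<^sub>R p, (1, \<delta>)) = 0 \<longleftrightarrow> hessp k' (p, (1, \<delta>)) = 0" for p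
      using scale[of \<delta> p 1] \<delta>(1) by auto
    \<comment> \<open>A zero outside both regions is rescaled to a place without zeros: to the unit
      sphere with the new line and e near 0 if it is too far out, and to the circle of radius R with
      e = \<delta> / r if it lies between the regions.\<close>
    have Z: "p \<in> cball 0 R \<or> \<delta> *\<^sub>R p \<in> K" if p: "p \<in> ?Z" for p
    proof (rule ccontr)
      assume neg: "\<not> ?thesis"
      have kz: "hessp k (\<delta> *\<^sub>R p, (1, \<delta>)) = 0" using p sc by simp
      have np: "norm p > R" "norm (\<delta> *\<^sub>R p) < \<rho> \<or> norm (\<delta> *\<^sub>R p) > R2" using neg by (auto simp: K_def)
      show False
      proof (cases "norm (\<delta> *\<^sub>R p) > R2")
        case True
        define \<tau> where "\<tau> = 1 / norm (\<delta> *\<^sub>R p)"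
        have nz: "norm (\<delta> *\<^sub>R p) > 0" using True R2(3) by linarith
        have "\<tau> < 1 / R2" unfolding \<tau>_def using True R2(3) by (intro divide_strict_left_mono) auto
        also have "\<dots> < \<tau>2" using R2(2,3) \<tau>2(1) by (simp add: field_simps)
        finally have \<tau>: "\<tau> > 0" "\<tau> < \<tau>2" using nz by (auto simp: \<tau>_def)
        have "\<tau> * \<delta> \<le> \<tau>" "\<tau> * \<delta> \<ge> 0" using \<tau>(1) \<delta>'(3) \<delta>(1) by (auto intro: mult_left_le)
        then have "\<bar>\<tau> * \<delta>\<bar> < \<tau>2" using \<tau>(2) by linarith
        moreover have "norm ((1 / norm x) *\<^sub>R x) = 1" if "norm x > 0" for x :: "real \<times> real" using that by simp
        from this[OF nz] have "norm (\<tau> *\<^sub>R (\<delta> *\<^sub>R p)) = 1" unfolding \<tau>_def .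
        ultimately have "hessp k (\<tau> *\<^sub>R (\<delta> *\<^sub>R p), (\<tau>, \<tau> * \<delta>)) \<noteq> 0" using \<tau>2(2) \<tau> by simp
        then show False using infinity[of \<tau> "\<tau> *\<^sub>R (\<delta> *\<^sub>R p)" \<delta>] \<tau>(1) kz by simp
      next
        case False
        then have small: "norm (\<delta> *\<^sub>R p) < \<rho>" using np by simp
        define r where "r = norm (\<delta> *\<^sub>R p) / R"
        have "\<delta> * R < \<delta> * norm p" using np(1) \<delta>(1) by simp
        then have r: "r > \<delta>" using R(1) \<delta>(1) by (simp add: r_def field_simps)
        have "R * r1 > \<rho>" using \<rho>(1,3) by linarith
        moreover have "R * r = norm (\<delta> *\<^sub>R p)" using R(1) by (simp add: r_def)
        ultimately have "R * r < R * r1" using small by linarith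
        then have "r < r1" using R(1) by (rule mult_left_less_imp_less[OF _ less_imp_le])
        moreover have "p \<noteq> 0" using np(1) R(1) by auto
        then have "norm ((1 / r) *\<^sub>R (\<delta> *\<^sub>R p)) = R" using \<delta>(1) R(1) by (simp add: r_def)
        moreover have "0 \<le> \<delta> / r" "\<delta> / r \<le> 1" using r \<delta>(1) by (auto simp: field_simps)
        ultimately have "hessp k' ((1 / r) *\<^sub>R (\<delta> *\<^sub>R p), (\<delta> / r, r)) \<noteq> 0" using r1(2) r \<delta>(1) by simp
        then show False using scale[of r "(1 / r) *\<^sub>R (\<delta> *\<^sub>R p)" "\<delta> / r"] kz r \<delta>(1) by simp
      qed
    qed
    have Zeq: "?Z = ?N \<union> (\<lambda>p. (1 / \<delta>) *\<^sub>R p) ` ?O"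
    proof (intro subset_antisym subsetI)
      fix p assume p: "p \<in> ?Z"
      show "p \<in> ?N \<union> (\<lambda>p. (1 / \<delta>) *\<^sub>R p) ` ?O"
      proof (cases "p \<in> cball 0 R")
        case False
        then have "\<delta> *\<^sub>R p \<in> ?O" using Z[OF p] p sc by simp
        moreover have "p = (1 / \<delta>) *\<^sub>R (\<delta> *\<^sub>R p)" using \<delta>(1) by simp
        ultimately show ?thesis by blast
      qed (use p in simp)
    next
      fix p assume "p \<in> ?N \<union> (\<lambda>p. (1 / \<delta>) *\<^sub>R p) ` ?O"
      then show "p \<in> ?Z"
      proof
        assume "p \<in> (\<lambda>p. (1 / \<delta>) *\<^sub>R p) ` ?O"
        then obtain x where "x \<in> ?O" "p = (1 / \<delta>) *\<^sub>R x" by blast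
        then show ?thesis using sc[of p] \<delta>(1) by simp
      qed simp
    qed
    have dis: "?N \<inter> (\<lambda>p. (1 / \<delta>) *\<^sub>R p) ` ?O = {}"
    proof -
      have "norm ((1 / \<delta>) *\<^sub>R x) > R" if "x \<in> ?O" for x
      proof -
        have "R * \<delta> < norm x" using that \<delta>'(5) by (auto simp: K_def)
        then show ?thesis using \<delta>(1) by (simp add: field_simps)
      qed
      then show ?thesis by force
    qed
    have ovZ: "ovals (N + (n - 1)) ?Z"
      unfolding Zeq
    proof (rule ovals_Un[OF d2(2)[OF \<delta>'(2)] ovals_image[OF d1(2)[OF \<delta>'(1)]] dis])
      show "inj_on (\<lambda>p. (1 / \<delta>) *\<^sub>R p) ?O" using \<delta>(1) by (auto intro!: inj_onI)
    qed (intro continuous_intros)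
    have regZ: "dird (1, 0) (\<lambda>p. hessp k' (p, (1, \<delta>))) p \<noteq> 0 \<or> dird (0, 1) (\<lambda>p. hessp k' (p, (1, \<delta>))) p \<noteq> 0"
      if p: "p \<in> ?Z" for p
    proof (cases "p \<in> cball 0 R")
      case True
      then show ?thesis using d2(3)[OF \<delta>'(2) True] p by (simp add: dird_slice[OF rpf_hessp[OF rk(2)]])
    next
      case False
      then have pK: "\<delta> *\<^sub>R p \<in> K" using Z[OF p] by simp
      have rs: "rpf (\<lambda>p. hessp k (p, (1, \<delta>)))" "rpf (\<lambda>p. hessp k' (p, (1, \<delta>)))"
        by (rule rpf_slice[OF rpf_hessp[OF rk(1)]] rpf_slice[OF rpf_hessp[OF rk(2)]])+
      have eq: "(\<lambda>p. \<delta> ^ 4 * hessp k (\<delta> *\<^sub>R p, (1, \<delta>))) = (\<lambda>p. (\<delta> ^ n)\<^sup>2 * hessp k' (p, (1, \<delta>)))"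
        using scale[of \<delta> _ 1] \<delta>(1) by auto
      have d: "\<delta> ^ 4 * (\<delta> * dird v (\<lambda>p. hessp k (p, (1, \<delta>))) (\<delta> *\<^sub>R p)) = (\<delta> ^ n)\<^sup>2 * dird v (\<lambda>p. hessp k' (p, (1, \<delta>))) p" for v
      proof -
        have r: "rpf (\<lambda>p. hessp k (\<delta> *\<^sub>R p, (1, \<delta>)))"
          using rpf_comp[OF rs(1), of "\<lambda>p. \<delta> *\<^sub>R p"] by (simp add: rpf_intros)
        have "dird v (\<lambda>p. \<delta> ^ 4 * hessp k (\<delta> *\<^sub>R p, (1, \<delta>))) p = dird v (\<lambda>p. (\<delta> ^ n)\<^sup>2 * hessp k' (p, (1, \<delta>))) p"
          unfolding eq ..
        then show ?thesis
          unfolding dird_cmult[OF r] dird_cmult[OF rs(2)] dird_linear_comp[OF rs(1) bounded_linear_scaleR_right] dird_scale_dir[OF rs(1)] .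
      qed
      have "dird (1, 0) (\<lambda>p. hessp k (p, (1, \<delta>))) (\<delta> *\<^sub>R p) \<noteq> 0 \<or> dird (0, 1) (\<lambda>p. hessp k (p, (1, \<delta>))) (\<delta> *\<^sub>R p) \<noteq> 0"
        using d1(3)[OF \<delta>'(1) pK] p sc by (simp add: dird_slice[OF rpf_hessp[OF rk(1)]])
      then show ?thesis using d[of "(1, 0)"] d[of "(0, 1)"] \<delta>(1) by auto
    qed
    show ?thesis
      unfolding good_def G_def[symmetric] G1 using rG hG lead roots ovZ regZ by blast
  qed
  then show ?thesis using that \<delta>0 by blast
qed

text \<open>
  The blow-up over a root of the leading form of \<open>F\<close> has a limit only if that root comes from a
  linear factor of \<open>F\<close> itself.
\<close>

definition splits :: "((real \<times> real) \<times> real \<Rightarrow> real) \<Rightarrow> bool" where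
  "splits F \<longleftrightarrow> (\<forall>p. p \<noteq> 0 \<longrightarrow> F (p, 0) = 0 \<longrightarrow> (\<exists>\<alpha> \<beta> \<gamma> Q. rpf Q \<and>
     (\<forall>x y e. F ((x, y), e) = (\<alpha> * x + \<beta> * y + \<gamma> * e) * Q ((x, y), e)) \<and> \<alpha> * fst p + \<beta> * snd p = 0))"

lemma splits_shear:
  assumes "splits F" shows "splits (\<lambda>q. F (shear c (fst q), snd q))"
  unfolding splits_def
proof (intro allI impI)
  fix p :: "real \<times> real" assume p: "p \<noteq> 0" "F (shear c (fst (p, 0)), snd (p, 0)) = 0"
  have "shear c p \<noteq> 0" using p(1) by (auto simp: prod_eq_iff)
  then have "\<exists>\<alpha> \<beta> \<gamma> Q. rpf Q \<and> (\<forall>x y e. F ((x, y), e) = (\<alpha> * x + \<beta> * y + \<gamma> * e) * Q ((x, y), e)) \<and>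
     \<alpha> * fst (shear c p) + \<beta> * snd (shear c p) = 0"
    using assms p(2) unfolding splits_def by simp
  then obtain \<alpha> \<beta> \<gamma> Q where Q: "rpf Q" "\<And>x y e. F ((x, y), e) = (\<alpha> * x + \<beta> * y + \<gamma> * e) * Q ((x, y), e)"
    "\<alpha> * fst (shear c p) + \<beta> * snd (shear c p) = 0"
    by (elim exE conjE) (rule that; simp)
  have r: "rpf (\<lambda>q::(real \<times> real) \<times> real. Q (shear c (fst q), snd q))"
    by (rule rpf_comp[OF Q(1)]) (intro rpf_intros)
  show "\<exists>\<alpha> \<beta> \<gamma> Q. rpf Q \<and> (\<forall>x y e. F (shear c (fst ((x, y), e)), snd ((x, y), e)) = (\<alpha> * x + \<beta> * y + \<gamma> * e) * Q ((x, y), e)) \<and>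
     \<alpha> * fst p + \<beta> * snd p = 0"
    by (rule exI[of _ \<alpha>], rule exI[of _ "\<beta> + \<alpha> * c"], rule exI[of _ \<gamma>], rule exI[of _ "\<lambda>q. Q (shear c (fst q), snd q)"])
      (use r Q(2,3) in \<open>simp add: algebra_simps\<close>)
qed

lemma splits_times:
  assumes "splits F" "rpf F" shows "splits (\<lambda>q. (snd q + \<delta> * fst (fst q)) * F q)"
  unfolding splits_def
proof (intro allI impI)
  fix p :: "real \<times> real" assume p: "p \<noteq> 0" "(snd (p, 0) + \<delta> * fst (fst (p, 0))) * F (p, 0) = 0"
  show "\<exists>\<alpha> \<beta> \<gamma> Q. rpf Q \<and> (\<forall>x y e. (snd ((x, y), e) + \<delta> * fst (fst ((x, y), e))) * F ((x, y), e)
     = (\<alpha> * x + \<beta> * y + \<gamma> * e) * Q ((x, y), e)) \<and> \<alpha> * fst p + \<beta> * snd p = 0"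
  proof (cases "\<delta> * fst p = 0")
    case True
    show ?thesis
      by (rule exI[of _ \<delta>], rule exI[of _ 0], rule exI[of _ 1], rule exI[of _ F])
        (use True assms(2) in \<open>simp add: algebra_simps\<close>)
  next
    case False
    then have "F (p, 0) = 0" using p(2) by simp
    then have "\<exists>\<alpha> \<beta> \<gamma> Q. rpf Q \<and> (\<forall>x y e. F ((x, y), e) = (\<alpha> * x + \<beta> * y + \<gamma> * e) * Q ((x, y), e)) \<and>
       \<alpha> * fst p + \<beta> * snd p = 0"
      using assms(1) p(1) unfolding splits_def by simp
    then obtain \<alpha> \<beta> \<gamma> Q where Q: "rpf Q" "\<And>x y e. F ((x, y), e) = (\<alpha> * x + \<beta> * y + \<gamma> * e) * Q ((x, y), e)"
      "\<alpha> * fst p + \<beta> * snd p = 0"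
      by (elim exE conjE) (rule that; simp)
    have r: "rpf (\<lambda>q. (snd q + \<delta> * fst (fst q)) * Q q)"
      by (intro rpf_basic(2,3) Q(1); intro rpf_intros)+
    show ?thesis
      by (rule exI[of _ \<alpha>], rule exI[of _ \<beta>], rule exI[of _ \<gamma>], rule exI[of _ "\<lambda>q. (snd q + \<delta> * fst (fst q)) * Q q"])
        (use r Q(2,3) in simp)
  qed
qed

section \<open>Iteration of the step, starting from a triangle\<close>

lemma good_Suc:
  assumes "good n N F" "n \<ge> 3"
  obtains G where "good (n + 1) (N + (n - 1)) G" "splits F \<Longrightarrow> splits G"
proof -
  obtain c q where c: "hyperbolic_form (\<lambda>p. F (shear c p, 0)) n q" "F (shear c (0, 1), 0) \<noteq> 0"
    using normal_form[OF assms] by blast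
  let ?F = "\<lambda>q. F (shear c (fst q), snd q)"
  have F: "good n N ?F" by (rule good_shear[OF assms(1)])
  obtain \<delta>0 where \<delta>0: "\<delta>0 > 0" "\<And>\<delta>. 0 < \<delta> \<Longrightarrow> \<delta> < \<delta>0 \<Longrightarrow> good (n + 1) (N + (n - 1)) (\<lambda>q. (snd q + \<delta> * fst (fst q)) * ?F q)"
    by (rule line_step[OF F, of q]) (use c in simp_all)
  show ?thesis
  proof (rule that)
    show "good (n + 1) (N + (n - 1)) (\<lambda>q. (snd q + \<delta>0 / 2 * fst (fst q)) * ?F q)"
      by (rule \<delta>0(2)) (use \<delta>0(1) in auto)
    show "splits (\<lambda>q. (snd q + \<delta>0 / 2 * fst (fst q)) * ?F q)" if "splits F"
      by (rule splits_times[OF splits_shear[OF that] goodD(1)[OF F]])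
  qed
qed

text \<open>The number (n - 1)(n - 2) / 2 of ovals obtained from n lines, written as a sum so that
  its increment is the n - 1 of \<open>line_step\<close>.\<close>

definition tri :: "nat \<Rightarrow> nat" where "tri n = (\<Sum>i<n - 1. i)"

lemma tri_Suc: "n \<ge> 1 \<Longrightarrow> tri (Suc n) = tri n + (n - 1)"
  by (cases n) (auto simp: tri_def)

lemma tri_double: "n \<ge> 1 \<Longrightarrow> 2 * tri n = (n - 1) * (n - 2)"
proof (induction n rule: nat_induct_at_least)
  case (Suc n)
  then have "2 * tri (Suc n) = (n - 1) * (n - 2) + 2 * (n - 1)" by (simp add: tri_Suc)
  also have "\<dots> = n * (n - 1)" using Suc(1) by (cases n; cases "n - 1") (auto simp: algebra_simps)
  finally show ?case by (simp add: mult.commute)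
qed (simp add: tri_def)

lemma tri_mono: "m \<le> n \<Longrightarrow> tri m \<le> tri n"
  unfolding tri_def by (intro sum_mono2) auto

lemma good_iterate:
  assumes "good k N F" "k \<ge> 3" "n \<ge> k"
  shows "\<exists>G. good n (N + (tri n - tri k)) G \<and> (splits F \<longrightarrow> splits G)"
  using assms(3)
proof (induction n rule: nat_induct_at_least)
  case base then show ?case using assms(1) by auto
next
  case (Suc n)
  then obtain G where G: "good n (N + (tri n - tri k)) G" "splits F \<longrightarrow> splits G" by auto
  obtain G' where G': "good (n + 1) (N + (tri n - tri k) + (n - 1)) G'" "splits G \<Longrightarrow> splits G'"
    using good_Suc[OF G(1)] Suc.hyps assms(2) by (metis le_trans)
  have "tri (Suc n) - tri k = (tri n - tri k) + (n - 1)"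
    using tri_Suc[of n] tri_mono[OF Suc.hyps] assms(2) Suc.hyps by simp
  then show ?case using G' G(2) by (intro exI[of _ G']) (simp add: add.assoc)
qed

text \<open>An equilateral triangle with inscribed circle of radius e. The product of its sides is
  the harmonic cubic x^3 - 3 x y^2 plus a rotation-invariant quadratic, so its Hessian is
  rotation-invariant and vanishes exactly on the inscribed circle.\<close>

definition triangle :: "(real \<times> real) \<times> real \<Rightarrow> real" where
  "triangle q = (fst (fst q) - snd q) * ((fst (fst q) + 2 * snd q - sqrt 3 * snd (fst q)) *
     (fst (fst q) + 2 * snd q + sqrt 3 * snd (fst q)))"

lemma triangle_eq: "triangle ((x, y), e) = x ^ 3 - 3 * x * y\<^sup>2 + 3 * e * (x\<^sup>2 + y\<^sup>2) - 4 * e ^ 3"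
proof -
  have "(x + 2 * e - sqrt 3 * y) * (x + 2 * e + sqrt 3 * y) = (x + 2 * e)\<^sup>2 - 3 * y\<^sup>2"
    by (simp add: power2_eq_square algebra_simps)
  then show ?thesis by (simp add: triangle_def power2_eq_square power3_eq_cube algebra_simps)
qed

lemma hess2_triangle: "hess2 (\<lambda>p. triangle (p, e)) = (\<lambda>p. 36 * e\<^sup>2 - 36 * (norm p)\<^sup>2)"
proof
  fix p :: "real \<times> real"
  let ?u = "\<lambda>p::real \<times> real. fst p ^ 3 - 3 * fst p * (snd p)\<^sup>2 + 3 * e * ((fst p)\<^sup>2 + (snd p)\<^sup>2) - 4 * e ^ 3"
  have u: "(\<lambda>p. triangle (p, e)) = ?u"
  proof
    fix p show "triangle (p, e) = ?u p" using triangle_eq[of "fst p" "snd p" e] by simp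
  qed
  have d: "dird v ?u p = fst v * (3 * (fst p)\<^sup>2 - 3 * (snd p)\<^sup>2 + 6 * e * fst p) + snd v * (6 * e * snd p - 6 * fst p * snd p)" for v p
    by (rule dirdI) (auto intro!: derivative_eq_intros simp: fun_eq_iff algebra_simps power2_eq_square)
  have d1: "dird (1, 0) ?u = (\<lambda>p. 3 * (fst p)\<^sup>2 - 3 * (snd p)\<^sup>2 + 6 * e * fst p)"
    "dird (0, 1) ?u = (\<lambda>p. 6 * e * snd p - 6 * fst p * snd p)" by (simp_all add: fun_eq_iff d)
  have d2: "dird v (\<lambda>p. 3 * (fst p)\<^sup>2 - 3 * (snd p)\<^sup>2 + 6 * e * fst p) p = fst v * (6 * fst p + 6 * e) - snd v * (6 * snd p)" for v
    by (rule dirdI) (auto intro!: derivative_eq_intros simp: fun_eq_iff algebra_simps power2_eq_square)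
  have d3: "dird v (\<lambda>p. 6 * e * snd p - 6 * fst p * snd p) p = - fst v * 6 * snd p + snd v * (6 * e - 6 * fst p)" for v
    by (rule dirdI) (auto intro!: derivative_eq_intros simp: fun_eq_iff algebra_simps power2_eq_square)
  have "(norm p)\<^sup>2 = (fst p)\<^sup>2 + (snd p)\<^sup>2" by (cases p) (simp add: norm_prod_def)
  then show "hess2 (\<lambda>p. triangle (p, e)) p = 36 * e\<^sup>2 - 36 * (norm p)\<^sup>2"
    unfolding u hess2_def d1 d2 d3 by (simp add: power2_eq_square algebra_simps)
qed

lemma good_triangle: "good 3 1 triangle" "splits triangle"
proof -
  have r: "rpf triangle" unfolding triangle_def by (intro rpf_intros)
  have h: "homog 3 triangle"
    unfolding homog_def triangle_def by (simp add: algebra_simps power3_eq_cube)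
  have 3: "sqrt 3 * sqrt 3 = (3::real)" by simp
  have S: "\<exists>S. finite S \<and> card S = 3 \<and> (\<forall>p\<in>S. triangle (p, 0) = 0) \<and>
        (\<forall>p\<in>S. \<forall>r\<in>S. p \<noteq> r \<longrightarrow> fst p * snd r \<noteq> snd p * fst r)"
    by (rule exI[of _ "{(0, 1), (sqrt 3, 1), (- sqrt 3, 1)}"]) (auto simp: triangle_def)
  have ov: "ovals 1 {p. hess2 (\<lambda>p. triangle (p, 1)) p = 0}"
  proof -
    have "{p. hess2 (\<lambda>p. triangle (p, 1)) p = 0} = sphere 0 (1::real)"
    proof -
      have "36 * 1\<^sup>2 - 36 * (norm p)\<^sup>2 = 0 \<longleftrightarrow> norm p = 1" for p :: "real \<times> real"
        using abs_square_eq_1[of "norm p"] by auto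
      then show ?thesis unfolding hess2_triangle by auto
    qed
    moreover have "connected (sphere 0 1 :: (real \<times> real) set)" by (rule connected_sphere) simp
    moreover have "(1, 0) \<in> (sphere 0 1 :: (real \<times> real) set)" by simp
    ultimately show ?thesis using ovals_1[of "sphere 0 1 :: (real \<times> real) set"] by auto
  qed
  have reg: "dird (1, 0) (hess2 (\<lambda>p. triangle (p, 1))) p \<noteq> 0 \<or> dird (0, 1) (hess2 (\<lambda>p. triangle (p, 1))) p \<noteq> 0"
    if "hess2 (\<lambda>p. triangle (p, 1)) p = 0" for p
  proof -
    have e: "hess2 (\<lambda>p. triangle (p, 1)) = (\<lambda>p. 36 - 36 * ((fst p)\<^sup>2 + (snd p)\<^sup>2))"
      unfolding hess2_triangle by (auto simp: norm_prod_def fun_eq_iff)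
    have "dird v (\<lambda>p. 36 - 36 * ((fst p)\<^sup>2 + (snd p)\<^sup>2)) p = - 72 * (fst v * fst p + snd v * snd p)" for v :: "real \<times> real"
      by (rule dirdI) (auto intro!: derivative_eq_intros simp: fun_eq_iff algebra_simps power2_eq_square)
    then show ?thesis using that unfolding e by auto
  qed
  have neg: "hess2 (\<lambda>p. triangle (p, 0)) p < 0" if "p \<noteq> 0" for p
    unfolding hess2_triangle using that by simp
  show "good 3 1 triangle" unfolding good_def using r h S ov reg neg by blast
  show "splits triangle"
    unfolding splits_def
  proof (intro allI impI)
    fix p :: "real \<times> real" assume p: "p \<noteq> 0" "triangle (p, 0) = 0"
    define l where "l \<alpha> \<beta> \<gamma> q = \<alpha> * fst (fst q) + \<beta> * snd (fst q) + \<gamma> * snd q"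
      for \<alpha> \<beta> \<gamma> :: real and q :: "(real \<times> real) \<times> real"
    have rl: "rpf (l \<alpha> \<beta> \<gamma>)" for \<alpha> \<beta> \<gamma> unfolding l_def by (intro rpf_intros)
    have t: "triangle q = l 1 0 (-1) q * (l 1 (- sqrt 3) 2 q * l 1 (sqrt 3) 2 q)" for q
      unfolding triangle_def l_def by (simp add: algebra_simps)
    have W: "\<exists>\<alpha> \<beta> \<gamma> Q. rpf Q \<and> (\<forall>x y e. triangle ((x, y), e) = (\<alpha> * x + \<beta> * y + \<gamma> * e) * Q ((x, y), e)) \<and> \<alpha> * fst p + \<beta> * snd p = 0"
      if "l \<alpha> \<beta> \<gamma> (p, 0) = 0" "\<And>q. triangle q = l \<alpha> \<beta> \<gamma> q * Q q" "rpf Q" for \<alpha> \<beta> \<gamma> Q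
      using that by (intro exI[of _ \<alpha>] exI[of _ \<beta>] exI[of _ \<gamma>] exI[of _ Q]) (auto simp: l_def)
    from p(2) have "l 1 0 (-1) (p, 0) = 0 \<or> l 1 (- sqrt 3) 2 (p, 0) = 0 \<or> l 1 (sqrt 3) 2 (p, 0) = 0"
      unfolding t by simp
    then show "\<exists>\<alpha> \<beta> \<gamma> Q. rpf Q \<and> (\<forall>x y e. triangle ((x, y), e) = (\<alpha> * x + \<beta> * y + \<gamma> * e) * Q ((x, y), e)) \<and> \<alpha> * fst p + \<beta> * snd p = 0"
    proof (elim disjE)
      assume "l 1 0 (-1) (p, 0) = 0" then show ?thesis
        by (rule W[where Q = "\<lambda>q. l 1 (- sqrt 3) 2 q * l 1 (sqrt 3) 2 q"]) (simp_all add: t rpf_basic rl)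
    next
      assume "l 1 (- sqrt 3) 2 (p, 0) = 0" then show ?thesis
        by (rule W[where Q = "\<lambda>q. l 1 0 (-1) q * l 1 (sqrt 3) 2 q"]) (simp_all add: t rpf_basic rl)
    next
      assume "l 1 (sqrt 3) 2 (p, 0) = 0" then show ?thesis
        by (rule W[where Q = "\<lambda>q. l 1 0 (-1) q * l 1 (- sqrt 3) 2 q"]) (simp_all add: t rpf_basic rl)
    qed
  qed
qed

lemma good_lines: "n \<ge> 3 \<Longrightarrow> \<exists>F. good n (tri n) F \<and> splits F"
  using good_iterate[OF good_triangle(1), of n] good_triangle(2) tri_mono[of 3 n]
  by (auto simp: tri_def numeral_3_eq_3)

section \<open>Harmonic polynomials\<close>

definition zc :: "real \<times> real \<Rightarrow> complex" where "zc p = Complex (fst p) (snd p)"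

definition re_poly :: "complex poly \<Rightarrow> real \<times> real \<Rightarrow> real" where
  "re_poly f p = Re (poly f (zc p))"

lemma bounded_linear_zc: "bounded_linear zc"
  unfolding zc_def Complex_eq by (intro bounded_linear_intros bounded_linear_compose[OF bounded_linear_of_real] bounded_linear_const_mult)

lemma rpf_re_im_poly: "rpf (\<lambda>p. Re (poly f (zc p))) \<and> rpf (\<lambda>p. Im (poly f (zc p)))"
proof (induction f)
  case 0 then show ?case by (simp add: rpf_basic)
next
  case (pCons a f)
  have z: "rpf (\<lambda>p. Re (zc p))" "rpf (\<lambda>p. Im (zc p))" unfolding zc_def by (simp_all, (intro rpf_intros)+)
  show ?case using pCons.IH z by (auto intro!: rpf_basic real_polynomial_function_diff)
qed

lemma rpf_re_poly [rpf_intros]: "rpf (re_poly f)"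
  using rpf_re_im_poly[of f] by (simp add: re_poly_def[abs_def])

text \<open>The Cauchy-Riemann equations in one formula: the real derivative along v is the real
  part of f' multiplied by v as a complex number.\<close>

lemma dird_re_poly: "dird v (re_poly f) = re_poly (smult (zc v) (pderiv f))"
proof
  fix p
  have "((\<lambda>p. poly f (zc p)) has_derivative (\<lambda>v. poly (pderiv f) (zc p) * zc v)) (at p)"
    using has_derivative_compose[OF bounded_linear_imp_has_derivative[OF bounded_linear_zc]
      poly_DERIV[of f "zc p", unfolded has_field_derivative_def]] .
  then have "(re_poly f has_derivative (\<lambda>v. Re (poly (pderiv f) (zc p) * zc v))) (at p)"
    unfolding re_poly_def[abs_def] by (rule has_derivative_Re)
  then show "dird v (re_poly f) p = re_poly (smult (zc v) (pderiv f)) p"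
    using dirdI[of "re_poly f" _ p v] by (simp add: re_poly_def mult.commute)
qed

text \<open>The Hessian matrix of the real part of f is symmetric and traceless with determinant
  -|f''|^2. Adding c times the identity changes the determinant to c^2 - |f''|^2, so prescribing f''
  prescribes the Hessian curve.\<close>

lemma hess2_harmonic:
  "hess2 (\<lambda>p. re_poly f p + c / 2 * ((fst p)\<^sup>2 + (snd p)\<^sup>2)) p = c\<^sup>2 - (cmod (poly (pderiv (pderiv f)) (zc p)))\<^sup>2"
proof -
  let ?q = "\<lambda>p::real \<times> real. c / 2 * ((fst p)\<^sup>2 + (snd p)\<^sup>2)"
  have rq: "rpf ?q" by (intro rpf_intros)
  have q: "dird v ?q = (\<lambda>p. c * (fst v * fst p + snd v * snd p))" for v
    by (rule ext, rule dirdI) (auto intro!: derivative_eq_intros simp: fun_eq_iff algebra_simps)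
  have rq': "rpf (\<lambda>p::real \<times> real. c * (fst v * fst p + snd v * snd p))" for v by (intro rpf_intros)
  have qq: "dird u (\<lambda>p. c * (fst v * fst p + snd v * snd p)) = (\<lambda>p. c * (fst v * fst u + snd v * snd u))" for u v :: "real \<times> real"
    by (rule ext, rule dirdI) (auto intro!: derivative_eq_intros simp: fun_eq_iff algebra_simps)
  have d: "dird v (\<lambda>p. re_poly f p + ?q p) = (\<lambda>p. re_poly (smult (zc v) (pderiv f)) p + c * (fst v * fst p + snd v * snd p))" for v
    unfolding dird_add[OF rpf_re_poly rq] dird_re_poly q ..
  have dd: "dird u (dird v (\<lambda>p. re_poly f p + ?q p)) p
     = re_poly (smult (zc u * zc v) (pderiv (pderiv f))) p + c * (fst v * fst u + snd v * snd u)" for u v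
    unfolding d dird_add[OF rpf_re_poly rq'] dird_re_poly qq by (simp add: pderiv_smult)
  have z: "zc (1, 0) = 1" "zc (0, 1) = \<i>" by (simp_all add: zc_def complex_eq_iff)
  define w where "w = poly (pderiv (pderiv f)) (zc p)"
  have "(cmod w)\<^sup>2 = (Re w)\<^sup>2 + (Im w)\<^sup>2" by (rule cmod_power2)
  then show ?thesis
    unfolding hess2_def dd z w_def[symmetric] by (simp add: re_poly_def w_def[symmetric] power2_eq_square algebra_simps)
qed

lemma poly_antiderivative:
  fixes g :: "complex poly"
  obtains f where "pderiv f = g"
proof
  let ?f = "\<Sum>i\<le>degree g. monom (coeff g i / of_nat (Suc i)) (Suc i)"
  show "pderiv ?f = g"
  proof (rule poly_eqI)
    fix n
    have "coeff ?f (Suc n) = (\<Sum>i\<le>degree g. if i = n then coeff g i / of_nat (Suc i) else 0)"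
      by (simp add: coeff_sum del: of_nat_Suc)
    also have "\<dots> = (if n \<le> degree g then coeff g n / of_nat (Suc n) else 0)" by (simp add: sum.delta del: of_nat_Suc)
    finally show "coeff (pderiv ?f) n = coeff g n"
      by (simp add: coeff_pderiv coeff_eq_0 del: of_nat_Suc)
  qed
qed

text \<open>
  The roots are placed on the real axis, which makes \<open>cmod\<close> of the polynomial increase with the
  distance to that axis.
\<close>

definition root_poly :: "nat \<Rightarrow> nat \<Rightarrow> complex poly" where
  "root_poly a h = [:0, 1:] ^ a * (\<Prod>j<h. [:- of_nat j, 1:])"

text \<open>The squared modulus of \<open>root_poly\<close> at x + i y, with t in place of y^2. For
  h \<ge> 1 the distinct zeros are 0, ..., h - 1; the exponent a only raises the multiplicity of 0,
  in order to fill up the degree.\<close>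

definition root_mod :: "nat \<Rightarrow> nat \<Rightarrow> real \<Rightarrow> real \<Rightarrow> real" where
  "root_mod a h x t = (x\<^sup>2 + t) ^ a * (\<Prod>j<h. (x - real j)\<^sup>2 + t)"

lemma cmod_root_poly: "(cmod (poly (root_poly a h) (zc p)))\<^sup>2 = root_mod a h (fst p) ((snd p)\<^sup>2)"
proof -
  have *: "(cmod (zc p - of_nat j))\<^sup>2 = (fst p - j)\<^sup>2 + (snd p)\<^sup>2" for j :: nat
    by (simp add: cmod_power2 zc_def)
  have "poly (root_poly a h) (zc p) = zc p ^ a * (\<Prod>j<h. zc p - of_nat j)"
    by (simp add: root_poly_def poly_prod poly_power)
  then have "(cmod (poly (root_poly a h) (zc p)))\<^sup>2 = ((cmod (zc p))\<^sup>2) ^ a * (\<Prod>j<h. (cmod (zc p - of_nat j))\<^sup>2)"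
    by (simp add: norm_mult norm_power power_mult_distrib prod_power_distrib power_commutes mult.commute
        flip: power_mult prod_norm)
  then show ?thesis using *[of 0] by (simp add: * root_mod_def)
qed

lemma degree_root_poly: "degree (root_poly a h) = a + h" "lead_coeff (root_poly a h) = 1"
proof -
  have 1: "lead_coeff (root_poly a h) = 1"
    unfolding root_poly_def lead_coeff_mult lead_coeff_prod lead_coeff_power by simp
  show "lead_coeff (root_poly a h) = 1" by (rule 1)
  have "degree (\<Prod>j<h. [:- of_nat j, 1:] :: complex poly) = h"
    by (subst degree_prod_eq_sum_degree) auto
  moreover have "degree ([:0, 1:] ^ a :: complex poly) = a" by (simp add: degree_power_eq)
  ultimately show "degree (root_poly a h) = a + h"
    unfolding root_poly_def by (subst degree_mult_eq) (auto simp: prod_zero_iff)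
qed

text \<open>A derivative without zeros has constant sign by the intermediate value theorem, and the
  mean value theorem shows that the sign is positive; so every level between is taken exactly
  once.\<close>

lemma poly_increasing:
  fixes p :: "real poly"
  assumes e: "e > 0" and p0: "poly p 0 = 0" and pe: "poly p e > 0"
    and d: "\<And>u. 0 < u \<Longrightarrow> u < e \<Longrightarrow> poly (pderiv p) u \<noteq> 0" and c: "0 < c" "c < poly p e"
  obtains b where "0 < b" "b < e" "poly p b = c" "\<And>u. 0 \<le> u \<Longrightarrow> u \<le> e \<Longrightarrow> poly p u \<le> c \<longleftrightarrow> u \<le> b"
proof -
  obtain u0 where u0: "0 < u0" "u0 < e" "poly p e - poly p 0 = (e - 0) * poly (pderiv p) u0"
    using poly_MVT[OF e, of p] by auto
  then have d0: "poly (pderiv p) u0 > 0" using pe p0 e by (simp add: zero_less_mult_iff)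
  have dpos: "poly (pderiv p) u > 0" if u: "0 < u" "u < e" for u
  proof (rule ccontr)
    assume "\<not> ?thesis"
    then have neg: "poly (pderiv p) u < 0" using d[OF u] by simp
    then have "u \<noteq> u0" using d0 by auto
    then consider "u < u0" | "u0 < u" by linarith
    then show False
    proof cases
      case 1 then show ?thesis using poly_IVT_pos[OF 1 neg d0] d u u0 by (metis less_trans)
    next
      case 2 then show ?thesis using poly_IVT_neg[OF 2 d0 neg] d u u0 by (metis less_trans)
    qed
  qed
  have mono: "poly p u < poly p v" if uv: "0 \<le> u" "u < v" "v \<le> e" for u v
  proof -
    obtain w where "u < w" "w < v" "poly p v - poly p u = (v - u) * poly (pderiv p) w"
      using poly_MVT[OF uv(2), of p] by auto
    then show ?thesis using dpos[of w] uv mult_pos_pos[of "v - u" "poly (pderiv p) w"] by linarith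
  qed
  have "poly (p - [:c:]) 0 < 0" "poly (p - [:c:]) e > 0" using p0 c by auto
  from poly_IVT_pos[OF e this] obtain b where b: "0 < b" "b < e" "poly p b = c" by auto
  have "poly p u \<le> c \<longleftrightarrow> u \<le> b" if "0 \<le> u" "u \<le> e" for u
    using mono[of u b] mono[of b u] b that by (cases u b rule: linorder_cases) auto
  then show ?thesis using that b by blast
qed

definition root_sq :: "nat \<Rightarrow> nat \<Rightarrow> real poly" where
  "root_sq a h = ([:0, 1:]\<^sup>2) ^ a * (\<Prod>j<h. [:- real j, 1:]\<^sup>2)"

lemma poly_root_sq: "poly (root_sq a h) x = root_mod a h x 0"
  by (simp add: root_sq_def root_mod_def poly_prod)

lemma pderiv_root_sq: "h \<ge> 1 \<Longrightarrow> pderiv (root_sq a h) \<noteq> 0"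
proof -
  assume h: "h \<ge> 1"
  have "poly (root_sq a h) 0 = 0"
    using h by (auto simp: poly_root_sq root_mod_def intro!: prod_zero bexI[of _ 0])
  moreover have "poly (root_sq a h) (real h) \<noteq> 0"
    using h by (auto simp: poly_root_sq root_mod_def)
  ultimately have "degree (root_sq a h) \<noteq> 0"
    by (metis degree_eq_zeroE mult_zero_right poly_pCons poly_0 add.right_neutral)
  then show ?thesis by (simp add: pderiv_eq_0_iff)
qed

text \<open>Within a small distance of a root the squared modulus on the real axis has no other
  critical point, so it increases on both sides of the root; outside these neighbourhoods it is at
  least \<open>c0\<close>. Every lower level therefore cuts out one interval about each root, and no
  critical point lies on it.\<close>

lemma root_intervals:
  assumes h: "h \<ge> 1"
  obtains c0 where "c0 > 0" "c0 \<le> 1" "\<And>c. 0 < c \<Longrightarrow> c < c0 \<Longrightarrow>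
     (\<exists>I. interval_family h (\<lambda>x. root_mod a h x 0 - c) I) \<and>
     (\<forall>x. root_mod a h x 0 = c \<longrightarrow> poly (pderiv (root_sq a h)) x \<noteq> 0)"
proof -
  let ?P = "root_sq a h" and ?Z = "{..<h}"
  define W where "W = {x. poly (pderiv ?P) x = 0}"
  have finW: "finite W" unfolding W_def by (rule poly_roots_finite[OF pderiv_root_sq[OF h]])
  \<comment> \<open>The entry 1/3 keeps the neighbourhoods of different integers disjoint; the other
    entries are half the distances from the roots to the remaining critical points.\<close>
  define D where "D = insert (1 / 3) ((\<lambda>(z, w). \<bar>w - real z\<bar> / 2) ` {(z, w). z \<in> ?Z \<and> w \<in> W \<and> w \<noteq> real z})"
  have "finite {(z, w). z \<in> ?Z \<and> w \<in> W \<and> w \<noteq> real z}"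
    by (rule finite_subset[of _ "?Z \<times> W"]) (use finW in auto)
  then have finD: "finite D" "D \<noteq> {}" by (auto simp: D_def)
  define \<epsilon> where "\<epsilon> = Min D"
  have "\<forall>x\<in>D. x > 0" by (auto simp: D_def)
  then have \<epsilon>: "\<epsilon> > 0" using finD by (simp add: \<epsilon>_def)
  have \<epsilon>3: "\<epsilon> \<le> 1 / 3" unfolding \<epsilon>_def by (rule Min_le[OF finD(1)]) (simp add: D_def)
  have \<epsilon>W: "w \<notin> W" if "z < h" "w \<noteq> real z" "\<bar>w - real z\<bar> \<le> \<epsilon>" for z w
  proof
    assume "w \<in> W"
    then have "\<bar>w - real z\<bar> / 2 \<in> D" unfolding D_def
      by (intro insertI2 image_eqI[of _ _ "(z, w)"]) (use that in auto)
    then have "\<epsilon> \<le> \<bar>w - real z\<bar> / 2" unfolding \<epsilon>_def using finD(1) by (rule Min_le[rotated])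
    then show False using that by simp
  qed
  \<comment> \<open>The lower bound for the product when each factor is at least \<epsilon>^2, that
    is, at distance at least \<epsilon> from all roots.\<close>
  define c0 where "c0 = (\<epsilon>\<^sup>2) ^ a * (\<epsilon>\<^sup>2) ^ h"
  have \<epsilon>1: "\<epsilon>\<^sup>2 \<le> 1" using \<epsilon> \<epsilon>3 by (simp add: power_le_one)
  have c0: "c0 > 0" "c0 \<le> 1" using \<epsilon> \<epsilon>1 by (auto simp: c0_def intro!: mult_le_one power_le_one)
  have far: "c0 \<le> root_mod a h x 0" if far': "\<And>z. z < h \<Longrightarrow> \<bar>x - real z\<bar> \<ge> \<epsilon>" for x
  proof -
    have sq: "\<epsilon>\<^sup>2 \<le> (x - real z)\<^sup>2" if z: "z < h" for z
    proof -
      have "\<epsilon> ^ 2 \<le> \<bar>x - real z\<bar> ^ 2" by (rule power_mono[OF far']) (use z \<epsilon> in auto)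
      then show ?thesis by simp
    qed
    have sq0: "\<epsilon>\<^sup>2 \<le> x\<^sup>2" using sq[of 0] h by simp
    have "(\<epsilon>\<^sup>2) ^ a \<le> (x\<^sup>2) ^ a" by (rule power_mono[OF sq0]) simp
    moreover have "(\<Prod>j<h. \<epsilon>\<^sup>2) \<le> (\<Prod>j<h. (x - real j)\<^sup>2)" using sq by (intro prod_mono) auto
    ultimately have "(\<epsilon>\<^sup>2) ^ a * (\<Prod>j<h. \<epsilon>\<^sup>2) \<le> (x\<^sup>2) ^ a * (\<Prod>j<h. (x - real j)\<^sup>2)"
      by (rule mult_mono) (auto intro: prod_nonneg)
    then show ?thesis unfolding c0_def root_mod_def by simp
  qed
  have zero: "root_mod a h (real z) 0 = 0" if "z < h" for z
    using that by (auto simp: root_mod_def intro!: prod_zero)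
  have main: "(\<exists>I. interval_family h (\<lambda>x. root_mod a h x 0 - c) I) \<and>
     (\<forall>x. root_mod a h x 0 = c \<longrightarrow> poly (pderiv ?P) x \<noteq> 0)" if c: "0 < c" "c < c0" for c
  proof -
    have side: "\<exists>b. 0 < b \<and> b < \<epsilon> \<and> root_mod a h (real z + s * b) 0 = c \<and>
        (\<forall>u. 0 \<le> u \<longrightarrow> u \<le> \<epsilon> \<longrightarrow> (root_mod a h (real z + s * u) 0 \<le> c \<longleftrightarrow> u \<le> b))"
      if z: "z < h" and s: "s = 1 \<or> s = -1" for z s
    proof -
      let ?p = "pcompose ?P [:real z, s:]"
      have pp: "poly ?p u = root_mod a h (real z + s * u) 0" for u
        by (simp add: poly_pcompose poly_root_sq mult.commute)
      have e: "c0 \<le> poly ?p \<epsilon>" unfolding pp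
      proof (rule far)
        fix j assume "j < h"
        show "\<epsilon> \<le> \<bar>real z + s * \<epsilon> - real j\<bar>"
        proof (cases "j = z")
          case True then show ?thesis using s \<epsilon> by auto
        next
          case False
          then have "\<bar>real z - real j\<bar> \<ge> 1" by (cases "z < j") auto
          then show ?thesis using s \<epsilon> \<epsilon>3 by auto
        qed
      qed
      have d: "poly (pderiv ?p) u \<noteq> 0" if "0 < u" "u < \<epsilon>" for u
      proof -
        have "real z + s * u \<notin> W" by (rule \<epsilon>W[OF z]) (use that s in auto)
        then show ?thesis using s by (auto simp: pderiv_pcompose poly_pcompose pderiv_pCons W_def mult.commute)
      qed
      have 0: "poly ?p 0 = 0" using pp[of 0] zero[OF z] by simp
      have pe: "poly ?p \<epsilon> > 0" "c < poly ?p \<epsilon>" using e c0 c by auto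
      obtain b where "0 < b" "b < \<epsilon>" "poly ?p b = c" "\<And>u. 0 \<le> u \<Longrightarrow> u \<le> \<epsilon> \<Longrightarrow> poly ?p u \<le> c \<longleftrightarrow> u \<le> b"
        using poly_increasing[OF \<epsilon> 0 pe(1) d c(1) pe(2)] by metis
      then show ?thesis unfolding pp by (intro exI[of _ b]) simp
    qed
    have "\<forall>z. \<exists>b. z < h \<longrightarrow> 0 < b \<and> b < \<epsilon> \<and> root_mod a h (real z + s * b) 0 = c \<and>
        (\<forall>u. 0 \<le> u \<longrightarrow> u \<le> \<epsilon> \<longrightarrow> (root_mod a h (real z + s * u) 0 \<le> c \<longleftrightarrow> u \<le> b))" if "s = 1 \<or> s = -1" for s
      using side that by blast
    from this[of 1] this[of "-1"] obtain B A where
      B: "\<And>z. z < h \<Longrightarrow> 0 < B z \<and> B z < \<epsilon> \<and> root_mod a h (real z + B z) 0 = c \<and>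
        (\<forall>u. 0 \<le> u \<longrightarrow> u \<le> \<epsilon> \<longrightarrow> (root_mod a h (real z + u) 0 \<le> c \<longleftrightarrow> u \<le> B z))" and
      A: "\<And>z. z < h \<Longrightarrow> 0 < A z \<and> A z < \<epsilon> \<and> root_mod a h (real z - A z) 0 = c \<and>
        (\<forall>u. 0 \<le> u \<longrightarrow> u \<le> \<epsilon> \<longrightarrow> (root_mod a h (real z - u) 0 \<le> c \<longleftrightarrow> u \<le> A z))"
      unfolding choice_iff by auto
    define J where "J z = (real z - A z, real z + B z)" for z
    have iff: "root_mod a h x 0 \<le> c \<longleftrightarrow> (\<exists>z<h. real z - A z \<le> x \<and> x \<le> real z + B z)" for x
    proof
      assume le: "root_mod a h x 0 \<le> c"
      then obtain z where z: "z < h" "\<bar>x - real z\<bar> < \<epsilon>" using far[of x] c by force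
      show "\<exists>z<h. real z - A z \<le> x \<and> x \<le> real z + B z"
      proof (cases "x \<ge> real z")
        case True
        then have "x - real z \<le> B z" using B[OF z(1)] z(2) le by (auto dest!: spec[of _ "x - real z"])
        then show ?thesis using z(1) True A[OF z(1)] by (intro exI[of _ z]) auto
      next
        case False
        then have "real z - x \<le> A z" using A[OF z(1)] z(2) le by (auto dest!: spec[of _ "real z - x"])
        then show ?thesis using z(1) False B[OF z(1)] by (intro exI[of _ z]) auto
      qed
    next
      assume "\<exists>z<h. real z - A z \<le> x \<and> x \<le> real z + B z"
      then obtain z where z: "z < h" "real z - A z \<le> x" "x \<le> real z + B z" by auto
      show "root_mod a h x 0 \<le> c"
      proof (cases "x \<ge> real z")
        case True
        then show ?thesis using B[OF z(1)] z by (auto dest!: spec[of _ "x - real z"])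
      next
        case False
        then show ?thesis using A[OF z(1)] z by (auto dest!: spec[of _ "real z - x"])
      qed
    qed
    have near: "\<bar>x - real z\<bar> < \<epsilon>" if "z < h" "real z - A z \<le> x" "x \<le> real z + B z" for x z
      using A[OF that(1)] B[OF that(1)] that by auto
    have inj: "inj_on J ?Z"
    proof (rule inj_onI)
      fix y z assume yz: "y \<in> ?Z" "z \<in> ?Z" "J y = J z"
      have "\<bar>fst (J y) - real y\<bar> < \<epsilon>" "\<bar>fst (J z) - real z\<bar> < \<epsilon>"
        using A[of y] A[of z] yz(1,2) by (auto simp: J_def)
      then have "\<bar>real y - real z\<bar> < 1" using yz(3) \<epsilon>3 by auto
      then show "y = z" by linarith
    qed
    have "interval_family h (\<lambda>x. root_mod a h x 0 - c) (J ` ?Z)"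
      unfolding interval_family_def
    proof (intro conjI)
      show "card (J ` ?Z) = h" using card_image[OF inj] by simp
      show "\<forall>(a', b')\<in>J ` ?Z. a' < b' \<and> root_mod a h a' 0 - c = 0 \<and> root_mod a h b' 0 - c = 0"
        using A B by (force simp: J_def)
      show "{s. root_mod a h s 0 - c \<le> 0} = (\<Union>(a, b)\<in>J ` ?Z. {a..b})"
        using iff by (auto simp: J_def)
      show "\<forall>i\<in>J ` ?Z. \<forall>j\<in>J ` ?Z. i \<noteq> j \<longrightarrow> {fst i..snd i} \<inter> {fst j..snd j} = {}"
      proof (intro ballI impI, rule ccontr)
        fix i j assume ij: "i \<in> J ` ?Z" "j \<in> J ` ?Z" "i \<noteq> j" "{fst i..snd i} \<inter> {fst j..snd j} \<noteq> {}"
        then obtain y z x where yz: "y < h" "z < h" "i = J y" "j = J z" "x \<in> {fst i..snd i}" "x \<in> {fst j..snd j}" by blast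
        then have "\<bar>x - real y\<bar> < \<epsilon>" "\<bar>x - real z\<bar> < \<epsilon>" using near[of y x] near[of z x] by (auto simp: J_def)
        then have "\<bar>real y - real z\<bar> < 1" using \<epsilon>3 by auto
        then have "y = z" by linarith
        then show False using yz ij(3) by simp
      qed
    qed simp
    moreover have "poly (pderiv ?P) x \<noteq> 0" if "root_mod a h x 0 = c" for x
    proof -
      obtain z where z: "z < h" "real z - A z \<le> x" "x \<le> real z + B z" using iff[of x] \<open>root_mod a h x 0 = c\<close> by auto
      have "x \<noteq> real z" using zero[OF z(1)] \<open>root_mod a h x 0 = c\<close> c by auto
      then have "x \<notin> W" using \<epsilon>W[OF z(1)] near[OF z] by simp
      then show ?thesis by (simp add: W_def)
    qed
    ultimately show ?thesis by blast
  qed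
  show ?thesis by (rule that[OF c0 main])
qed

lemma root_mod_strict_mono:
  assumes h: "h \<ge> 1" and t: "0 \<le> t" "t < u" shows "root_mod a h x t < root_mod a h x u"
proof -
  have 1: "(x\<^sup>2 + t) ^ a \<le> (x\<^sup>2 + u) ^ a" using t by (intro power_mono) auto
  have 2: "(x\<^sup>2 + u) ^ a > 0" using t by (intro zero_less_power) (simp add: add_nonneg_pos)
  have 3: "(\<Prod>j<h. (x - real j)\<^sup>2 + t) < (\<Prod>j<h. (x - real j)\<^sup>2 + u)"
    using h t by (intro prod_mono_strict[of 0]) (auto intro: add_nonneg_pos)
  have 4: "(\<Prod>j<h. (x - real j)\<^sup>2 + t) \<ge> 0" using t by (intro prod_nonneg) auto
  show ?thesis unfolding root_mod_def
    by (rule order_le_less_trans[OF mult_right_mono[OF 1 4] mult_strict_left_mono[OF 3 2]])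
qed

lemma root_mod_one: "root_mod a h x 1 \<ge> 1"
proof -
  have "1 \<le> (x\<^sup>2 + 1) ^ a" "1 \<le> (\<Prod>j<h. (x - real j)\<^sup>2 + 1)" by (intro one_le_power prod_ge_1; simp)+
  then show ?thesis unfolding root_mod_def using mult_mono[of 1 _ 1] by fastforce
qed

text \<open>The squared modulus increases strictly with y^2, so the level set is y^2 = R(x) over the
  intervals of \<open>I\<close>, again a double cover. As C \<le> 1, the solution lies in [0, 1];
  this compact range makes \<open>R\<close> continuous by the closed graph criterion.\<close>

lemma ovals_root_mod:
  assumes h: "h \<ge> 1" and C: "0 < C" "C \<le> 1" and I: "interval_family h (\<lambda>x. root_mod a h x 0 - C) I"
  shows "ovals h {p. root_mod a h (fst p) ((snd p)\<^sup>2) = C}"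
proof -
  define X where "X = {x. root_mod a h x 0 - C \<le> 0}"
  have cont: "continuous_on S (\<lambda>p::real \<times> real. root_mod a h (fst p) (snd p))" for S
    unfolding root_mod_def by (intro continuous_intros)
  note mono = root_mod_strict_mono[OF h]
  have "\<exists>t. 0 \<le> t \<and> t \<le> 1 \<and> root_mod a h x t = C" if "x \<in> X" for x
  proof -
    have "continuous_on {0..1} (\<lambda>t. root_mod a h x t)" unfolding root_mod_def by (intro continuous_intros)
    then show ?thesis using IVT'[of "root_mod a h x" 0 C 1] that root_mod_one[of a h x] C by (auto simp: X_def)
  qed
  then obtain R where R: "\<And>x. x \<in> X \<Longrightarrow> 0 \<le> R x \<and> R x \<le> 1 \<and> root_mod a h x (R x) = C" by metis
  have uniq: "t = R x" if "x \<in> X" "t \<ge> 0" "root_mod a h x t = C" for x t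
    using mono[of t "R x" a x] mono[of "R x" t a x] R[OF that(1)] that by (cases t "R x" rule: linorder_cases) auto
  have graph: "(\<lambda>x. (x, R x)) ` X = {p. root_mod a h (fst p) 0 \<le> C \<and> 0 \<le> snd p \<and> snd p \<le> 1 \<and> root_mod a h (fst p) (snd p) = C}"
    using R uniq by (auto simp: X_def image_iff)
  have c0: "continuous_on UNIV (\<lambda>p::real \<times> real. root_mod a h (fst p) 0)"
    unfolding root_mod_def by (intro continuous_intros)
  have "closed ((\<lambda>x. (x, R x)) ` X)" unfolding graph
    by (intro closed_Collect_conj closed_Collect_le closed_Collect_eq cont c0 continuous_intros)
  then have "continuous_on X R"
    by (intro continuous_from_closed_graph[of "{0..1}"]) (use R in \<open>auto intro: closed_subset\<close>)
  moreover have "R s = 0" if "root_mod a h s 0 - C = 0" for s using uniq[of s 0] that by (auto simp: X_def)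
  ultimately have "ovals h {(s, v). root_mod a h s 0 - C \<le> 0 \<and> v\<^sup>2 = R s}"
    using R by (intro ovals_double_cover[OF I]) (auto simp: X_def)
  moreover have "{(s, v). root_mod a h s 0 - C \<le> 0 \<and> v\<^sup>2 = R s} = {p. root_mod a h (fst p) ((snd p)\<^sup>2) = C}"
  proof (intro subset_antisym subsetI)
    fix p assume "p \<in> {p. root_mod a h (fst p) ((snd p)\<^sup>2) = C}"
    then have e: "root_mod a h (fst p) ((snd p)\<^sup>2) = C" by simp
    have "root_mod a h (fst p) 0 \<le> C"
      using mono[of 0 "(snd p)\<^sup>2" a "fst p"] e by (cases "snd p = 0") auto
    then show "p \<in> {(s, v). root_mod a h s 0 - C \<le> 0 \<and> v\<^sup>2 = R s}"
      using uniq[of "fst p" "(snd p)\<^sup>2"] e by (auto simp: X_def)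
  next
    fix p assume "p \<in> {(s, v). root_mod a h s 0 - C \<le> 0 \<and> v\<^sup>2 = R s}"
    then show "p \<in> {p. root_mod a h (fst p) ((snd p)\<^sup>2) = C}" using R by (auto simp: X_def)
  qed
  ultimately show ?thesis by simp
qed

text \<open>On the real axis the x derivative is, up to sign, that of \<open>root_sq\<close>; off
  the axis the y derivative is 2 y times a positive sum, up to sign.\<close>

lemma root_mod_regular:
  fixes C :: real
  assumes h: "h \<ge> 1" and p: "poly (pderiv (root_sq a h)) x \<noteq> 0 \<or> y \<noteq> 0"
  defines "H \<equiv> \<lambda>p. C - root_mod a h (fst p) ((snd p)\<^sup>2)"
  shows "dird (1, 0) H (x, y) \<noteq> 0 \<or> dird (0, 1) H (x, y) \<noteq> 0"
proof (cases "y = 0")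
  case True
  have H: "rpf H" unfolding H_def root_mod_def by (intro rpf_intros) auto
  have "(\<lambda>x. H (x, 0)) = (\<lambda>x. C - poly (root_sq a h) x)" by (simp add: H_def poly_root_sq)
  then have "dird (1, 0) H (x, 0) = dird 1 (\<lambda>x. C - poly (root_sq a h) x) x" using dird_slice[OF H, of 1 0] by metis
  also have "\<dots> = - (poly (pderiv (root_sq a h)) x * 1)"
    by (rule dirdI[where f' = "\<lambda>v. - (poly (pderiv (root_sq a h)) x * v)"])
      (auto intro!: derivative_eq_intros poly_DERIV[THEN has_field_derivative_imp_has_derivative])
  finally show ?thesis using p True by simp
next
  case False
  let ?g = "\<lambda>j::nat. (x - real j)\<^sup>2 + y\<^sup>2"
  let ?S = "\<Sum>i<h. \<Prod>j\<in>{..<h} - {i}. ?g j"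
  have "dird (0, 1) H (x, y) = - (2 * y * ((x\<^sup>2 + y\<^sup>2) ^ a * ?S + a * (x\<^sup>2 + y\<^sup>2) ^ (a - 1) * (\<Prod>j<h. ?g j)))"
  proof -
    have "dird (0, 1) H (x, y) = (\<lambda>v. - ((x\<^sup>2 + y\<^sup>2) ^ a * (\<Sum>i<h. (2 * (x - real i) * fst v + 2 * y * snd v) * (\<Prod>j\<in>{..<h} - {i}. ?g j))
        + a * (x\<^sup>2 + y\<^sup>2) ^ (a - 1) * (2 * x * fst v + 2 * y * snd v) * (\<Prod>j<h. ?g j))) (0, 1)"
      unfolding H_def root_mod_def
      by (rule dirdI) (auto intro!: derivative_eq_intros simp: sum_distrib_left algebra_simps)
    then show ?thesis by (simp add: algebra_simps sum_distrib_left)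
  qed
  moreover have "?S > 0" using h False
    by (intro sum_pos prod_pos) (auto simp: add_nonneg_pos lessThan_empty_iff)
  moreover have "(x\<^sup>2 + y\<^sup>2) ^ a > 0" "(\<Prod>j<h. ?g j) \<ge> 0" using False
    by (auto simp: add_nonneg_pos intro!: prod_nonneg)
  ultimately show ?thesis using False
    by (simp add: add_pos_nonneg less_imp_neq[symmetric] zero_le_mult_iff)
qed

text \<open>The homogenisation in degree k of \<open>re_poly f\<close> plus c / 2 times x^2 +
  y^2.\<close>

definition harmonic_form :: "complex poly \<Rightarrow> nat \<Rightarrow> real \<Rightarrow> (real \<times> real) \<times> real \<Rightarrow> real" where
  "harmonic_form f k c v = (\<Sum>j\<le>k. re_poly (monom (coeff f j) j) (fst v) * snd v ^ (k - j)) +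
     c / 2 * ((fst (fst v))\<^sup>2 + (snd (fst v))\<^sup>2) * snd v ^ (k - 2)"

lemma zc_scale: "zc (t *\<^sub>R p) = of_real t * zc p"
  by (simp add: zc_def complex_eq_iff)

lemma Re_of_real_mult: "Re (of_real c * z) = c * Re z" by simp

lemma re_poly_monom_scale: "re_poly (monom b j) (t *\<^sub>R p) = t ^ j * re_poly (monom b j) p"
proof -
  have "poly (monom b j) (zc (t *\<^sub>R p)) = of_real (t ^ j) * poly (monom b j) (zc p)"
    unfolding zc_scale by (simp add: poly_monom power_mult_distrib)
  then show ?thesis unfolding re_poly_def by (simp only: Re_of_real_mult)
qed

lemma re_poly_sum: "re_poly (\<Sum>j\<in>A. f j) p = (\<Sum>j\<in>A. re_poly (f j) p)"
  by (simp add: re_poly_def poly_sum)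

text \<open>Integrating \<open>root_poly a h\<close> twice with a = k - 2 - h gives f of degree k,
  and the quadratic term has coefficient \<open>sqrt C / 2\<close>, so that the Hessian curve is the
  level C of |f''|^2, with h ovals. The leading form is a multiple of the real part of z^k.\<close>

lemma good_harmonic:
  assumes k: "k \<ge> 3" and h: "1 \<le> h" "h \<le> k - 2"
  obtains F where "good k h F"
proof -
  define a where "a = k - 2 - h"
  obtain f1 where f1: "pderiv f1 = root_poly a h" by (rule poly_antiderivative)
  obtain f where f: "pderiv f = f1" by (rule poly_antiderivative)
  have ah: "a + h = k - 2" using h by (simp add: a_def)
  have deg1: "degree f1 = k - 1" using degree_pderiv[of f1] degree_root_poly(1)[of a h] f1 ah k by simp
  have deg: "degree f = k" using degree_pderiv[of f] f deg1 k by simp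
  have "coeff (pderiv (pderiv f)) (k - 2) = 1" using degree_root_poly[of a h] f f1 ah by simp
  then have cf: "coeff f k = 1 / (of_nat k * of_nat (k - 1))"
    using k by (simp add: coeff_pderiv Suc_diff_Suc numeral_2_eq_2 field_simps)
  obtain c0 where c0: "c0 > 0" "c0 \<le> 1" "\<And>c. 0 < c \<Longrightarrow> c < c0 \<Longrightarrow>
     (\<exists>I. interval_family h (\<lambda>x. root_mod a h x 0 - c) I) \<and>
     (\<forall>x. root_mod a h x 0 = c \<longrightarrow> poly (pderiv (root_sq a h)) x \<noteq> 0)" using root_intervals[OF h(1)] by metis
  define C where "C = c0 / 2"
  have C: "0 < C" "C < c0" "C \<le> 1" using c0 by (auto simp: C_def)
  obtain I where I: "interval_family h (\<lambda>x. root_mod a h x 0 - C) I" using c0(3)[OF C(1,2)] by blast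
  define G where "G = harmonic_form f k (sqrt C)"
  have rG: "rpf G" unfolding G_def harmonic_form_def by (intro rpf_intros rpf_comp[OF rpf_re_poly]) auto
  have hG: "homog k G" unfolding homog_def
  proof (intro allI impI)
    fix t :: real and v :: "(real \<times> real) \<times> real"
    have "t ^ k = t ^ j * t ^ (k - j)" if "j \<le> k" for j using that by (simp flip: power_add)
    then have 1: "(\<Sum>j\<le>k. t ^ j * re_poly (monom (coeff f j) j) (fst v) * (t * snd v) ^ (k - j))
      = t ^ k * (\<Sum>j\<le>k. re_poly (monom (coeff f j) j) (fst v) * snd v ^ (k - j))"
      by (simp add: sum_distrib_left power_mult_distrib ac_simps)
    have "2 + (k - 2) = k" using k by simp
    then have "t ^ k = t\<^sup>2 * t ^ (k - 2)" by (metis power_add)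
    then have 2: "((t * fst (fst v))\<^sup>2 + (t * snd (fst v))\<^sup>2) * (t * snd v) ^ (k - 2)
      = t ^ k * (((fst (fst v))\<^sup>2 + (snd (fst v))\<^sup>2) * snd v ^ (k - 2))"
      by (simp add: power_mult_distrib algebra_simps)
    show "G (t *\<^sub>R v) = t ^ k * G v"
      unfolding G_def harmonic_form_def fst_scaleR snd_scaleR re_poly_monom_scale real_scaleR_def 1
      using arg_cong[OF 2, of "\<lambda>r. sqrt C / 2 * r"] by (simp add: algebra_simps)
  qed
  have G1: "(\<lambda>p. G (p, 1)) = (\<lambda>p. re_poly f p + sqrt C / 2 * ((fst p)\<^sup>2 + (snd p)\<^sup>2))"
    using poly_as_sum_of_monoms[of f] by (simp add: G_def harmonic_form_def deg flip: re_poly_sum)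
  have G0: "(\<lambda>p. G (p, 0)) = re_poly (monom (coeff f k) k)"
  proof
    fix p
    have "(\<Sum>j\<le>k. re_poly (monom (coeff f j) j) p * 0 ^ (k - j)) = (\<Sum>j\<le>k. if j = k then re_poly (monom (coeff f j) j) p else 0)"
      by (rule sum.cong) auto
    then show "G (p, 0) = re_poly (monom (coeff f k) k) p" using k by (simp add: G_def harmonic_form_def)
  qed
  have H1: "hess2 (\<lambda>p. G (p, 1)) = (\<lambda>p. C - root_mod a h (fst p) ((snd p)\<^sup>2))"
    unfolding G1 hess2_harmonic fun_eq_iff using C f f1 by (simp add: cmod_root_poly)
  have neg: "hess2 (\<lambda>p. G (p, 0)) p < 0" if "p \<noteq> 0" for p
  proof -
    have "zc p \<noteq> 0" using that by (auto simp: zc_def complex_eq_iff prod_eq_iff)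
    moreover have "pderiv (pderiv (monom (coeff f k) k)) = monom 1 (k - 2)"
      using k cf by (simp add: pderiv_monom numeral_2_eq_2)
    ultimately have "poly (pderiv (pderiv (monom (coeff f k) k))) (zc p) \<noteq> 0" by (simp add: poly_monom)
    then show ?thesis unfolding G0 using hess2_harmonic[of "monom (coeff f k) k" 0 p] by simp
  qed
  \<comment> \<open>The angles with cos (k \<theta>) = 0, one for each root line of the real part of
    z^k.\<close>
  define \<theta> where "\<theta> j = (2 * real j + 1) * pi / (2 * real k)" for j
  define u where "u j = (cos (\<theta> j), sin (\<theta> j))" for j
  have diff: "fst (u i) * snd (u j) \<noteq> snd (u i) * fst (u j)" if "i < k" "j < k" "i \<noteq> j" for i j
  proof
    assume "fst (u i) * snd (u j) = snd (u i) * fst (u j)"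
    then have s: "sin (\<theta> j - \<theta> i) = 0" by (simp add: u_def sin_diff mult.commute)
    have e: "\<theta> j - \<theta> i = (real j - real i) * pi / real k" using k by (simp add: \<theta>_def field_simps)
    then have "\<bar>\<theta> j - \<theta> i\<bar> = \<bar>real j - real i\<bar> * pi / real k" by (simp only: abs_mult abs_divide) simp
    moreover have "\<bar>real j - real i\<bar> * pi < real k * pi" using that by (intro mult_strict_right_mono) auto
    ultimately have b: "\<bar>\<theta> j - \<theta> i\<bar> < pi" using k by (simp add: divide_less_eq mult.commute)
    have "- pi < \<theta> j - \<theta> i" "\<theta> j - \<theta> i < pi" using b by linarith+
    then have "\<theta> j - \<theta> i = 0" using s by (rule sin_eq_0_pi)
    then show False using that k unfolding e by simp
  qed
  have inj: "inj_on u {..<k}"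
  proof (rule inj_onI, rule ccontr)
    fix i j assume ij: "i \<in> {..<k}" "j \<in> {..<k}" "u i = u j" "i \<noteq> j"
    then show False using diff[of i j] by (simp add: mult.commute)
  qed
  have root: "G (u j, 0) = 0" for j
  proof -
    have "zc (u j) = cis (\<theta> j)" by (simp add: zc_def u_def cis.ctr)
    then have "zc (u j) ^ k = cis (real k * \<theta> j)" by (simp only: Complex.DeMoivre)
    also have "real k * \<theta> j = pi / 2 + real j * pi" using k by (simp add: \<theta>_def field_simps)
    finally have "Re (zc (u j) ^ k) = 0" by (simp add: cos_add)
    moreover have "G (u j, 0) = Re (of_real (1 / (real k * real (k - 1))) * zc (u j) ^ k)"
      using G0[THEN fun_cong, of "u j"] by (simp add: re_poly_def poly_monom cf)
    ultimately show ?thesis by (simp only: Re_of_real_mult mult_zero_right)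
  qed
  have S: "\<exists>S. finite S \<and> card S = k \<and> (\<forall>p\<in>S. G (p, 0) = 0) \<and>
        (\<forall>p\<in>S. \<forall>r\<in>S. p \<noteq> r \<longrightarrow> fst p * snd r \<noteq> snd p * fst r)"
    by (rule exI[of _ "u ` {..<k}"]) (use card_image[OF inj] root diff in auto)
  have ov: "ovals h {p. hess2 (\<lambda>p. G (p, 1)) p = 0}"
  proof -
    have "{p. C - root_mod a h (fst p) ((snd p)\<^sup>2) = 0} = {p. root_mod a h (fst p) ((snd p)\<^sup>2) = C}" by auto
    then show ?thesis using ovals_root_mod[OF h(1) C(1,3) I] unfolding H1 by simp
  qed
  have reg: "dird (1, 0) (hess2 (\<lambda>p. G (p, 1))) p \<noteq> 0 \<or> dird (0, 1) (hess2 (\<lambda>p. G (p, 1))) p \<noteq> 0"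
    if "hess2 (\<lambda>p. G (p, 1)) p = 0" for p
  proof -
    have "poly (pderiv (root_sq a h)) (fst p) \<noteq> 0 \<or> snd p \<noteq> 0"
      using that c0(3)[OF C(1,2)] unfolding H1 by (cases "snd p = 0") auto
    then show ?thesis using root_mod_regular[OF h(1)] unfolding H1 by (cases p) simp
  qed
  show ?thesis
    by (rule that[of G], unfold good_def, intro conjI S rG hG ov allI impI) (fact neg reg)+
qed

text \<open>Since (d - 2)^2 = 2 \<open>tri d\<close> - (d - 2), this form has to miss exactly d - 2
  of the \<open>tri d\<close> ovals. A harmonic start in degree k with h ovals in place of
  \<open>tri k\<close> loses \<open>tri k\<close> - h, which dictates h. For the least k with
  \<open>tri k\<close> \<ge> d - 1 the value is admissible: h \<ge> 1 is clear, and
  \<open>tri (k - 1)\<close> \<le> d - 2 gives h \<le> \<open>tri k\<close> -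
  \<open>tri (k - 1)\<close> = k - 2.\<close>

lemma good_complement:
  assumes d: "d \<ge> 4"
  shows "\<exists>N G. good d N G \<and> tri d + N = (d - 2)\<^sup>2"
proof -
  define k where "k = (LEAST k. k \<ge> 1 \<and> d - 1 \<le> tri k)"
  have td: "2 * tri d = (d - 1) * (d - 2)" using d by (intro tri_double) simp
  have "(d - 1) * 2 \<le> (d - 1) * (d - 2)" using d by (intro mult_left_mono) auto
  then have dd: "d \<ge> 1 \<and> d - 1 \<le> tri d" using td d by linarith
  have k: "k \<ge> 1" "d - 1 \<le> tri k" using LeastI[of "\<lambda>k. k \<ge> 1 \<and> d - 1 \<le> tri k" d, OF dd] by (auto simp: k_def)
  have kd: "k \<le> d" unfolding k_def using Least_le[where P = "\<lambda>k. k \<ge> 1 \<and> d - 1 \<le> tri k", of d] dd by blast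
  have tk: "2 * tri k = (k - 1) * (k - 2)" by (rule tri_double[OF k(1)])
  have k3: "k \<ge> 3"
  proof (rule ccontr)
    assume "\<not> ?thesis"
    then have "k = 1 \<or> k = 2" using k(1) by linarith
    then show False using tk k(2) d by auto
  qed
  have "\<not> (k - 1 \<ge> 1 \<and> d - 1 \<le> tri (k - 1))"
    using not_less_Least[of "k - 1" "\<lambda>k. k \<ge> 1 \<and> d - 1 \<le> tri k"] k3 unfolding k_def[symmetric] by simp
  then have m: "tri (k - 1) < d - 1" using k3 by linarith
  have s: "tri k = tri (k - 1) + (k - 2)" using tri_Suc[of "k - 1"] k3 by simp
  define h where "h = tri k - (d - 2)"
  have h: "1 \<le> h" "h \<le> k - 2" unfolding h_def using k(2) m s d by linarith+
  obtain F where F: "good k h F" using good_harmonic[OF k3 h] by metis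
  obtain G where G: "good d (h + (tri d - tri k)) G" using good_iterate[OF F k3 kd] by auto
  have "tri k \<le> tri d" by (rule tri_mono[OF kd])
  then have "tri d + (h + (tri d - tri k)) = 2 * tri d - (d - 2)" using k(2) by (simp add: h_def)
  also have "\<dots> = (d - 2)\<^sup>2"
  proof -
    have "d = (d - 2) + 2" using d by simp
    then obtain c where "d = c + 2" by blast
    then show ?thesis unfolding td by (simp add: power2_eq_square)
  qed
  finally show ?thesis using G by blast
qed

section \<open>Hessians in four variables\<close>

lemma det_4:
  "det (A :: real ^ 4 ^ 4) =
    A$1$1 * (A$2$2 * (A$3$3 * A$4$4 - A$3$4 * A$4$3) - A$2$3 * (A$3$2 * A$4$4 - A$3$4 * A$4$2) + A$2$4 * (A$3$2 * A$4$3 - A$3$3 * A$4$2))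
  - A$1$2 * (A$2$1 * (A$3$3 * A$4$4 - A$3$4 * A$4$3) - A$2$3 * (A$3$1 * A$4$4 - A$3$4 * A$4$1) + A$2$4 * (A$3$1 * A$4$3 - A$3$3 * A$4$1))
  + A$1$3 * (A$2$1 * (A$3$2 * A$4$4 - A$3$4 * A$4$2) - A$2$2 * (A$3$1 * A$4$4 - A$3$4 * A$4$1) + A$2$4 * (A$3$1 * A$4$2 - A$3$2 * A$4$1))
  - A$1$4 * (A$2$1 * (A$3$2 * A$4$3 - A$3$3 * A$4$2) - A$2$2 * (A$3$1 * A$4$3 - A$3$3 * A$4$1) + A$2$3 * (A$3$1 * A$4$2 - A$3$2 * A$4$1))"
proof -
  have f: "finite {2::4, 3, 4}" "1 \<notin> {2::4, 3, 4}" "finite {3::4, 4}" "2 \<notin> {3::4, 4}" "finite {4::4}" "3 \<notin> {4::4}"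
    by auto
  show ?thesis
    unfolding det_def UNIV_4
    unfolding sum_over_permutations_insert[OF f(1,2)] sum_over_permutations_insert[OF f(3,4)]
      sum_over_permutations_insert[OF f(5,6)] permutes_sing
    by (simp add: sign_swap_id permutation_swap_id permutation_compose sign_compose sign_id swap_id_eq algebra_simps)
qed

lemma det_corner:
  fixes A :: "real ^ 4 ^ 4"
  assumes "A$1$3 = 0" "A$2$3 = 0" "A$3$1 = 0" "A$3$2 = 0" "A$3$3 = 0"
  shows "det A = - (A$3$4 * A$4$3) * (A$1$1 * A$2$2 - A$1$2 * A$2$1)"
  unfolding det_4 assms by (simp add: algebra_simps)

lemma det_blocks:
  fixes A :: "real ^ 4 ^ 4"
  assumes "A$1$3 = 0" "A$1$4 = 0" "A$2$3 = 0" "A$2$4 = 0"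
  shows "det A = (A$1$1 * A$2$2 - A$1$2 * A$2$1) * (A$3$3 * A$4$4 - A$3$4 * A$4$3)"
  unfolding det_4 assms by (simp add: algebra_simps)

definition hess4 :: "(real ^ 4 \<Rightarrow> real) \<Rightarrow> real ^ 4 \<Rightarrow> real" where
  "hess4 f v = det (\<chi> i j. dird (axis i 1) (dird (axis j 1) f) v)"

text \<open>As with \<open>hessp\<close>, parameters are variables of the function but do not enter
  the Hessian matrix.\<close>

definition hessq :: "((real ^ 4) \<times> 'p::euclidean_space \<Rightarrow> real) \<Rightarrow> (real ^ 4) \<times> 'p \<Rightarrow> real" where
  "hessq Q q = det (\<chi> i j. dird (axis i 1, 0) (dird (axis j 1, 0) Q) q)"

lemma rpf_det:
  assumes "\<And>i j. rpf (\<lambda>x. A x i j)" shows "rpf (\<lambda>x. det (\<chi> i j. A x i j :: real ^ 'n ^ 'n))"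
  unfolding det_def vec_lambda_beta
  by (intro real_polynomial_function_sum real_polynomial_function_prod rpf_basic assms finite_permutations finite)

lemma rpf_hess4 [rpf_intros]: "rpf f \<Longrightarrow> rpf (hess4 f)"
  unfolding hess4_def by (intro rpf_det rpf_dird)

lemma rpf_hessq [rpf_intros]: "rpf Q \<Longrightarrow> rpf (hessq Q)"
  unfolding hessq_def by (intro rpf_det rpf_dird)

lemma hess4_slice:
  assumes "rpf Q" shows "hess4 (\<lambda>v. Q (v, t)) = (\<lambda>v. hessq Q (v, t))"
  unfolding hess4_def hessq_def using assms by (simp add: dird_slice rpf_dird)

lemma dird_vec:
  fixes f :: "real ^ 'n::finite \<Rightarrow> real"
  assumes "rpf f" shows "dird w f x = (\<Sum>k\<in>UNIV. w $ k * dird (axis k 1) f x)"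
proof -
  have "dird w f x = dird (\<Sum>k\<in>UNIV. w $ k *\<^sub>R axis k 1) f x"
    using basis_expansion[of w] by (simp add: scalar_mult_eq_scaleR)
  then show ?thesis by (simp add: dird_sum_dir[OF assms] dird_scale_dir[OF assms])
qed

lemma hess4_linear:
  assumes f: "rpf f"
  shows "hess4 (\<lambda>u. f (M *v u)) u = (det M)\<^sup>2 * hess4 f (M *v u)"
proof -
  let ?H = "(\<chi> i j. dird (axis i 1) (dird (axis j 1) f) (M *v u)) :: real ^ 4 ^ 4"
  have L: "bounded_linear ((*v) M)" by (rule matrix_vector_mul_bounded_linear)
  have "dird (axis i 1) (dird (axis j 1) (\<lambda>u. f (M *v u))) u = (transpose M ** ?H ** M) $ i $ j" for i j
  proof -
    have "dird (axis i 1) (dird (axis j 1) (\<lambda>u. f (M *v u))) u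
        = dird (M *v axis i 1) (dird (M *v axis j 1) f) (M *v u)"
      unfolding dird_linear_comp[OF f L] dird_linear_comp[OF rpf_dird[OF f] L] ..
    also have "\<dots> = dird (M *v axis j 1) (dird (M *v axis i 1) f) (M *v u)"
      using dird_commute[OF f] by metis
    also have "\<dots> = (\<Sum>l\<in>UNIV. M $ l $ j * dird (axis l 1) (dird (M *v axis i 1) f) (M *v u))"
      by (subst dird_vec[OF rpf_dird[OF f]]) (simp add: matrix_vector_mul_component column_def matrix_vector_mult_basis)
    also have "\<dots> = (\<Sum>l\<in>UNIV. M $ l $ j * dird (M *v axis i 1) (dird (axis l 1) f) (M *v u))"
      using dird_commute[OF f] by metis
    also have "\<dots> = (\<Sum>l\<in>UNIV. M $ l $ j * (\<Sum>k\<in>UNIV. M $ k $ i * dird (axis k 1) (dird (axis l 1) f) (M *v u)))"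
      by (subst dird_vec[OF rpf_dird[OF f]]) (simp add: column_def matrix_vector_mult_basis)
    also have "\<dots> = (transpose M ** ?H ** M) $ i $ j"
      by (simp add: matrix_matrix_mult_def transpose_def mult.commute)
    finally show ?thesis .
  qed
  then have "(\<chi> i j. dird (axis i 1) (dird (axis j 1) (\<lambda>u. f (M *v u))) u) = transpose M ** ?H ** M"
    by (simp add: vec_eq_iff)
  then show ?thesis unfolding hess4_def by (simp add: det_mul power2_eq_square)
qed

lemma det_cmult: "det (\<chi> i j. c * A i j :: real ^ 4 ^ 4) = c ^ 4 * det (\<chi> i j. A i j)"
  unfolding det_4 vec_lambda_beta by (simp add: algebra_simps power4_eq_xxxx)

lemma hess4_cmult:
  assumes "rpf f" shows "hess4 (\<lambda>u. c * f u) u = c ^ 4 * hess4 f u"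
  unfolding hess4_def dird_cmult[OF assms] dird_cmult[OF rpf_dird[OF assms]] det_cmult ..

text \<open>Euler's relation for the first derivatives puts x into the kernel of the Hessian matrix.
  A singular point of the surface would thus be a parabolic point with dependent differentials, so
  smoothness of the surface follows from that of the curve.\<close>

lemma hess4_critical:
  assumes f: "rpf f" "homog d f" and d: "d \<ge> 2" and x: "x \<noteq> 0" and crit: "\<And>v. dird v f x = 0"
  shows "f x = 0" "hess4 f x = 0"
proof -
  show "f x = 0" using euler[OF f, of x] crit d by simp
  let ?H = "(\<chi> i j. dird (axis i 1) (dird (axis j 1) f) x) :: real ^ 4 ^ 4"
  have "?H *v x = 0"
  proof -
    have "(?H *v x) $ i = 0" for i
    proof -
      have h: "homog (d - 1) (dird (axis i 1) f)" using homog_dird'[of f "d - 1" "axis i 1"] f d by simp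
      have "(?H *v x) $ i = (\<Sum>j\<in>UNIV. x $ j * dird (axis j 1) (dird (axis i 1) f) x)"
        unfolding dird_commute[OF f(1), of "axis i 1"] by (simp add: matrix_vector_mult_def mult.commute dird_commute[OF f(1), of "axis i 1"])
      also have "\<dots> = dird x (dird (axis i 1) f) x" by (rule dird_vec[OF rpf_dird[OF f(1)], symmetric])
      also have "\<dots> = 0" using euler[OF rpf_dird[OF f(1)] h] crit by simp
      finally show ?thesis .
    qed
    then show ?thesis by (simp add: vec_eq_iff)
  qed
  then show "hess4 f x = 0" unfolding hess4_def
    using x invertible_det_nz[of ?H] matrix_left_invertible_ker[of ?H] invertible_def[of ?H] by metis
qed

lemma hess4_homog:
  assumes f: "rpf f" "homog d f" and d: "d \<ge> 2"
  shows "homog (4 * (d - 2)) (hess4 f)"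
proof -
  have h: "homog (d - 2) (dird v (dird w f))" for v w
    using homog_dird'[of "dird w f" "d - 2" v] homog_dird'[of f "d - 1" w] f d by (simp add: rpf_dird Suc_diff_Suc numeral_2_eq_2)
  show ?thesis unfolding homog_def
  proof (intro allI impI)
    fix t :: real and x :: "real ^ 4" assume t: "t \<noteq> 0"
    show "hess4 f (t *\<^sub>R x) = t ^ (4 * (d - 2)) * hess4 f x"
      unfolding hess4_def homogD[OF h t] det_cmult by (simp add: mult.commute flip: power_mult)
  qed
qed

definition vec4 :: "real \<Rightarrow> real \<Rightarrow> real \<Rightarrow> real \<Rightarrow> real ^ 4" where
  "vec4 a b c d = (\<chi> i. if i = 1 then a else if i = 2 then b else if i = 3 then c else d)"

lemma vec4_nth [simp]: "vec4 a b c d $ 1 = a" "vec4 a b c d $ 2 = b" "vec4 a b c d $ 3 = c" "vec4 a b c d $ 4 = d"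
  by (simp_all add: vec4_def)

lemma polyfun_vec4 [rpf_intros]:
  assumes "rpf a" "rpf b" "rpf c" "rpf d" shows "polynomial_function (\<lambda>x. vec4 (a x) (b x) (c x) (d x))"
  unfolding vec4_def
proof (rule polyfun_vec)
  show "rpf (\<lambda>x. if i = 1 then a x else if i = 2 then b x else if i = 3 then c x else d x)" for i :: 4
    by (cases "i = 1"; cases "i = 2"; cases "i = 3"; simp add: assms)
qed

text \<open>The limit of the blow-up. The coordinate z occurs only in \<kappa> z w^(d - 1), so the
  third row and column of the Hessian matrix have the single entry \<kappa> (d - 1) at w = 1, and
  the determinant reduces to the planar Hessian.\<close>

lemma hess4_corner:
  assumes F: "rpf F" and d: "d \<ge> 3"
  shows "hess4 (\<lambda>u. \<kappa> * u $ 3 * u $ 4 ^ (d - 1) + F ((u $ 1, u $ 2), e * u $ 4)) (vec4 x y z 1)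
    = - (\<kappa> * (d - 1))\<^sup>2 * hessp F ((x, y), e)"
proof -
  define g where "g = (\<lambda>u::real^4. \<kappa> * u $ 3 * u $ 4 ^ (d - 1))"
  define L where "L = (\<lambda>u::real^4. ((u $ 1, u $ 2), e * u $ 4))"
  have L: "bounded_linear L" unfolding L_def
    by (intro bounded_linear_intros bounded_linear_vec_nth)
  have g: "rpf g" unfolding g_def by (intro rpf_intros)
  have FL: "rpf (\<lambda>u. F (L u))" unfolding L_def by (rule rpf_comp[OF F]) (intro rpf_intros)
  have dg: "dird v g = (\<lambda>u. \<kappa> * v $ 3 * u $ 4 ^ (d - 1) + \<kappa> * (d - 1) * u $ 3 * u $ 4 ^ (d - 2) * v $ 4)" for v
    unfolding g_def by (rule ext, rule dirdI) (use d in \<open>auto intro!: derivative_eq_intros bounded_linear_imp_has_derivative bounded_linear_vec_nth simp: fun_eq_iff algebra_simps diff_diff_eq numeral_2_eq_2\<close>)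
  have rdg: "rpf (\<lambda>u::real^4. \<kappa> * v $ 3 * u $ 4 ^ (d - 1) + \<kappa> * (d - 1) * u $ 3 * u $ 4 ^ (d - 2) * v $ 4)" for v :: "real^4"
    by (intro rpf_intros)
  have ddg: "dird w (dird v g) u = \<kappa> * (d - 1) * v $ 3 * u $ 4 ^ (d - 2) * w $ 4 + \<kappa> * (d - 1) * w $ 3 * u $ 4 ^ (d - 2) * v $ 4
      + \<kappa> * (d - 1) * (d - 2) * u $ 3 * u $ 4 ^ (d - 3) * v $ 4 * w $ 4" for v w u
    unfolding dg by (rule dirdI) (use d in \<open>auto intro!: derivative_eq_intros bounded_linear_imp_has_derivative bounded_linear_vec_nth simp: fun_eq_iff algebra_simps diff_diff_eq numeral_2_eq_2 numeral_3_eq_3\<close>)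
  have dd: "dird w (dird v (\<lambda>u. g u + F (L u))) u = dird w (dird v g) u + dird (L w) (dird (L v) F) (L u)" for v w u
    unfolding dird_add[OF g FL] dird_linear_comp[OF F L]
    by (subst dird_add) (auto intro!: rpf_dird g rpf_comp[OF rpf_dird[OF F]] polynomial_function_bounded_linear L simp: dird_linear_comp[OF rpf_dird[OF F] L])
  have c: "dird (axis i 1) (dird (axis j 1) (\<lambda>u. \<kappa> * u $ 3 * u $ 4 ^ (d - 1) + F ((u $ 1, u $ 2), e * u $ 4))) (vec4 x y z 1)
      = dird (axis i 1) (dird (axis j 1) g) (vec4 x y z 1) + dird (L (axis i 1)) (dird (L (axis j 1)) F) ((x, y), e)" for i j
    using dd[of "axis i 1" "axis j 1" "vec4 x y z 1"] by (simp add: g_def L_def)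
  have La: "L (axis 1 1) = ((1, 0), 0)" "L (axis 2 1) = ((0, 1), 0)" "L (axis 3 1) = 0"
    by (simp_all add: L_def axis_def zero_prod_def)
  have ax: "axis i (1::real) $ j = (if i = j then 1 else 0)" for i j :: 4 by (simp add: axis_def eq_commute)
  have z': "dird v (dird 0 F) q = 0" "dird 0 (dird v F) q = 0" for v q
    using dird_zero_dir[OF rpf_dird[OF F]] dird_commute[OF F, of v 0] by metis+
  have com: "dird ((0, 1), 0) (dird ((1, 0), 0) F) = dird ((1, 0), 0) (dird ((0, 1), 0) F)" by (rule dird_commute[OF F])
  show ?thesis
    unfolding hess4_def c
    by (subst det_corner) (simp_all add: La ddg ax z' hessp_def com power2_eq_square)
qed

lemma dird_0_dir [simp]: "rpf f \<Longrightarrow> dird 0 f = (\<lambda>x. 0)"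
  using dird_zero_dir by blast

lemma hess4_blocks:
  assumes A: "rpf A" and B: "rpf B"
  shows "hess4 (\<lambda>u. A (u $ 1, u $ 2) + B (u $ 4, u $ 3)) u = hess2 A (u $ 1, u $ 2) * hess2 B (u $ 4, u $ 3)"
proof -
  define L where "L = (\<lambda>u::real^4. (u $ 1, u $ 2))"
  define M where "M = (\<lambda>u::real^4. (u $ 4, u $ 3))"
  have L: "bounded_linear L" and M: "bounded_linear M"
    unfolding L_def M_def by (intro bounded_linear_intros bounded_linear_vec_nth)+
  have r: "rpf (\<lambda>u. f (L u))" "rpf (\<lambda>u. f (M u))" if "rpf f" for f
    by (rule rpf_comp[OF that] polynomial_function_bounded_linear L M)+
  have dd: "dird w (dird v (\<lambda>u. A (L u) + B (M u))) u = dird (L w) (dird (L v) A) (L u) + dird (M w) (dird (M v) B) (M u)" for v w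
    unfolding dird_add[OF r(1)[OF A] r(2)[OF B]] dird_linear_comp[OF A L] dird_linear_comp[OF B M]
      dird_add[OF r(1)[OF rpf_dird[OF A]] r(2)[OF rpf_dird[OF B]]]
      dird_linear_comp[OF rpf_dird[OF A] L] dird_linear_comp[OF rpf_dird[OF B] M] ..
  have La: "L (axis 1 1) = (1, 0)" "L (axis 2 1) = (0, 1)" "L (axis 3 1) = 0" "L (axis 4 1) = 0"
    and Ma: "M (axis 1 1) = 0" "M (axis 2 1) = 0" "M (axis 3 1) = (0, 1)" "M (axis 4 1) = (1, 0)"
    by (simp_all add: L_def M_def axis_def zero_prod_def)
  have com: "dird (0, 1) (dird (1, 0) A) = dird (1, 0) (dird (0, 1) A)" "dird (0, 1) (dird (1, 0) B) = dird (1, 0) (dird (0, 1) B)"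
    by (rule dird_commute[OF A] dird_commute[OF B])+
  have "hess4 (\<lambda>u. A (L u) + B (M u)) u = hess2 A (L u) * hess2 B (M u)"
    unfolding hess4_def dd
    by (subst det_blocks) (simp_all add: La Ma A B rpf_dird hess2_def com power2_eq_square algebra_simps)
  then show ?thesis by (simp add: L_def M_def)
qed

text \<open>Scale r in x and y but r^d in height, since the surface leaves its tangent plane at the
  flat point only to order d. The entry \<open>a\<close> moves the origin of the chart to the flat
  point, and the entry \<open>s * r\<close> is a shear of the height along x.\<close>

definition sheet_matrix :: "nat \<Rightarrow> real \<Rightarrow> real \<Rightarrow> real \<Rightarrow> real ^ 4 ^ 4" where
  "sheet_matrix d a r s = (\<chi> i. if i = 1 then vec4 r 0 0 0 else if i = 2 then vec4 0 r 0 0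
     else if i = 3 then vec4 (s * r) 0 (r ^ d) a else vec4 0 0 0 1)"

lemma sheet_matrix_mult:
  "sheet_matrix d a r s *v u = vec4 (r * u $ 1) (r * u $ 2) (s * r * u $ 1 + r ^ d * u $ 3 + a * u $ 4) (u $ 4)"
  by (simp add: vec_eq_iff forall_4 matrix_vector_mult_def sum_4 sheet_matrix_def)

lemma det_sheet_matrix: "det (sheet_matrix d a r s) = r ^ (d + 2)"
  by (simp add: det_4 sheet_matrix_def power_add power2_eq_square)

section \<open>Blowing up a flat point\<close>

definition indep :: "(real ^ 4 \<Rightarrow> real) \<Rightarrow> (real ^ 4 \<Rightarrow> real) \<Rightarrow> real ^ 4 \<Rightarrow> bool" where
  "indep f g x \<longleftrightarrow> (\<exists>v w. dird v f x * dird w g x - dird w f x * dird v g x \<noteq> 0)"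

definition sheet_zeros :: "((real ^ 4) \<times> real \<Rightarrow> real) \<Rightarrow> real \<Rightarrow> real \<Rightarrow> real \<Rightarrow> (real ^ 4) set" where
  "sheet_zeros Q a \<rho> \<epsilon> = {X. X $ 4 = 1 \<and> norm (X $ 1, X $ 2) < \<rho> \<and> \<bar>X $ 3 - a\<bar> < \<rho> \<and>
     Q (X, \<epsilon>) = 0 \<and> hessq Q (X, \<epsilon>) = 0}"

abbreviation "chart_pt p \<equiv> vec4 (fst p) (fst (snd p)) (snd (snd p)) 1"

lemma chart_pt_has_derivative:
  "((\<lambda>p. chart_pt p) has_derivative (\<lambda>v. vec4 (fst v) (fst (snd v)) (snd (snd v)) 0)) (at p)"
proof -
  have "linear (\<lambda>v::real \<times> real \<times> real. vec4 (fst v) (fst (snd v)) (snd (snd v)) 0)"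
    by (rule linearI) (simp_all add: vec_eq_iff forall_4)
  then have b: "bounded_linear (\<lambda>v::real \<times> real \<times> real. vec4 (fst v) (fst (snd v)) (snd (snd v)) 0)"
    by (simp add: linear_conv_bounded_linear)
  have eq: "(\<lambda>p. chart_pt p) = (\<lambda>p. vec4 (fst p) (fst (snd p)) (snd (snd p)) 0 + vec4 0 0 0 1)"
    by (rule ext) (simp add: vec_eq_iff forall_4)
  show ?thesis unfolding eq by (rule has_derivative_add_const, rule bounded_linear_imp_has_derivative[OF b])
qed

text \<open>
  Zooming in at a flat point \<open>(0, 0, a, 1)\<close>: the weighted rescaling \<open>sheet_matrix\<close> turns the surface
  \<open>Q\<close> into \<open>P\<close>, which converges to the graph of the planar form \<open>F\<close>. The parameter \<open>r\<close> is the scale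
  and \<open>e\<close> is the value that the rescaling leaves in the last argument of \<open>F\<close>; \<open>e = 1\<close> shows
  the ovals, and \<open>e \<in> [0, 1]\<close> on the rim \<open>norm (x, y) = R\<close> covers all the larger scales.
\<close>

locale sheet =
  fixes Q :: "(real ^ 4) \<times> real \<Rightarrow> real" and P :: "(real ^ 4) \<times> (real \<times> real \<times> real) \<Rightarrow> real"
    and a c \<kappa> :: real and m d N :: nat and F :: "(real \<times> real) \<times> real \<Rightarrow> real"
  assumes Q: "rpf Q" and P: "rpf P" and F: "good d N F" and d: "d \<ge> 3" and m: "m \<ge> 1" and \<kappa>: "\<kappa> \<noteq> 0"
    and scale: "\<And>u e r \<epsilon>. \<epsilon> > 0 \<Longrightarrow> r > 0 \<Longrightarrow> r * e = \<epsilon> ^ m \<Longrightarrow>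
      Q (sheet_matrix d a r (c * \<epsilon>) *v u, \<epsilon>) = r ^ d * P (u, (e, r, \<epsilon>))"
    and lim: "\<And>u e. P (u, (e, 0, 0)) = \<kappa> * u $ 3 * u $ 4 ^ (d - 1) + F ((u $ 1, u $ 2), e * u $ 4)"
    and vert: "dird (axis 3 1, 0) Q (vec4 0 0 a 1, 0) \<noteq> 0"
begin

abbreviation "M r \<epsilon> \<equiv> sheet_matrix d a r (c * \<epsilon>)"

definition \<Phi> :: "(real \<times> real \<times> real) \<times> (real \<times> real \<times> real) \<Rightarrow> real" where
  "\<Phi> q = P (chart_pt (fst q), snd q)"

definition \<Psi> :: "(real \<times> real \<times> real) \<times> (real \<times> real \<times> real) \<Rightarrow> real" where
  "\<Psi> q = hessq P (chart_pt (fst q), snd q)"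

definition \<Omega> :: "real \<times> real \<Rightarrow> real" where "\<Omega> p = - (\<kappa> * (d - 1))\<^sup>2 * hessp F (p, 1)"

lemma rpf_limits: "rpf \<Phi>" "rpf \<Psi>" "rpf \<Omega>"
proof -
  show "rpf \<Phi>" unfolding \<Phi>_def[abs_def] by (rule rpf_comp[OF P]) (intro rpf_intros)
  show "rpf \<Psi>" unfolding \<Psi>_def[abs_def] by (rule rpf_comp[OF rpf_hessq[OF P]]) (intro rpf_intros)
  show "rpf \<Omega>" unfolding \<Omega>_def[abs_def]
    by (intro rpf_basic rpf_comp[OF rpf_hessp[OF goodD(1)[OF F]]] rpf_intros)
qed

lemma scale_hess:
  assumes "\<epsilon> > 0" "r > 0" "r * e = \<epsilon> ^ m"
  shows "(r ^ (d + 2))\<^sup>2 * hessq Q (M r \<epsilon> *v u, \<epsilon>) = (r ^ d) ^ 4 * hessq P (u, (e, r, \<epsilon>))"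
proof -
  have "hess4 (\<lambda>u. Q (M r \<epsilon> *v u, \<epsilon>)) u = hess4 (\<lambda>u. r ^ d * P (u, (e, r, \<epsilon>))) u"
    using scale[OF assms] by simp
  then show ?thesis
    using hess4_linear[OF rpf_slice[OF Q], of "M r \<epsilon>" \<epsilon> u] hess4_cmult[OF rpf_slice[OF P], of "r ^ d" "(e, r, \<epsilon>)" u]
    by (simp only: det_sheet_matrix hess4_slice[OF Q] hess4_slice[OF P])
qed

lemma zero_iff:
  assumes "\<epsilon> > 0" "r > 0" "r * e = \<epsilon> ^ m"
  shows "Q (M r \<epsilon> *v chart_pt p, \<epsilon>) = 0 \<longleftrightarrow> \<Phi> (p, (e, r, \<epsilon>)) = 0"
    "hessq Q (M r \<epsilon> *v chart_pt p, \<epsilon>) = 0 \<longleftrightarrow> \<Psi> (p, (e, r, \<epsilon>)) = 0"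
proof -
  show "Q (M r \<epsilon> *v chart_pt p, \<epsilon>) = 0 \<longleftrightarrow> \<Phi> (p, (e, r, \<epsilon>)) = 0"
    using scale[OF assms, of "chart_pt p"] assms(2) by (simp add: \<Phi>_def)
  have "(r ^ (d + 2))\<^sup>2 \<noteq> 0" "(r ^ d) ^ 4 \<noteq> 0" using assms(2) by auto
  then show "hessq Q (M r \<epsilon> *v chart_pt p, \<epsilon>) = 0 \<longleftrightarrow> \<Psi> (p, (e, r, \<epsilon>)) = 0"
    using scale_hess[OF assms, of "chart_pt p"] unfolding \<Psi>_def by (metis fst_conv snd_conv mult_eq_0_iff)
qed

lemma lim_\<Phi>: "\<Phi> ((x, y, z), (e, 0, 0)) = \<kappa> * z + F ((x, y), e)"
  by (simp add: \<Phi>_def lim)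

lemma lim_\<Psi>: "\<Psi> ((x, y, z), (e, 0, 0)) = - (\<kappa> * (d - 1))\<^sup>2 * hessp F ((x, y), e)"
proof -
  have "hessq P (vec4 x y z 1, (e, 0, 0)) = hess4 (\<lambda>u. P (u, (e, 0, 0))) (vec4 x y z 1)"
    by (simp add: hess4_slice[OF P])
  then show ?thesis using hess4_corner[OF goodD(1)[OF F] d] by (simp add: \<Psi>_def lim)
qed

lemma indep_scale:
  assumes e: "\<epsilon> > 0" "r > 0" "r * e = \<epsilon> ^ m"
    and i: "dird (v, 0) \<Phi> (p, (e, r, \<epsilon>)) * dird (w, 0) \<Psi> (p, (e, r, \<epsilon>)) - dird (w, 0) \<Phi> (p, (e, r, \<epsilon>)) * dird (v, 0) \<Psi> (p, (e, r, \<epsilon>)) \<noteq> 0"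
  shows "indep (\<lambda>X. Q (X, \<epsilon>)) (hess4 (\<lambda>X. Q (X, \<epsilon>))) (M r \<epsilon> *v chart_pt p)"
proof -
  let ?t = "(e, r, \<epsilon>)" and ?X = "M r \<epsilon> *v chart_pt p"
  define L where "L v = M r \<epsilon> *v vec4 (fst v) (fst (snd v)) (snd (snd v)) 0" for v :: "real \<times> real \<times> real"
  have D: "((\<lambda>p. M r \<epsilon> *v chart_pt p) has_derivative L) (at p)" unfolding L_def
    by (rule bounded_linear.has_derivative[OF matrix_vector_mul_bounded_linear chart_pt_has_derivative])
  have 1: "dird (L v) (\<lambda>X. Q (X, \<epsilon>)) ?X = r ^ d * dird (v, 0) \<Phi> (p, ?t)" for v
  proof -
    have "dird v (\<lambda>p. Q (M r \<epsilon> *v chart_pt p, \<epsilon>)) p = dird v (\<lambda>p. r ^ d * \<Phi> (p, ?t)) p"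
      using scale[OF e] by (simp add: \<Phi>_def)
    then show ?thesis
      unfolding dird_cmult[OF rpf_slice[OF rpf_limits(1)]] dird_slice[OF rpf_limits(1)]
      using dird_chain[OF rpf_slice[OF Q] D, of v \<epsilon>] by simp
  qed
  have 2: "(r ^ (d + 2))\<^sup>2 * dird (L v) (\<lambda>X. hessq Q (X, \<epsilon>)) ?X = (r ^ d) ^ 4 * dird (v, 0) \<Psi> (p, ?t)" for v
  proof -
    have eq: "dird v (\<lambda>p. (r ^ (d + 2))\<^sup>2 * hessq Q (M r \<epsilon> *v chart_pt p, \<epsilon>)) p = dird v (\<lambda>p. (r ^ d) ^ 4 * \<Psi> (p, ?t)) p"
      using scale_hess[OF e] by (simp add: \<Psi>_def)
    have r: "rpf (\<lambda>p. hessq Q (M r \<epsilon> *v chart_pt p, \<epsilon>))"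
      unfolding sheet_matrix_mult by (rule rpf_comp[OF rpf_hessq[OF Q]]) (intro rpf_intros)
    show ?thesis using eq
      unfolding dird_cmult[OF rpf_slice[OF rpf_limits(2)]] dird_slice[OF rpf_limits(2)] dird_cmult[OF r]
      using dird_chain[OF rpf_slice[OF rpf_hessq[OF Q]] D, of v \<epsilon>] by simp
  qed
  define R1 R2 where "R1 = (r ^ (d + 2))\<^sup>2" and "R2 = (r ^ d) ^ 4"
  have R: "R1 \<noteq> 0" "R2 \<noteq> 0" using e(2) by (auto simp: R1_def R2_def)
  have "R1 * (dird (L v) (\<lambda>X. Q (X, \<epsilon>)) ?X * dird (L w) (\<lambda>X. hessq Q (X, \<epsilon>)) ?X
      - dird (L w) (\<lambda>X. Q (X, \<epsilon>)) ?X * dird (L v) (\<lambda>X. hessq Q (X, \<epsilon>)) ?X)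
    = dird (L v) (\<lambda>X. Q (X, \<epsilon>)) ?X * (R1 * dird (L w) (\<lambda>X. hessq Q (X, \<epsilon>)) ?X)
      - dird (L w) (\<lambda>X. Q (X, \<epsilon>)) ?X * (R1 * dird (L v) (\<lambda>X. hessq Q (X, \<epsilon>)) ?X)"
    by (simp add: algebra_simps)
  also have "\<dots> = r ^ d * R2 * (dird (v, 0) \<Phi> (p, ?t) * dird (w, 0) \<Psi> (p, ?t) - dird (w, 0) \<Phi> (p, ?t) * dird (v, 0) \<Psi> (p, ?t))"
    unfolding 1 2[folded R1_def R2_def] by (simp add: algebra_simps)
  also have "\<dots> \<noteq> 0" using i R e(2) by simp
  finally show ?thesis unfolding indep_def hess4_slice[OF Q]
    by (intro exI[of _ "L v"] exI[of _ "L w"]) auto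
qed

lemma vert_bound:
  obtains \<mu> \<delta> where "\<mu> > 0" "\<delta> > 0"
    "\<And>X \<epsilon>. X $ 4 = 1 \<Longrightarrow> \<bar>X $ 1\<bar> < \<delta> \<Longrightarrow> \<bar>X $ 2\<bar> < \<delta> \<Longrightarrow> \<bar>X $ 3 - a\<bar> < \<delta> \<Longrightarrow> \<bar>\<epsilon>\<bar> < \<delta> \<Longrightarrow> \<bar>dird (axis 3 1, 0) Q (X, \<epsilon>)\<bar> > \<mu>"
proof -
  let ?D = "dird (axis 3 1, 0) Q" and ?O = "(vec4 0 0 a 1, 0)"
  define \<mu> where "\<mu> = \<bar>?D ?O\<bar> / 2"
  have \<mu>: "\<mu> > 0" "\<bar>?D ?O\<bar> > \<mu>" using vert by (auto simp: \<mu>_def)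
  have "continuous_on UNIV (\<lambda>q. \<bar>?D q\<bar>)" by (intro continuous_intros rpf_cont[OF rpf_dird[OF Q]])
  then have "open {q. \<mu> < \<bar>?D q\<bar>}" by (intro open_Collect_less continuous_on_const)
  then obtain \<delta> where \<delta>: "\<delta> > 0" "\<And>q. dist q ?O < \<delta> \<Longrightarrow> \<mu> < \<bar>?D q\<bar>"
    using \<mu>(2) unfolding open_dist by blast
  show ?thesis
  proof (rule that[OF \<mu>(1), of "\<delta> / 4"])
    fix X :: "real ^ 4" and \<epsilon> :: real
    assume X: "X $ 4 = 1" "\<bar>X $ 1\<bar> < \<delta> / 4" "\<bar>X $ 2\<bar> < \<delta> / 4" "\<bar>X $ 3 - a\<bar> < \<delta> / 4" "\<bar>\<epsilon>\<bar> < \<delta> / 4"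
    have "dist (X, \<epsilon>) ?O = norm (X - vec4 0 0 a 1, \<epsilon>)" by (simp add: dist_norm)
    also have "\<dots> \<le> norm (X - vec4 0 0 a 1) + \<bar>\<epsilon>\<bar>" using norm_Pair_le[of "X - vec4 0 0 a 1" \<epsilon>] by simp
    also have "\<dots> \<le> \<bar>X $ 1\<bar> + \<bar>X $ 2\<bar> + \<bar>X $ 3 - a\<bar> + \<bar>\<epsilon>\<bar>"
      using norm_le_l1_cart[of "X - vec4 0 0 a 1"] X(1) by (simp add: sum_4)
    also have "\<dots> < \<delta>" using X by linarith
    finally show "\<bar>?D (X, \<epsilon>)\<bar> > \<mu>" by (rule \<delta>(2))
  qed (use \<delta> in simp)
qed

lemma bounded_P:
  obtains C where "C > 0"
    "\<And>x y e r \<epsilon>. norm (x, y) \<le> R \<Longrightarrow> 0 \<le> e \<Longrightarrow> e \<le> 1 \<Longrightarrow> 0 \<le> r \<Longrightarrow> r \<le> 1 \<Longrightarrow> 0 \<le> \<epsilon> \<Longrightarrow> \<epsilon> \<le> 1 \<Longrightarrow> \<bar>P (vec4 x y 0 1, (e, r, \<epsilon>))\<bar> \<le> C"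
proof -
  let ?S = "cball (0::real \<times> real) R \<times> ({0..1::real} \<times> {0..1::real} \<times> {0..1::real})"
  let ?g = "\<lambda>q. P (vec4 (fst (fst q)) (snd (fst q)) 0 1, snd q)"
  have "rpf ?g" by (rule rpf_comp[OF P]) (intro rpf_intros)
  then have "compact (?g ` ?S)" by (intro compact_continuous_image rpf_cont compact_Times compact_cball compact_Icc)
  then have "bounded (?g ` ?S)" by (rule compact_imp_bounded)
  then obtain C where C: "C > 0" "\<forall>y\<in>?g ` ?S. norm y \<le> C"
    unfolding bounded_pos by (elim exE conjE) (rule that)
  show ?thesis
  proof (rule that[OF C(1)])
    fix x y e r \<epsilon> :: real
    assume "norm (x, y) \<le> R" "0 \<le> e" "e \<le> 1" "0 \<le> r" "r \<le> 1" "0 \<le> \<epsilon>" "\<epsilon> \<le> 1"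
    then show "\<bar>P (vec4 x y 0 1, (e, r, \<epsilon>))\<bar> \<le> C"
      using C(2)[rule_format, OF imageI[of "((x, y), (e, r, \<epsilon>))"]] by simp
  qed
qed

lemma cylinder_compact:
  fixes B :: "(real \<times> real) set"
  assumes "compact B" shows "compact {p. (fst p, fst (snd p)) \<in> B \<and> \<bar>snd (snd p)\<bar> \<le> (Z::real)}"
proof -
  have "{p. (fst p, fst (snd p)) \<in> B \<and> \<bar>snd (snd p)\<bar> \<le> Z} = (\<lambda>p. (fst (fst p), snd (fst p), snd p)) ` (B \<times> {-Z..Z})"
    by (auto simp: image_iff abs_le_iff) force+
  then show ?thesis by (auto intro!: compact_continuous_image continuous_intros compact_Times assms)
qed

text \<open>
  The mean value theorem in the vertical direction bounds the rescaled height of the points of the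
  surface, so that the whole neighbourhood is visible in the chart.
\<close>

lemma height_bound:
  assumes \<mu>: "\<mu> > 0" "\<And>X. X $ 4 = 1 \<Longrightarrow> \<bar>X $ 1\<bar> < \<delta> \<Longrightarrow> \<bar>X $ 2\<bar> < \<delta> \<Longrightarrow> \<bar>X $ 3 - a\<bar> < \<delta> \<Longrightarrow> \<bar>dird (axis 3 1, 0) Q (X, \<epsilon>)\<bar> > \<mu>"
    and C: "\<bar>P (vec4 x y 0 1, (e, r, \<epsilon>))\<bar> \<le> C"
    and e: "\<epsilon> > 0" "r > 0" "r * e = \<epsilon> ^ m"
    and X: "Q (M r \<epsilon> *v vec4 x y z 1, \<epsilon>) = 0" "\<bar>r * x\<bar> < \<delta>" "\<bar>r * y\<bar> < \<delta>" "\<bar>c * \<epsilon> * r * x\<bar> < \<delta>"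
      "\<bar>c * \<epsilon> * r * x + r ^ d * z\<bar> < \<delta>"
  shows "\<bar>z\<bar> \<le> C / \<mu>"
proof -
  let ?X = "M r \<epsilon> *v vec4 x y z 1" and ?Y = "M r \<epsilon> *v vec4 x y 0 1"
  obtain s where s: "0 < s" "s < 1" and
    eq: "Q (?X, \<epsilon>) - Q (?Y, \<epsilon>) = dird (?X - ?Y) (\<lambda>X. Q (X, \<epsilon>)) (?Y + s *\<^sub>R (?X - ?Y))"
    using rpf_mvt[OF rpf_slice[OF Q]] .
  let ?\<xi> = "?Y + s *\<^sub>R (?X - ?Y)"
  have diff: "?X - ?Y = (r ^ d * z) *\<^sub>R axis 3 1"
    by (simp add: sheet_matrix_mult vec_eq_iff forall_4 axis_def)
  have \<xi>3: "?\<xi> $ 3 - a = (1 - s) * (c * \<epsilon> * r * x) + s * (c * \<epsilon> * r * x + r ^ d * z)"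
    by (simp add: sheet_matrix_mult algebra_simps)
  have "\<bar>(1 - s) * (c * \<epsilon> * r * x) + s * (c * \<epsilon> * r * x + r ^ d * z)\<bar> \<le> (1 - s) * \<bar>c * \<epsilon> * r * x\<bar> + s * \<bar>c * \<epsilon> * r * x + r ^ d * z\<bar>"
    using abs_triangle_ineq[of "(1 - s) * (c * \<epsilon> * r * x)" "s * (c * \<epsilon> * r * x + r ^ d * z)"] s by (simp add: abs_mult)
  also have "\<dots> < (1 - s) * \<delta> + s * \<delta>" using s X(4,5) by (intro add_strict_mono mult_strict_left_mono) auto
  finally have "\<bar>?\<xi> $ 3 - a\<bar> < \<delta>" unfolding \<xi>3 by (simp add: algebra_simps)
  then have "\<bar>dird (axis 3 1, 0) Q (?\<xi>, \<epsilon>)\<bar> > \<mu>"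
    by (rule \<mu>(2)[rotated 3]) (use X(2,3) in \<open>simp_all add: sheet_matrix_mult\<close>)
  then have big: "\<bar>dird (axis 3 1) (\<lambda>X. Q (X, \<epsilon>)) ?\<xi>\<bar> > \<mu>" by (simp add: dird_slice[OF Q])
  have "r ^ d * \<bar>P (vec4 x y 0 1, (e, r, \<epsilon>))\<bar> = \<bar>Q (?X, \<epsilon>) - Q (?Y, \<epsilon>)\<bar>"
    using X(1) scale[OF e, of "vec4 x y 0 1"] e(2) by (simp add: abs_mult)
  also have "\<dots> = r ^ d * \<bar>z\<bar> * \<bar>dird (axis 3 1) (\<lambda>X. Q (X, \<epsilon>)) ?\<xi>\<bar>"
    unfolding eq unfolding diff dird_scale_dir[OF rpf_slice[OF Q]] using e(2) by (simp add: abs_mult)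
  also have "\<dots> \<ge> r ^ d * \<bar>z\<bar> * \<mu>" using big e(2) by (intro mult_left_mono) auto
  finally have "r ^ d * (\<bar>z\<bar> * \<mu>) \<le> r ^ d * \<bar>P (vec4 x y 0 1, (e, r, \<epsilon>))\<bar>" by (simp add: mult.assoc)
  then have "\<bar>z\<bar> * \<mu> \<le> \<bar>P (vec4 x y 0 1, (e, r, \<epsilon>))\<bar>" using e(2) by simp
  then have "\<bar>z\<bar> * \<mu> \<le> C" using C by linarith
  then show ?thesis using \<mu>(1) by (simp add: field_simps)
qed

text \<open>At the scale r = \<epsilon>^m, where e = 1, the rescaled curve is a small perturbation
  of the planar Hessian curve. A zero further out is rescaled by a larger r so that it comes to lie
  on the rim of radius R; there e = \<epsilon>^m / r is in [0, 1], and the limiting Hessian has no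
  zero.\<close>

theorem ovals_sheet:
  obtains \<rho>0 where "\<rho>0 > 0" "\<And>\<rho>. 0 < \<rho> \<Longrightarrow> \<rho> \<le> \<rho>0 \<Longrightarrow> eventually (\<lambda>\<epsilon>. ovals N (sheet_zeros Q a \<rho> \<epsilon>) \<and>
    (\<forall>X\<in>sheet_zeros Q a \<rho> \<epsilon>. indep (\<lambda>X. Q (X, \<epsilon>)) (hess4 (\<lambda>X. Q (X, \<epsilon>))) X)) (at_right 0)"
proof -
  note F' = goodD[OF F]
  obtain R where R: "R > 0" "\<And>p e. 0 \<le> e \<Longrightarrow> e \<le> 1 \<Longrightarrow> norm p \<ge> R \<Longrightarrow> hessp F (p, e) \<noteq> 0"
    "\<And>p. hessp F (p, 1) = 0 \<Longrightarrow> norm p < R" using hessp_far[OF F] by (metis (no_types))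
  obtain \<mu> \<delta> where \<mu>: "\<mu> > 0" "\<delta> > 0"
    "\<And>X \<epsilon>. X $ 4 = 1 \<Longrightarrow> \<bar>X $ 1\<bar> < \<delta> \<Longrightarrow> \<bar>X $ 2\<bar> < \<delta> \<Longrightarrow> \<bar>X $ 3 - a\<bar> < \<delta> \<Longrightarrow> \<bar>\<epsilon>\<bar> < \<delta> \<Longrightarrow> \<bar>dird (axis 3 1, 0) Q (X, \<epsilon>)\<bar> > \<mu>"
    using vert_bound by (metis (no_types))
  obtain C where C: "C > 0"
    "\<And>x y e r \<epsilon>. norm (x, y) \<le> R \<Longrightarrow> 0 \<le> e \<Longrightarrow> e \<le> 1 \<Longrightarrow> 0 \<le> r \<Longrightarrow> r \<le> 1 \<Longrightarrow> 0 \<le> \<epsilon> \<Longrightarrow> \<epsilon> \<le> 1 \<Longrightarrow> \<bar>P (vec4 x y 0 1, (e, r, \<epsilon>))\<bar> \<le> C"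
    using bounded_P[of R] by (metis (no_types))
  let ?K = "cball (0::real \<times> real) R"
  have "bounded ((\<lambda>p. F (p, 1)) ` ?K)"
    by (intro compact_imp_bounded compact_continuous_image rpf_cont rpf_slice F'(1) compact_cball)
  then obtain C' where C': "C' > 0" "\<forall>y\<in>(\<lambda>p. F (p, 1)) ` ?K. norm y \<le> C'"
    unfolding bounded_pos by (elim exE conjE) (rule that)
  \<comment> \<open>The first summand is the bound of \<open>height_bound\<close> for points of the
    surface, the second keeps the limiting graph inside the cylinder.\<close>
  define Z where "Z = C / \<mu> + (C' + 1) / \<bar>\<kappa>\<bar>"
  have Z: "Z > 0" "C / \<mu> \<le> Z" using C(1) \<mu>(1) C'(1) \<kappa> by (auto simp: Z_def intro!: add_pos_pos)
  have fZ: "\<bar>F (p, 1)\<bar> < \<bar>\<kappa>\<bar> * Z" if "p \<in> ?K" for p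
  proof -
    have "\<bar>F (p, 1)\<bar> \<le> C'" using C'(2) that by simp
    also have "C' < \<bar>\<kappa>\<bar> * ((C' + 1) / \<bar>\<kappa>\<bar>)" using \<kappa> by simp
    also have "\<dots> \<le> \<bar>\<kappa>\<bar> * Z" unfolding Z_def using C(1) \<mu>(1) by (intro mult_left_mono) auto
    finally show ?thesis .
  qed
  have \<Omega>0: "\<Omega> p = 0 \<longleftrightarrow> hessp F (p, 1) = 0" for p using \<kappa> d by (simp add: \<Omega>_def)
  have \<Omega>K: "{p \<in> ?K. \<Omega> p = 0} = {p. hessp F (p, 1) = 0}" using R(3) by (force simp: \<Omega>0)
  have int: "{p \<in> ?K. \<Omega> p = 0} \<subseteq> interior ?K" using R(3) by (auto simp: \<Omega>0)
  have reg: "dird (1, 0) \<Omega> p \<noteq> 0 \<or> dird (0, 1) \<Omega> p \<noteq> 0" if "\<Omega> p = 0" for p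
  proof -
    have "dird v \<Omega> p = - (\<kappa> * (d - 1))\<^sup>2 * dird (v, 0) (hessp F) (p, 1)" for v
      unfolding \<Omega>_def[abs_def] dird_cmult[OF rpf_slice[OF rpf_hessp[OF F'(1)]]] dird_slice[OF rpf_hessp[OF F'(1)]] ..
    then show ?thesis using F'(5)[of p] that \<kappa> d by (auto simp: \<Omega>0)
  qed
  have l1: "\<Phi> ((x, y, z), (1, 0, 0)) = \<kappa> * z + F ((x, y), 1)" for x y z by (rule lim_\<Phi>)
  have l2: "\<Psi> ((x, y, z), (1, 0, 0)) = \<Omega> (x, y)" for x y z unfolding \<Omega>_def by (rule lim_\<Psi>)
  note stable = zero_curve_stable[OF rpf_limits(1,2,3) compact_cball Z(1) l1 l2 \<kappa> fZ F'(4)[folded \<Omega>K] int reg]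
  define T where "T \<epsilon> = (1::real, \<epsilon> ^ m, \<epsilon>)" for \<epsilon> :: real
  have "((\<lambda>\<epsilon>::real. (1::real, \<epsilon> ^ m, \<epsilon>)) \<longlongrightarrow> (1, 0 ^ m, 0)) (at_right 0)"
    by (intro tendsto_intros)
  then have T: "filterlim T (nhds (1, 0, 0)) (at_right 0)" using m unfolding T_def[abs_def] by (simp add: power_0_left)
  \<comment> \<open>The rim, with all values of e in [0, 1] at once; compactness makes the exclusion
    of zeros uniform in e.\<close>
  define S where "S = {p. (fst p, fst (snd p)) \<in> sphere (0::real \<times> real) R \<and> \<bar>snd (snd p)\<bar> \<le> Z} \<times> {0..1::real}"
  have cS: "compact S" unfolding S_def by (intro compact_Times cylinder_compact compact_sphere compact_Icc)
  define W where "W = {q. \<Psi> (fst (fst q), (snd (fst q), fst (snd q), snd (snd q))) \<noteq> 0}"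
  have W: "open W" unfolding W_def
    by (intro open_Collect_neq continuous_intros continuous_on_const rpf_cont rpf_comp[OF rpf_limits(2)] rpf_intros)
  have "(p, (0, 0)) \<in> W" if "p \<in> S" for p
  proof -
    obtain x y z e where p: "p = ((x, y, z), e)" by (cases p) auto
    then have "norm (x, y) = R" "0 \<le> e" "e \<le> 1" using that by (auto simp: S_def)
    then show ?thesis using R(2)[of e "(x, y)"] \<kappa> d unfolding W_def p by (simp add: lim_\<Psi>)
  qed
  from eventually_nhds_Pair0[OF eventually_tube[OF cS W this]] obtain \<delta>2 where \<delta>2: "\<delta>2 > 0"
    "\<And>r \<epsilon>. \<bar>r - 0\<bar> < \<delta>2 \<Longrightarrow> \<bar>\<epsilon>\<bar> < \<delta>2 \<Longrightarrow> \<forall>p\<in>S. (p, (r, \<epsilon>)) \<in> W" by (metis (no_types))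
  \<comment> \<open>The shear displaces the height by at most |c| \<rho>, hence the factor 1 + |c|.
    The bounds by R and by R \<delta>2 / 2 keep the scale n / R of a point below 1 and below
    \<delta>2.\<close>
  define \<rho>0 where "\<rho>0 = min (min (\<delta> / (2 * (1 + \<bar>c\<bar>))) R) (R * \<delta>2 / 2)"
  have \<rho>0: "\<rho>0 > 0" using \<mu>(2) R(1) \<delta>2(1) by (auto simp: \<rho>0_def add_pos_nonneg)
  show ?thesis
  proof (rule that[OF \<rho>0])
    fix \<rho> :: real assume \<rho>: "0 < \<rho>" "\<rho> \<le> \<rho>0"
    have \<rho>': "\<rho> \<le> R" "\<rho> / R < \<delta>2" "\<rho> * (1 + \<bar>c\<bar>) < \<delta>"
    proof -
      have "\<rho> \<le> \<delta> / (2 * (1 + \<bar>c\<bar>))" "\<rho> \<le> R * \<delta>2 / 2" using \<rho>(2) by (simp_all add: \<rho>0_def)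
      then have "\<rho> * (2 * (1 + \<bar>c\<bar>)) \<le> \<delta>" "\<rho> / R \<le> \<delta>2 / 2" using R(1) by (simp_all add: field_simps add_pos_nonneg)
      then show "\<rho> / R < \<delta>2" "\<rho> * (1 + \<bar>c\<bar>) < \<delta>" using \<delta>2(1) \<mu>(2) by linarith+
      show "\<rho> \<le> R" using \<rho>(2) by (simp add: \<rho>0_def)
    qed
    have small: "eventually (\<lambda>\<epsilon>. 0 < \<epsilon> \<and> \<epsilon> < \<delta> \<and> \<epsilon> < \<delta>2 \<and> \<epsilon> < 1 \<and> \<epsilon> ^ m < \<delta>2 \<and> \<epsilon> ^ m < 1 \<and> \<epsilon> ^ m * R < \<rho> \<and>
        \<bar>c\<bar> * \<epsilon> * \<epsilon> ^ m * R + (\<epsilon> ^ m) ^ d * Z < \<rho>) (at_right 0)"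
    proof -
      have p: "((\<lambda>\<epsilon>. \<epsilon> ^ m) \<longlongrightarrow> (0::real) ^ m) (at_right 0)" by (rule tendsto_power[OF tendsto_ident_at])
      have lim: "((\<lambda>\<epsilon>. \<epsilon>) \<longlongrightarrow> (0::real)) (at_right 0)" "((\<lambda>\<epsilon>. \<epsilon> ^ m) \<longlongrightarrow> (0::real) ^ m) (at_right 0)"
        "((\<lambda>\<epsilon>. \<epsilon> ^ m * R) \<longlongrightarrow> 0 ^ m * R) (at_right 0)"
        "((\<lambda>\<epsilon>. \<bar>c\<bar> * \<epsilon> * \<epsilon> ^ m * R + (\<epsilon> ^ m) ^ d * Z) \<longlongrightarrow> \<bar>c\<bar> * 0 * 0 ^ m * R + (0 ^ m) ^ d * Z) (at_right 0)"
        by (rule tendsto_ident_at p | intro tendsto_intros p)+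
      have z: "(0::real) ^ m = 0" "(0::real) ^ d = 0" using m d by (auto simp: power_0_left)
      note lt = lim[unfolded z mult_zero_left mult_zero_right add_0_left, THEN order_tendstoD(2)]
      show ?thesis
        by (intro eventually_conj eventually_at_right_less lt) (use \<mu>(2) \<delta>2(1) \<rho>(1) in auto)
    qed
    have st1: "eventually (\<lambda>\<epsilon>. ovals N (zero_curve \<Phi> \<Psi> ?K Z (T \<epsilon>))) (at_right 0)"
      by (rule eventually_compose_filterlim[OF _ T], rule stable(1))
    have st2: "eventually (\<lambda>\<epsilon>. \<forall>p\<in>zero_curve \<Phi> \<Psi> ?K Z (T \<epsilon>).
       dird ex3 \<Phi> (p, T \<epsilon>) * dird ex1 \<Psi> (p, T \<epsilon>) - dird ex1 \<Phi> (p, T \<epsilon>) * dird ex3 \<Psi> (p, T \<epsilon>) \<noteq> 0 \<or>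
       dird ex3 \<Phi> (p, T \<epsilon>) * dird ex2 \<Psi> (p, T \<epsilon>) - dird ex2 \<Phi> (p, T \<epsilon>) * dird ex3 \<Psi> (p, T \<epsilon>) \<noteq> 0) (at_right 0)"
      by (rule eventually_compose_filterlim[OF _ T], rule stable(2))
    from small st1 st2
    show "eventually (\<lambda>\<epsilon>. ovals N (sheet_zeros Q a \<rho> \<epsilon>) \<and>
      (\<forall>X\<in>sheet_zeros Q a \<rho> \<epsilon>. indep (\<lambda>X. Q (X, \<epsilon>)) (hess4 (\<lambda>X. Q (X, \<epsilon>))) X)) (at_right 0)"
    proof eventually_elim
      case (elim \<epsilon>)
      define r0 where "r0 = \<epsilon> ^ m"
      have \<epsilon>: "0 < \<epsilon>" "\<epsilon> < \<delta>" "\<epsilon> < \<delta>2" "\<epsilon> < 1" and r0: "r0 > 0" "r0 < \<delta>2" "r0 < 1" "r0 * R < \<rho>"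
        "\<bar>c\<bar> * \<epsilon> * r0 * R + r0 ^ d * Z < \<rho>" using elim(1) by (auto simp: r0_def)
      have "r0 * 1 = \<epsilon> ^ m" by (simp add: r0_def)
      note e1 = \<epsilon>(1) r0(1) this
      define f where "f p = M r0 \<epsilon> *v chart_pt p" for p
      let ?C = "zero_curve \<Phi> \<Psi> ?K Z (T \<epsilon>)"
      have t: "T \<epsilon> = (1, r0, \<epsilon>)" by (simp add: T_def r0_def)
      have "f ` ?C = sheet_zeros Q a \<rho> \<epsilon>"
      proof (intro subset_antisym subsetI)
        fix X assume "X \<in> f ` ?C"
        then obtain x y z where X: "X = f (x, y, z)" "norm (x, y) \<le> R" "\<bar>z\<bar> \<le> Z"
          "\<Phi> ((x, y, z), (1, r0, \<epsilon>)) = 0" "\<Psi> ((x, y, z), (1, r0, \<epsilon>)) = 0"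
          by (auto simp: zero_curve_def t)
        have v: "X = vec4 (r0 * x) (r0 * y) (c * \<epsilon> * r0 * x + r0 ^ d * z + a) 1"
          unfolding X(1) f_def sheet_matrix_mult by simp
        have "norm (r0 * x, r0 * y) = r0 * norm (x, y)" using norm_scaleR[of r0 "(x, y)"] r0(1) by simp
        also have "\<dots> \<le> r0 * R" using X(2) r0(1) by (intro mult_left_mono) auto
        also have "\<dots> < \<rho>" by (rule r0(4))
        finally have n: "norm (r0 * x, r0 * y) < \<rho>" .
        have "\<bar>x\<bar> \<le> R" using norm_fst_le[of x y] X(2) by simp
        then have "\<bar>c * \<epsilon> * r0 * x\<bar> \<le> \<bar>c\<bar> * \<epsilon> * r0 * R" using \<epsilon>(1) r0(1) by (simp add: abs_mult mult_left_mono)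
        moreover have "\<bar>r0 ^ d * z\<bar> \<le> r0 ^ d * Z" using X(3) r0(1) by (simp add: abs_mult mult_left_mono)
        ultimately have "\<bar>c * \<epsilon> * r0 * x + r0 ^ d * z\<bar> < \<rho>" using r0(5) by linarith
        then show "X \<in> sheet_zeros Q a \<rho> \<epsilon>"
          using n X(4,5) zero_iff[OF e1, of "(x, y, z)"] unfolding X(1) sheet_zeros_def f_def by (simp add: sheet_matrix_mult)
      next
        fix X assume "X \<in> sheet_zeros Q a \<rho> \<epsilon>"
        then have X: "X $ 4 = 1" "norm (X $ 1, X $ 2) < \<rho>" "\<bar>X $ 3 - a\<bar> < \<rho>" "Q (X, \<epsilon>) = 0" "hessq Q (X, \<epsilon>) = 0"
          by (auto simp: sheet_zeros_def)
        define n where "n = norm (X $ 1, X $ 2)"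
        \<comment> \<open>The smallest scale, not below \<open>r0\<close>, at which the point falls
          into the disc of radius R. If it is larger than \<open>r0\<close>, the rescaled point is
          on the rim.\<close>
        define r where "r = max r0 (n / R)"
        define e where "e = r0 / r"
        have n: "n \<ge> 0" "n < \<rho>" "n / R < \<delta>2" "n / R < 1"
        proof -
          show "n \<ge> 0" "n < \<rho>" using X(2) by (simp_all add: n_def)
          then have "n / R < \<rho> / R" "\<rho> / R \<le> 1" using R(1) \<rho>'(1) by (simp_all add: divide_strict_right_mono)
          then show "n / R < \<delta>2" "n / R < 1" using \<rho>'(2) by linarith+
        qed
        have r: "r > 0" "r < \<delta>2" "r < 1" "r \<ge> r0" "n \<le> r * R"
        proof -
          show "r > 0" "r < \<delta>2" "r < 1" "r \<ge> r0" using r0 n by (auto simp: r_def)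
          have "n / R \<le> r" by (simp add: r_def)
          then show "n \<le> r * R" using R(1) by (simp add: field_simps)
        qed
        have e: "0 \<le> e" "e \<le> 1" "r * e = \<epsilon> ^ m" using r r0 by (auto simp: e_def r0_def[symmetric])
        define x y z where "x = X $ 1 / r" and "y = X $ 2 / r" and "z = (X $ 3 - a - c * \<epsilon> * X $ 1) / r ^ d"
        have xyz: "r * x = X $ 1" "r * y = X $ 2" "r ^ d * z = X $ 3 - a - c * \<epsilon> * X $ 1"
          using r(1) by (auto simp: x_def y_def z_def)
        have Xf: "X = M r \<epsilon> *v chart_pt (x, y, z)"
          using X(1) xyz(3) by (simp add: sheet_matrix_mult vec_eq_iff forall_4 xyz(1,2) mult.assoc)
        have nr: "norm (x, y) = n / r"
        proof -
          have "n = norm (r *\<^sub>R (x, y))" by (simp add: n_def xyz)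
          then show ?thesis using r(1) by (simp only: norm_scaleR) simp
        qed
        then have nR: "norm (x, y) \<le> R" using r(1,5) by (simp only: pos_divide_le_eq mult.commute)
        have ab: "\<bar>X $ 1\<bar> \<le> n" "\<bar>X $ 2\<bar> \<le> n" using norm_fst_le[of "X $ 1" "X $ 2"] norm_snd_le[of "X $ 2" "X $ 1"] by (auto simp: n_def)
        have \<rho>\<delta>: "\<rho> < \<delta>" "\<bar>c\<bar> * \<rho> < \<delta>"
        proof -
          have "\<rho> + \<bar>c\<bar> * \<rho> < \<delta>" using \<rho>'(3) by (simp add: algebra_simps)
          moreover have "\<bar>c\<bar> * \<rho> \<ge> 0" using \<rho>(1) by simp
          ultimately show "\<rho> < \<delta>" "\<bar>c\<bar> * \<rho> < \<delta>" using \<rho>(1) by linarith+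
        qed
        have "\<bar>c * \<epsilon> * X $ 1\<bar> \<le> \<bar>c\<bar> * (1 * \<rho>)" unfolding abs_mult mult.assoc
          using \<epsilon> ab(1) n(2) by (intro mult_left_mono mult_mono) auto
        then have c1: "\<bar>c * \<epsilon> * r * x\<bar> < \<delta>" using \<rho>\<delta>(2) by (simp add: mult.assoc xyz(1))
        have "\<bar>z\<bar> \<le> C / \<mu>"
        proof (rule height_bound[OF \<mu>(1), of \<delta> \<epsilon> x y e r])
          show "\<bar>dird (axis 3 1, 0) Q (X, \<epsilon>)\<bar> > \<mu>" if "X $ 4 = 1" "\<bar>X $ 1\<bar> < \<delta>" "\<bar>X $ 2\<bar> < \<delta>" "\<bar>X $ 3 - a\<bar> < \<delta>" for X
            using \<mu>(3)[OF that] \<epsilon> by simp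
          show "\<bar>P (vec4 x y 0 1, (e, r, \<epsilon>))\<bar> \<le> C" by (rule C(2)[OF nR]) (use e r \<epsilon> in auto)
          show "Q (M r \<epsilon> *v vec4 x y z 1, \<epsilon>) = 0" using X(4) Xf by simp
          show "\<bar>r * x\<bar> < \<delta>" "\<bar>r * y\<bar> < \<delta>" unfolding xyz using ab n(2) \<rho>\<delta>(1) by linarith+
          show "\<bar>c * \<epsilon> * r * x + r ^ d * z\<bar> < \<delta>" unfolding xyz(3) using X(3) \<rho>\<delta>(1) by (simp add: xyz(1) mult.assoc)
        qed (use \<epsilon>(1) r(1) e(3) c1 in auto)
        then have z: "\<bar>z\<bar> \<le> Z" using Z(2) by simp
        have \<Psi>0: "\<Psi> ((x, y, z), (e, r, \<epsilon>)) = 0" and \<Phi>0: "\<Phi> ((x, y, z), (e, r, \<epsilon>)) = 0"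
          using X(4,5) zero_iff[OF \<epsilon>(1) r(1) e(3), of "(x, y, z)"] Xf by simp_all
        have "r = r0"
        proof (rule ccontr)
          assume "r \<noteq> r0"
          then have "r = n / R" by (auto simp: r_def max_def split: if_splits)
          then have "norm (x, y) = R" using nr r(1) R(1) by (auto simp: field_simps)
          then have "((x, y, z), e) \<in> S" using z e by (simp add: S_def)
          then have "(((x, y, z), e), (r, \<epsilon>)) \<in> W" using \<delta>2(2)[of r \<epsilon>] r \<epsilon> by auto
          then show False using \<Psi>0 by (simp add: W_def)
        qed
        then have "e = 1" using r0(1) by (simp add: e_def)
        then have "(x, y, z) \<in> ?C" using nR z \<Psi>0 \<Phi>0 \<open>r = r0\<close> by (simp add: zero_curve_def t)
        then show "X \<in> f ` ?C" using Xf \<open>r = r0\<close> unfolding f_def by blast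
      qed
      then have eq: "sheet_zeros Q a \<rho> \<epsilon> = f ` ?C" ..
      have inj: "inj_on f ?C"
      proof (rule inj_onI)
        fix p q assume "f p = f q"
        then have "M r0 \<epsilon> *v (chart_pt p - chart_pt q) = 0" by (simp add: f_def matrix_vector_mult_diff_distrib)
        then have "vec4 (fst p) (fst (snd p)) (snd (snd p)) 1 = chart_pt q"
          using r0(1) by (auto simp: sheet_matrix_mult vec_eq_iff forall_4)
        then show "p = q" by (simp add: vec_eq_iff forall_4 prod_eq_iff)
      qed
      have cf: "continuous_on ?C f"
      proof -
        have "(f has_derivative (\<lambda>v. M r0 \<epsilon> *v vec4 (fst v) (fst (snd v)) (snd (snd v)) 0)) (at p)" for p
          unfolding f_def by (rule bounded_linear.has_derivative[OF matrix_vector_mul_bounded_linear chart_pt_has_derivative])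
        then show ?thesis by (meson continuous_at_imp_continuous_on has_derivative_continuous)
      qed
      have "indep (\<lambda>X. Q (X, \<epsilon>)) (hess4 (\<lambda>X. Q (X, \<epsilon>))) X" if "X \<in> sheet_zeros Q a \<rho> \<epsilon>" for X
      proof -
        from that have "X \<in> f ` ?C" unfolding eq .
        then obtain p where p: "X = f p" "p \<in> ?C" by (rule imageE)
        from elim(3) p(2) have "dird ex3 \<Phi> (p, T \<epsilon>) * dird ex1 \<Psi> (p, T \<epsilon>) - dird ex1 \<Phi> (p, T \<epsilon>) * dird ex3 \<Psi> (p, T \<epsilon>) \<noteq> 0 \<or>
          dird ex3 \<Phi> (p, T \<epsilon>) * dird ex2 \<Psi> (p, T \<epsilon>) - dird ex2 \<Phi> (p, T \<epsilon>) * dird ex3 \<Psi> (p, T \<epsilon>) \<noteq> 0" by (rule bspec)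
        then show ?thesis unfolding p(1) f_def t by (elim disjE; intro indep_scale[OF e1])
      qed
      then show ?case using ovals_image[OF elim(2) cf inj] eq by simp
    qed
  qed
qed

end

text \<open>Hadamard's lemma along a direction: the quotient is again polynomial, jointly in x and
  t. Thus the rescaled surface, after division by r^d, extends polynomially to r = 0.\<close>

lemma difference_quotient:
  assumes "rpf h"
  shows "\<exists>g. rpf g \<and> (\<forall>x t. h (x + t *\<^sub>R v) = h x + t * g (x, t))"
  using assms
proof (induction h rule: real_polynomial_function.induct)
  case (linear f)
  then interpret bounded_linear f .
  show ?case by (rule exI[of _ "\<lambda>_. f v"]) (auto simp: add scaleR intro: rpf_intros)
next
  case (const c)
  show ?case by (rule exI[of _ "\<lambda>_. 0"]) (auto intro: rpf_intros)
next
  case (add f g)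
  then obtain f' g' where "rpf f'" "rpf g'"
    "\<forall>x t. f (x + t *\<^sub>R v) = f x + t * f' (x, t)" "\<forall>x t. g (x + t *\<^sub>R v) = g x + t * g' (x, t)" by blast
  then show ?case by (intro exI[of _ "\<lambda>q. f' q + g' q"]) (auto intro: rpf_basic simp: algebra_simps)
next
  case (mult f g)
  then obtain f' g' where fg: "rpf f'" "rpf g'"
    "\<forall>x t. f (x + t *\<^sub>R v) = f x + t * f' (x, t)" "\<forall>x t. g (x + t *\<^sub>R v) = g x + t * g' (x, t)" by blast
  have "rpf (\<lambda>q. f' q * g (fst q) + (f (fst q) + snd q * f' q) * g' q)"
    by (intro rpf_basic(2,3) fg rpf_comp[OF mult.hyps(1)] rpf_comp[OF mult.hyps(2)] rpf_intros)
  then show ?case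
    by (intro exI[of _ "\<lambda>q. f' q * g (fst q) + (f (fst q) + snd q * f' q) * g' q"]) (use fg in \<open>auto simp: algebra_simps\<close>)
qed

lemma difference_quotient_at_0:
  assumes "rpf h" "rpf g" "\<forall>x t. h (x + t *\<^sub>R v) = h x + t * g (x, t)"
  shows "g (x, 0) = dird v h x"
proof -
  have rg: "rpf (\<lambda>t. g (x, t))" by (rule rpf_slice2[OF assms(2)])
  have "dird 1 (\<lambda>t. h (x + t *\<^sub>R v)) 0 = dird v h x"
    by (rule dird_compose[OF assms(1), where g' = "\<lambda>h. h *\<^sub>R v"]) (auto intro!: derivative_eq_intros)
  moreover have "dird 1 (\<lambda>t. h x + t * g (x, t)) 0 = 1 * g (x, 0)"
    by (rule dirdI[where f' = "\<lambda>s. s * g (x, 0)"]) (auto intro!: derivative_eq_intros rpf_has_derivative[OF rg])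
  moreover have "(\<lambda>t. h (x + t *\<^sub>R v)) = (\<lambda>t. h x + t * g (x, t))" using assms(3) by blast
  ultimately show ?thesis by simp
qed

lemma homog_dird_line:
  fixes F :: "(real \<times> real) \<times> real \<Rightarrow> real"
  assumes F: "rpf F" "homog d F" and d: "d \<ge> 2"
  shows "dird v F ((w, b * w), 0) = w ^ (d - 1) * dird v F ((1, b), 0)"
proof -
  have h: "homog (d - 1) (dird v F)" using homog_dird'[of F "d - 1"] F d by simp
  show ?thesis
  proof (cases "w = 0")
    case True
    then show ?thesis using homog_0[OF h] d by (simp add: zero_prod_def)
  next
    case False
    then show ?thesis using homogD[OF h False, of "((1, b), 0)"] by (simp add: mult.commute)
  qed
qed

lemma homog_line:
  fixes F :: "(real \<times> real) \<times> real \<Rightarrow> real"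
  assumes F: "homog d F" and d: "d \<ge> 1" and 0: "F ((1, b), 0) = 0"
  shows "F ((w, b * w), 0) = 0"
proof (cases "w = 0")
  case True
  then show ?thesis using homog_0[OF F] d by (simp add: zero_prod_def)
next
  case False
  then show ?thesis using homogD[OF F False, of "((1, b), 0)"] 0 by (simp add: mult.commute)
qed

lemma dird_vertical:
  assumes A: "rpf A" and B: "rpf B"
  shows "dird (axis 3 1) (\<lambda>X::real^4. A (X $ 1, X $ 2) + B (X $ 4, X $ 3)) X = dird (0, 1) B (X $ 4, X $ 3)"
proof -
  define L where "L = (\<lambda>u::real^4. (u $ 1, u $ 2))"
  define M where "M = (\<lambda>u::real^4. (u $ 4, u $ 3))"
  have L: "bounded_linear L" and M: "bounded_linear M"
    unfolding L_def M_def by (intro bounded_linear_intros bounded_linear_vec_nth)+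
  have r: "rpf (\<lambda>u. f (L u))" "rpf (\<lambda>u. f (M u))" if "rpf f" for f
    by (rule rpf_comp[OF that] polynomial_function_bounded_linear L M)+
  have "dird v (\<lambda>X. A (L X) + B (M X)) X = dird (L v) A (L X) + dird (M v) B (M X)" for v
    unfolding dird_add[OF r(1)[OF A] r(2)[OF B]] dird_linear_comp[OF A L] dird_linear_comp[OF B M] ..
  moreover have "L (axis 3 1) = 0" "M (axis 3 1) = (0, 1)" by (simp_all add: L_def M_def axis_def zero_prod_def)
  ultimately show ?thesis using dird_zero_dir[OF A] by (simp add: L_def M_def)
qed

text \<open>Reversal exchanges the pairs (x, y) and (w, z), so that the flat points over the roots
  of \<open>F\<close> also take the shape (0, 0, b, 1).\<close>

definition rev4 :: "real ^ 4 \<Rightarrow> real ^ 4" where "rev4 v = vec4 (v $ 4) (v $ 3) (v $ 2) (v $ 1)"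

lemma rev4_nth [simp]: "rev4 v $ 1 = v $ 4" "rev4 v $ 2 = v $ 3" "rev4 v $ 3 = v $ 2" "rev4 v $ 4 = v $ 1"
  by (simp_all add: rev4_def)

lemma rev4_rev4 [simp]: "rev4 (rev4 v) = v"
  by (simp add: vec_eq_iff forall_4)

lemma bounded_linear_rev4: "bounded_linear rev4"
  unfolding linear_conv_bounded_linear[symmetric] by (rule linearI) (simp_all add: vec_eq_iff forall_4)

lemma rev4_matrix: "rev4 v = (\<chi> i. if i = 1 then vec4 0 0 0 1 else if i = 2 then vec4 0 0 1 0
     else if i = 3 then vec4 0 1 0 0 else vec4 1 0 0 0) *v v"
  by (simp add: vec_eq_iff forall_4 matrix_vector_mult_def sum_4)

lemma hess4_rev4: "rpf f \<Longrightarrow> hess4 (\<lambda>v. f (rev4 v)) = (\<lambda>v. hess4 f (rev4 v))"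
  unfolding rev4_matrix by (rule ext) (simp add: hess4_linear det_4)

lemma indep_rev4:
  assumes "rpf f" "indep (\<lambda>v. f (rev4 v)) (hess4 (\<lambda>v. f (rev4 v))) x"
  shows "indep f (hess4 f) (rev4 x)"
proof -
  obtain v w where "dird (rev4 v) f (rev4 x) * dird (rev4 w) (hess4 f) (rev4 x) - dird (rev4 w) f (rev4 x) * dird (rev4 v) (hess4 f) (rev4 x) \<noteq> 0"
    using assms(2) unfolding hess4_rev4[OF assms(1)] indep_def dird_linear_comp[OF assms(1) bounded_linear_rev4]
      dird_linear_comp[OF rpf_hess4[OF assms(1)] bounded_linear_rev4] by (elim exE) (rule that)
  then show ?thesis unfolding indep_def by (intro exI)
qed

lemma indep_scaleR:
  assumes f: "rpf f" "homog m f" and g: "rpf g" "homog n g" and t: "t \<noteq> 0" and i: "indep f g x"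
  shows "indep f g (t *\<^sub>R x)"
proof -
  obtain v w where vw: "dird v f x * dird w g x - dird w f x * dird v g x \<noteq> 0" using i unfolding indep_def by blast
  have "t * dird v f (t *\<^sub>R x) * (t * dird w g (t *\<^sub>R x)) - t * dird w f (t *\<^sub>R x) * (t * dird v g (t *\<^sub>R x))
     = t ^ m * t ^ n * (dird v f x * dird w g x - dird w f x * dird v g x)"
    unfolding homog_dird[OF f t] homog_dird[OF g t] by (simp add: algebra_simps)
  also have "\<dots> \<noteq> 0" using t vw by simp
  finally show ?thesis unfolding indep_def by (intro exI[of _ v] exI[of _ w]) (auto simp: algebra_simps)
qed

section \<open>Local models at the flat points over the roots of the two forms\<close>

locale form_pair =
  fixes F G :: "(real \<times> real) \<times> real \<Rightarrow> real" and d NF NG :: nat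
  assumes d: "d \<ge> 3" and F: "good d NF F" and G: "good d NG G" and sF: "splits F"
    and F01: "F ((0, 1), 0) \<noteq> 0" and G01: "G ((0, 1), 0) \<noteq> 0"
    and rF: "card {s. F ((1, s), 0) = 0} = d" and rG: "card {s. G ((1, s), 0) = 0} = d"
    and simpleF: "\<And>s. F ((1, s), 0) = 0 \<Longrightarrow> dird ((0, 1), 0) F ((1, s), 0) \<noteq> 0"
    and simpleG: "\<And>s. G ((1, s), 0) = 0 \<Longrightarrow> dird ((0, 1), 0) G ((1, s), 0) \<noteq> 0"
begin

definition Q :: "(real ^ 4) \<times> real \<Rightarrow> real" where
  "Q q = F ((fst q $ 1, fst q $ 2), snd q * fst q $ 4) + G ((fst q $ 4, fst q $ 3), snd q ^ d * fst q $ 1)"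

definition Q' :: "(real ^ 4) \<times> real \<Rightarrow> real" where "Q' q = Q (rev4 (fst q), snd q)"

lemmas F' = goodD[OF F] and G' = goodD[OF G]

lemma rpf_Q: "rpf Q" "rpf Q'"
proof -
  show "rpf Q" unfolding Q_def[abs_def]
    by (intro rpf_basic(2) rpf_comp[OF F'(1)] rpf_comp[OF G'(1)] rpf_intros)
  then show "rpf Q'" unfolding Q'_def[abs_def] rev4_def by (rule rpf_comp) (intro rpf_intros)
qed

lemma Q_limit: "Q (X, 0) = F ((X $ 1, X $ 2), 0) + G ((X $ 4, X $ 3), 0)"
  and Q'_limit: "Q' (X, 0) = G ((X $ 1, X $ 2), 0) + F ((X $ 4, X $ 3), 0)"
proof -
  have z: "(0::real) ^ d = 0" using d by (simp add: power_0_left)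
  show "Q (X, 0) = F ((X $ 1, X $ 2), 0) + G ((X $ 4, X $ 3), 0)"
    and "Q' (X, 0) = G ((X $ 1, X $ 2), 0) + F ((X $ 4, X $ 3), 0)"
    unfolding Q_def Q'_def fst_conv snd_conv z by simp_all
qed

lemma vertical:
  "dird (axis 3 1, 0) Q (X, 0) = dird ((0, 1), 0) G ((X $ 4, X $ 3), 0)"
  "dird (axis 3 1, 0) Q' (X, 0) = dird ((0, 1), 0) F ((X $ 4, X $ 3), 0)"
proof -
  have "dird (axis 3 1, 0) Q (X, 0) = dird (axis 3 1) (\<lambda>X. Q (X, 0)) X" by (simp add: dird_slice[OF rpf_Q(1)])
  also have "\<dots> = dird (0, 1) (\<lambda>p. G (p, 0)) (X $ 4, X $ 3)" unfolding Q_limit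
    by (rule dird_vertical[OF rpf_slice[OF F'(1)] rpf_slice[OF G'(1)]])
  finally show "dird (axis 3 1, 0) Q (X, 0) = dird ((0, 1), 0) G ((X $ 4, X $ 3), 0)" by (simp add: dird_slice[OF G'(1)])
  have "dird (axis 3 1, 0) Q' (X, 0) = dird (axis 3 1) (\<lambda>X. Q' (X, 0)) X" by (simp add: dird_slice[OF rpf_Q(2)])
  also have "\<dots> = dird (0, 1) (\<lambda>p. F (p, 0)) (X $ 4, X $ 3)" unfolding Q'_limit
    by (rule dird_vertical[OF rpf_slice[OF G'(1)] rpf_slice[OF F'(1)]])
  finally show "dird (axis 3 1, 0) Q' (X, 0) = dird ((0, 1), 0) F ((X $ 4, X $ 3), 0)" by (simp add: dird_slice[OF F'(1)])
qed

text \<open>As r e = \<epsilon>, the perturbation of \<open>G\<close> is \<epsilon>^d r x = r^d (r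
  e^d x); after division by r^d a factor r remains and it vanishes in the limit. What survives of
  \<open>G\<close> is its linear term at the root, with coefficient \<kappa>. The quotients
  \<open>g1\<close> and \<open>g2\<close> of \<open>G\<close> in its second and third variable
  express both facts polynomially.\<close>

lemma sheet_G:
  assumes a: "G ((1, a), 0) = 0"
  shows "\<exists>P \<kappa>. sheet Q P a 0 \<kappa> 1 d NF F"
proof -
  obtain g1 where g1: "rpf g1" "\<forall>x t. G (x + t *\<^sub>R ((0, 1), 0)) = G x + t * g1 (x, t)"
    using difference_quotient[OF G'(1)] by blast
  obtain g2 where g2: "rpf g2" "\<forall>x t. G (x + t *\<^sub>R (0, 1)) = G x + t * g2 (x, t)"
    using difference_quotient[OF G'(1)] by blast
  define \<kappa> where "\<kappa> = dird ((0, 1), 0) G ((1, a), 0)"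
  define P where "P = (\<lambda>q::(real^4) \<times> real \<times> real \<times> real. let u = fst q; e = fst (snd q); r = fst (snd (snd q)); \<epsilon> = snd (snd (snd q)) in
    u $ 3 * g1 (((u $ 4, a * u $ 4), 0), r ^ d * u $ 3)
    + r * e ^ d * u $ 1 * g2 (((u $ 4, a * u $ 4 + r ^ d * u $ 3), 0), \<epsilon> ^ d * (r * u $ 1)) + F ((u $ 1, u $ 2), e * u $ 4))"
  have "sheet Q P a 0 \<kappa> 1 d NF F"
  proof (unfold_locales)
    show "rpf P" unfolding P_def Let_def
      by (intro rpf_basic(2,3) rpf_comp[OF F'(1)] rpf_comp[OF g1(1)] rpf_comp[OF g2(1)] rpf_intros)
    show "Q (sheet_matrix d a r (0 * \<epsilon>) *v u, \<epsilon>) = r ^ d * P (u, (e, r, \<epsilon>))" if h: "\<epsilon> > 0" "r > 0" "r * e = \<epsilon> ^ 1" for u e r \<epsilon>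
    proof -
      have e: "\<epsilon> = r * e" using h by simp
      have 1: "F ((r * u $ 1, r * u $ 2), \<epsilon> * u $ 4) = r ^ d * F ((u $ 1, u $ 2), e * u $ 4)"
        using homogD[OF F'(2), of r "((u $ 1, u $ 2), e * u $ 4)"] h(2) by (simp add: e mult.assoc)
      have "G ((u $ 4, r ^ d * u $ 3 + a * u $ 4), \<epsilon> ^ d * (r * u $ 1))
          = G ((u $ 4, a * u $ 4 + r ^ d * u $ 3), 0) + \<epsilon> ^ d * (r * u $ 1) * g2 (((u $ 4, a * u $ 4 + r ^ d * u $ 3), 0), \<epsilon> ^ d * (r * u $ 1))"
        using g2(2)[rule_format, of "((u $ 4, a * u $ 4 + r ^ d * u $ 3), 0)" "\<epsilon> ^ d * (r * u $ 1)"] by (simp add: add.commute)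
      also have "G ((u $ 4, a * u $ 4 + r ^ d * u $ 3), 0) = r ^ d * u $ 3 * g1 (((u $ 4, a * u $ 4), 0), r ^ d * u $ 3)"
        using g1(2)[rule_format, of "((u $ 4, a * u $ 4), 0)" "r ^ d * u $ 3"] homog_line[OF G'(2) _ a, of "u $ 4"] d by simp
      finally show ?thesis
        unfolding Q_def P_def sheet_matrix_mult Let_def using 1 by (simp add: e power_mult_distrib distrib_left mult.assoc)
    qed
    show "P (u, (e, 0, 0)) = \<kappa> * u $ 3 * u $ 4 ^ (d - 1) + F ((u $ 1, u $ 2), e * u $ 4)" for u e
    proof -
      have z: "(0::real) ^ d = 0" using d by (simp add: power_0_left)
      have "g1 (((u $ 4, a * u $ 4), 0), 0) = u $ 4 ^ (d - 1) * \<kappa>"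
        unfolding \<kappa>_def difference_quotient_at_0[OF G'(1) g1] by (rule homog_dird_line[OF G'(1,2)]) (use d in simp)
      then show ?thesis unfolding P_def Let_def fst_conv snd_conv z mult_zero_left mult_zero_right by simp
    qed
    show "\<kappa> \<noteq> 0" unfolding \<kappa>_def by (rule simpleG[OF a])
    then show "dird (axis 3 1, 0) Q (vec4 0 0 a 1, 0) \<noteq> 0" by (simp add: vertical \<kappa>_def)
  qed (use rpf_Q F d in auto)
  then show ?thesis by blast
qed

text \<open>Here r e = \<epsilon>^d, and at e = 1 the perturbation \<epsilon> r x of
  \<open>F\<close> dominates r^d. The linear factor of \<open>F\<close> at the root absorbs it: the
  shear with c = - \<gamma> / \<beta> turns this factor into exactly r^d \<beta> z, so that r^d
  divides without remainder. This is where \<open>splits\<close> is needed.\<close>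

lemma sheet_F:
  assumes b: "F ((1, b), 0) = 0"
  shows "\<exists>P c \<kappa>. sheet Q' P b c \<kappa> d d NG G"
proof -
  obtain \<alpha> \<beta> \<gamma> H where H: "rpf H" "\<And>x y e. F ((x, y), e) = (\<alpha> * x + \<beta> * y + \<gamma> * e) * H ((x, y), e)" "\<alpha> + \<beta> * b = 0"
  proof -
    have "(1, b) \<noteq> (0 :: real \<times> real)" by (simp add: zero_prod_def)
    from sF[unfolded splits_def, rule_format, OF this b] show ?thesis by (elim exE conjE) (rule that, auto)
  qed
  have \<beta>: "\<beta> \<noteq> 0" using H(3) F01 H(2)[of 0 1 0] by auto
  define c where "c = - \<gamma> / \<beta>"
  define \<kappa> where "\<kappa> = dird ((0, 1), 0) F ((1, b), 0)"
  have slope: "\<beta> * H ((w, b * w), 0) = w ^ (d - 1) * \<kappa>" for w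
  proof -
    have bl: "bounded_linear (\<lambda>q::(real \<times> real) \<times> real. \<alpha> * fst (fst q) + \<beta> * snd (fst q) + \<gamma> * snd q)"
      by (intro bounded_linear_intros)
    have "F = (\<lambda>q. (\<alpha> * fst (fst q) + \<beta> * snd (fst q) + \<gamma> * snd q) * H q)" by (auto simp: fun_eq_iff H(2))
    then have "dird ((0, 1), 0) F ((w, b * w), 0) = dird ((0, 1), 0) (\<lambda>q. (\<alpha> * fst (fst q) + \<beta> * snd (fst q) + \<gamma> * snd q) * H q) ((w, b * w), 0)"
      by simp
    also have "\<dots> = (\<alpha> + \<beta> * b) * w * dird ((0, 1), 0) H ((w, b * w), 0) + \<beta> * H ((w, b * w), 0)"
      by (subst dird_mult[OF real_polynomial_function.intros(1)[OF bl] H(1)]) (simp only: dird_linear[OF bl], simp add: algebra_simps)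
    finally show ?thesis using homog_dird_line[OF F'(1,2), of "((0, 1), 0)" w b] d by (simp add: H(3) \<kappa>_def)
  qed
  define P where "P = (\<lambda>q::(real^4) \<times> real \<times> real \<times> real. let u = fst q; e = fst (snd q); r = fst (snd (snd q)); \<epsilon> = snd (snd (snd q)) in
    \<beta> * u $ 3 * H ((u $ 4, c * \<epsilon> * r * u $ 1 + r ^ d * u $ 3 + b * u $ 4), \<epsilon> * (r * u $ 1)) + G ((u $ 1, u $ 2), e * u $ 4))"
  have "sheet Q' P b c \<kappa> d d NG G"
  proof (unfold_locales)
    show "rpf P" unfolding P_def Let_def
      by (intro rpf_basic(2,3) rpf_comp[OF G'(1)] rpf_comp[OF H(1)] rpf_intros)
    show "Q' (sheet_matrix d b r (c * \<epsilon>) *v u, \<epsilon>) = r ^ d * P (u, (e, r, \<epsilon>))" if h: "\<epsilon> > 0" "r > 0" "r * e = \<epsilon> ^ d" for u e r \<epsilon>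
    proof -
      have 1: "G ((r * u $ 1, r * u $ 2), \<epsilon> ^ d * u $ 4) = r ^ d * G ((u $ 1, u $ 2), e * u $ 4)"
        using homogD[OF G'(2), of r "((u $ 1, u $ 2), e * u $ 4)"] h by (simp flip: mult.assoc)
      have \<alpha>: "\<alpha> = - (\<beta> * b)" using H(3) by simp
      have \<gamma>: "\<gamma> = - (\<beta> * c)" using \<beta> by (simp add: c_def)
      have "\<alpha> * u $ 4 + \<beta> * (c * \<epsilon> * r * u $ 1 + r ^ d * u $ 3 + b * u $ 4) + \<gamma> * (\<epsilon> * (r * u $ 1)) = r ^ d * (\<beta> * u $ 3)"
        unfolding \<alpha> \<gamma> by (simp add: algebra_simps)
      then have "F ((u $ 4, c * \<epsilon> * r * u $ 1 + r ^ d * u $ 3 + b * u $ 4), \<epsilon> * (r * u $ 1))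
        = r ^ d * (\<beta> * u $ 3 * H ((u $ 4, c * \<epsilon> * r * u $ 1 + r ^ d * u $ 3 + b * u $ 4), \<epsilon> * (r * u $ 1)))"
        unfolding H(2) by simp
      then show ?thesis using 1 by (simp add: Q'_def Q_def P_def sheet_matrix_mult distrib_left)
    qed
    show "P (u, (e, 0, 0)) = \<kappa> * u $ 3 * u $ 4 ^ (d - 1) + G ((u $ 1, u $ 2), e * u $ 4)" for u e
    proof -
      have z: "(0::real) ^ d = 0" using d by (simp add: power_0_left)
      have "\<beta> * u $ 3 * H ((u $ 4, b * u $ 4), 0) = u $ 3 * (\<beta> * H ((u $ 4, b * u $ 4), 0))" by simp
      then show ?thesis unfolding P_def Let_def fst_conv snd_conv z mult_zero_left mult_zero_right add_0_left slope by (simp add: mult.commute)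
    qed
    show "\<kappa> \<noteq> 0" unfolding \<kappa>_def by (rule simpleF[OF b])
    then show "dird (axis 3 1, 0) Q' (vec4 0 0 b 1, 0) \<noteq> 0" by (simp add: vertical \<kappa>_def)
  qed (use rpf_Q G d in auto)
  then show ?thesis by blast
qed

end

section \<open>The perturbed surface\<close>

lemma finite_positive_lower_bound:
  fixes f :: "'a \<Rightarrow> real"
  assumes "finite A" "\<And>x. x \<in> A \<Longrightarrow> f x > 0"
  obtains \<rho> where "\<rho> > 0" "\<And>x. x \<in> A \<Longrightarrow> \<rho> \<le> f x"
proof (rule that[of "Min (insert 1 (f ` A))"])
  show "Min (insert 1 (f ` A)) > 0" using assms by (subst Min_gr_iff) auto
qed (use assms(1) in auto)

lemma separated_finite:
  fixes A :: "real set"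
  assumes "finite A"
  shows "\<exists>\<rho>>0. \<forall>a\<in>A. \<forall>b\<in>A. a \<noteq> b \<longrightarrow> \<rho> \<le> \<bar>a - b\<bar>"
proof -
  have f: "finite {p \<in> A \<times> A. fst p \<noteq> snd p}" using assms by simp
  obtain \<rho> where \<rho>: "\<rho> > 0" "\<And>p. p \<in> {p \<in> A \<times> A. fst p \<noteq> snd p} \<Longrightarrow> \<rho> \<le> \<bar>fst p - snd p\<bar>"
    by (rule finite_positive_lower_bound[OF f, of "\<lambda>p. \<bar>fst p - snd p\<bar>"]) auto
  show ?thesis
  proof (intro exI[of _ \<rho>] conjI ballI impI \<rho>(1))
    fix a b assume "a \<in> A" "b \<in> A" "a \<noteq> b"
    then show "\<rho> \<le> \<bar>a - b\<bar>" using \<rho>(2)[of "(a, b)"] by simp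
  qed
qed

text \<open>The homogeneous form of the chart neighbourhood in \<open>sheet_zeros\<close>: the cone
  over a neighbourhood of (0, 0, a, 1).\<close>

definition root_cone :: "real \<Rightarrow> real \<Rightarrow> (real ^ 4) set" where
  "root_cone a \<rho> = {X. norm (X $ 1, X $ 2) < \<rho> * \<bar>X $ 4\<bar> \<and> \<bar>X $ 3 - a * X $ 4\<bar> < \<rho> * \<bar>X $ 4\<bar>}"

lemma open_cone: "open (root_cone a \<rho>)"
  unfolding root_cone_def by (intro open_Collect_conj open_Collect_less continuous_intros)

lemma cone_scaleR:
  assumes "X \<in> root_cone a \<rho>" "t \<noteq> 0" shows "t *\<^sub>R X \<in> root_cone a \<rho>"
proof -
  have t: "\<bar>t\<bar> > 0" using assms(2) by simp
  have "norm (t * X $ 1, t * X $ 2) = \<bar>t\<bar> * norm (X $ 1, X $ 2)" using norm_scaleR[of t "(X $ 1, X $ 2)"] by simp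
  moreover have "\<bar>t * X $ 3 - a * (t * X $ 4)\<bar> = \<bar>t\<bar> * \<bar>X $ 3 - a * X $ 4\<bar>"
    by (simp add: algebra_simps flip: abs_mult)
  ultimately show ?thesis using assms(1) t unfolding root_cone_def by (simp add: abs_mult mult.left_commute)
qed

lemma cone_nonzero: "X \<in> root_cone a \<rho> \<Longrightarrow> X $ 4 \<noteq> 0"
  unfolding root_cone_def by (auto dest: le_less_trans[OF norm_ge_zero])

lemma sheet_zeros_cone: "X \<in> sheet_zeros Q a \<rho> \<epsilon> \<longleftrightarrow> X \<in> root_cone a \<rho> \<and> X $ 4 = 1 \<and> Q (X, \<epsilon>) = 0 \<and> hessq Q (X, \<epsilon>) = 0"
  unfolding sheet_zeros_def root_cone_def by auto

lemma cone_rev4_disjoint: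
  assumes "\<rho> < 1" "X \<in> root_cone a \<rho>" "rev4 X \<in> root_cone b \<rho>" shows False
proof -
  have n: "\<bar>X $ 1\<bar> \<le> norm (X $ 1, X $ 2)" "\<bar>X $ 4\<bar> \<le> norm (X $ 4, X $ 3)"
    using norm_fst_le[of "X $ 1" "X $ 2"] norm_fst_le[of "X $ 4" "X $ 3"] by simp_all
  have l: "\<bar>X $ 1\<bar> < \<rho> * \<bar>X $ 4\<bar>" "\<bar>X $ 4\<bar> < \<rho> * \<bar>X $ 1\<bar>" using assms(2,3) n unfolding root_cone_def by auto
  have "\<rho> * \<bar>X $ 4\<bar> \<le> 1 * \<bar>X $ 4\<bar>" "\<rho> * \<bar>X $ 1\<bar> \<le> 1 * \<bar>X $ 1\<bar>" using assms(1) by (intro mult_right_mono; simp)+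
  then show False using l by linarith
qed

lemma span_singleton_eq:
  assumes "span {x} = span {y}" "x \<noteq> (0 :: 'a::real_vector)" "y \<noteq> 0" obtains t where "t \<noteq> 0" "y = t *\<^sub>R x"
proof -
  have "y \<in> span {x}" using assms(1) span_base[of y "{y}"] by simp
  then obtain t where "y = t *\<^sub>R x" by (auto simp: span_singleton)
  then show ?thesis using that assms(3) by auto
qed

lemma span_scaleR: "t \<noteq> 0 \<Longrightarrow> span {t *\<^sub>R x} = span {x}" for x :: "'a::real_vector"
  by (rule span_image_scale[of "{x}" "\<lambda>_. t", simplified]) auto

definition good_sheet :: "((real ^ 4) \<times> real \<Rightarrow> real) \<Rightarrow> nat \<Rightarrow> real \<Rightarrow> real \<Rightarrow> real \<Rightarrow> bool" where
  "good_sheet Q N a \<rho> \<epsilon> \<longleftrightarrow> ovals N (sheet_zeros Q a \<rho> \<epsilon>) \<and>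
    (\<forall>X\<in>sheet_zeros Q a \<rho> \<epsilon>. indep (\<lambda>X. Q (X, \<epsilon>)) (hess4 (\<lambda>X. Q (X, \<epsilon>))) X)"

text \<open>\<open>C\<close> contains one nonzero vector on each line of the parabolic curve, a
  compact section over it; so components can be counted in the vector space.\<close>

definition has_curve :: "nat \<Rightarrow> nat \<Rightarrow> (real ^ 4 \<Rightarrow> real) \<Rightarrow> (real ^ 4) set \<Rightarrow> bool" where
  "has_curve d N f C \<longleftrightarrow> rpf f \<and> homog d f \<and> (\<exists>x. f x \<noteq> 0) \<and> ovals N C \<and> 0 \<notin> C \<and> inj_on (\<lambda>x. span {x}) C \<and>
    (\<lambda>x. span {x}) ` C = {span {x} | x. x \<noteq> 0 \<and> f x = 0 \<and> hess4 f x = 0} \<and>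
    (\<forall>x. x \<noteq> 0 \<longrightarrow> f x = 0 \<longrightarrow> hess4 f x = 0 \<longrightarrow> indep f (hess4 f) x)"

context form_pair
begin

abbreviation "RF \<equiv> {s. F ((1, s), 0) = 0}"
abbreviation "RG \<equiv> {s. G ((1, s), 0) = 0}"

lemma finite_roots: "finite RF" "finite RG"
  by (rule card_ge_0_finite; use rF rG d in simp)+

lemma hessq_Q_limit: "hessq Q (X, 0) = hessp F ((X $ 1, X $ 2), 0) * hessp G ((X $ 4, X $ 3), 0)"
proof -
  have "hessq Q (X, 0) = hess4 (\<lambda>X. Q (X, 0)) X" by (simp add: hess4_slice[OF rpf_Q(1)])
  also have "\<dots> = hess2 (\<lambda>p. F (p, 0)) (X $ 1, X $ 2) * hess2 (\<lambda>p. G (p, 0)) (X $ 4, X $ 3)"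
    unfolding Q_limit by (rule hess4_blocks[OF rpf_slice[OF F'(1)] rpf_slice[OF G'(1)]])
  finally show ?thesis by (simp add: hess2_slice[OF F'(1)] hess2_slice[OF G'(1)])
qed

lemma hessq_Q': "hessq Q' (X, \<epsilon>) = hessq Q (rev4 X, \<epsilon>)"
proof -
  have "hessq Q' (X, \<epsilon>) = hess4 (\<lambda>X. Q' (X, \<epsilon>)) X" by (simp add: hess4_slice[OF rpf_Q(2)])
  also have "\<dots> = hess4 (\<lambda>X. Q (rev4 X, \<epsilon>)) X" by (simp add: Q'_def)
  also have "\<dots> = hess4 (\<lambda>X. Q (X, \<epsilon>)) (rev4 X)" by (simp add: hess4_rev4[OF rpf_slice[OF rpf_Q(1)]])
  finally show ?thesis by (simp add: hess4_slice[OF rpf_Q(1)])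
qed

lemma root_of_zero:
  assumes H: "homog d H" and H01: "H ((0, 1), 0) \<noteq> 0" and 0: "H ((x, y), 0) = 0" and nz: "(x, y) \<noteq> (0::real \<times> real)"
  shows "x \<noteq> 0 \<and> H ((1, y / x), 0) = 0"
proof -
  have "x \<noteq> 0"
  proof
    assume x: "x = 0"
    then have y: "y \<noteq> 0" using nz by (auto simp: zero_prod_def)
    have "H (y *\<^sub>R ((0, 1), 0)) = y ^ d * H ((0, 1), 0)" by (rule homogD[OF H y])
    then show False using x y 0 H01 by simp
  qed
  moreover have "H (x *\<^sub>R ((1, y / x), 0)) = x ^ d * H ((1, y / x), 0)" using calculation by (rule homogD[OF H])
  ultimately show ?thesis using 0 by simp
qed

lemma flat_points:
  assumes X: "X \<noteq> 0" and 0: "Q (X, 0) = 0" "hessq Q (X, 0) = 0" and \<rho>: "\<rho> > 0"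
  shows "(\<exists>a\<in>RG. X \<in> root_cone a \<rho>) \<or> (\<exists>b\<in>RF. rev4 X \<in> root_cone b \<rho>)"
proof -
  have nz: "(X $ 1, X $ 2) \<noteq> 0 \<or> (X $ 4, X $ 3) \<noteq> 0" using X by (auto simp: vec_eq_iff forall_4 zero_prod_def)
  have "hessp F ((X $ 1, X $ 2), 0) = 0 \<or> hessp G ((X $ 4, X $ 3), 0) = 0" using 0(2) by (simp add: hessq_Q_limit)
  then have z: "(X $ 1, X $ 2) = 0 \<or> (X $ 4, X $ 3) = 0" using F'(3) G'(3) by (metis less_irrefl)
  have hz: "H (0, 0) = 0" if "homog d H" for H :: "(real \<times> real) \<times> real \<Rightarrow> real" using homog_0[OF that] d by (simp add: zero_prod_def)
  from z show ?thesis
  proof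
    assume z: "(X $ 1, X $ 2) = 0"
    then have "G ((X $ 4, X $ 3), 0) = 0" using 0(1) hz[OF F'(2)] by (simp add: Q_limit)
    then have g: "X $ 4 \<noteq> 0 \<and> G ((1, X $ 3 / X $ 4), 0) = 0" using nz z by (intro root_of_zero[OF G'(2) G01]) auto
    then have "X \<in> root_cone (X $ 3 / X $ 4) \<rho>" using z \<rho> by (simp add: root_cone_def)
    then show ?thesis using g by blast
  next
    assume z: "(X $ 4, X $ 3) = 0"
    then have "F ((X $ 1, X $ 2), 0) = 0" using 0(1) hz[OF G'(2)] by (simp add: Q_limit)
    then have g: "X $ 1 \<noteq> 0 \<and> F ((1, X $ 2 / X $ 1), 0) = 0" using nz z by (intro root_of_zero[OF F'(2) F01]) auto
    then have "rev4 X \<in> root_cone (X $ 2 / X $ 1) \<rho>" using z \<rho> by (simp add: root_cone_def)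
    then show ?thesis using g by blast
  qed
qed

lemma Q_homog: "homog d (\<lambda>X. Q (X, \<epsilon>))"
  unfolding homog_def
proof (intro allI impI)
  fix t :: real and X :: "real ^ 4" assume t: "t \<noteq> 0"
  show "Q (t *\<^sub>R X, \<epsilon>) = t ^ d * Q (X, \<epsilon>)"
    using homogD[OF F'(2) t, of "((X $ 1, X $ 2), \<epsilon> * X $ 4)"] homogD[OF G'(2) t, of "((X $ 4, X $ 3), \<epsilon> ^ d * X $ 1)"]
    by (simp add: Q_def algebra_simps)
qed

text \<open>The unit sphere without the cones is compact and contains no parabolic point of the
  surface at \<epsilon> = 0, hence none for small \<epsilon>; homogeneity extends this to all
  nonzero vectors.\<close>

lemma eventually_zeros_in_cones:
  assumes \<rho>: "\<rho> > 0"
  shows "eventually (\<lambda>\<epsilon>. \<forall>X. X \<noteq> 0 \<longrightarrow> Q (X, \<epsilon>) = 0 \<longrightarrow> hessq Q (X, \<epsilon>) = 0 \<longrightarrow>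
     (\<exists>a\<in>RG. X \<in> root_cone a \<rho>) \<or> (\<exists>b\<in>RF. rev4 X \<in> root_cone b \<rho>)) (nhds 0)"
proof -
  define U where "U = (\<Union>a\<in>RG. root_cone a \<rho>) \<union> (\<Union>b\<in>RF. rev4 -` root_cone b \<rho>)"
  have oU: "open U" unfolding U_def
    by (intro open_Un open_UN ballI open_cone open_vimage linear_continuous_on bounded_linear_rev4)
  define S where "S = sphere (0::real^4) 1 - U"
  have cS: "compact S" unfolding S_def by (intro compact_diff compact_sphere oU)
  define W where "W = {q. Q q \<noteq> 0 \<or> hessq Q q \<noteq> 0}"
  have oW: "open W" unfolding W_def
    by (intro open_Collect_disj open_Collect_neq rpf_cont rpf_Q rpf_hessq continuous_on_const)
  have "(X, 0) \<in> W" if "X \<in> S" for X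
  proof (rule ccontr)
    assume "(X, 0) \<notin> W"
    then have "(\<exists>a\<in>RG. X \<in> root_cone a \<rho>) \<or> (\<exists>b\<in>RF. rev4 X \<in> root_cone b \<rho>)"
      using that by (intro flat_points \<rho>) (auto simp: W_def S_def)
    then have "X \<in> U" by (auto simp: U_def)
    then show False using that by (simp add: S_def)
  qed
  then have "eventually (\<lambda>\<epsilon>. \<forall>p\<in>S. (p, \<epsilon>) \<in> W) (nhds 0)" by (rule eventually_tube[OF cS oW])
  then show ?thesis
  proof eventually_elim
    case (elim \<epsilon>)
    show ?case
    proof (intro allI impI)
      fix X :: "real ^ 4" assume X: "X \<noteq> 0" "Q (X, \<epsilon>) = 0" "hessq Q (X, \<epsilon>) = 0"
      define t where "t = 1 / norm X"
      have t: "t \<noteq> 0" using X(1) by (simp add: t_def)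
      have "Q (t *\<^sub>R X, \<epsilon>) = 0" using homogD[OF Q_homog t] X(2) by simp
      moreover have "hessq Q (t *\<^sub>R X, \<epsilon>) = 0"
        using homogD[OF hess4_homog[OF rpf_slice[OF rpf_Q(1)] Q_homog] t, of \<epsilon> X] X(3) d by (simp add: hess4_slice[OF rpf_Q(1)])
      ultimately have "(t *\<^sub>R X, \<epsilon>) \<notin> W" by (simp add: W_def)
      then have "t *\<^sub>R X \<notin> S" using elim by blast
      moreover have "norm (t *\<^sub>R X) = 1" using X(1) by (simp add: t_def)
      ultimately have "t *\<^sub>R X \<in> U" by (simp add: S_def)
      then show "(\<exists>a\<in>RG. X \<in> root_cone a \<rho>) \<or> (\<exists>b\<in>RF. rev4 X \<in> root_cone b \<rho>)" unfolding U_def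
      proof (elim UnE UN_E)
        fix a assume "a \<in> RG" "t *\<^sub>R X \<in> root_cone a \<rho>"
        then show ?thesis using cone_scaleR[of "t *\<^sub>R X" a \<rho> "1 / t"] t by (intro disjI1 bexI[of _ a]) auto
      next
        fix b assume b: "b \<in> RF" "t *\<^sub>R X \<in> rev4 -` root_cone b \<rho>"
        have "rev4 ((1 / t) *\<^sub>R (t *\<^sub>R X)) = (1 / t) *\<^sub>R rev4 (t *\<^sub>R X)"
          by (rule linear_cmul[OF bounded_linear.linear[OF bounded_linear_rev4]])
        then have "rev4 X \<in> root_cone b \<rho>"
          using cone_scaleR[of "rev4 (t *\<^sub>R X)" b \<rho> "1 / t"] t b(2) by simp
        then show ?thesis using b(1) by (intro disjI2 bexI[of _ b])
      qed
    qed
  qed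
qed

lemma eventually_good_sheets:
  "\<exists>\<rho>0>0. \<forall>\<rho>. 0 < \<rho> \<longrightarrow> \<rho> \<le> \<rho>0 \<longrightarrow>
    eventually (\<lambda>\<epsilon>. (\<forall>a\<in>RG. good_sheet Q NF a \<rho> \<epsilon>) \<and> (\<forall>b\<in>RF. good_sheet Q' NG b \<rho> \<epsilon>)) (at_right 0)"
proof -
  have "\<forall>a\<in>RG. \<exists>\<rho>0>0. \<forall>\<rho>. 0 < \<rho> \<longrightarrow> \<rho> \<le> \<rho>0 \<longrightarrow> eventually (good_sheet Q NF a \<rho>) (at_right 0)"
  proof
    fix a assume "a \<in> RG"
    then obtain P \<kappa> where "sheet Q P a 0 \<kappa> 1 d NF F" using sheet_G by blast
    then interpret sheet Q P a 0 \<kappa> 1 d NF F .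
    show "\<exists>\<rho>0>0. \<forall>\<rho>. 0 < \<rho> \<longrightarrow> \<rho> \<le> \<rho>0 \<longrightarrow> eventually (good_sheet Q NF a \<rho>) (at_right 0)"
      unfolding good_sheet_def[abs_def] by (rule ovals_sheet) blast
  qed
  from bchoice[OF this] obtain r1 where r1: "\<forall>a\<in>RG. r1 a > 0 \<and> (\<forall>\<rho>. 0 < \<rho> \<longrightarrow> \<rho> \<le> r1 a \<longrightarrow> eventually (good_sheet Q NF a \<rho>) (at_right 0))"
    by (elim exE) (rule that)
  have "\<forall>b\<in>RF. \<exists>\<rho>0>0. \<forall>\<rho>. 0 < \<rho> \<longrightarrow> \<rho> \<le> \<rho>0 \<longrightarrow> eventually (good_sheet Q' NG b \<rho>) (at_right 0)"
  proof
    fix b assume "b \<in> RF"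
    then obtain P c \<kappa> where "sheet Q' P b c \<kappa> d d NG G" using sheet_F by blast
    then interpret sheet Q' P b c \<kappa> d d NG G .
    show "\<exists>\<rho>0>0. \<forall>\<rho>. 0 < \<rho> \<longrightarrow> \<rho> \<le> \<rho>0 \<longrightarrow> eventually (good_sheet Q' NG b \<rho>) (at_right 0)"
      unfolding good_sheet_def[abs_def] by (rule ovals_sheet) blast
  qed
  from bchoice[OF this] obtain r2 where r2: "\<forall>b\<in>RF. r2 b > 0 \<and> (\<forall>\<rho>. 0 < \<rho> \<longrightarrow> \<rho> \<le> r2 b \<longrightarrow> eventually (good_sheet Q' NG b \<rho>) (at_right 0))"
    by (elim exE) (rule that)
  obtain \<rho>1 where \<rho>1: "\<rho>1 > 0" "\<And>a. a \<in> RG \<Longrightarrow> \<rho>1 \<le> r1 a"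
    by (rule finite_positive_lower_bound[OF finite_roots(2), of r1]) (use r1 in auto)
  obtain \<rho>2 where \<rho>2: "\<rho>2 > 0" "\<And>b. b \<in> RF \<Longrightarrow> \<rho>2 \<le> r2 b"
    by (rule finite_positive_lower_bound[OF finite_roots(1), of r2]) (use r2 in auto)
  show ?thesis
  proof (intro exI[of _ "min \<rho>1 \<rho>2"] conjI allI impI)
    fix \<rho> assume \<rho>: "0 < \<rho>" "\<rho> \<le> min \<rho>1 \<rho>2"
    have "eventually (good_sheet Q NF a \<rho>) (at_right 0)" if a: "a \<in> RG" for a
      using r1 a \<rho>1(2)[OF a] \<rho> by simp
    moreover have "eventually (good_sheet Q' NG b \<rho>) (at_right 0)" if b: "b \<in> RF" for b
      using r2 b \<rho>2(2)[OF b] \<rho> by simp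
    ultimately show "eventually (\<lambda>\<epsilon>. (\<forall>a\<in>RG. good_sheet Q NF a \<rho> \<epsilon>) \<and> (\<forall>b\<in>RF. good_sheet Q' NG b \<rho> \<epsilon>)) (at_right 0)"
      by (intro eventually_conj eventually_ball_finite finite_roots ballI) auto
  qed (use \<rho>1 \<rho>2 in simp)
qed

theorem has_curve_Q: "\<exists>f C. has_curve d (d * NF + d * NG) f C"
proof -
  obtain \<rho>0 where \<rho>0: "\<rho>0 > 0" "\<forall>\<rho>. 0 < \<rho> \<longrightarrow> \<rho> \<le> \<rho>0 \<longrightarrow>
    eventually (\<lambda>\<epsilon>. (\<forall>a\<in>RG. good_sheet Q NF a \<rho> \<epsilon>) \<and> (\<forall>b\<in>RF. good_sheet Q' NG b \<rho> \<epsilon>)) (at_right 0)"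
    using eventually_good_sheets by (elim exE conjE) (rule that)
  obtain s1 where s1: "s1 > 0" "\<forall>a\<in>RG. \<forall>b\<in>RG. a \<noteq> b \<longrightarrow> s1 \<le> \<bar>a - b\<bar>"
    using separated_finite[OF finite_roots(2)] by (elim exE conjE) (rule that)
  obtain s2 where s2: "s2 > 0" "\<forall>a\<in>RF. \<forall>b\<in>RF. a \<noteq> b \<longrightarrow> s2 \<le> \<bar>a - b\<bar>"
    using separated_finite[OF finite_roots(1)] by (elim exE conjE) (rule that)
  \<comment> \<open>At most half the separation of the roots makes the cones over different roots of
    one form disjoint in their chart; \<rho> < 1 separates the cones of \<open>G\<close> from the
    reversed ones of \<open>F\<close>.\<close>
  define \<rho> where "\<rho> = min (min \<rho>0 (1 / 2)) (min (s1 / 2) (s2 / 2))"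
  have \<rho>: "0 < \<rho>" "\<rho> \<le> \<rho>0" "\<rho> < 1" "2 * \<rho> \<le> s1" "2 * \<rho> \<le> s2"
    using \<rho>0(1) s1(1) s2(1) by (auto simp: \<rho>_def)
  have "eventually (\<lambda>\<epsilon>. \<forall>X. X \<noteq> 0 \<longrightarrow> Q (X, \<epsilon>) = 0 \<longrightarrow> hessq Q (X, \<epsilon>) = 0 \<longrightarrow>
     (\<exists>a\<in>RG. X \<in> root_cone a \<rho>) \<or> (\<exists>b\<in>RF. rev4 X \<in> root_cone b \<rho>)) (at_right 0)"
    by (rule filter_leD[OF at_within_le_nhds eventually_zeros_in_cones[OF \<rho>(1)]])
  from eventually_happens'[OF trivial_limit_at_right_real eventually_conj[OF \<rho>0(2)[rule_format, OF \<rho>(1,2)] this]] obtain \<epsilon> where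
    good: "\<forall>a\<in>RG. good_sheet Q NF a \<rho> \<epsilon>" "\<forall>b\<in>RF. good_sheet Q' NG b \<rho> \<epsilon>" and
    zeros: "\<forall>X. X \<noteq> 0 \<longrightarrow> Q (X, \<epsilon>) = 0 \<longrightarrow> hessq Q (X, \<epsilon>) = 0 \<longrightarrow> (\<exists>a\<in>RG. X \<in> root_cone a \<rho>) \<or> (\<exists>b\<in>RF. rev4 X \<in> root_cone b \<rho>)"
    by (elim exE conjE) (rule that)
  define f where "f X = Q (X, \<epsilon>)" for X
  have f: "rpf f" "homog d f" unfolding f_def[abs_def] by (rule rpf_slice[OF rpf_Q(1)] Q_homog)+
  have hf: "hess4 f = (\<lambda>X. hessq Q (X, \<epsilon>))" unfolding f_def[abs_def] by (rule hess4_slice[OF rpf_Q(1)])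
  have hh: "rpf (hess4 f)" "homog (4 * (d - 2)) (hess4 f)"
    using rpf_hess4[OF f(1)] hess4_homog[OF f] d by auto
  define S where "S a = sheet_zeros Q a \<rho> \<epsilon>" for a
  define T where "T b = rev4 ` sheet_zeros Q' b \<rho> \<epsilon>" for b
  have S: "X \<in> S a \<longleftrightarrow> X \<in> root_cone a \<rho> \<and> X $ 4 = 1 \<and> f X = 0 \<and> hess4 f X = 0" for X a
    unfolding S_def sheet_zeros_cone hf f_def ..
  have T: "X \<in> T b \<longleftrightarrow> rev4 X \<in> root_cone b \<rho> \<and> X $ 1 = 1 \<and> f X = 0 \<and> hess4 f X = 0" for X b
  proof -
    have "X \<in> T b \<longleftrightarrow> rev4 X \<in> sheet_zeros Q' b \<rho> \<epsilon>" unfolding T_def by (metis imageE imageI rev4_rev4)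
    then show ?thesis unfolding sheet_zeros_cone hf f_def hessq_Q' by (simp add: Q'_def)
  qed
  define C where "C = (\<Union>a\<in>RG. S a) \<union> (\<Union>b\<in>RF. T b)"
  have cone_dis: "a = a'" if "X \<in> root_cone a \<rho>" "X \<in> root_cone a' \<rho>" "X $ 4 = 1" "s \<ge> 2 * \<rho>" "a \<noteq> a' \<Longrightarrow> s \<le> \<bar>a - a'\<bar>" for X a a' s
  proof -
    have "\<bar>X $ 3 - a\<bar> < \<rho>" "\<bar>X $ 3 - a'\<bar> < \<rho>" using that(1-3) by (auto simp: root_cone_def)
    then have "\<bar>a - a'\<bar> < 2 * \<rho>" by linarith
    then show ?thesis using that(4,5) by force
  qed
  have "ovals (card RG * NF) (\<Union>a\<in>RG. S a)"
  proof (rule ovals_UN[OF finite_roots(2)])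
    show "ovals NF (S a)" if "a \<in> RG" for a using good(1) that by (auto simp: good_sheet_def S_def)
    show "S a \<inter> S b = {}" if "a \<in> RG" "b \<in> RG" "a \<noteq> b" for a b
      using cone_dis[OF _ _ _ \<rho>(4) s1(2)[rule_format, OF that(1,2)]] that(3) by (auto simp: S)
  qed
  moreover have "ovals (card RF * NG) (\<Union>b\<in>RF. T b)"
  proof (rule ovals_UN[OF finite_roots(1)])
    show "ovals NG (T b)" if "b \<in> RF" for b unfolding T_def
      using good(2) that by (intro ovals_image linear_continuous_on bounded_linear_rev4 inj_on_inverseI[of _ rev4]) (auto simp: good_sheet_def)
    show "T a \<inter> T b = {}" if "a \<in> RF" "b \<in> RF" "a \<noteq> b" for a b
    proof -
      have "a = b" if "X \<in> T a" "X \<in> T b" for X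
        by (rule cone_dis[of "rev4 X" a b s2, OF _ _ _ \<rho>(5) s2(2)[rule_format, OF \<open>a \<in> RF\<close> \<open>b \<in> RF\<close>]]) (use that T in auto)
      then show ?thesis using that(3) by blast
    qed
  qed
  moreover have "(\<Union>a\<in>RG. S a) \<inter> (\<Union>b\<in>RF. T b) = {}"
    using cone_rev4_disjoint[OF \<rho>(3)] by (auto simp: S T)
  ultimately have ov: "ovals (d * NF + d * NG) C" unfolding C_def rF rG by (rule ovals_Un)
  have C0: "0 \<notin> C" by (auto simp: C_def S T)
  have Cz: "f X = 0 \<and> hess4 f X = 0" if "X \<in> C" for X using that by (auto simp: C_def S T)
  have inj: "inj_on (\<lambda>x. span {x}) C"
  proof (rule inj_onI)
    fix X Y assume XY: "X \<in> C" "Y \<in> C" "span {X} = span {Y}"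
    then obtain t where t: "t \<noteq> 0" "Y = t *\<^sub>R X" using C0 by (metis span_singleton_eq)
    \<comment> \<open>Representatives are normalised by the fourth coordinate over roots of
      \<open>G\<close> and by the first over roots of \<open>F\<close>. A line cannot meet both
      kinds of cone, so proportional representatives share a normalisation and coincide.\<close>
    have no: False if Z: "Z \<in> S a" "t *\<^sub>R Z \<in> T b" "t \<noteq> 0" for Z a b t
    proof -
      have "t *\<^sub>R Z \<in> root_cone a \<rho>" using Z by (intro cone_scaleR) (auto simp: S)
      then show False using cone_rev4_disjoint[OF \<rho>(3)] Z(2) by (auto simp: T)
    qed
    have "X = (1 / t) *\<^sub>R Y" using t by simp
    then have "t = 1" using XY(1,2) no[of X _ t] no[of Y _ "1 / t"] t unfolding C_def
      by (elim UnE UN_E) (auto simp: S T)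
    then show "X = Y" using t by simp
  qed
  have norm: "\<exists>t Y. t \<noteq> 0 \<and> Y \<in> C \<and> X = t *\<^sub>R Y" if X: "X \<noteq> 0" "f X = 0" "hess4 f X = 0" for X
  proof -
    have z: "f (t *\<^sub>R X) = 0" "hess4 f (t *\<^sub>R X) = 0" if "t \<noteq> 0" for t
      using homogD[OF f(2) that] homogD[OF hh(2) that] X by simp_all
    have "(\<exists>a\<in>RG. X \<in> root_cone a \<rho>) \<or> (\<exists>b\<in>RF. rev4 X \<in> root_cone b \<rho>)" using zeros X by (simp add: f_def hf)
    then show ?thesis
    proof (elim disjE bexE)
      fix a assume a: "a \<in> RG" "X \<in> root_cone a \<rho>"
      have n: "X $ 4 \<noteq> 0" by (rule cone_nonzero[OF a(2)])
      have "(1 / X $ 4) *\<^sub>R X \<in> S a" using cone_scaleR[OF a(2), of "1 / X $ 4"] n z[of "1 / X $ 4"] by (simp add: S)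
      then show ?thesis using a(1) n by (intro exI[of _ "X $ 4"] exI[of _ "(1 / X $ 4) *\<^sub>R X"]) (auto simp: C_def)
    next
      fix b assume b: "b \<in> RF" "rev4 X \<in> root_cone b \<rho>"
      have n: "X $ 1 \<noteq> 0" using cone_nonzero[OF b(2)] by simp
      have "rev4 ((1 / X $ 1) *\<^sub>R X) = (1 / X $ 1) *\<^sub>R rev4 X"
        by (rule linear_cmul[OF bounded_linear.linear[OF bounded_linear_rev4]])
      then have "(1 / X $ 1) *\<^sub>R X \<in> T b" using cone_scaleR[OF b(2), of "1 / X $ 1"] n z[of "1 / X $ 1"] by (simp add: T)
      then show ?thesis using b(1) n by (intro exI[of _ "X $ 1"] exI[of _ "(1 / X $ 1) *\<^sub>R X"]) (auto simp: C_def)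
    qed
  qed
  have "(\<lambda>x. span {x}) ` C = {span {x} | x. x \<noteq> 0 \<and> f x = 0 \<and> hess4 f x = 0}"
  proof (intro subset_antisym subsetI)
    fix l assume "l \<in> (\<lambda>x. span {x}) ` C"
    then show "l \<in> {span {x} | x. x \<noteq> 0 \<and> f x = 0 \<and> hess4 f x = 0}" using Cz C0 by blast
  next
    fix l assume "l \<in> {span {x} | x. x \<noteq> 0 \<and> f x = 0 \<and> hess4 f x = 0}"
    then obtain X where X: "l = span {X}" "X \<noteq> 0" "f X = 0" "hess4 f X = 0" by blast
    then obtain t Y where t: "t \<noteq> 0" "Y \<in> C" "X = t *\<^sub>R Y" using norm by blast
    then show "l \<in> (\<lambda>x. span {x}) ` C" using X(1) span_scaleR[OF t(1), of Y] by blast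
  qed
  moreover have "indep f (hess4 f) X" if X: "X \<noteq> 0" "f X = 0" "hess4 f X = 0" for X
  proof -
    obtain t Y where t: "t \<noteq> 0" "Y \<in> C" "X = t *\<^sub>R Y" using norm[OF X] by blast
    have "indep f (hess4 f) Y"
      using t(2) unfolding C_def
    proof (elim UnE UN_E)
      fix a assume "a \<in> RG" "Y \<in> S a"
      then show ?thesis using good(1) by (simp add: good_sheet_def S_def f_def[abs_def])
    next
      fix b assume b: "b \<in> RF" "Y \<in> T b"
      then obtain Z where Z: "Y = rev4 Z" "Z \<in> sheet_zeros Q' b \<rho> \<epsilon>" by (auto simp: T_def)
      then have "indep (\<lambda>X. Q' (X, \<epsilon>)) (hess4 (\<lambda>X. Q' (X, \<epsilon>))) Z" using good(2) b(1) by (simp add: good_sheet_def)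
      moreover have "(\<lambda>X. Q' (X, \<epsilon>)) = (\<lambda>X. f (rev4 X))" by (simp add: Q'_def f_def)
      ultimately show ?thesis unfolding Z(1) by (intro indep_rev4 f(1)) simp
    qed
    then show ?thesis unfolding t(3) by (rule indep_scaleR[OF f hh t(1)])
  qed
  moreover have "\<exists>x. f x \<noteq> 0"
  proof -
    have "G ((0, 0), 0) = 0" using homog_0[OF G'(2)] d by (simp add: zero_prod_def)
    then have "f (vec4 0 1 0 0) = F ((0, 1), 0)" by (simp add: f_def Q_def)
    then show ?thesis using F01 by metis
  qed
  ultimately have "has_curve d (d * NF + d * NG) f C"
    unfolding has_curve_def using f ov C0 inj by (intro conjI allI impI)
  then show ?thesis by blast
qed

end

lemma good_normalize:
  assumes "good d N F" "d \<ge> 3"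
  shows "\<exists>H. good d N H \<and> (splits F \<longrightarrow> splits H) \<and> H ((0, 1), 0) \<noteq> 0 \<and> card {s. H ((1, s), 0) = 0} = d \<and>
    (\<forall>s. H ((1, s), 0) = 0 \<longrightarrow> dird ((0, 1), 0) H ((1, s), 0) \<noteq> 0)"
proof -
  obtain c q where c: "hyperbolic_form (\<lambda>p. F (shear c p, 0)) d q" "F (shear c (0, 1), 0) \<noteq> 0"
    using normal_form[OF assms] by (elim exE conjE) (rule that)
  define H where "H = (\<lambda>q. F (shear c (fst q), snd q))"
  have g: "good d N H" unfolding H_def by (rule good_shear[OF assms(1)])
  interpret A: hyperbolic_form "\<lambda>p. F (shear c p, 0)" d q by (rule c(1))
  have q: "H ((1, s), 0) = poly q s" for s using A.q(1)[of s] by (simp add: H_def)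
  have rH: "rpf H" using g by (simp add: good_def)
  show ?thesis
  proof (intro exI[of _ H] conjI impI allI g)
    show "splits H" if "splits F" unfolding H_def by (rule splits_shear[OF that])
    show "H ((0, 1), 0) \<noteq> 0" using c(2) by (simp add: H_def)
    show "card {s. H ((1, s), 0) = 0} = d" unfolding q by (rule A.q(3))
    show "dird ((0, 1), 0) H ((1, s), 0) \<noteq> 0" if s: "H ((1, s), 0) = 0" for s
    proof -
      have "dird ((0, 1), 0) H ((1, s), 0) = dird 1 (\<lambda>s. H ((1, s), 0)) s"
        by (rule dird_compose[OF rH, where g' = "\<lambda>h. ((0, h), 0)", symmetric]) (auto intro!: derivative_eq_intros)
      also have "\<dots> = poly (pderiv q) s * 1" unfolding q
        by (rule dirdI) (use poly_DERIV[of q s] in \<open>simp add: has_field_derivative_def\<close>)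
      finally have e: "dird ((0, 1), 0) H ((1, s), 0) = poly (pderiv q) s" by simp
      have q0: "q \<noteq> 0" using A.q(2) A.n by auto
      have "poly q s = 0" using s q by simp
      then show ?thesis using e simple_root_pderiv[of q s] A.q(2,3) q0 by simp
    qed
  qed
qed

theorem exists_curve:
  assumes d: "d \<ge> 4"
  shows "\<exists>f C. has_curve d (d * (d - 2)\<^sup>2) f C"
proof -
  obtain F0 where F0: "good d (tri d) F0" "splits F0" using good_lines[of d] d by auto
  obtain N G0 where G0: "good d N G0" "tri d + N = (d - 2)\<^sup>2" using good_complement[OF d] by blast
  have d3: "d \<ge> 3" using d by simp
  obtain F where F: "good d (tri d) F" "splits F0 \<longrightarrow> splits F" "F ((0, 1), 0) \<noteq> 0" "card {s. F ((1, s), 0) = 0} = d"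
    "\<forall>s. F ((1, s), 0) = 0 \<longrightarrow> dird ((0, 1), 0) F ((1, s), 0) \<noteq> 0"
    using good_normalize[OF F0(1) d3] by (elim exE conjE) (rule that)
  obtain G where G: "good d N G" "G ((0, 1), 0) \<noteq> 0" "card {s. G ((1, s), 0) = 0} = d"
    "\<forall>s. G ((1, s), 0) = 0 \<longrightarrow> dird ((0, 1), 0) G ((1, s), 0) \<noteq> 0"
    using good_normalize[OF G0(1) d3] by (elim exE conjE) (rule that)
  interpret form_pair F G d "tri d" N
    by (rule form_pair.intro[OF d3 F(1) G(1) F(2)[rule_format, OF F0(2)] F(3) G(2) F(4) G(3)]) (rule F(5)[rule_format] G(4)[rule_format], assumption)+
  have "d * tri d + d * N = d * (d - 2)\<^sup>2" using G0(2) by (simp flip: distrib_left)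
  then show ?thesis using has_curve_Q by simp
qed

section \<open>Projective space and formal polynomials\<close>

text \<open>Finiteness makes every closed member open as well; a nonempty connected clopen set is a
  component.\<close>

lemma connected_components_of_clopen_family:
  assumes fin: "finite \<S>" and "\<Union>\<S> = topspace X"
    and S: "\<And>S. S \<in> \<S> \<Longrightarrow> connectedin X S \<and> closedin X S \<and> S \<noteq> {}" and dis: "disjoint \<S>"
  shows "connected_components_of X = \<S>"
proof -
  have opn: "openin X S" if "S \<in> \<S>" for S
  proof -
    have "closedin X (\<Union>(\<S> - {S}))" using fin S by (intro closedin_Union) auto
    moreover have "S = topspace X - \<Union>(\<S> - {S})"
      using that dis assms(2) unfolding disjoint_def by fastforce
    ultimately show ?thesis by (metis openin_diff openin_topspace)
  qed
  have comp: "connected_component_of_set X x = S" if "S \<in> \<S>" "x \<in> S" for S x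
  proof
    have "connected_component_of_set X x \<subseteq> S \<or> disjnt (connected_component_of_set X x) S"
      by (rule connectedin_clopen_cases[OF connectedin_connected_component_of]) (use S opn that in auto)
    moreover have "x \<in> connected_component_of_set X x"
      using assms(2) that by (auto simp: connected_component_of_refl)
    ultimately show "connected_component_of_set X x \<subseteq> S" using that(2) by (auto simp: disjnt_iff)
    show "S \<subseteq> connected_component_of_set X x"
      by (rule connected_component_of_maximal) (use S that in auto)
  qed
  show ?thesis
  proof (intro subset_antisym subsetI)
    fix C assume "C \<in> connected_components_of X"
    then obtain x where "x \<in> topspace X" "C = connected_component_of_set X x" by (auto simp: connected_components_of_def)
    then show "C \<in> \<S>" using comp assms(2) by blast
  next
    fix C assume C: "C \<in> \<S>"
    then obtain x where "x \<in> C" using S by blast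
    then show "C \<in> connected_components_of X"
      using comp[OF C] C assms(2) unfolding connected_components_of_def by blast
  qed
qed

text \<open>The matrix of the orthogonal projection onto the line. It does not depend on the chosen
  spanning vector and determines the line; this continuous injection into the space of matrices
  shows that projective space is Hausdorff.\<close>

definition line_projection :: "(real ^ 'n) set \<Rightarrow> real ^ 'n ^ 'n" where
  "line_projection l = (let x = SOME x. x \<noteq> 0 \<and> span {x} = l in \<chi> i j. x $ i * x $ j / (x \<bullet> x))"

lemma line_projection_span:
  fixes x :: "real ^ 'n" assumes "x \<noteq> 0"
  shows "line_projection (span {x}) = (\<chi> i j. x $ i * x $ j / (x \<bullet> x))"
proof -
  define y where "y = (SOME y. y \<noteq> 0 \<and> span {y} = span {x})"
  have "y \<noteq> 0 \<and> span {y} = span {x}" unfolding y_def by (rule someI[of _ x]) (use assms in simp)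
  then obtain t where "t \<noteq> 0" "y = t *\<^sub>R x" using assms by (metis span_singleton_eq)
  then show ?thesis unfolding line_projection_def y_def[symmetric] Let_def \<open>y = t *\<^sub>R x\<close>
    by (simp add: vec_eq_iff)
qed

lemma Hausdorff_rproj_space: "Hausdorff_space (rproj_space :: (real ^ 'n) set topology)"
proof (rule Hausdorff_space_injective_preimage)
  show "Hausdorff_space (euclidean :: (real ^ 'n ^ 'n) topology)" by simp
  have "continuous_on (- {0}) (\<lambda>x::real^'n. \<chi> i j. x $ i * x $ j / (x \<bullet> x))"
    by (intro continuous_intros) auto
  then have "continuous_map (top_of_set (- {0})) euclidean (\<lambda>x::real^'n. line_projection (span {x}))"
    by (simp add: line_projection_span cong: continuous_on_cong_simp)
  then show "continuous_map rproj_space euclidean (line_projection :: (real ^ 'n) set \<Rightarrow> _)"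
    by (intro continuous_compose_quotient_map[OF quotient_map_rproj]) (simp add: o_def)
  show "inj_on line_projection (topspace (rproj_space :: (real ^ 'n) set topology))"
  proof (rule inj_onI)
    fix k l :: "(real ^ 'n) set"
    assume "k \<in> topspace rproj_space" "l \<in> topspace rproj_space" and eq: "line_projection k = line_projection l"
    then obtain x y where xy: "k = span {x}" "l = span {y}" "x \<noteq> 0" "y \<noteq> 0"
      unfolding topspace_rproj_space rproj_points_def by blast
    have m: "line_projection (span {z}) *v y = ((z \<bullet> y) / (z \<bullet> z)) *\<^sub>R z" if "z \<noteq> 0" for z
      unfolding line_projection_span[OF that]
      by (simp add: vec_eq_iff matrix_vector_mult_def inner_vec_def[of z y] sum_distrib_left sum_divide_distrib mult_ac)
    have y: "y = ((x \<bullet> y) / (x \<bullet> x)) *\<^sub>R x"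
      using m[OF xy(4)] m[OF xy(3)] eq xy by simp
    then have "(x \<bullet> y) / (x \<bullet> x) \<noteq> 0" using xy(4) by auto
    then show "k = l" unfolding xy(1,2) using span_scaleR[of "(x \<bullet> y) / (x \<bullet> x)" x] y by metis
  qed
qed

text \<open>The projection is continuous and injective on \<open>C\<close>, so the continua go to
  disjoint compact connected sets, which are closed because projective space is Hausdorff.\<close>

lemma card_components_rproj:
  fixes C :: "(real ^ 'n) set"
  assumes ov: "ovals N C" and C0: "0 \<notin> C" and inj: "inj_on (\<lambda>x. span {x}) C"
  shows "card (connected_components_of (subtopology rproj_space ((\<lambda>x. span {x}) ` C))) = N"
proof -
  let ?s = "\<lambda>x::real^'n. span {x}" and ?Y = "subtopology rproj_space ((\<lambda>x. span {x}) ` C)"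
  obtain \<K> where K: "finite \<K>" "card \<K> = N" "\<forall>K\<in>\<K>. compact K \<and> connected K \<and> K \<noteq> {}" "disjoint \<K>" "C = \<Union>\<K>"
    using ov by (auto simp: ovals_def)
  have "continuous_map (top_of_set (- {0})) rproj_space ?s" by (rule quotient_imp_continuous_map[OF quotient_map_rproj])
  then have "continuous_map (top_of_set C) rproj_space ?s"
    using C0 continuous_map_from_subtopology_mono[of euclidean "- {0}" rproj_space ?s C] by auto
  then have cont: "continuous_map (top_of_set C) ?Y ?s" by (auto simp: continuous_map_in_subtopology)
  have top: "topspace ?Y = ?s ` C" using C0 by (auto simp: topspace_rproj_space rproj_points_def)
  have H: "Hausdorff_space ?Y" by (rule Hausdorff_space_subtopology[OF Hausdorff_rproj_space])
  have inj_im: "inj_on ((`) ?s) \<K>"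
    by (rule inj_on_subset[OF inj_on_image_Pow[OF inj]]) (use K(5) in auto)
  have "connected_components_of ?Y = (`) ?s ` \<K>"
  proof (rule connected_components_of_clopen_family)
    show "finite ((`) ?s ` \<K>)" using K(1) by simp
    show "\<Union>((`) ?s ` \<K>) = topspace ?Y" unfolding top using K(5) by blast
    show "connectedin ?Y S \<and> closedin ?Y S \<and> S \<noteq> {}" if "S \<in> (`) ?s ` \<K>" for S
    proof -
      obtain L where L: "S = ?s ` L" "L \<in> \<K>" using \<open>S \<in> (`) ?s ` \<K>\<close> by blast
      have l: "compactin (top_of_set C) L" "connectedin (top_of_set C) L"
        using K(3,5) L(2) by (auto simp: compactin_subtopology connectedin_subtopology)
      show ?thesis unfolding L(1)
        using connectedin_continuous_map_image[OF cont l(2)] compactin_imp_closedin[OF H image_compactin[OF l(1) cont]] K(3) L(2) by auto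
    qed
    show "disjoint ((`) ?s ` \<K>)"
    proof (rule pairwise_imageI)
      fix A B assume AB: "A \<in> \<K>" "B \<in> \<K>" "A \<noteq> B"
      then have "A \<inter> B = {}" using K(4) by (simp add: disjoint_def)
      then show "disjnt (?s ` A) (?s ` B)" unfolding disjnt_def
        using inj_on_image_Int[OF inj, of A B] AB K(5) by auto
    qed
  qed
  then show ?thesis using card_image[OF inj_im] K(2) by simp
qed

section \<open>Formal polynomials and the functions they define\<close>

abbreviation "mon m x \<equiv> \<Prod>i\<in>UNIV. (x $ i) ^ Poly_Mapping.lookup m i"

lemma rpoly_eval_superset:
  assumes "finite S" "Poly_Mapping.keys P \<subseteq> S"
  shows "rpoly_eval P x = (\<Sum>m\<in>S. Poly_Mapping.lookup P m * mon m x)"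
  unfolding rpoly_eval_def by (rule sum.mono_neutral_left) (use assms in \<open>auto simp: in_keys_iff\<close>)

lemma rpoly_eval_add: "rpoly_eval (P + Q) x = rpoly_eval P x + rpoly_eval Q x"
proof -
  let ?S = "Poly_Mapping.keys P \<union> Poly_Mapping.keys Q"
  have "rpoly_eval R x = (\<Sum>m\<in>?S. Poly_Mapping.lookup R m * mon m x)" if "Poly_Mapping.keys R \<subseteq> ?S" for R
    by (rule rpoly_eval_superset[OF _ that]) simp
  from this[of P] this[of Q] this[of "P + Q"] show ?thesis
    using keys_add[of P Q] by (simp add: lookup_add distrib_right sum.distrib)
qed

lemma rpoly_eval_0 [simp]: "rpoly_eval 0 x = 0"
  by (simp add: rpoly_eval_def)

lemma rpoly_eval_sum: "rpoly_eval (\<Sum>i\<in>A. f i) x = (\<Sum>i\<in>A. rpoly_eval (f i) x)"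
  by (induction A rule: infinite_finite_induct) (auto simp: rpoly_eval_add)

lemma rpoly_eval_single: "rpoly_eval (Poly_Mapping.single m c) x = c * mon m x"
  by (cases "c = 0") (auto simp: rpoly_eval_def)

lemma rpoly_eval_uminus: "rpoly_eval (- P) x = - rpoly_eval P x"
proof -
  have "rpoly_eval (P + - P) x = 0" by (simp only: add.right_inverse rpoly_eval_0)
  then show ?thesis unfolding rpoly_eval_add by linarith
qed

lemma mon_add: "mon (m + n) x = mon m x * mon n x"
  by (simp add: lookup_add power_add prod.distrib)

lemma rpoly_sum_singles: "P = (\<Sum>m\<in>Poly_Mapping.keys P. Poly_Mapping.single m (Poly_Mapping.lookup P m))"
  by (rule poly_mapping_eqI) (auto simp: lookup_sum lookup_single when_def in_keys_iff)

lemma rpoly_eval_mult: "rpoly_eval (P * Q) x = rpoly_eval P x * rpoly_eval Q x"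
proof -
  have "P * Q = (\<Sum>m\<in>Poly_Mapping.keys P. \<Sum>n\<in>Poly_Mapping.keys Q.
      Poly_Mapping.single (m + n) (Poly_Mapping.lookup P m * Poly_Mapping.lookup Q n))"
    by (subst rpoly_sum_singles[of P], subst rpoly_sum_singles[of Q]) (simp add: sum_product mult_single)
  then have "rpoly_eval (P * Q) x = (\<Sum>m\<in>Poly_Mapping.keys P. \<Sum>n\<in>Poly_Mapping.keys Q.
      (Poly_Mapping.lookup P m * Poly_Mapping.lookup Q n) * (mon m x * mon n x))"
    by (simp add: rpoly_eval_sum rpoly_eval_single mon_add)
  then show ?thesis by (simp add: rpoly_eval_def sum_product mult_ac)
qed

lemma rpoly_eval_1 [simp]: "rpoly_eval 1 x = 1"
proof -
  have "rpoly_eval (Poly_Mapping.single 0 1) x = 1" unfolding rpoly_eval_single by (simp only: lookup_zero power_0 prod.neutral_const mult_1_right)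
  then show ?thesis by (simp only: single_one)
qed

lemma rpoly_eval_prod: "rpoly_eval (\<Prod>i\<in>A. f i) x = (\<Prod>i\<in>A. rpoly_eval (f i) x)"
  by (induction A rule: infinite_finite_induct) (auto simp: rpoly_eval_mult)

lemma rpoly_eval_det: "rpoly_eval (det A) x = det (\<chi> i j. rpoly_eval (A $ i $ j) x)"
proof -
  have "rpoly_eval (of_int (sign p)) x = of_int (sign p)" for p :: "'b \<Rightarrow> 'b"
    by (auto simp: sign_def rpoly_eval_uminus)
  then show ?thesis by (simp add: det_def rpoly_eval_sum rpoly_eval_mult rpoly_eval_prod)
qed

lemma rpf_rpoly_eval: "rpf (rpoly_eval P)"
  unfolding rpoly_eval_def[abs_def] by (intro rpf_intros) auto

lemma dird_mon:
  fixes i :: "'n::finite"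
  shows "dird (axis i 1) (mon m) x = Poly_Mapping.lookup m i * mon (m - Poly_Mapping.single i 1) x"
proof -
  let ?e = "Poly_Mapping.lookup m"
  have "dird (axis i 1) (mon m) x = (\<Sum>k\<in>UNIV. (?e k * axis i (1::real) $ k * x $ k ^ (?e k - 1)) * (\<Prod>j\<in>UNIV - {k}. x $ j ^ ?e j))"
    by (rule dirdI[where f' = "\<lambda>v. \<Sum>k\<in>UNIV. (?e k * v $ k * x $ k ^ (?e k - 1)) * (\<Prod>j\<in>UNIV - {k}. x $ j ^ ?e j)"]) (auto intro!: derivative_eq_intros bounded_linear_imp_has_derivative bounded_linear_vec_nth simp: mult_ac)
  also have "\<dots> = (\<Sum>k\<in>UNIV. if k = i then ?e i * x $ i ^ (?e i - 1) * (\<Prod>j\<in>UNIV - {i}. x $ j ^ ?e j) else 0)"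
    by (rule sum.cong) (auto simp: axis_def)
  also have "\<dots> = ?e i * (x $ i ^ (?e i - 1) * (\<Prod>j\<in>UNIV - {i}. x $ j ^ ?e j))" by simp
  also have "x $ i ^ (?e i - 1) * (\<Prod>j\<in>UNIV - {i}. x $ j ^ ?e j) = mon (m - Poly_Mapping.single i 1) x"
    by (subst (2) prod.remove[of _ i]) (auto simp: lookup_minus lookup_single when_def intro!: prod.cong)
  finally show ?thesis .
qed

lemma rpoly_eval_partial: "rpoly_eval (rpoly_partial i P) = dird (axis i 1) (rpoly_eval P)"
proof
  fix x
  have r: "rpf (mon m)" for m :: "'a \<Rightarrow>\<^sub>0 nat" by (intro rpf_intros) auto
  have "((\<lambda>x. \<Sum>m\<in>Poly_Mapping.keys P. Poly_Mapping.lookup P m * mon m x) has_derivative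
      (\<lambda>v. \<Sum>m\<in>Poly_Mapping.keys P. Poly_Mapping.lookup P m * dird v (mon m) x)) (at x)"
    by (intro has_derivative_sum has_derivative_mult_right rpf_has_derivative r)
  then have "dird (axis i 1) (rpoly_eval P) x = (\<Sum>m\<in>Poly_Mapping.keys P. Poly_Mapping.lookup P m * dird (axis i 1) (mon m) x)"
    unfolding rpoly_eval_def[abs_def] by (rule dirdI)
  then show "rpoly_eval (rpoly_partial i P) x = dird (axis i 1) (rpoly_eval P) x"
    by (simp add: rpoly_partial_def rpoly_eval_sum rpoly_eval_single dird_mon mult_ac)
qed

lemma rpoly_eval_Hess: "rpoly_eval (Hess P) = hess4 (rpoly_eval P)"
  by (rule ext) (simp add: Hess_def rpoly_eval_det hess4_def rpoly_eval_partial)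

lemma rpf_eq_rpoly_eval:
  fixes f :: "real ^ 'n::finite \<Rightarrow> real"
  assumes "rpf f" shows "\<exists>P. rpoly_eval P = f"
  using assms
proof (induction f rule: real_polynomial_function.induct)
  case (linear f)
  then interpret bounded_linear f .
  have "rpoly_eval (\<Sum>i\<in>UNIV. Poly_Mapping.single (Poly_Mapping.single i 1) (f (axis i 1))) x = f x" for x
  proof -
    have m: "mon (Poly_Mapping.single i 1) x = x $ i" for i
    proof -
      have "mon (Poly_Mapping.single i 1) x = (\<Prod>j\<in>UNIV. if j = i then x $ i else 1)"
        by (rule prod.cong) (auto simp: lookup_single when_def)
      then show ?thesis by simp
    qed
    have "f x = f (\<Sum>i\<in>UNIV. x $ i *\<^sub>R axis i 1)" using basis_expansion[of x] by (simp add: scalar_mult_eq_scaleR)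
    also have "\<dots> = (\<Sum>i\<in>UNIV. x $ i * f (axis i 1))" by (simp add: sum scaleR)
    finally show ?thesis by (simp add: rpoly_eval_sum rpoly_eval_single m[simplified] mult.commute)
  qed
  then show ?case by (intro exI ext)
next
  case (const c)
  show ?case by (rule exI[of _ "Poly_Mapping.single 0 c"]) (simp add: rpoly_eval_single fun_eq_iff)
next
  case (add f g)
  then obtain P Q where "rpoly_eval P = f" "rpoly_eval Q = g" by blast
  then show ?case by (intro exI[of _ "P + Q"]) (auto simp: rpoly_eval_add)
next
  case (mult f g)
  then obtain P Q where "rpoly_eval P = f" "rpoly_eval Q = g" by blast
  then show ?case by (intro exI[of _ "P * Q"]) (auto simp: rpoly_eval_mult)
qed

text \<open>The part of degree d of any representing polynomial already represents f: for fixed x,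
  the polynomial P(t x) - t^d f(x) in t has infinitely many zeros, and its coefficient at t^d can be
  read off. This avoids proving that the representation is unique.\<close>

lemma homog_eq_rpoly_eval:
  fixes f :: "real ^ 'n::finite \<Rightarrow> real"
  assumes f: "rpf f" "homog d f" and nz: "f x0 \<noteq> 0"
  shows "\<exists>P. homogeneous_of_degree d P \<and> rpoly_eval P = f"
proof -
  obtain P where P: "rpoly_eval P = f" using rpf_eq_rpoly_eval[OF f(1)] by blast
  let ?K = "Poly_Mapping.keys P" and ?c = "Poly_Mapping.lookup P"
  let ?deg = "\<lambda>m. \<Sum>i\<in>UNIV. Poly_Mapping.lookup m i"
  define R where "R = (\<Sum>m\<in>{m \<in> ?K. ?deg m = d}. Poly_Mapping.single m (?c m))"
  have R: "rpoly_eval R x = f x" for x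
  proof -
    define p where "p = (\<Sum>m\<in>?K. Polynomial.monom (?c m * mon m x) (?deg m)) - Polynomial.monom (f x) d"
    have "poly p t = 0" if t: "t \<noteq> 0" for t
    proof -
      have "mon m (t *\<^sub>R x) = t ^ ?deg m * mon m x" for m
        by (simp add: power_mult_distrib prod.distrib power_sum)
      then have "f (t *\<^sub>R x) = (\<Sum>m\<in>?K. ?c m * (t ^ ?deg m * mon m x))"
        unfolding P[symmetric] by (simp only: rpoly_eval_def)
      then show ?thesis using homogD[OF f(2) t, of x] by (simp add: p_def poly_sum poly_monom mult_ac)
    qed
    then have "{0<..} \<subseteq> {t. poly p t = 0}" by auto
    then have "infinite {t. poly p t = 0}" using infinite_Ioi infinite_super by blast
    then have "p = 0" using poly_roots_finite by blast
    then have "coeff p d = 0" by simp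
    then have "f x = (\<Sum>m\<in>?K. if ?deg m = d then ?c m * mon m x else 0)"
      by (simp add: p_def coeff_sum)
    also have "\<dots> = rpoly_eval R x" unfolding R_def rpoly_eval_sum rpoly_eval_single
      by (rule sum.inter_filter[symmetric]) simp
    finally show ?thesis ..
  qed
  have "homogeneous_of_degree d R"
    unfolding homogeneous_of_degree_def
  proof (intro conjI ballI)
    show "R \<noteq> 0" using R[of x0] nz by auto
    fix m assume "m \<in> Poly_Mapping.keys R"
    then have "Poly_Mapping.lookup R m \<noteq> 0" by (simp add: in_keys_iff)
    then have "\<exists>n\<in>{m \<in> ?K. ?deg m = d}. Poly_Mapping.lookup (Poly_Mapping.single n (?c n)) m \<noteq> 0"
      unfolding R_def lookup_sum by (metis (no_types, lifting) sum.neutral)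
    then show "?deg m = d" by (auto simp: lookup_single when_def split: if_splits)
  qed
  then show ?thesis using R by (intro exI[of _ R] conjI ext)
qed

section \<open>The Jacobian criterion and the conclusion\<close>

lemma jacobian_mult: "(jacobian_at E x *v v) $ k = dird v (rpoly_eval (E $ k)) x"
  by (subst dird_vec[OF rpf_rpoly_eval]) (simp add: jacobian_at_def matrix_vector_mult_def rpoly_eval_partial mult.commute)

lemma smooth_surfaceI:
  assumes "\<And>x. x \<noteq> 0 \<Longrightarrow> rpoly_eval P x = 0 \<Longrightarrow> \<exists>v. dird v (rpoly_eval P) x \<noteq> 0"
  shows "smooth_rproj_zeros (surface_eqs P)"
  unfolding smooth_rproj_zeros_def
proof (intro allI impI)
  fix x :: "real ^ 4" assume x: "x \<noteq> 0 \<and> (\<forall>k. rpoly_eval (surface_eqs P $ k) x = 0)"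
  then obtain v where v: "dird v (rpoly_eval P) x \<noteq> 0" using assms[of x] by (auto simp: surface_eqs_def)
  let ?J = "jacobian_at (surface_eqs P) x"
  have "surj ((*v) ?J)"
  proof (rule surjI)
    fix y :: "real ^ 1"
    show "?J *v ((y $ 1 / dird v (rpoly_eval P) x) *\<^sub>R v) = y"
      using v by (simp add: vec_eq_iff forall_1 jacobian_mult dird_scale_dir[OF rpf_rpoly_eval] surface_eqs_def)
  qed
  then show "rank ?J = CARD(1)" by (simp only: full_rank_surjective)
qed

lemma smooth_parabolicI:
  assumes "\<And>x. x \<noteq> 0 \<Longrightarrow> rpoly_eval P x = 0 \<Longrightarrow> rpoly_eval (Hess P) x = 0 \<Longrightarrow> indep (rpoly_eval P) (rpoly_eval (Hess P)) x"
  shows "smooth_rproj_zeros (parabolic_curve_eqs P)"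
  unfolding smooth_rproj_zeros_def
proof (intro allI impI)
  fix x :: "real ^ 4" assume x: "x \<noteq> 0 \<and> (\<forall>k. rpoly_eval (parabolic_curve_eqs P $ k) x = 0)"
  let ?f = "rpoly_eval P" and ?g = "rpoly_eval (Hess P)"
  have "indep ?f ?g x" using x by (intro assms) (auto simp: parabolic_curve_eqs_def forall_2)
  then obtain v w where D: "dird v ?f x * dird w ?g x - dird w ?f x * dird v ?g x \<noteq> 0" (is "?D \<noteq> 0") by (auto simp: indep_def)
  let ?J = "jacobian_at (parabolic_curve_eqs P) x"
  have "surj ((*v) ?J)"
  proof (rule surjI)
    fix y :: "real ^ 2"
    \<comment> \<open>Cramer's rule: the differentials restricted to the span of v and w already map
      onto the plane.\<close>
    let ?a = "(y $ 1 * dird w ?g x - y $ 2 * dird w ?f x) / ?D" and ?b = "(y $ 2 * dird v ?f x - y $ 1 * dird v ?g x) / ?D"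
    have d: "dird (?a *\<^sub>R v + ?b *\<^sub>R w) h x = ?a * dird v h x + ?b * dird w h x" if "rpf h" for h
      unfolding dird_add_dir[OF that] dird_scale_dir[OF that] ..
    have "?a * dird v ?f x + ?b * dird w ?f x = y $ 1" "?a * dird v ?g x + ?b * dird w ?g x = y $ 2"
      using D by (simp_all add: divide_simps) (simp_all add: algebra_simps)
    then show "?J *v (?a *\<^sub>R v + ?b *\<^sub>R w) = y"
      unfolding vec_eq_iff forall_2 jacobian_mult d[OF rpf_rpoly_eval] by (simp add: parabolic_curve_eqs_def)
  qed
  then show "rank ?J = CARD(2)" by (simp only: full_rank_surjective)
qed

theorem corollary1p2:
  fixes d :: nat
  assumes "d \<ge> 4"
  shows "\<exists>P :: 4 rpoly.
           homogeneous_of_degree d P \<and>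
           smooth_rproj_zeros (surface_eqs P) \<and>
           smooth_rproj_zeros (parabolic_curve_eqs P) \<and>
           card (connected_components_of (subtopology rproj_space (parabolic_curve P)))
             = d * (d - 2)^2"
proof -
  obtain f C where fC: "has_curve d (d * (d - 2)\<^sup>2) f C" using exists_curve[OF assms] by blast
  note H = fC[unfolded has_curve_def]
  have f: "rpf f" "homog d f" using H by blast+
  obtain x0 where x0: "f x0 \<noteq> 0" using H by blast
  obtain P :: "4 rpoly" where P: "homogeneous_of_degree d P" "rpoly_eval P = f"
    using homog_eq_rpoly_eval[OF f x0] by blast
  have HP: "rpoly_eval (Hess P) = hess4 f" by (simp add: rpoly_eval_Hess P(2))
  have ind: "indep f (hess4 f) x" if "x \<noteq> 0" "f x = 0" "hess4 f x = 0" for x using H that by blast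
  have s2: "smooth_rproj_zeros (parabolic_curve_eqs P)"
    by (rule smooth_parabolicI) (unfold HP P(2), rule ind)
  \<comment> \<open>A singular point of the surface would be a parabolic point at which all
    derivatives of f vanish, contradicting the independence of the differentials there.\<close>
  have s1: "smooth_rproj_zeros (surface_eqs P)"
  proof (rule smooth_surfaceI, unfold P(2), rule ccontr)
    fix x assume x: "x \<noteq> 0" "f x = 0" "\<nexists>v. dird v f x \<noteq> 0"
    then have "hess4 f x = 0" using hess4_critical(2)[OF f _ x(1)] assms by simp
    from ind[OF x(1,2) this] x(3) show False by (auto simp: indep_def)
  qed
  have "parabolic_curve P = {span {x} | x. x \<noteq> 0 \<and> f x = 0 \<and> hess4 f x = 0}"
    unfolding parabolic_curve_def rproj_zeros_def by (simp add: parabolic_curve_eqs_def forall_2 P(2) HP)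
  then have "parabolic_curve P = (\<lambda>x. span {x}) ` C" using H by simp
  then have "card (connected_components_of (subtopology rproj_space (parabolic_curve P))) = d * (d - 2)\<^sup>2"
    using card_components_rproj[of "d * (d - 2)\<^sup>2" C] H by simp
  then show ?thesis using P(1) s1 s2 by blast
qed

end
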